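(* Let $(C,X)$ be a $d$-embedded curve and $D^c$ an effective divisor of $X$. Suppose $D^c$ is an integral multiple of a reduced divisor of $X$. Let $$r_C:H^0(\mathcal{N}_{C|\mathbb{P}^3})\to H^0(\mathcal{N}_{C|\mathbb{P}^3}\otimes\mathcal{O}_{C.D^c})\to H^0(\mathcal{N}_{X|\mathbb{P}^3}\otimes\mathcal{O}_{C.D^c}),$$ $$r_{D^c}:H^0(\mathcal{N}_{D^c|\mathbb{P}^3})\to H^0(\mathcal{N}_{D^c|\mathbb{P}^3}\otimes\mathcal{O}_{C.D^c})\to H^0(\mathcal{N}_{X|\mathbb{P}^3}\otimes\mathcal{O}_{C.D^c}),$$ where in both cases the first map is the canonical restriction and the second map arises as the restriction to $\mathcal{O}_{C.D^c}$ of the normal sheaf sequence $0\to\mathcal{N}_{Z|X}\to\mathcal{N}_{Z|\mathbb{P}^3}\to\mathcal{N}_{X|\mathbb{P}^3}\otimes\mathcal{O}_Z\to0$ for $Z=C$, respectively $Z=D^c$. If $\mathrm{Im}(r_C)\subset\mathrm{Im}(r_{D^c})$, then $(C\cup D^c,X)$ is a simple extension of $(C,X)$.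
   Context: The base field is $\mathbb{C}$. A curve is a closed subscheme of $\mathbb{P}^3$ of pure dimension $1$ (not necessarily reduced). A $d$-embedded curve is a pair $(C,X)$ with $X$ a smooth degree $d$ surface in $\mathbb{P}^3$ and $C\subset X$ a curve. $C.D^c$ denotes the scheme-theoretic intersection of $C$ and $D^c$, and $C\cup D^c$ denotes the divisor $C+D^c$ on $X$. For a closed subscheme $Y\subset\mathbb{P}^3$ with ideal sheaf $\mathcal{I}_Y$, $\mathcal{N}_{Y|\mathbb{P}^3}=\mathcal{H}om_{\mathbb{P}^3}(\mathcal{I}_Y,\mathcal{O}_Y)$ is the normal sheaf, and $Y_{\mathrm{red}}$ is the associated reduced scheme; $\mathcal{N}_{Z|X}$ is the normal sheaf of $Z$ in $X$. For effective divisors $C\le D$ on $X$, $\Upsilon^5_{C\le D}:H^0(\mathcal{N}_{D|\mathbb{P}^3})\to H^0(\mathcal{N}_{D|\mathbb{P}^3}\otimes\mathcal{O}_C)$ is the restriction map, and $\Upsilon^6_{C\le D}:H^0(\mathcal{N}_{C|\mathbb{P}^3})\to H^0(\mathcal{N}_{D|\mathbb{P}^3}\otimes\mathcal{O}_C)$ is obtained by applying $\mathcal{H}om_{\mathbb{P}^3}(-,\mathcal{O}_C)$ and then global sections to the inclusion $\mathcal{I}_D\hookrightarrow\mathcal{I}_C$. For $d$-embedded curves $(C,X)$ and $(D,X)$, one says that $(D,X)$ is a simple extension of $(C,X)$ if (1) $D-C$ is of the form $nC'$ for some positive integer $n$ and some reduced curve $C'\subset X$ such that $C'\cap C_{\mathrm{red}}$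 consists of finitely many points; and (2) $\mathrm{Im}\,\Upsilon^6_{C\le D}\subset\mathrm{Im}\,\Upsilon^5_{C\le D}$.
   Formalization: The added hypothesis that C and D^c meet in only finitely many points is necessary: for C = D^c a line on X the images of r_C and r_{D^c} agree, but C ∪ D^c is not a simple extension of C; the conclusion itself forces this finiteness. *)

theory Defs
  imports "HOL-Analysis.Analysis"
begin

section \<open>Projective space and its structure sheaf\<close>

text \<open>
  Projective 3-space over the complex numbers is treated as a classical variety: its points are the
  lines through the origin of \<open>complex^4\<close>, it carries the Zariski topology, and its structure
  sheaf consists of the complex-valued functions that are locally quotients of forms of equal
  degree. Sheaves on the space of closed points of a variety are the same as
  sheaves on the scheme.
\<close>

typedef p3 = "{L :: (complex^4) set. \<exists>v. v \<noteq> 0 \<and> L = range (\<lambda>c. c *s v)}"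
proof -
  have "axis 0 1 \<noteq> (0 :: complex^4)" by (simp add: axis_eq_0_iff)
  then show ?thesis by blast
qed

definition coords :: "p3 \<Rightarrow> (complex^4) set" where
  "coords p = Rep_p3 p - {0}"

definition exponents :: "nat \<Rightarrow> (4 \<Rightarrow> nat) set" where
  "exponents d = {a. (\<Sum>i\<in>UNIV. a i) = d}"

lemma finite_exponents: "finite (exponents d)"
proof (rule finite_subset)
  show "exponents d \<subseteq> Pi\<^sub>E UNIV (\<lambda>_. {..d})"
    by (auto simp: exponents_def PiE_def extensional_def intro!: member_le_sum)
  show "finite (Pi\<^sub>E (UNIV :: 4 set) (\<lambda>_. {..d}))"
    by (intro finite_PiE) auto
qed

text \<open>Homogeneous polynomials of degree \<open>d\<close> (including zero), as polynomial functions.\<close>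

definition form :: "nat \<Rightarrow> (complex^4 \<Rightarrow> complex) \<Rightarrow> bool" where
  "form d F \<longleftrightarrow> (\<exists>c :: (4 \<Rightarrow> nat) \<Rightarrow> complex. \<forall>v.
     F v = (\<Sum>a\<in>exponents d. c a * (\<Prod>i\<in>UNIV. (v $ i) ^ a i)))"

definition zariski :: "p3 topology" where
  "zariski = topology_generated_by
     {{p. \<forall>v\<in>coords p. F v \<noteq> 0} | F. \<exists>d. form d F}"

text \<open>
  A (pre)sheaf of modules over the structure sheaf. The sections over \<open>U\<close> form the set
  \<open>Sec M U\<close>, which is only meaningful for open \<open>U\<close>; \<open>Res M V x\<close> restricts a section \<open>x\<close>
  to a smaller open set \<open>V\<close>. The functions \<open>Add\<close> and \<open>Smul\<close> are indexed by the open set on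
  which the arguments live. In every sheaf below, sections are normalised outside their domain,
  so that equality of sections is equality in HOL.
\<close>

record 's omodule =
  Sec :: "p3 set \<Rightarrow> 's set"
  Res :: "p3 set \<Rightarrow> 's \<Rightarrow> 's"
  Add :: "p3 set \<Rightarrow> 's \<Rightarrow> 's \<Rightarrow> 's"
  Smul :: "p3 set \<Rightarrow> (p3 \<Rightarrow> complex) \<Rightarrow> 's \<Rightarrow> 's"

definition H0 :: "'s omodule \<Rightarrow> 's set" where
  "H0 M = Sec M UNIV"

definition OP :: "(p3 \<Rightarrow> complex) omodule" where
  "OP = \<lparr>
     Sec = (\<lambda>U. {f.
       (\<forall>p\<in>U. \<exists>V d G H. openin zariski V \<and> p \<in> V \<and> V \<subseteq> U \<and> form d G \<and> form d H \<and>
          (\<forall>q\<in>V. \<forall>v\<in>coords q. H v \<noteq> 0 \<and> f q = G v / H v)) \<and>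
       (\<forall>p. p \<notin> U \<longrightarrow> f p = 0)}),
     Res = (\<lambda>V f p. if p \<in> V then f p else 0),
     Add = (\<lambda>U f g p. f p + g p),
     Smul = (\<lambda>U a f p. a p * f p)\<rparr>"

definition Diff :: "'s omodule \<Rightarrow> p3 set \<Rightarrow> 's \<Rightarrow> 's \<Rightarrow> 's" where
  "Diff M U x y = Add M U x (Smul M U (\<lambda>p. if p \<in> U then - 1 else 0) y)"

section \<open>Operations on sheaves of modules\<close>

text \<open>The subsheaf of \<open>M\<close> generated by a family \<open>N\<close> of sets of sections.\<close>

definition localize :: "'s omodule \<Rightarrow> (p3 set \<Rightarrow> 's set) \<Rightarrow> p3 set \<Rightarrow> 's set" where
  "localize M N U = {x \<in> Sec M U. \<forall>p\<in>U. \<exists>V. openin zariski V \<and> p \<in> V \<and> V \<subseteq> U \<and> Res M V x \<in> N V}"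

inductive_set add_closure :: "'s omodule \<Rightarrow> p3 set \<Rightarrow> 's set \<Rightarrow> 's set"
  for M U A where
    base: "x \<in> A \<Longrightarrow> x \<in> add_closure M U A"
  | add: "x \<in> add_closure M U A \<Longrightarrow> y \<in> add_closure M U A \<Longrightarrow> Add M U x y \<in> add_closure M U A"

text \<open>
  For a subsheaf \<open>N\<close> of \<open>M\<close>, \<open>qgerm M N p U x\<close> is the class in the stalk of \<open>M/N\<close> at \<open>p\<close>
  of a section \<open>x\<close> of \<open>M\<close> over \<open>U\<close>, as the set of all its representatives.
\<close>

definition qgerm ::
    "'s omodule \<Rightarrow> (p3 set \<Rightarrow> 's set) \<Rightarrow> p3 \<Rightarrow> p3 set \<Rightarrow> 's \<Rightarrow> (p3 set \<times> 's) set" where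
  "qgerm M N p U x = {(V, y). openin zariski V \<and> p \<in> V \<and> y \<in> Sec M V \<and>
     (\<exists>W. openin zariski W \<and> p \<in> W \<and> W \<subseteq> U \<inter> V \<and> Diff M W (Res M W y) (Res M W x) \<in> N W)}"

text \<open>
  The quotient sheaf \<open>M/N\<close>: a section assigns to each point an element of the stalk of \<open>M/N\<close>,
  in such a way that locally all these elements come from one section of \<open>M\<close>.
\<close>

type_synonym 's qsec = "p3 \<Rightarrow> (p3 set \<times> 's) set"

definition quot :: "'s omodule \<Rightarrow> (p3 set \<Rightarrow> 's set) \<Rightarrow> 's qsec omodule" where
  "quot M N = \<lparr>
     Sec = (\<lambda>U. {\<sigma>.
       (\<forall>p\<in>U. \<exists>V x. openin zariski V \<and> p \<in> V \<and> V \<subseteq> U \<and> x \<in> Sec M V \<and>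
          (\<forall>q\<in>V. \<sigma> q = qgerm M N q V x)) \<and>
       (\<forall>p. p \<notin> U \<longrightarrow> \<sigma> p = {})}),
     Res = (\<lambda>V \<sigma> p. if p \<in> V then \<sigma> p else {}),
     Add = (\<lambda>U \<sigma> \<tau> p. \<Union>(V, x)\<in>\<sigma> p. \<Union>(W, y)\<in>\<tau> p.
       qgerm M N p (V \<inter> W) (Add M (V \<inter> W) (Res M (V \<inter> W) x) (Res M (V \<inter> W) y))),
     Smul = (\<lambda>U a \<sigma> p. \<Union>(V, x)\<in>\<sigma> p.
       qgerm M N p (U \<inter> V) (Smul M (U \<inter> V) (Res OP (U \<inter> V) a) (Res M (U \<inter> V) x)))\<rparr>"

definition quot_proj ::
    "'s omodule \<Rightarrow> (p3 set \<Rightarrow> 's set) \<Rightarrow> p3 set \<Rightarrow> 's \<Rightarrow> 's qsec" where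
  "quot_proj M N U x = (\<lambda>p. if p \<in> U then qgerm M N p U x else {})"

text \<open>
  The projection from \<open>M/N\<close> to \<open>M/N'\<close> for \<open>N \<subseteq> N'\<close>. All elements of \<open>\<sigma> p\<close> contribute
  the same class to the union.
\<close>

definition quot_change ::
    "'s omodule \<Rightarrow> (p3 set \<Rightarrow> 's set) \<Rightarrow> 's qsec \<Rightarrow> 's qsec" where
  "quot_change M N' \<sigma> = (\<lambda>p. \<Union>(V, x)\<in>\<sigma> p. qgerm M N' p V x)"

text \<open>
  The sheaf of homomorphisms: a section over \<open>U\<close> is a family of linear maps
  \<open>M(V) \<rightarrow> M'(V)\<close>, for \<open>V\<close> open in \<open>U\<close>, that commutes with restriction.
\<close>

definition sheaf_hom ::
    "'s omodule \<Rightarrow> 't omodule \<Rightarrow> (p3 set \<Rightarrow> 's \<Rightarrow> 't) omodule" where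
  "sheaf_hom M M' = \<lparr>
     Sec = (\<lambda>U. {\<phi>. openin zariski U \<and>
       (\<forall>V. openin zariski V \<and> V \<subseteq> U \<longrightarrow>
         (\<forall>x\<in>Sec M V.
            \<phi> V x \<in> Sec M' V \<and>
            (\<forall>y\<in>Sec M V. \<phi> V (Add M V x y) = Add M' V (\<phi> V x) (\<phi> V y)) \<and>
            (\<forall>a\<in>Sec OP V. \<phi> V (Smul M V a x) = Smul M' V a (\<phi> V x)) \<and>
            (\<forall>W. openin zariski W \<and> W \<subseteq> V \<longrightarrow> \<phi> W (Res M W x) = Res M' W (\<phi> V x)))) \<and>
       (\<forall>V x. \<not> (openin zariski V \<and> V \<subseteq> U \<and> x \<in> Sec M V) \<longrightarrow> \<phi> V x = undefined)}),
     Res = (\<lambda>V \<phi> W x. if W \<subseteq> V then \<phi> W x else undefined),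
     Add = (\<lambda>U \<phi> \<psi> V x.
       if openin zariski V \<and> V \<subseteq> U \<and> x \<in> Sec M V then Add M' V (\<phi> V x) (\<psi> V x) else undefined),
     Smul = (\<lambda>U a \<phi> V x.
       if openin zariski V \<and> V \<subseteq> U \<and> x \<in> Sec M V
       then Smul M' V (Res OP V a) (\<phi> V x) else undefined)\<rparr>"

section \<open>Closed subschemes\<close>

text \<open>
  A closed subscheme is represented by its ideal sheaf. Hence \<open>X \<le> C\<close>, for the pointwise order,
  says that the subscheme \<open>C\<close> is contained in the subscheme \<open>X\<close>, and the empty subscheme is
  \<open>Sec OP\<close>.
\<close>

type_synonym ideal = "p3 set \<Rightarrow> (p3 \<Rightarrow> complex) set"

definition as_module :: "ideal \<Rightarrow> (p3 \<Rightarrow> complex) omodule" where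
  "as_module I = OP\<lparr>Sec := I\<rparr>"

text \<open>
  On a noetherian scheme the quasi-coherent ideal sheaves are those of finite type, which is
  the last condition.
\<close>

definition closed_subscheme :: "ideal \<Rightarrow> bool" where
  "closed_subscheme I \<longleftrightarrow>
     (\<forall>U. I U \<subseteq> Sec OP U) \<and>
     (\<forall>U. openin zariski U \<longrightarrow> (\<lambda>_. 0) \<in> I U \<and>
        (\<forall>f\<in>I U. \<forall>g\<in>I U. Add OP U f g \<in> I U) \<and>
        (\<forall>a\<in>Sec OP U. \<forall>f\<in>I U. Smul OP U a f \<in> I U) \<and>
        (\<forall>V. openin zariski V \<and> V \<subseteq> U \<longrightarrow> Res OP V ` I U \<subseteq> I V)) \<and>
     (\<forall>U. localize OP I U \<subseteq> I U) \<and>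
     (\<forall>p. \<exists>U S. openin zariski U \<and> p \<in> U \<and> finite S \<and> S \<subseteq> I U \<and>
        (\<forall>V. openin zariski V \<and> V \<subseteq> U \<longrightarrow>
           I V = localize OP (\<lambda>W. add_closure OP W
                   {Smul OP W a (Res OP W s) | a s. a \<in> Sec OP W \<and> s \<in> S}) V))"

definition structure_sheaf :: "ideal \<Rightarrow> (p3 \<Rightarrow> complex) qsec omodule" where
  "structure_sheaf Y = quot OP Y"

definition points :: "ideal \<Rightarrow> p3 set" where
  "points Y = {p. \<forall>U. \<forall>f\<in>Y U. p \<in> U \<longrightarrow> f p = 0}"

definition scheme_inter :: "ideal \<Rightarrow> ideal \<Rightarrow> ideal" where
  "scheme_inter Y Z = localize OP (\<lambda>U. {Add OP U f g | f g. f \<in> Y U \<and> g \<in> Z U})"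

definition reduction :: "ideal \<Rightarrow> ideal" where
  "reduction Y = localize OP (\<lambda>U. {f. \<exists>n>0. (\<lambda>p. f p ^ n) \<in> Y U})"

definition is_reduced :: "ideal \<Rightarrow> bool" where
  "is_reduced Y \<longleftrightarrow> (\<forall>U. \<forall>f\<in>Sec OP U. \<forall>n>0. (\<lambda>p. f p ^ n) \<in> Y U \<longrightarrow> f \<in> Y U)"

definition irreducible_closed :: "'a topology \<Rightarrow> 'a set \<Rightarrow> bool" where
  "irreducible_closed T Z \<longleftrightarrow> closedin T Z \<and> Z \<noteq> {} \<and>
     (\<forall>A B. closedin T A \<and> closedin T B \<and> Z \<subseteq> A \<union> B \<longrightarrow> Z \<subseteq> A \<or> Z \<subseteq> B)"

definition irreducible_chain :: "'a topology \<Rightarrow> nat \<Rightarrow> bool" where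
  "irreducible_chain T n \<longleftrightarrow> (\<exists>Z :: nat \<Rightarrow> 'a set.
     (\<forall>i\<le>n. irreducible_closed T (Z i)) \<and> (\<forall>i<n. Z i \<subset> Z (Suc i)))"

definition has_krull_dim :: "'a topology \<Rightarrow> nat \<Rightarrow> bool" where
  "has_krull_dim T n \<longleftrightarrow> irreducible_chain T n \<and> \<not> irreducible_chain T (Suc n)"

text \<open>The support of the sheaf \<open>J/I\<close>, for ideal sheaves \<open>I \<le> J\<close>.\<close>

definition quot_support :: "ideal \<Rightarrow> ideal \<Rightarrow> p3 set" where
  "quot_support I J = {p. \<exists>U. p \<in> U \<and>
     (\<exists>f\<in>J U. \<forall>V. openin zariski V \<and> p \<in> V \<and> V \<subseteq> U \<longrightarrow> Res OP V f \<notin> I V)}"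

text \<open>
  Pure dimension 1 means, as for sheaves in general, that every nonzero coherent subsheaf of
  the structure sheaf of \<open>C\<close> has support of dimension 1, so that embedded points are excluded.
  These subsheaves are the \<open>J/C\<close> with \<open>J\<close> a coherent ideal sheaf containing \<open>C\<close>.
  The empty scheme satisfies the condition vacuously.
\<close>

definition curve :: "ideal \<Rightarrow> bool" where
  "curve C \<longleftrightarrow> closed_subscheme C \<and>
     (\<forall>J. closed_subscheme J \<and> C \<le> J \<and> J \<noteq> C \<longrightarrow>
        has_krull_dim (subtopology zariski (quot_support C J)) 1)"

section \<open>Smooth surfaces and their divisors\<close>

definition hypersurface :: "nat \<Rightarrow> (complex^4 \<Rightarrow> complex) \<Rightarrow> ideal" where
  "hypersurface d F = localize OP (\<lambda>U. {f. \<exists>e G H. form e G \<and> form (d + e) H \<and>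
     (\<forall>q\<in>U. \<forall>v\<in>coords q. H v \<noteq> 0 \<and> f q = F v * G v / H v)})"

definition smooth_surface :: "nat \<Rightarrow> ideal \<Rightarrow> bool" where
  "smooth_surface d X \<longleftrightarrow> d > 0 \<and> (\<exists>F. form d F \<and> X = hypersurface d F \<and>
     (\<forall>v. v \<noteq> 0 \<and> F v = 0 \<longrightarrow> (\<exists>i. deriv (\<lambda>t. F (v + axis i t)) 0 \<noteq> 0)))"

definition d_embedded :: "nat \<Rightarrow> ideal \<Rightarrow> ideal \<Rightarrow> bool" where
  "d_embedded d C X \<longleftrightarrow> smooth_surface d X \<and> curve C \<and> X \<le> C"

text \<open>
  Effective (Cartier) divisors on \<open>X\<close>: closed subschemes of \<open>X\<close> locally defined by one
  equation \<open>f\<close> which is not a zero divisor modulo the ideal of \<open>X\<close>.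
\<close>

definition effective_divisor :: "ideal \<Rightarrow> ideal \<Rightarrow> bool" where
  "effective_divisor X D \<longleftrightarrow> closed_subscheme D \<and> X \<le> D \<and>
     (\<forall>p. \<exists>U. openin zariski U \<and> p \<in> U \<and> (\<exists>f\<in>D U.
        \<forall>V. openin zariski V \<and> V \<subseteq> U \<longrightarrow>
          D V = localize OP (\<lambda>W. {Add OP W (Smul OP W a (Res OP W f)) b | a b.
                   a \<in> Sec OP W \<and> b \<in> X W}) V \<and>
          (\<forall>g\<in>Sec OP V. Smul OP V g (Res OP V f) \<in> X V \<longrightarrow> g \<in> X V)))"

text \<open>The product of an ideal sheaf with a module, as a subsheaf of that module.\<close>

definition ideal_mult :: "ideal \<Rightarrow> 's omodule \<Rightarrow> p3 set \<Rightarrow> 's set" where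
  "ideal_mult I M =
     localize M (\<lambda>U. add_closure M U {Smul M U a x | a x. a \<in> I U \<and> x \<in> Sec M U})"

text \<open>
  Addition of divisors on \<open>X\<close> is multiplication of their ideals in the structure sheaf of \<open>X\<close>;
  the ideal of \<open>C + D\<close> in projective space is therefore the product of the two ideals plus
  the ideal of \<open>X\<close>.
\<close>

definition div_add :: "ideal \<Rightarrow> ideal \<Rightarrow> ideal \<Rightarrow> ideal" where
  "div_add X C D = scheme_inter (ideal_mult C (as_module D)) X"

fun div_mult :: "ideal \<Rightarrow> nat \<Rightarrow> ideal \<Rightarrow> ideal" where
  "div_mult X 0 D = Sec OP"
| "div_mult X (Suc n) D = div_add X D (div_mult X n D)"

section \<open>Normal sheaves\<close>

type_synonym nsec = "p3 set \<Rightarrow> (p3 \<Rightarrow> complex) \<Rightarrow> (p3 \<Rightarrow> complex) qsec"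

definition normal :: "ideal \<Rightarrow> nsec omodule" where
  "normal Y = sheaf_hom (as_module Y) (structure_sheaf Y)"

text \<open>
  The tensor product of \<open>M\<close> with the structure sheaf of a closed subscheme \<open>Z\<close> is the quotient
  of \<open>M\<close> by the product of the ideal of \<open>Z\<close> with \<open>M\<close>.
\<close>

definition tensor_O :: "'s omodule \<Rightarrow> ideal \<Rightarrow> 's qsec omodule" where
  "tensor_O M Z = quot M (ideal_mult Z M)"

definition restrict_to :: "'s omodule \<Rightarrow> ideal \<Rightarrow> p3 set \<Rightarrow> 's \<Rightarrow> 's qsec" where
  "restrict_to M Z = quot_proj M (ideal_mult Z M)"

text \<open>
  For a closed subscheme \<open>Z\<close> of \<open>Y\<close>, \<open>can Y Z U\<close> is the canonical map, over \<open>U\<close>, from the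
  normal sheaf of \<open>Y\<close> tensored with the structure sheaf of \<open>Z\<close> to the sheaf of homomorphisms
  from the ideal of \<open>Y\<close> to the structure sheaf of \<open>Z\<close>. It sends the class of
  \<open>\<psi> \<otimes> 1\<close> to the reduction of \<open>\<psi>\<close> modulo the ideal of \<open>Z\<close>, and is an isomorphism when \<open>Y\<close> is
  a local complete intersection, in particular when \<open>Y\<close> is \<open>X\<close> or a divisor on \<open>X\<close>.
\<close>

definition can :: "ideal \<Rightarrow> ideal \<Rightarrow> p3 set \<Rightarrow> nsec qsec \<Rightarrow> nsec" where
  "can Y Z U \<sigma> = (\<lambda>V a. if openin zariski V \<and> V \<subseteq> U \<and> a \<in> Y V
     then (\<lambda>p. if p \<in> V
       then \<Union>(W, \<psi>)\<in>\<sigma> p. quot_change OP Z (\<psi> (V \<inter> W) (Res OP (V \<inter> W) a)) p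
       else {})
     else undefined)"

text \<open>
  Restriction of a homomorphism on the ideal of \<open>Z\<close> to the smaller ideal of \<open>Y\<close>, that is, the
  image under the functor of homomorphisms of the inclusion of ideal sheaves.
\<close>

definition hom_restrict :: "ideal \<Rightarrow> p3 set \<Rightarrow> nsec \<Rightarrow> nsec" where
  "hom_restrict Y U \<phi> = (\<lambda>V a. if openin zariski V \<and> V \<subseteq> U \<and> a \<in> Y V then \<phi> V a else undefined)"

text \<open>
  For \<open>Z\<close> contained in \<open>Y\<close>, the map over \<open>U\<close> from the normal sheaf of \<open>Z\<close> to the normal
  sheaf of \<open>Y\<close> tensored with the structure sheaf of \<open>Z\<close>. For \<open>Y = X\<close> it is the surjection of
  the normal sheaf sequence of \<open>Z\<close> in \<open>X\<close>.
\<close>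

definition normal_map :: "ideal \<Rightarrow> ideal \<Rightarrow> p3 set \<Rightarrow> nsec \<Rightarrow> nsec qsec" where
  "normal_map Y Z U \<phi> =
     inv_into (Sec (tensor_O (normal Y) Z) U) (can Y Z U) (hom_restrict Y U \<phi>)"

definition Upsilon5 :: "ideal \<Rightarrow> ideal \<Rightarrow> nsec \<Rightarrow> nsec qsec" where
  "Upsilon5 C D = restrict_to (normal D) C UNIV"

definition Upsilon6 :: "ideal \<Rightarrow> ideal \<Rightarrow> nsec \<Rightarrow> nsec qsec" where
  "Upsilon6 C D = normal_map D C UNIV"

text \<open>
  The map \<open>normal_map X Z\<close> tensored with the structure sheaf of a closed subscheme \<open>W\<close> of \<open>Z\<close>.
  The target is the normal sheaf of \<open>X\<close> tensored with the structure sheaf of \<open>W\<close>, because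
  tensoring first with that of \<open>Z\<close> and then with that of \<open>W\<close> is the same as tensoring with
  that of \<open>W\<close>.
\<close>

definition normal_map_restricted :: "ideal \<Rightarrow> ideal \<Rightarrow> ideal \<Rightarrow> nsec qsec \<Rightarrow> nsec qsec" where
  "normal_map_restricted X Z W \<sigma> = (\<lambda>p. \<Union>(V, \<phi>)\<in>\<sigma> p.
     quot_change (normal X) (ideal_mult W (normal X)) (normal_map X Z V \<phi>) p)"

definition r_map :: "ideal \<Rightarrow> ideal \<Rightarrow> ideal \<Rightarrow> nsec \<Rightarrow> nsec qsec" where
  "r_map X Z W \<phi> = normal_map_restricted X Z W (restrict_to (normal Z) W UNIV \<phi>)"

definition simple_extension :: "nat \<Rightarrow> ideal \<Rightarrow> ideal \<Rightarrow> ideal \<Rightarrow> bool" where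
  "simple_extension d D C X \<longleftrightarrow> d_embedded d C X \<and> d_embedded d D X \<and>
     (\<exists>n>0. \<exists>C'. curve C' \<and> is_reduced C' \<and> X \<le> C' \<and>
        D = div_add X C (div_mult X n C') \<and>
        finite (points (scheme_inter C' (reduction C)))) \<and>
     Upsilon6 C D ` H0 (normal C) \<subseteq> Upsilon5 C D ` H0 (normal D)"

end

theory Submission
  imports Defs "HOL-Computational_Algebra.Fundamental_Theorem_Algebra"
begin

text \<open>
  Write \<open>D = C + E\<close> with \<open>E = Dc\<close>. Since \<open>C\<close> has no embedded points and meets \<open>E\<close> in finitely many
  points, a local equation of \<open>E\<close> is not a zero divisor modulo \<open>C\<close>; therefore the ideal of \<open>D\<close> is the
  intersection of the ideals of \<open>C\<close> and \<open>E\<close>. The hypothesis provides, for a homomorphism \<open>\<phi>\<close> on the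
  ideal of \<open>C\<close>, a homomorphism \<open>\<psi>\<close> on the ideal of \<open>E\<close> such that both agree on the ideal of \<open>X\<close> modulo
  the sum of the two ideals. The ideal of \<open>D\<close> is the product of those of \<open>C\<close> and \<open>E\<close> plus that of
  \<open>X\<close>, so they agree on it as well, and the values modulo \<open>C\<close> and modulo \<open>E\<close> glue to
  a section of the normal sheaf of \<open>D\<close> with the same image as \<open>\<phi>\<close>.

  All stalks are regarded as subsets of the function field. Curves on the smooth surface
  \<open>X\<close> are locally cut out by one equation, because the local rings of \<open>X\<close> are regular of dimension
  two and an ideal whose quotient has depth one is principal. Hence \<open>X\<close> and \<open>D\<close> are local complete intersections and the maps \<open>can\<close> are injective.
\<close>

text \<open>The definitions speak of sections over open sets and of sets of representatives, the
  argument of local algebra; much of the work is the passage between the two. Projective space is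
  irreducible, so every germ is an element of the function field and restriction becomes inclusion
  of stalks. Two definitions resist this translation. Purity is given by the Krull dimension of
  supports of coherent subsheaves; it is traded for depth at every point, in both directions, and
  the way back needs the Nullstellensatz, since membership off a point must be turned into
  membership of a multiple at that point. \<open>normal_map\<close> is an inverse image under
  \<open>can\<close>, so a glued section is of use only once preimages are known to exist and to be
  unique; for this the equations of \<open>D\<close> must have no unexpected relations. The
  agreement on the product of the ideals rests on a symmetry: for \<open>c\<close> in the ideal of
  \<open>C\<close> and \<open>e\<close> in that of \<open>E\<close>, linearity gives \<phi>(c e) = e
  \<phi>(c) and \<psi>(c e) = c \<psi>(e), and both vanish modulo the sum of the two ideals.\<close>

abbreviation zopen :: "p3 set \<Rightarrow> bool" where
  "zopen \<equiv> openin zariski"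

section \<open>Ideals of subrings\<close>

text \<open>A ring is a subset of an ambient ring, not a type. Polynomial extensions, localizations
  and stalks at different points are then compared by inclusion, without connecting
  homomorphisms.\<close>

locale subring =
  fixes R :: "'a::comm_ring_1 set"
  assumes one_closed [simp, intro]: "1 \<in> R"
    and diff_closed [simp, intro]: "a \<in> R ==> b \<in> R ==> a - b \<in> R"
    and mult_closed [simp, intro]: "a \<in> R ==> b \<in> R ==> a * b \<in> R"
begin

lemma zero_closed [simp, intro]: "0 \<in> R"
  using diff_closed[OF one_closed one_closed] by simp

lemma uminus_closed [simp, intro]: "a \<in> R ==> - a \<in> R"
  using diff_closed[of 0 a] by simp

lemma add_closed [simp, intro]: "a \<in> R ==> b \<in> R ==> a + b \<in> R"
  using diff_closed[of a "- b"] by simp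

lemma power_closed [simp, intro]: "a \<in> R ==> a ^ n \<in> R"
  by (induction n) auto

lemma of_nat_closed [simp, intro]: "of_nat n \<in> R"
  by (induction n) auto

lemma sum_closed [intro]: "(\<And>i. i \<in> S ==> f i \<in> R) ==> sum f S \<in> R"
  by (induction S rule: infinite_finite_induct) auto

lemma prod_closed [intro]: "(\<And>i. i \<in> S ==> f i \<in> R) ==> prod f S \<in> R"
  by (induction S rule: infinite_finite_induct) auto

end

definition ideal_in :: "'a::comm_ring_1 set \<Rightarrow> 'a set \<Rightarrow> bool" where
  "ideal_in R I \<longleftrightarrow> I \<subseteq> R \<and> 0 \<in> I \<and> (\<forall>a\<in>I. \<forall>b\<in>I. a + b \<in> I) \<and> (\<forall>r\<in>R. \<forall>a\<in>I. r * a \<in> I)"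

lemma idealD:
  assumes "ideal_in R I"
  shows "a \<in> I ==> a \<in> R" "0 \<in> I" "a \<in> I ==> b \<in> I ==> a + b \<in> I"
    "r \<in> R ==> a \<in> I ==> r * a \<in> I" "r \<in> R ==> a \<in> I ==> a * r \<in> I"
  using assms by (auto simp: ideal_in_def mult.commute)

lemma ideal_in_sum:
  assumes "ideal_in R I" "\<And>i. i \<in> S ==> f i \<in> I"
  shows "sum f S \<in> I"
  using assms(2) by (induction S rule: infinite_finite_induct) (auto intro: idealD[OF assms(1)])

inductive_set gen :: "'a::comm_ring_1 set \<Rightarrow> 'a set \<Rightarrow> 'a set" for R S where
  zero: "0 \<in> gen R S"
| step: "r \<in> R ==> s \<in> S ==> a \<in> gen R S ==> r * s + a \<in> gen R S"

definition noeth :: "'a::comm_ring_1 set \<Rightarrow> bool" where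
  "noeth R \<longleftrightarrow> (\<forall>I. ideal_in R I \<longrightarrow> (\<exists>S. finite S \<and> S \<subseteq> I \<and> I = gen R S))"

definition prime_ideal :: "'a::comm_ring_1 set \<Rightarrow> 'a set \<Rightarrow> bool" where
  "prime_ideal R P \<longleftrightarrow> ideal_in R P \<and> 1 \<notin> P \<and> (\<forall>a\<in>R. \<forall>b\<in>R. a * b \<in> P \<longrightarrow> a \<in> P \<or> b \<in> P)"

lemma gen_mono: "S \<subseteq> T ==> gen R S \<subseteq> gen R T"
proof
  fix x assume "S \<subseteq> T" "x \<in> gen R S"
  then show "x \<in> gen R T" by (induction rule: gen.induct[OF \<open>x \<in> gen R S\<close>]) (auto intro: gen.intros)
qed

lemma gen_least: "ideal_in R I ==> S \<subseteq> I ==> gen R S \<subseteq> I"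
proof
  fix x assume "ideal_in R I" "S \<subseteq> I" "x \<in> gen R S"
  from this(3) show "x \<in> I"
    by induction (use \<open>ideal_in R I\<close> \<open>S \<subseteq> I\<close> in \<open>auto simp: ideal_in_def\<close>)
qed

lemma gen_empty [simp]: "gen R {} = {0}"
  by (auto intro: gen.zero elim: gen.cases)

context subring
begin

lemma ideal_uminus: "ideal_in R I ==> a \<in> I ==> - a \<in> I"
  using idealD(4)[of R I "- 1" a] by simp

lemma ideal_diff: "ideal_in R I ==> a \<in> I ==> b \<in> I ==> a - b \<in> I"
  using idealD(3)[of R I a "- b"] ideal_uminus by simp

lemma ideal_add_iff: "ideal_in R I ==> b \<in> I ==> a + b \<in> I \<longleftrightarrow> a \<in> I"
  using ideal_diff[of I "a + b" b] idealD(3)[of R I a b] by auto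

lemma gen_incl: "S \<subseteq> gen R S"
  using gen.step[OF one_closed _ gen.zero] by auto

lemma gen_ideal:
  assumes "S \<subseteq> R" shows "ideal_in R (gen R S)"
proof -
  have 1: "a \<in> R" if "a \<in> gen R S" for a
    using that by induction (use assms in auto)
  have 2: "a + b \<in> gen R S" if "a \<in> gen R S" "b \<in> gen R S" for a b
    using that by induction (auto simp: add.assoc intro: gen.step)
  have 3: "r * a \<in> gen R S" if "a \<in> gen R S" "r \<in> R" for a r
    using that by induction (auto simp: distrib_left mult.assoc[symmetric] intro: gen.intros)
  show ?thesis unfolding ideal_in_def using 1 2 3 gen.zero by auto
qed

lemma gen_insert:
  assumes "insert s S \<subseteq> R"
  shows "gen R (insert s S) = {r * s + a | r a. r \<in> R \<and> a \<in> gen R S}"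
proof
  show "{r * s + a | r a. r \<in> R \<and> a \<in> gen R S} \<subseteq> gen R (insert s S)"
    using gen_mono[of S "insert s S" R] by (auto intro!: gen.step)
  show "gen R (insert s S) \<subseteq> {r * s + a | r a. r \<in> R \<and> a \<in> gen R S}"
  proof
    fix x assume "x \<in> gen R (insert s S)"
    then show "x \<in> {r * s + a | r a. r \<in> R \<and> a \<in> gen R S}"
    proof induction
      case zero
      show ?case using gen.zero[of R S] by (auto intro!: exI[of _ 0])
    next
      case (step r t b)
      then obtain r' a where a: "b = r' * s + a" "r' \<in> R" "a \<in> gen R S" by auto
      show ?case
      proof (cases "t = s")
        case True
        then have "r * t + b = (r + r') * s + a" using a by (simp add: algebra_simps)
        then show ?thesis using a step by blast
      next
        case False
        then have "r * t + b = r' * s + (r * t + a)" "r * t + a \<in> gen R S"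
          using a step gen.step[of r R t S a] by (auto simp only: algebra_simps insert_iff)
        then show ?thesis using a by blast
      qed
    qed
  qed
qed

lemma gen1: "s \<in> R ==> gen R {s} = {r * s | r. r \<in> R}"
  using gen_insert[of s "{}"] by auto

lemma gen2: "s \<in> R ==> t \<in> R ==> gen R {s, t} = {r * s + q * t | r q. r \<in> R \<and> q \<in> R}"
  using gen_insert[of s "{t}"] by (auto simp: gen1)

lemma gen3: "s \<in> R ==> t \<in> R ==> u \<in> R ==>
    gen R {s, t, u} = {r * s + q * t + p * u | r q p. r \<in> R \<and> q \<in> R \<and> p \<in> R}"
  using gen_insert[of s "{t, u}"] by (auto simp: gen2 add.assoc)

lemma gen1I: "s \<in> R ==> r \<in> R ==> r * s \<in> gen R {s}"
  by (auto simp: gen1)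

lemma gen2I: "s \<in> R ==> t \<in> R ==> r \<in> R ==> q \<in> R ==> r * s + q * t \<in> gen R {s, t}"
  by (auto simp: gen2)

lemma whole_ideal: "ideal_in R R"
  by (auto simp: ideal_in_def)

lemma ideal_one: "ideal_in R I ==> 1 \<in> I ==> I = R"
  unfolding ideal_in_def by (metis mult.right_neutral subsetI subset_antisym)

text \<open>The union of a chain is finitely generated, and its finitely many generators already lie
  in one member of the chain. So the union belongs to the family and Zorn's lemma applies.\<close>

lemma maximal_ideal_exists:
  assumes "noeth R" "\<F> \<noteq> {}" "\<And>I. I \<in> \<F> ==> ideal_in R I"
  obtains M where "M \<in> \<F>" "\<And>I. I \<in> \<F> ==> M \<subseteq> I ==> I = M"
proof -
  have "\<exists>M\<in>\<F>. \<forall>X\<in>\<F>. M \<subseteq> X \<longrightarrow> X = M"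
  proof (rule subset_Zorn_nonempty[OF assms(2)])
    fix \<C> assume C: "\<C> \<noteq> {}" "subset.chain \<F> \<C>"
    have id: "ideal_in R I" if "I \<in> \<C>" for I
      using C(2) assms(3) that by (auto simp: subset.chain_def)
    have "ideal_in R (\<Union>\<C>)"
      unfolding ideal_in_def
    proof (intro conjI ballI)
      show "\<Union>\<C> \<subseteq> R" using idealD(1)[OF id] by blast
      show "0 \<in> \<Union>\<C>" using C(1) id by (auto simp: ideal_in_def)
      show "a + b \<in> \<Union>\<C>" if "a \<in> \<Union>\<C>" "b \<in> \<Union>\<C>" for a b
      proof -
        obtain I J where IJ: "a \<in> I" "I \<in> \<C>" "b \<in> J" "J \<in> \<C>" using \<open>a \<in> \<Union>\<C>\<close> \<open>b \<in> \<Union>\<C>\<close> by auto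
        then have "I \<subseteq> J \<or> J \<subseteq> I" using C(2) by (auto simp: subset.chain_def subset_iff_psubset_eq)
        then show ?thesis using IJ id idealD(3) by (metis UnionI subsetD)
      qed
      show "r * a \<in> \<Union>\<C>" if "r \<in> R" "a \<in> \<Union>\<C>" for r a
        using idealD(4)[OF id] that by blast
    qed
    then obtain S where S: "finite S" "S \<subseteq> \<Union>\<C>" "\<Union>\<C> = gen R S"
      using assms(1) by (auto simp: noeth_def)
    obtain X where X: "X \<in> \<C>" "S \<subseteq> X"
      using finite_subset_Union_chain[OF S(1,2) C] by auto
    have "\<Union>\<C> \<subseteq> X" using gen_least[OF id[OF X(1)] X(2)] S(3) by simp
    then have "\<Union>\<C> = X" using X(1) by auto
    then show "\<Union>\<C> \<in> \<F>" using X(1) C(2) by (auto simp: subset.chain_def)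
  qed
  then show ?thesis using that by blast
qed

text \<open>The ascending chain condition in the form used later: along a sequence, some term is
  already a combination of \<open>T\<close> and the earlier terms. It is read off from a maximal one
  among the ideals generated by initial segments.\<close>

lemma acc_gen:
  fixes s :: "nat \<Rightarrow> 'a"
  assumes "noeth R" "\<And>n. s n \<in> R" "T \<subseteq> R"
  obtains n where "s n \<in> gen R (T \<union> s ` {..<n})"
proof -
  let ?F = "range (\<lambda>n. gen R (T \<union> s ` {..<n}))"
  have "\<And>I. I \<in> ?F ==> ideal_in R I" using assms(2,3) by (auto intro!: gen_ideal)
  then obtain M where M: "M \<in> ?F" "\<And>I. I \<in> ?F ==> M \<subseteq> I ==> I = M"
    using maximal_ideal_exists[OF assms(1), of ?F] by blast
  then obtain n where n: "M = gen R (T \<union> s ` {..<n})" by auto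
  have "M \<subseteq> gen R (T \<union> s ` {..<Suc n})" unfolding n by (rule gen_mono) auto
  then have "gen R (T \<union> s ` {..<Suc n}) = M" using M(2) by blast
  moreover have "s n \<in> gen R (T \<union> s ` {..<Suc n})" using gen_incl[of "T \<union> s ` {..<Suc n}"] by auto
  ultimately show ?thesis using n that by auto
qed

end

lemma prime_idealD:
  assumes "prime_ideal R P"
  shows "ideal_in R P" "1 \<notin> P" "a \<in> R ==> b \<in> R ==> a * b \<in> P ==> a \<in> P \<or> b \<in> P"
  using assms by (auto simp: prime_ideal_def)

section \<open>Hilbert's basis theorem\<close>

definition adj :: "'a::comm_ring_1 set \<Rightarrow> 'a \<Rightarrow> 'a set" where
  "adj R x = {poly p x | p. \<forall>i. coeff p i \<in> R}"

context subring
begin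

lemma coeff_mult_closed: "\<forall>i. coeff p i \<in> R ==> \<forall>i. coeff q i \<in> R ==> coeff (p * q) i \<in> R"
  by (auto simp: coeff_mult)

lemma subring_adj: "subring (adj R x)"
proof
  show "1 \<in> adj R x" unfolding adj_def by (auto intro!: exI[of _ 1] simp: coeff_1)
next
  fix a b assume "a \<in> adj R x" "b \<in> adj R x"
  then obtain p q where pq: "a = poly p x" "b = poly q x" "\<forall>i. coeff p i \<in> R" "\<forall>i. coeff q i \<in> R"
    by (auto simp: adj_def)
  show "a - b \<in> adj R x" using pq unfolding adj_def by (auto intro!: exI[of _ "p - q"])
  show "a * b \<in> adj R x" using pq coeff_mult_closed unfolding adj_def by (auto intro!: exI[of _ "p * q"])
qed

text \<open>Hilbert's argument, for an \<open>x\<close> that may satisfy algebraic relations over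
  \<open>R\<close>. Degrees and leading coefficients belong to polynomials, so the minimal choices
  are made among polynomials with value in \<open>I\<close>, while membership is tested on the
  values.\<close>

theorem noeth_adj:
  assumes "noeth R" shows "noeth (adj R x)"
  unfolding noeth_def
proof (intro allI impI, rule ccontr)
  let ?A = "adj R x"
  interpret A: subring ?A by (rule subring_adj)
  fix I assume I: "ideal_in ?A I" and nofg: "\<nexists>S. finite S \<and> S \<subseteq> I \<and> I = gen ?A S"
  define J where "J = {p. (\<forall>i. coeff p i \<in> R) \<and> poly p x \<in> I}"
  define ev where "ev = (\<lambda>p. poly p x)"
  define ok where "ok T p \<longleftrightarrow> p \<in> J \<and> ev p \<notin> gen ?A (ev ` T)" for T p
  define pick where "pick T = (ARG_MIN degree p. ok T p)" for T
  have JI: "ev ` T \<subseteq> I" if "T \<subseteq> J" for T using that by (auto simp: J_def ev_def)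
  have IA: "I \<subseteq> ?A" using I by (auto simp: ideal_in_def)
  have ex: "\<exists>p. ok T p" if "finite T" "T \<subseteq> J" for T
  proof -
    have "gen ?A (ev ` T) \<subseteq> I" by (rule gen_least[OF I JI[OF that(2)]])
    moreover have "gen ?A (ev ` T) \<noteq> I" using nofg JI[OF that(2)] that(1) by blast
    ultimately obtain a where a: "a \<in> I" "a \<notin> gen ?A (ev ` T)" by auto
    then obtain p where "a = poly p x" "\<forall>i. coeff p i \<in> R" using IA by (auto simp: adj_def)
    then show ?thesis using a by (auto simp: ok_def J_def ev_def)
  qed
  have pick: "ok T (pick T)" "\<And>p. ok T p ==> degree (pick T) \<le> degree p" if "finite T" "T \<subseteq> J" for T
    using ex[OF that] unfolding pick_def by (auto intro: arg_min_natI arg_min_nat_le)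
  define T where "T = rec_nat {} (\<lambda>n t. insert (pick t) t)"
  define q where "q n = pick (T n)" for n
  have T0: "T 0 = {}" and TS: "T (Suc n) = insert (q n) (T n)" for n by (auto simp: T_def q_def)
  have TJ: "finite (T n) \<and> T n \<subseteq> J" for n
  proof (induction n)
    case (Suc n)
    then have "q n \<in> J" using pick(1)[of "T n"] by (auto simp: q_def ok_def)
    then show ?case using Suc by (auto simp: TS)
  qed (simp add: T0)
  have Tq: "T n = q ` {..<n}" for n
    by (induction n) (auto simp: T0 TS lessThan_Suc)
  have q: "ok (T n) (q n)" "\<And>p. ok (T n) p ==> degree (q n) \<le> degree p" for n
    using pick TJ by (auto simp: q_def)
  have qJ: "q n \<in> J" for n using q(1) by (auto simp: ok_def)
  \<comment> \<open>By the chain condition in \<open>R\<close>, the leading coefficient of some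
    \<open>q N\<close> is a combination of those of its predecessors.\<close>
  define a where "a n = lead_coeff (q n)" for n
  have "a n \<in> R" for n using qJ by (auto simp: a_def J_def)
  then obtain N where "a N \<in> gen R ({} \<union> a ` {..<N})"
    using acc_gen[OF assms, of a "{}"] by auto
  then have aN: "a N \<in> gen R (a ` {..<N})" by simp
  define d where "d = degree (q N)"
  define G where "G = gen ?A (ev ` T N)"
  have Gid: "ideal_in ?A G" unfolding G_def using JI IA TJ by (intro A.gen_ideal) blast
  have Ginc: "ev p \<in> G" if "p \<in> T N" for p using A.gen_incl that unfolding G_def by blast
  \<comment> \<open>Such a combination is realized by a polynomial of degree at most
    \<open>d\<close> with value in \<open>G\<close>: the \<open>q i\<close> are raised to degree
    \<open>d\<close> by monomials.\<close>
  have "\<exists>r. r \<in> J \<and> ev r \<in> G \<and> degree r \<le> d \<and> coeff r d = c" if "c \<in> gen R (a ` {..<N})" for c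
    using that
  proof induction
    case zero
    show ?case using I Gid by (intro exI[of _ 0]) (auto simp: J_def ev_def ideal_in_def)
  next
    case (step r0 s c')
    then obtain r' where r': "r' \<in> J" "ev r' \<in> G" "degree r' \<le> d" "coeff r' d = c'" by blast
    obtain i where i: "i < N" "s = a i" using step by auto
    have "gen ?A (ev ` T i) \<subseteq> G" unfolding G_def using i by (intro gen_mono) (auto simp: Tq)
    \<comment> \<open>\<open>q N\<close> was already a candidate when \<open>q i\<close> was chosen,
      so the degree of \<open>q i\<close> is no larger.\<close>
    then have "ok (T i) (q N)" using q(1)[of N] by (auto simp: ok_def G_def)
    then have deg: "degree (q i) \<le> d" using q(2) by (auto simp: d_def)
    define m where "m = monom r0 (d - degree (q i))"
    have mc: "\<forall>j. coeff m j \<in> R" using step by (auto simp: m_def)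
    have qc: "\<forall>j. coeff (q i) j \<in> R" using qJ by (auto simp: J_def)
    have mA: "poly m x \<in> ?A" using mc by (auto simp: adj_def)
    let ?r = "m * q i + r'"
    have "poly (m * q i) x \<in> I" using idealD(4)[OF I mA] qJ[of i] by (simp add: J_def)
    then have "?r \<in> J" using r' I coeff_mult_closed[OF mc qc] by (auto simp: J_def ideal_in_def)
    moreover have "ev ?r \<in> G"
      using idealD(3)[OF Gid idealD(4)[OF Gid mA Ginc[of "q i"]] r'(2)] i by (auto simp: ev_def Tq)
    moreover have "degree ?r \<le> d"
    proof (rule degree_add_le[OF _ r'(3)])
      have "degree m \<le> d - degree (q i)" unfolding m_def by (rule degree_monom_le)
      then show "degree (m * q i) \<le> d" using degree_mult_le[of m "q i"] deg by linarith
    qed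
    moreover have "coeff ?r d = r0 * s + c'"
      using deg by (simp add: m_def coeff_monom_mult r' i a_def)
    ultimately show ?case by blast
  qed
  from this[OF aN] obtain r where r: "r \<in> J" "ev r \<in> G" "degree r \<le> d" "coeff r d = a N" by blast
  \<comment> \<open>The leading terms cancel but the value stays outside \<open>G\<close>.
    Minimality of \<open>q N\<close> leaves only the zero polynomial, whose value lies in
    \<open>G\<close> after all.\<close>
  let ?p = "q N - r"
  have evp: "ev ?p = ev (q N) - ev r" by (simp add: ev_def)
  have nG: "ev (q N) \<notin> G" using q(1)[of N] by (simp add: ok_def G_def)
  have pG: "ev ?p \<notin> G" using A.ideal_add_iff[OF Gid r(2), of "ev ?p"] nG evp by simp
  have "?p \<in> J" using r(1) qJ[of N] A.ideal_diff[OF I] by (auto simp: J_def)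
  then have "ok (T N) ?p" using pG by (simp add: ok_def G_def)
  then have "d \<le> degree ?p" using q(2) d_def by auto
  moreover have "degree ?p \<le> d" using r(3) by (intro degree_diff_le) (auto simp: d_def)
  ultimately have "degree ?p = d" by simp
  moreover have "coeff ?p d = 0" using r(4) by (simp add: a_def d_def)
  ultimately have "?p = 0" using leading_coeff_0_iff by metis
  then have "ev ?p = 0" by (simp add: ev_def)
  then show False using pG idealD(2)[OF Gid] by simp
qed

end

section \<open>Finitely generated algebras over the complex numbers\<close>

inductive_set alg :: "(complex \<Rightarrow> 'a::comm_ring_1) \<Rightarrow> 'a set \<Rightarrow> 'a set" for cst Y where
  cst: "cst c \<in> alg cst Y"
| gen: "y \<in> Y ==> y \<in> alg cst Y"
| add: "a \<in> alg cst Y ==> b \<in> alg cst Y ==> a + b \<in> alg cst Y"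
| mult: "a \<in> alg cst Y ==> b \<in> alg cst Y ==> a * b \<in> alg cst Y"

locale complex_algebra =
  fixes cst :: "complex \<Rightarrow> 'a::comm_ring_1"
  assumes cst_1 [simp]: "cst 1 = 1"
    and cst_add: "cst (a + b) = cst a + cst b"
    and cst_mult: "cst (a * b) = cst a * cst b"
begin

lemma cst_0 [simp]: "cst 0 = 0"
  using cst_add[of 0 0] by simp

lemma cst_uminus: "cst (- a) = - cst a"
  using cst_add[of a "- a"] by (simp add: eq_neg_iff_add_eq_0 add.commute)

lemma cst_diff: "cst (a - b) = cst a - cst b"
  using cst_add[of a "- b"] by (simp add: cst_uminus)

lemma subring_alg: "subring (alg cst Y)"
proof
  show "1 \<in> alg cst Y" using alg.cst[of cst 1] by simp
  have "- b \<in> alg cst Y" if "b \<in> alg cst Y" for b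
    using alg.mult[OF alg.cst[of cst "- 1"] that] by (simp add: cst_uminus)
  then show "a - b \<in> alg cst Y" if "a \<in> alg cst Y" "b \<in> alg cst Y" for a b
    using alg.add[of a cst Y "- b"] that by simp
qed (rule alg.mult)

lemma alg_empty: "alg cst {} = range cst"
proof
  show "alg cst {} \<subseteq> range cst"
  proof
    fix x assume "x \<in> alg cst {}"
    then show "x \<in> range cst"
    proof induction
      case (add a b)
      then obtain u v where "a = cst u" "b = cst v" by auto
      then show ?case using cst_add[of u v] by (intro range_eqI[of _ _ "u + v"]) simp
    next
      case (mult a b)
      then obtain u v where "a = cst u" "b = cst v" by auto
      then show ?case using cst_mult[of u v] by (intro range_eqI[of _ _ "u * v"]) simp
    qed auto
  qed
qed (auto intro: alg.cst)

lemma alg_insert: "alg cst (insert y Y) = adj (alg cst Y) y"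
proof
  interpret Y: subring "alg cst Y" by (rule subring_alg)
  interpret A: subring "adj (alg cst Y) y" by (rule Y.subring_adj)
  interpret I: subring "alg cst (insert y Y)" by (rule subring_alg)
  have base: "a \<in> adj (alg cst Y) y" if "a \<in> alg cst Y" for a
    using that unfolding adj_def by (intro CollectI exI[of _ "[:a:]"]) (auto simp: coeff_pCons split: nat.splits)
  have "poly [:0, 1:] y \<in> adj (alg cst Y) y"
    unfolding adj_def by (intro CollectI exI[of _ "[:0,1:]"]) (auto simp: coeff_pCons split: nat.splits)
  then have y: "y \<in> adj (alg cst Y) y" by simp
  show "alg cst (insert y Y) \<subseteq> adj (alg cst Y) y"
  proof
    fix x assume "x \<in> alg cst (insert y Y)"
    then show "x \<in> adj (alg cst Y) y"
      by induction (use y in \<open>auto intro: base alg.intros\<close>)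
  qed
  have sub: "a \<in> alg cst (insert y Y)" if "a \<in> alg cst Y" for a
    using that by induction (auto intro: alg.intros)
  show "adj (alg cst Y) y \<subseteq> alg cst (insert y Y)"
  proof
    fix x assume "x \<in> adj (alg cst Y) y"
    then obtain p where p: "x = poly p y" "\<forall>i. coeff p i \<in> alg cst Y" by (auto simp: adj_def)
    have "y \<in> alg cst (insert y Y)" by (rule alg.gen) simp
    then show "x \<in> alg cst (insert y Y)" unfolding p(1) poly_altdef
      using sub p(2) by blast
  qed
qed

lemma noeth_alg: "finite Y ==> noeth (alg cst Y)"
proof (induction Y rule: finite_induct)
  case empty
  interpret subring "alg cst {}" by (rule subring_alg)
  show ?case unfolding noeth_def
  proof (intro allI impI)
    fix I assume I: "ideal_in (alg cst {}) I"
    show "\<exists>S. finite S \<and> S \<subseteq> I \<and> I = gen (alg cst {}) S"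
    proof (cases "I = {0}")
      case True
      then show ?thesis by (intro exI[of _ "{}"]) auto
    next
      case False
      then obtain a where "a \<in> I" "a \<noteq> 0" using I by (auto simp: ideal_in_def)
      then obtain c where "a = cst c" using I by (auto simp: ideal_in_def alg_empty)
      with \<open>a \<noteq> 0\<close> have c: "a = cst c" "c \<noteq> 0" by auto
      have "cst (1 / c) * a \<in> I" using idealD(4)[OF I] \<open>a \<in> I\<close> by (auto intro: alg.cst)
      then have "1 \<in> I" using c cst_mult[of "1 / c" c] by simp
      moreover from this have "I = gen (alg cst {}) {1}"
        using ideal_one[OF I] by (auto simp: gen1)
      ultimately show ?thesis by (intro exI[of _ "{1}"]) auto
    qed
  qed
next
  case (insert y Y)
  then show ?case using subring.noeth_adj[OF subring_alg] by (simp add: alg_insert)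
qed

section \<open>Complex polynomials evaluated in the algebra, and its countable dimension\<close>

definition evalp :: "complex poly \<Rightarrow> 'a \<Rightarrow> 'a" where
  "evalp p y = poly (map_poly cst p) y"

lemma evalp_0 [simp]: "evalp 0 y = 0"
  by (simp add: evalp_def)

lemma evalp_pCons [simp]: "evalp (pCons c p) y = cst c + y * evalp p y"
  by (simp add: evalp_def map_poly_pCons)

lemma evalp_add: "evalp (p + q) y = evalp p y + evalp q y"
proof (induction p arbitrary: q)
  case (pCons a p)
  show ?case by (cases q) (simp add: pCons.IH cst_add distrib_left add.assoc add.left_commute)
qed simp

lemma evalp_smult: "evalp (smult c q) y = cst c * evalp q y"
  by (induction q) (auto simp: cst_mult algebra_simps)

lemma evalp_mult: "evalp (p * q) y = evalp p y * evalp q y"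
  by (induction p) (auto simp: evalp_add evalp_smult algebra_simps)

lemma evalp_1 [simp]: "evalp 1 y = 1"
  by (simp add: one_pCons)

lemma evalp_sum: "evalp (sum f S) y = (\<Sum>i\<in>S. evalp (f i) y)"
  by (induction S rule: infinite_finite_induct) (auto simp: evalp_add)

lemma evalp_prod: "evalp (prod f S) y = (\<Prod>i\<in>S. evalp (f i) y)"
  by (induction S rule: infinite_finite_induct) (auto simp: evalp_mult)

sublocale vs: vector_space "\<lambda>c a. cst c * a"
  by unfold_locales (auto simp: cst_add cst_mult algebra_simps)

text \<open>The monomials are written as products of lists over \<open>Y\<close> because lists over
  a finite set are visibly countable.\<close>

lemma alg_span: "alg cst Y \<subseteq> vs.span (prod_list ` lists Y)"
proof
  let ?S = "vs.span (prod_list ` lists Y)"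
  fix x assume "x \<in> alg cst Y"
  then show "x \<in> ?S"
  proof induction
    case (cst c)
    have "1 \<in> ?S" by (rule vs.span_base) (auto intro!: image_eqI[of _ _ "[]"])
    from vs.span_scale[OF this, of c] show ?case by simp
  next
    case (gen y)
    then show ?case by (intro vs.span_base) (auto intro!: image_eqI[of _ _ "[y]"])
  next
    case (add a b)
    then show ?case by (intro vs.span_add)
  next
    case (mult a b)
    have 1: "m * n \<in> ?S" if "n \<in> prod_list ` lists Y" "m \<in> prod_list ` lists Y" for m n
    proof -
      obtain u v where "u \<in> lists Y" "v \<in> lists Y" "m = prod_list u" "n = prod_list v" using \<open>n \<in> _\<close> \<open>m \<in> _\<close> by auto
      then show ?thesis by (intro vs.span_base image_eqI[of _ _ "u @ v"]) (auto simp del: in_lists_conv_set)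
    qed
    have 2: "a * n \<in> ?S" if "a \<in> ?S" "n \<in> prod_list ` lists Y" for a n
      using that(1)
    proof (induction rule: vs.span_induct_alt)
      case base then show ?case by (simp add: vs.span_zero)
    next
      case (step c m z)
      have "(cst c * m + z) * n = cst c * (m * n) + z * n" by (simp add: algebra_simps)
      then show ?case using step 1[OF that(2) step(1)] by (simp add: vs.span_add vs.span_scale)
    qed
    show ?case using mult(4)
    proof (induction rule: vs.span_induct_alt)
      case base then show ?case by (simp add: vs.span_zero)
    next
      case (step c m z)
      have "a * (cst c * m + z) = cst c * (a * m) + a * z" by (simp add: algebra_simps)
      then show ?case using step 2[OF mult(3) step(1)] by (simp add: vs.span_add vs.span_scale)
    qed
  qed
qed

text \<open>Dependence is needed for the indexed family, not for its image: two indices may carry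
  the same vector, and then the coefficients 1 and -1 give the relation.\<close>

lemma dependent_family:
  fixes r :: "complex \<Rightarrow> 'a"
  assumes "finite T" "finite C" "card T < card C" "\<And>c. c \<in> C ==> r c \<in> vs.span T"
  obtains a c where "c \<in> C" "a c \<noteq> 0" "(\<Sum>c\<in>C. cst (a c) * r c) = 0"
proof (cases "inj_on r C")
  case True
  have "vs.dependent (r ` C)"
  proof (rule ccontr)
    assume "\<not> vs.dependent (r ` C)"
    then have "card (r ` C) \<le> card T" using vs.independent_span_bound[OF assms(1)] assms(4) by blast
    then show False using True assms(3) by (simp add: card_image)
  qed
  then obtain u v where "v \<in> r ` C" "u v \<noteq> 0" "(\<Sum>v\<in>r ` C. cst (u v) * v) = 0"
    using vs.dependent_finite[of "r ` C"] assms(2) by auto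
  then show ?thesis using that[of _ "u \<circ> r"] True by (auto simp: sum.reindex)
next
  case False
  then obtain c d where cd: "c \<in> C" "d \<in> C" "c \<noteq> d" "r c = r d" by (auto simp: inj_on_def)
  define a where "a = (\<lambda>e. if e = c then 1 else if e = d then - 1 else (0::complex))"
  have "(\<Sum>e\<in>C. cst (a e) * r e) = (\<Sum>e\<in>{c, d}. cst (a e) * r e)"
    using cd assms(2) by (intro sum.mono_neutral_right) (auto simp: a_def)
  also have "\<dots> = 0" using cd by (simp add: a_def cst_uminus)
  finally show ?thesis using that[of c a] cd by (auto simp: a_def)
qed

text \<open>Over the complex numbers \<open>G\<close> splits into linear factors, and a prime ideal
  containing the product of their values contains one of them.\<close>

lemma linear_factor_in_prime:
  assumes Q: "prime_ideal (alg cst Y) Q" and y: "y \<in> alg cst Y"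
  shows "G \<noteq> 0 ==> evalp G y \<in> Q ==> \<exists>c. y - cst c \<in> Q"
proof (induction "degree G" arbitrary: G)
  case 0
  then obtain a where a: "G = [:a:]" by (metis degree_eq_zeroE)
  with 0 have "cst (1 / a) * cst a \<in> Q"
    using idealD(4)[OF prime_idealD(1)[OF Q] alg.cst] by simp
  moreover have "cst (1 / a) * cst a = 1" using a 0 cst_mult[of "1 / a" a] by simp
  ultimately show ?case using prime_idealD(2)[OF Q] by simp
next
  case (Suc n)
  interpret subring "alg cst Y" by (rule subring_alg)
  have ev: "evalp p y \<in> alg cst Y" for p
    by (induction p) (auto intro: y alg.cst)
  have "\<not> (\<exists>a l. a \<noteq> 0 \<and> l = 0 \<and> G = pCons a l)" using Suc(2) by auto
  then obtain z where "poly G z = 0" using fundamental_theorem_of_algebra_alt by blast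
  then obtain H where H: "G = [:- z, 1:] * H" by (metis dvdE poly_eq_0_iff_dvd)
  with Suc have H0: "H \<noteq> 0" by auto
  have "degree G = Suc (degree H)" unfolding H using H0 by (subst degree_mult_eq) auto
  then have dH: "n = degree H" using Suc(2) by simp
  have "evalp G y = (y - cst z) * evalp H y" by (simp add: H evalp_mult cst_uminus del: mult_pCons_left)
  then have "y - cst z \<in> Q \<or> evalp H y \<in> Q"
    using prime_idealD(3)[OF Q, of "y - cst z" "evalp H y"] Suc(4) y ev by (auto intro: alg.cst)
  then show ?case using Suc(1)[OF dH H0] by blast
qed

text \<open>Over an uncountable field the algebra has countable dimension, whereas the inverses of the
  elements \<open>y - c\<close> in a larger field would be linearly independent.\<close>

theorem nullstellensatz:
  assumes Y: "finite Y" and I: "ideal_in (alg cst Y) I" and e: "e \<in> alg cst Y" and eI: "\<And>k. e ^ k \<notin> I"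
  obtains Q where "prime_ideal (alg cst Y) Q" "I \<subseteq> Q" "e \<notin> Q" "\<And>y. y \<in> Y ==> \<exists>c. y - cst c \<in> Q"
proof -
  let ?P = "alg cst Y"
  interpret subring ?P by (rule subring_alg)
  \<comment> \<open>An ideal maximal among those that contain \<open>I\<close> and no power of
    \<open>e\<close> is prime, and modulo it every nonzero element divides a power of
    \<open>e\<close>.\<close>
  define F where "F = {Q. ideal_in ?P Q \<and> I \<subseteq> Q \<and> (\<forall>k. e ^ k \<notin> Q)}"
  have "F \<noteq> {}" "\<And>J. J \<in> F ==> ideal_in ?P J" using I eI by (auto simp: F_def)
  then obtain Q where QF: "Q \<in> F" and Qmax: "\<And>J. J \<in> F ==> Q \<subseteq> J ==> J = Q"
    using maximal_ideal_exists[OF noeth_alg[OF Y], of F] by blast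
  have Qid: "ideal_in ?P Q" and IQ: "I \<subseteq> Q" and eQ: "e ^ k \<notin> Q" for k using QF by (auto simp: F_def)
  have ext: "\<exists>k r. r \<in> ?P \<and> e ^ k - r * f \<in> Q" if f: "f \<in> ?P" "f \<notin> Q" for f
  proof -
    define J where "J = {r * f + q | r q. r \<in> ?P \<and> q \<in> Q}"
    have "ideal_in ?P J"
      unfolding ideal_in_def
    proof (intro conjI ballI)
      show "J \<subseteq> ?P" using idealD(1)[OF Qid] f by (auto simp: J_def)
      show "0 \<in> J" using idealD(2)[OF Qid] by (auto simp: J_def intro!: exI[of _ 0])
      show "a + b \<in> J" if ab: "a \<in> J" "b \<in> J" for a b
      proof -
        obtain r q s t where "a = r * f + q" "b = s * f + t" "r \<in> ?P" "s \<in> ?P" "q \<in> Q" "t \<in> Q"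
          using ab by (auto simp: J_def)
        then have "a + b = (r + s) * f + (q + t)" "r + s \<in> ?P" "q + t \<in> Q"
          using idealD(3)[OF Qid] by (auto simp: algebra_simps)
        then show ?thesis unfolding J_def by blast
      qed
      show "u * a \<in> J" if ua: "u \<in> ?P" "a \<in> J" for u a
      proof -
        obtain r q where "a = r * f + q" "r \<in> ?P" "q \<in> Q"
          using ua by (auto simp: J_def)
        then have "u * a = (u * r) * f + u * q" "u * r \<in> ?P" "u * q \<in> Q"
          using idealD(4)[OF Qid] ua(1) by (auto simp: distrib_left mult.assoc)
        then show ?thesis unfolding J_def by blast
      qed
    qed
    moreover have QJ: "Q \<subseteq> J"
    proof
      fix q assume "q \<in> Q"
      then have "q = 0 * f + q \<and> 0 \<in> ?P \<and> q \<in> Q" by simp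
      then show "q \<in> J" unfolding J_def by blast
    qed
    moreover have "f \<in> J"
    proof -
      have "f = 1 * f + 0 \<and> 1 \<in> ?P \<and> 0 \<in> Q" using idealD(2)[OF Qid] by simp
      then show ?thesis unfolding J_def by blast
    qed
    ultimately have "J \<notin> F" using Qmax[of J] f by auto
    then obtain k where "e ^ k \<in> J" using \<open>ideal_in ?P J\<close> IQ QJ by (auto simp: F_def)
    then show ?thesis by (auto simp: J_def) (metis add_diff_cancel_left')
  qed
  have prime: "prime_ideal ?P Q"
    unfolding prime_ideal_def
  proof (intro conjI ballI impI Qid)
    show "1 \<notin> Q" using eQ[of 0] by simp
    fix f g assume fg: "f \<in> ?P" "g \<in> ?P" "f * g \<in> Q"
    show "f \<in> Q \<or> g \<in> Q"
    proof (rule ccontr)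
      assume "\<not> ?thesis"
      then obtain k r l s where *: "r \<in> ?P" "e ^ k - r * f \<in> Q" "s \<in> ?P" "e ^ l - s * g \<in> Q"
        using ext fg by meson
      have "e ^ (k + l) = (e ^ k - r * f) * e ^ l + (r * f) * (e ^ l - s * g) + r * s * (f * g)"
        by (simp add: algebra_simps power_add)
      also have "\<dots> \<in> Q"
      proof (intro idealD(3)[OF Qid])
        show "(e ^ k - r * f) * e ^ l \<in> Q" using * e by (intro idealD(5)[OF Qid]) auto
        show "r * f * (e ^ l - s * g) \<in> Q" "r * s * (f * g) \<in> Q"
          using * fg by (auto intro: idealD(4)[OF Qid])
      qed
      finally show False using eQ by blast
    qed
  qed
  have "\<exists>c. y - cst c \<in> Q" if "y \<in> Y" for y
  proof (rule ccontr)
    assume no: "\<nexists>c. y - cst c \<in> Q"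
    have yP: "y \<in> ?P" using that by (rule alg.gen)
    have "\<exists>k r. r \<in> ?P \<and> e ^ k - r * (y - cst c) \<in> Q" for c
      using ext[of "y - cst c"] no yP by (auto intro: alg.cst)
    then obtain n r where nr: "\<And>c. r c \<in> ?P" "\<And>c. e ^ n c - r c * (y - cst c) \<in> Q" by metis
    \<comment> \<open>Each \<open>r c\<close> uses finitely many of the countably many monomials,
      and there are only countably many finite sets of monomials.\<close>
    have "\<exists>t. finite t \<and> t \<subseteq> prod_list ` lists Y \<and> r c \<in> vs.span t" for c
    proof -
      have "r c \<in> vs.span (prod_list ` lists Y)" using nr(1) alg_span by blast
      then obtain t u where t: "finite t" "t \<subseteq> prod_list ` lists Y" "r c = (\<Sum>a\<in>t. cst (u a) * a)"
        unfolding vs.span_explicit by auto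
      moreover have "r c \<in> vs.span t" unfolding t(3)
        by (intro vs.span_sum vs.span_scale vs.span_base)
      ultimately show ?thesis by blast
    qed
    then obtain t where t: "\<And>c. finite (t c)" "\<And>c. t c \<subseteq> prod_list ` lists Y" "\<And>c. r c \<in> vs.span (t c)"
      by metis
    let ?D = "(UNIV :: nat set) \<times> {T. finite T \<and> T \<subseteq> prod_list ` lists Y}"
    have "countable ?D"
      using Y by (intro countable_SIGMA countable_Collect_finite_subset countable_image countable_lists)
        (auto intro: countable_finite)
    \<comment> \<open>Uncountably many \<open>c\<close> are distributed over countably many pairs of
      an exponent and a support, so infinitely many share one pair. More than \<open>card T\<close>
      of the corresponding \<open>r c\<close> in the span of \<open>T\<close> are dependent.\<close>
    have "\<exists>d\<in>?D. infinite {c. (n c, t c) = d}"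
    proof (rule ccontr)
      assume "\<not> ?thesis"
      then have "\<forall>d\<in>?D. countable {c. (n c, t c) = d}" by (auto intro: countable_finite)
      then have "countable (\<Union>d\<in>?D. {c. (n c, t c) = d})" using \<open>countable ?D\<close> by (intro countable_UN) auto
      moreover have "(\<Union>d\<in>?D. {c. (n c, t c) = d}) = UNIV" using t by auto
      ultimately show False using uncountable_UNIV_complex by simp
    qed
    then obtain m T where mT: "finite T" "infinite {c. n c = m \<and> t c = T}" by auto
    obtain C where C: "C \<subseteq> {c. n c = m \<and> t c = T}" "finite C" "card C = Suc (card T)"
      using infinite_arbitrarily_large[OF mT(2), of "Suc (card T)"] by auto
    have rT: "r c \<in> vs.span T" if "c \<in> C" for c
    proof -
      have "t c = T" using C(1) that by blast
      then show ?thesis using t(3)[of c] by simp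
    qed
    obtain c0 a where a: "c0 \<in> C" "a c0 \<noteq> 0" "(\<Sum>c\<in>C. cst (a c) * r c) = 0"
      using dependent_family[OF mT(1) C(2) _ rT, of "\<lambda>c. c"] C(3) by (metis lessI)
    \<comment> \<open>The numerator of the sum of the fractions \<open>a c / (y - c)\<close> over
      \<open>C\<close>. At \<open>c0\<close> a single summand survives, so \<open>G\<close> is not
      zero.\<close>
    define G where "G = (\<Sum>c\<in>C. smult (a c) (\<Prod>d\<in>C - {c}. [:- d, 1:]))"
    have "poly G c0 = (\<Sum>c\<in>C. a c * (\<Prod>d\<in>C - {c}. c0 - d))"
      by (simp add: G_def poly_sum poly_prod)
    also have "\<dots> = (\<Sum>c\<in>{c0}. a c * (\<Prod>d\<in>C - {c}. c0 - d))"
      using a C(2) by (intro sum.mono_neutral_right) auto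
    also have "\<dots> = a c0 * (\<Prod>d\<in>C - {c0}. c0 - d)" by simp
    also have "\<dots> \<noteq> 0" using C(2) by (simp only: mult_eq_0_iff a(2) prod_zero_iff finite_Diff) auto
    finally have "G \<noteq> 0" by auto
    define w where "w c = y - cst c" for c
    have wP: "w c \<in> ?P" for c using yP by (auto simp: w_def intro: alg.cst)
    have evG: "evalp G y = (\<Sum>c\<in>C. cst (a c) * (\<Prod>d\<in>C - {c}. w d))"
      by (simp add: G_def evalp_sum evalp_smult evalp_prod w_def cst_uminus)
    \<comment> \<open>Modulo \<open>Q\<close> each \<open>r c * w c\<close> equals
      \<open>e ^ m\<close>. Making this replacement turns the sum into the linear relation times the
      product of all \<open>w c\<close>.\<close>
    have "e ^ m * evalp G y = (\<Sum>c\<in>C. e ^ m * (cst (a c) * (\<Prod>d\<in>C - {c}. w d)))"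
      by (simp add: evG sum_distrib_left)
    also have "\<dots> = (\<Sum>c\<in>C. (e ^ m - r c * w c) * (cst (a c) * (\<Prod>d\<in>C - {c}. w d))
        + cst (a c) * r c * (w c * (\<Prod>d\<in>C - {c}. w d)))"
      by (rule sum.cong[OF refl]) (simp add: algebra_simps)
    also have "\<dots> = (\<Sum>c\<in>C. (e ^ m - r c * w c) * (cst (a c) * (\<Prod>d\<in>C - {c}. w d)))
        + (\<Sum>c\<in>C. cst (a c) * r c * (w c * (\<Prod>d\<in>C - {c}. w d)))"
      by (rule sum.distrib)
    also have "(\<Sum>c\<in>C. cst (a c) * r c * (w c * (\<Prod>d\<in>C - {c}. w d))) = (\<Sum>c\<in>C. cst (a c) * r c * (\<Prod>d\<in>C. w d))"
      by (rule sum.cong[OF refl]) (metis prod.remove[OF C(2)])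
    also have "\<dots> = (\<Sum>c\<in>C. cst (a c) * r c) * (\<Prod>d\<in>C. w d)"
      by (rule sum_distrib_right[symmetric])
    also have "\<dots> = 0" unfolding a(3) by simp
    finally have "e ^ m * evalp G y = (\<Sum>c\<in>C. (e ^ m - r c * w c) * (cst (a c) * (\<Prod>d\<in>C - {c}. w d)))" by simp
    also have "\<dots> \<in> Q"
    proof (rule ideal_in_sum[OF Qid])
      fix c assume "c \<in> C"
      then have "n c = m" using C(1) by blast
      then have 1: "e ^ m - r c * w c \<in> Q" using nr(2)[of c] by (simp add: w_def)
      show "(e ^ m - r c * w c) * (cst (a c) * (\<Prod>d\<in>C - {c}. w d)) \<in> Q"
        by (rule idealD(5)[OF Qid _ 1]) (rule mult_closed[OF alg.cst prod_closed[OF wP]])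
    qed
    finally have "e ^ m * evalp G y \<in> Q" .
    moreover have "evalp G y \<in> ?P" unfolding evG
      by (rule sum_closed) (rule mult_closed[OF alg.cst prod_closed[OF wP]])
    ultimately have "evalp G y \<in> Q"
      using prime_idealD(3)[OF prime power_closed[OF e], of "evalp G y" m] eQ by blast
    then show False using linear_factor_in_prime[OF prime yP \<open>G \<noteq> 0\<close>] no by blast
  qed
  then show ?thesis using that[OF prime IQ] eQ[of 1] by auto
qed

end

section \<open>Regular local rings of dimension three\<close>

text \<open>Positive integers are required to be units: the members \<open>y + of_nat n * z\<close>
  of a pencil of parameters then differ from each other by unit multiples of
  \<open>z\<close>.\<close>

locale local_domain = subring A for A :: "'a::field set" +
  fixes M :: "'a set"
  assumes M_ideal: "ideal_in A M"
    and one_notin_M: "1 \<notin> M"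
    and inverse_closed: "a \<in> A ==> a \<notin> M ==> inverse a \<in> A"
    and of_nat_notin_M: "n > 0 ==> of_nat n \<notin> M"
    and noetherian: "noeth A"
begin

lemma M_closed: "a \<in> M ==> a \<in> A"
  using M_ideal by (auto simp: ideal_in_def)

lemma notin_M_nonzero: "a \<notin> M ==> a \<noteq> 0"
  using idealD(2)[OF M_ideal] by auto

lemma one_minus_notin_M: "a \<in> M ==> 1 - a \<notin> M"
  using idealD(3)[OF M_ideal, of a "1 - a"] one_notin_M by auto

lemma unit_cancel:
  assumes "ideal_in A I" "u \<in> A" "u \<notin> M" "u * a \<in> I"
  shows "a \<in> I"
proof -
  have "inverse u * (u * a) \<in> I" using assms inverse_closed by (auto intro: idealD(4))
  then show ?thesis using notin_M_nonzero[OF assms(3)] by (simp add: mult.assoc[symmetric])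
qed

lemma proper_ideal_le_M: "ideal_in A I ==> 1 \<notin> I ==> I \<subseteq> M"
proof
  fix a assume I: "ideal_in A I" "1 \<notin> I" and a: "a \<in> I"
  then have aA: "a \<in> A" using idealD(1) by blast
  show "a \<in> M"
  proof (rule ccontr)
    assume "a \<notin> M"
    then have "1 \<in> I" using unit_cancel[OF I(1) aA, of 1] a by simp
    then show False using I by simp
  qed
qed

lemma prime_M: "prime_ideal A M"
  unfolding prime_ideal_def
proof (intro conjI ballI impI M_ideal one_notin_M)
  fix a b assume "a \<in> A" "a * b \<in> M"
  then show "a \<in> M \<or> b \<in> M" using unit_cancel[OF M_ideal, of a b] by blast
qed

text \<open>Generators of \<open>N\<close> are discarded one at a time. A generator \<open>s\<close>
  is \<open>y * n\<close> modulo \<open>L\<close>, and \<open>n\<close> is \<open>r * s\<close> plus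
  a combination of the rest; so \<open>(1 - y * r) * s\<close> is a combination of the rest, and
  \<open>1 - y * r\<close> is a unit.\<close>

lemma nakayama:
  assumes N: "ideal_in A N" and L: "ideal_in A L" and y: "y \<in> M"
    and NL: "\<And>a. a \<in> N ==> \<exists>n\<in>N. a - y * n \<in> L"
  shows "N \<subseteq> L"
proof -
  have LA: "L \<subseteq> A" and NA: "N \<subseteq> A" using L N by (auto simp: ideal_in_def)
  have "N \<subseteq> L" if "finite S" "S \<subseteq> N" "N \<subseteq> gen A (L \<union> S)" for S
    using that
  proof (induction S rule: finite_induct)
    case empty
    then show ?case using gen_least[OF L, of L] by auto
  next
    case (insert s S)
    let ?G = "gen A (L \<union> S)"
    have sub: "L \<union> S \<subseteq> A" "insert s (L \<union> S) \<subseteq> A" using insert LA NA by auto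
    have G: "ideal_in A ?G" using sub(1) by (rule gen_ideal)
    have eq: "gen A (L \<union> insert s S) = {r * s + a | r a. r \<in> A \<and> a \<in> ?G}"
      using gen_insert[OF sub(2)] by simp
    obtain n where n: "n \<in> N" "s - y * n \<in> L" using NL[of s] insert(4) by blast
    then obtain r a where r: "n = r * s + a" "r \<in> A" "a \<in> ?G" using insert(5) eq by auto
    have "s - y * n \<in> ?G" using n gen_incl[of "L \<union> S"] by auto
    then have "(s - y * n) + y * a \<in> ?G"
      using r y M_closed by (intro idealD(3)[OF G] idealD(4)[OF G]) auto
    also have "(s - y * n) + y * a = (1 - y * r) * s" by (simp add: r algebra_simps)
    finally have "s \<in> ?G"
      using unit_cancel[OF G, of "1 - y * r" s] one_minus_notin_M[of "y * r"] y r(2) M_closed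
        idealD(5)[OF M_ideal] by auto
    then have "gen A (L \<union> insert s S) \<subseteq> ?G"
      using gen_incl[of "L \<union> S"] by (intro gen_least[OF G]) auto
    then show ?case using insert by auto
  qed
  moreover obtain S where "finite S" "S \<subseteq> N" "N = gen A S"
    using noetherian N by (auto simp: noeth_def)
  ultimately show ?thesis using gen_mono[of S "L \<union> S" A] by auto
qed

text \<open>An ideal satisfies \<open>deep\<close> if the quotient by it has depth at least one, or is zero.\<close>

definition deep :: "'a set \<Rightarrow> bool" where
  "deep I \<longleftrightarrow> ideal_in A I \<and> (\<forall>s\<in>A. (\<forall>m\<in>M. m * s \<in> I) \<longrightarrow> s \<in> I)"

lemma deepD: "deep I ==> ideal_in A I" "deep I ==> s \<in> A ==> (\<And>m. m \<in> M ==> m * s \<in> I) ==> s \<in> I"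
  by (auto simp: deep_def)

lemma deep_whole: "deep A"
  by (simp add: deep_def whole_ideal)

text \<open>Any element of \<open>M\<close> outside \<open>P\<close> can be cancelled modulo
  \<open>P\<close>.\<close>

lemma prime_deep:
  assumes "prime_ideal A P" "P \<noteq> M" shows "deep P"
  unfolding deep_def
proof (intro conjI ballI impI)
  show P: "ideal_in A P" using assms by (simp add: prime_ideal_def)
  fix s assume s: "s \<in> A" "\<forall>m\<in>M. m * s \<in> P"
  have "P \<subseteq> M" using proper_ideal_le_M[OF P] assms by (simp add: prime_ideal_def)
  then obtain m where "m \<in> M" "m \<notin> P" using assms(2) by auto
  then show "s \<in> P" using s assms(1) M_closed by (auto simp: prime_ideal_def)
qed

text \<open>If \<open>s\<close> were not in \<open>I\<close>, multiplying it by the highest harmless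
  power of each generator in turn would give an element outside \<open>I\<close> which all of
  \<open>M\<close> multiplies into \<open>I\<close>. The induction is over the set \<open>T\<close>
  of generators for which only a power is known to work.\<close>

lemma deep_nilpotent:
  assumes I: "deep I" and S: "finite S" "S \<subseteq> A" "M = gen A S"
    and s: "s \<in> A" "\<And>u. u \<in> S ==> \<exists>k. u ^ k * s \<in> I"
  shows "s \<in> I"
proof -
  have id: "ideal_in A I" using I by (simp add: deep_def)
  have "\<forall>s\<in>A. (\<forall>u\<in>S. \<exists>k. u ^ k * s \<in> I) \<and> (\<forall>u\<in>S - T. u * s \<in> I) \<longrightarrow> s \<in> I" if "finite T" for T
    using that
  proof (induction T rule: finite_induct)
    case empty
    show ?case
    proof (intro ballI impI, elim conjE)
      fix s assume s: "s \<in> A" "\<forall>u\<in>S - {}. u * s \<in> I"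
      have "m * s \<in> I" if "m \<in> M" for m
        using that unfolding S(3)
      proof induction
        case zero
        then show ?case using idealD(2)[OF id] by simp
      next
        case (step r t a)
        have "t * s \<in> I" using s(2) step(2) by auto
        then have "r * (t * s) + a * s \<in> I"
          using idealD(3)[OF id idealD(4)[OF id step(1)] step(4)] by blast
        then show ?case by (simp add: algebra_simps)
      qed
      then show "s \<in> I" using I s(1) by (auto simp: deep_def)
    qed
  next
    case (insert u T)
    have *: "u ^ k * s \<in> I ==> s \<in> I"
      if s: "s \<in> A" "\<forall>u\<in>S. \<exists>k. u ^ k * s \<in> I" "\<forall>v\<in>S - insert u T. v * s \<in> I" "u \<in> S" for s k
    proof (induction k)
      case (Suc k)
      let ?s = "u ^ k * s"
      have uA: "u ^ k \<in> A" using that S by auto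
      have "\<forall>v\<in>S. \<exists>l. v ^ l * ?s \<in> I"
      proof
        fix v assume "v \<in> S"
        then obtain l where "v ^ l * s \<in> I" using s(2) by auto
        then have "u ^ k * (v ^ l * s) \<in> I" using idealD(4)[OF id uA] by simp
        then show "\<exists>l. v ^ l * ?s \<in> I" by (auto simp: ac_simps)
      qed
      moreover have "\<forall>v\<in>S - T. v * ?s \<in> I"
      proof
        fix v assume "v \<in> S - T"
        show "v * ?s \<in> I"
        proof (cases "v = u")
          case True
          then show ?thesis using Suc(2) by (simp add: ac_simps)
        next
          case False
          then have "u ^ k * (v * s) \<in> I" using \<open>v \<in> S - T\<close> that(3) idealD(4)[OF id uA] by simp
          then show ?thesis by (simp add: ac_simps)
        qed
      qed
      ultimately have "?s \<in> I" using insert(3) that(1) uA by auto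
      then show ?case by (rule Suc(1))
    qed simp
    show ?case
    proof (intro ballI impI, elim conjE)
      fix s assume s: "s \<in> A" "\<forall>u\<in>S. \<exists>k. u ^ k * s \<in> I" "\<forall>v\<in>S - insert u T. v * s \<in> I"
      show "s \<in> I"
      proof (cases "u \<in> S")
        case True
        then show ?thesis using *[OF s True] s(2) by auto
      next
        case False
        then have "\<forall>v\<in>S - T. v * s \<in> I" using s(3) by auto
        then show ?thesis using insert(3) s by auto
      qed
    qed
  qed
  from this[OF S(1)] show ?thesis using s by auto
qed

end

text \<open>The hypotheses say that \<open>w, z, F\<close> is a regular sequence generating the maximal ideal whose
  initial segments \<open>w\<close> and \<open>w, z\<close> generate prime ideals. The point is to reorder it.\<close>

locale regular_system = local_domain A M for A :: "'a::field set" and M +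
  fixes F w z :: 'a
  assumes w_nonzero: "w \<noteq> 0"
    and prime_w: "prime_ideal A (gen A {w})"
    and prime_wz: "prime_ideal A (gen A {w, z})"
    and z_notin: "z \<notin> gen A {w}"
    and F_notin: "F \<notin> gen A {w, z}"
    and M_gen: "M = gen A {F, w, z}"
    and FA [simp, intro]: "F \<in> A" and wA [simp, intro]: "w \<in> A" and zA [simp, intro]: "z \<in> A"
begin

lemma in_M: "F \<in> M" "w \<in> M" "z \<in> M"
  unfolding M_gen using gen_incl[of "{F, w, z}"] by auto

lemma F_regular_mod_w:
  assumes "a \<in> A" "F * a \<in> gen A {w}" shows "a \<in> gen A {w}"
  using prime_idealD(3)[OF prime_w, of F a] assms F_notin gen_mono[of "{w}" "{w, z}" A] by auto

lemma w_regular_mod_F: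
  assumes "a \<in> A" "w * a \<in> gen A {F}" shows "a \<in> gen A {F}"
proof -
  obtain b where b: "w * a = b * F" "b \<in> A" using assms(2) by (auto simp: gen1)
  then have "F * b \<in> gen A {w}" using assms(1) by (auto simp: gen1 ac_simps intro!: exI[of _ a])
  then obtain c where c: "b = c * w" "c \<in> A" using F_regular_mod_w b by (auto simp: gen1)
  then have "w * a = w * (c * F)" using b by (simp add: ac_simps)
  then have "a = c * F" using w_nonzero by simp
  then show ?thesis using c by (auto simp: gen1)
qed

text \<open>This says that \<open>z\<close> is not nilpotent modulo \<open>F\<close> and
  \<open>w\<close>. If \<open>z ^ Suc k\<close> is \<open>d * F\<close> modulo \<open>w\<close>,
  then \<open>d\<close> lies in the prime generated by \<open>w\<close> and \<open>z\<close>,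
  because \<open>F\<close> does not; so \<open>d\<close> may be replaced by \<open>e * z\<close>,
  and one factor \<open>z\<close> cancels modulo the prime generated by \<open>w\<close>.\<close>

lemma z_power_notin_aux: "d \<in> A ==> z ^ k - d * F \<notin> gen A {w}"
proof (induction k arbitrary: d)
  case 0
  have "gen A {w} \<subseteq> M" using in_M by (intro gen_least[OF M_ideal]) auto
  then show ?case using one_minus_notin_M[of "d * F"] idealD(4)[OF M_ideal 0 in_M(1)] by auto
next
  case (Suc k)
  show ?case
  proof
    assume "z ^ Suc k - d * F \<in> gen A {w}"
    then obtain r where r: "z ^ Suc k - d * F = r * w" "r \<in> A" by (auto simp: gen1)
    have eq: "d * F = (- r) * w + z ^ k * z" using r by (simp add: algebra_simps)
    have "d * F \<in> gen A {w, z}" unfolding eq using r by (intro gen2I) auto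
    then have "d \<in> gen A {w, z}" using prime_idealD(3)[OF prime_wz Suc(2)] F_notin by auto
    then obtain c e where ce: "d = c * w + e * z" "c \<in> A" "e \<in> A" by (auto simp: gen2)
    have "z * (z ^ k - e * F) = (r + c * F) * w" using r ce by (simp add: algebra_simps)
    then have "z * (z ^ k - e * F) \<in> gen A {w}" using r ce by (auto simp: gen1)
    then have "z ^ k - e * F \<in> gen A {w}"
      using prime_idealD(3)[OF prime_w, of z "z ^ k - e * F"] ce z_notin by auto
    then show False using Suc(1) ce by blast
  qed
qed

lemma z_power_notin: "z ^ k \<notin> gen A {F, w}"
proof
  assume "z ^ k \<in> gen A {F, w}"
  then obtain d r where dr: "z ^ k = d * F + r * w" "d \<in> A" "r \<in> A" by (auto simp: gen2)
  then have "z ^ k - d * F = r * w" by simp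
  then have "z ^ k - d * F \<in> gen A {w}" using dr(3) by (auto simp: gen1)
  then show False using z_power_notin_aux dr by blast
qed

lemma Fw_ideal: "ideal_in A (gen A {F, w})" by (rule gen_ideal) auto
lemma F_ideal: "ideal_in A (gen A {F})" by (rule gen_ideal) auto

lemma M_mod_Fw:
  assumes "a \<in> M" obtains r where "r \<in> A" "a - r * z \<in> gen A {F, w}"
proof -
  obtain p q r where "a = p * F + q * w + r * z" "p \<in> A" "q \<in> A" "r \<in> A"
    using assms by (auto simp: M_gen gen3)
  then show ?thesis using that[of r] by (auto simp: gen2)
qed

text \<open>Modulo \<open>F\<close> and \<open>w\<close> the maximal ideal is generated by
  \<open>z\<close>, which is not nilpotent there, so the quotient is a discrete valuation ring. What
  must be excluded is a nonzero element divisible by all powers of \<open>z\<close>.\<close>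

lemma unit_times_power:
  assumes a: "a \<in> A" "a \<notin> gen A {F, w}"
  obtains u k where "u \<in> A" "u \<notin> M" "a - u * z ^ k \<in> gen A {F, w}"
proof -
  let ?L = "gen A {F, w}"
  note L = Fw_ideal
  \<comment> \<open>The elements divisible by every power of \<open>z\<close> modulo
    \<open>?L\<close>; the claim \<open>N \<subseteq> ?L\<close> below is Krull's intersection
    theorem for this ring.\<close>
  define N where "N = {a \<in> A. \<forall>k. \<exists>r\<in>A. a - r * z ^ k \<in> ?L}"
  have repr: "\<exists>u k. u \<in> A \<and> u \<notin> M \<and> a - u * z ^ k \<in> ?L" if aN: "a \<in> A" "a \<notin> N" for a
  proof -
    define ok where "ok k \<longleftrightarrow> (\<exists>r\<in>A. a - r * z ^ k \<in> ?L)" for k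
    have "ok 0" using aN idealD(2)[OF L] by (auto simp: ok_def intro!: bexI[of _ a])
    moreover have "\<not> (\<forall>k. ok k)" using aN by (auto simp: N_def ok_def)
    ultimately obtain k where k: "ok k" "\<not> ok (Suc k)" by (metis nat_induct)
    then obtain r where r: "r \<in> A" "a - r * z ^ k \<in> ?L" by (auto simp: ok_def)
    have "r \<notin> M"
    proof
      assume "r \<in> M"
      then obtain q where q: "q \<in> A" "r - q * z \<in> ?L" by (rule M_mod_Fw)
      have "(a - r * z ^ k) + (r - q * z) * z ^ k \<in> ?L"
        by (intro idealD(3)[OF L] idealD(5)[OF L] r q) auto
      then have "a - q * z ^ Suc k \<in> ?L" by (simp add: algebra_simps)
      then show False using k(2) q(1) by (auto simp: ok_def)
    qed
    then show ?thesis using r by blast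
  qed
  have idN: "ideal_in A N"
    unfolding ideal_in_def
  proof (intro conjI ballI)
    show "N \<subseteq> A" by (auto simp: N_def)
    show "0 \<in> N" using idealD(2)[OF L] by (auto simp: N_def intro!: bexI[of _ 0])
    show "a + b \<in> N" if ab: "a \<in> N" "b \<in> N" for a b
    proof -
      have "\<exists>r\<in>A. a + b - r * z ^ k \<in> ?L" for k
      proof -
        obtain r q where "r \<in> A" "a - r * z ^ k \<in> ?L" "q \<in> A" "b - q * z ^ k \<in> ?L"
          using ab unfolding N_def by blast
        then have "(a - r * z ^ k) + (b - q * z ^ k) \<in> ?L" "r + q \<in> A" using idealD(3)[OF L] by auto
        then show ?thesis by (intro bexI[of _ "r + q"]) (auto simp: algebra_simps)
      qed
      then show ?thesis using that by (auto simp: N_def)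
    qed
    show "c * a \<in> N" if ca: "c \<in> A" "a \<in> N" for c a
    proof -
      have "\<exists>r\<in>A. c * a - r * z ^ k \<in> ?L" for k
      proof -
        obtain r where "r \<in> A" "a - r * z ^ k \<in> ?L" using ca unfolding N_def by blast
        then have "c * (a - r * z ^ k) \<in> ?L" "c * r \<in> A" using idealD(4)[OF L] that by auto
        then show ?thesis by (intro bexI[of _ "c * r"]) (auto simp: algebra_simps)
      qed
      then show ?thesis using that by (auto simp: N_def)
    qed
  qed
  have "N \<subseteq> ?L"
  proof (rule nakayama[OF idN L in_M(3)])
    fix a assume "a \<in> N"
    then obtain b where b: "b \<in> A" "a - b * z \<in> ?L" unfolding N_def by (auto dest: spec[of _ 1])
    have "b \<in> N"
    proof (rule ccontr)
      assume "b \<notin> N"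
      then obtain u k where u: "u \<in> A" "u \<notin> M" "b - u * z ^ k \<in> ?L" using repr b by blast
      \<comment> \<open>Modulo \<open>?L\<close>, \<open>a\<close> is
        \<open>u * z ^ (k + 1)\<close>. The exponent \<open>k + 2\<close> is one more, so the
        difference is \<open>z ^ (k + 1)\<close> times the unit \<open>u - c * z\<close>.\<close>
      obtain c where c: "c \<in> A" "a - c * z ^ (k + 2) \<in> ?L" using \<open>a \<in> N\<close> unfolding N_def by blast
      have "(a - c * z ^ (k + 2)) - ((a - b * z) + (b - u * z ^ k) * z) \<in> ?L"
        by (intro ideal_diff[OF L] idealD(3)[OF L] idealD(5)[OF L] b c u) auto
      then have "(u - c * z) * z ^ Suc k \<in> ?L" by (simp add: algebra_simps)
      moreover have "u - c * z \<notin> M"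
        using idealD(3)[OF M_ideal, of "u - c * z" "c * z"] idealD(4)[OF M_ideal c(1) in_M(3)] u(2) by auto
      moreover have "u - c * z \<in> A" using u(1) c(1) by auto
      ultimately have "z ^ Suc k \<in> ?L"
        using unit_cancel[OF L, of "u - c * z" "z ^ Suc k"] by blast
      then show False using z_power_notin by blast
    qed
    then show "\<exists>n\<in>N. a - z * n \<in> ?L" using b by (auto simp: mult.commute)
  qed
  then show ?thesis using repr[of a] a that by blast
qed

text \<open>A product of two units times powers of \<open>z\<close> is again a unit times a power of
  \<open>z\<close>, which is not zero in the quotient.\<close>

lemma prime_Fw: "prime_ideal A (gen A {F, w})"
  unfolding prime_ideal_def
proof (intro conjI ballI impI Fw_ideal)
  let ?L = "gen A {F, w}"
  note L = Fw_ideal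
  show "1 \<notin> ?L" using z_power_notin[of 0] by simp
  fix a b assume ab: "a \<in> A" "b \<in> A" "a * b \<in> ?L"
  show "a \<in> ?L \<or> b \<in> ?L"
  proof (rule ccontr)
    assume "\<not> ?thesis"
    then obtain u k v l where u: "u \<in> A" "u \<notin> M" "a - u * z ^ k \<in> ?L" and v: "v \<in> A" "v \<notin> M" "b - v * z ^ l \<in> ?L"
      using unit_times_power ab by metis
    have "a * b - ((a - u * z ^ k) * b + (u * z ^ k) * (b - v * z ^ l)) \<in> ?L"
      using u v ab by (intro ideal_diff[OF L ab(3)] idealD(3)[OF L idealD(5)[OF L ab(2) u(3)] idealD(4)[OF L _ v(3)]]) auto
    then have "(u * v) * z ^ (k + l) \<in> ?L" by (simp add: algebra_simps power_add)
    moreover have "u * v \<notin> M" using prime_M u v by (auto simp: prime_ideal_def)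
    ultimately show False using unit_cancel[OF L] u v z_power_notin by blast
  qed
qed

text \<open>The same intersection argument one dimension higher, for the powers of \<open>w\<close>
  modulo \<open>F\<close>. Since \<open>w\<close> can be cancelled modulo \<open>F\<close>, the
  quotient of an element of \<open>N\<close> by \<open>w\<close> is again in \<open>N\<close>
  without further work.\<close>

lemma power_of_w:
  assumes a: "a \<in> A" "a \<notin> gen A {F}"
  obtains b k where "b \<in> A" "b \<notin> gen A {F, w}" "a - b * w ^ k \<in> gen A {F}"
proof -
  let ?L = "gen A {F}"
  note L = F_ideal
  define N where "N = {a \<in> A. \<forall>k. \<exists>r\<in>A. a - r * w ^ k \<in> ?L}"
  have idN: "ideal_in A N"
    unfolding ideal_in_def
  proof (intro conjI ballI)
    show "N \<subseteq> A" by (auto simp: N_def)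
    show "0 \<in> N" using idealD(2)[OF L] by (auto simp: N_def intro!: bexI[of _ 0])
    show "a + b \<in> N" if ab: "a \<in> N" "b \<in> N" for a b
    proof -
      have "\<exists>r\<in>A. a + b - r * w ^ k \<in> ?L" for k
      proof -
        obtain r q where "r \<in> A" "a - r * w ^ k \<in> ?L" "q \<in> A" "b - q * w ^ k \<in> ?L"
          using ab unfolding N_def by blast
        then have "(a - r * w ^ k) + (b - q * w ^ k) \<in> ?L" "r + q \<in> A" using idealD(3)[OF L] by auto
        then show ?thesis by (intro bexI[of _ "r + q"]) (auto simp: algebra_simps)
      qed
      then show ?thesis using that by (auto simp: N_def)
    qed
    show "c * a \<in> N" if ca: "c \<in> A" "a \<in> N" for c a
    proof -
      have "\<exists>r\<in>A. c * a - r * w ^ k \<in> ?L" for k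
      proof -
        obtain r where "r \<in> A" "a - r * w ^ k \<in> ?L" using ca unfolding N_def by blast
        then have "c * (a - r * w ^ k) \<in> ?L" "c * r \<in> A" using idealD(4)[OF L] that by auto
        then show ?thesis by (intro bexI[of _ "c * r"]) (auto simp: algebra_simps)
      qed
      then show ?thesis using that by (auto simp: N_def)
    qed
  qed
  have "N \<subseteq> ?L"
  proof (rule nakayama[OF idN L in_M(2)])
    fix a assume "a \<in> N"
    then obtain b where b: "b \<in> A" "a - b * w \<in> ?L" unfolding N_def by (auto dest: spec[of _ 1])
    have "\<exists>r\<in>A. b - r * w ^ k \<in> ?L" for k
    proof -
      obtain c where c: "c \<in> A" "a - c * w ^ Suc k \<in> ?L" using \<open>a \<in> N\<close> unfolding N_def by blast
      have "(a - c * w ^ Suc k) - (a - b * w) \<in> ?L" by (rule ideal_diff[OF L c(2) b(2)])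
      then have "w * (b - c * w ^ k) \<in> ?L" by (simp add: algebra_simps)
      then show ?thesis using w_regular_mod_F[of "b - c * w ^ k"] b c by auto
    qed
    then have "b \<in> N" using b by (auto simp: N_def)
    then show "\<exists>n\<in>N. a - w * n \<in> ?L" using b by (auto simp: mult.commute)
  qed
  then have "a \<notin> N" using a by auto
  define ok where "ok k \<longleftrightarrow> (\<exists>r\<in>A. a - r * w ^ k \<in> ?L)" for k
  have "ok 0" using a idealD(2)[OF L] by (auto simp: ok_def intro!: bexI[of _ a])
  moreover have "\<not> (\<forall>k. ok k)" using a \<open>a \<notin> N\<close> by (auto simp: N_def ok_def)
  ultimately obtain k where k: "ok k" "\<not> ok (Suc k)" by (metis nat_induct)
  then obtain r where r: "r \<in> A" "a - r * w ^ k \<in> ?L" by (auto simp: ok_def)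
  have "r \<notin> gen A {F, w}"
  proof
    assume "r \<in> gen A {F, w}"
    then obtain p q where pq: "r = p * F + q * w" "p \<in> A" "q \<in> A" by (auto simp: gen2)
    have "p * F \<in> ?L" using pq by (auto simp: gen1)
    then have "(a - r * w ^ k) + (p * F) * w ^ k \<in> ?L"
      by (intro idealD(3)[OF L r(2)] idealD(5)[OF L _ \<open>p * F \<in> ?L\<close>]) auto
    then have "a - q * w ^ Suc k \<in> ?L" by (simp add: pq algebra_simps)
    then show False using k(2) pq(3) by (auto simp: ok_def)
  qed
  then show ?thesis using that r by blast
qed

text \<open>The argument of \<open>prime_Fw\<close> one dimension higher: \<open>w\<close> takes the
  place of \<open>z\<close>, and elements outside the prime generated by \<open>F\<close> and
  \<open>w\<close> take the place of units.\<close>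

lemma prime_F: "prime_ideal A (gen A {F})"
  unfolding prime_ideal_def
proof (intro conjI ballI impI F_ideal)
  let ?L = "gen A {F}"
  note L = F_ideal
  have LF: "?L \<subseteq> gen A {F, w}" by (rule gen_mono) auto
  then show "1 \<notin> ?L" using prime_idealD(2)[OF prime_Fw] by auto
  fix a b assume ab: "a \<in> A" "b \<in> A" "a * b \<in> ?L"
  show "a \<in> ?L \<or> b \<in> ?L"
  proof (rule ccontr)
    assume "\<not> ?thesis"
    then obtain u k v l where u: "u \<in> A" "u \<notin> gen A {F, w}" "a - u * w ^ k \<in> ?L"
      and v: "v \<in> A" "v \<notin> gen A {F, w}" "b - v * w ^ l \<in> ?L"
      using power_of_w ab by metis
    have "a * b - ((a - u * w ^ k) * b + (u * w ^ k) * (b - v * w ^ l)) \<in> ?L"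
      using u v ab by (intro ideal_diff[OF L ab(3)] idealD(3)[OF L idealD(5)[OF L ab(2) u(3)] idealD(4)[OF L _ v(3)]]) auto
    then have "w ^ (k + l) * (u * v) \<in> ?L" by (simp add: algebra_simps power_add)
    moreover have "w ^ n * c \<in> ?L ==> c \<in> ?L" if "c \<in> A" for n c
    proof (induction n)
      case (Suc n)
      then show ?case using w_regular_mod_F[of "w ^ n * c"] that by (auto simp: mult.assoc)
    qed simp
    ultimately have "u * v \<in> ?L" using u v by auto
    then show False using prime_idealD(3)[OF prime_Fw] u v LF by blast
  qed
qed

text \<open>A Koszul argument. Modulo \<open>F\<close>, \<open>w * s = a * h\<close> and
  \<open>z * s = b * h\<close> give \<open>z * a = w * b\<close> after cancelling \<open>h\<close>.
  Hence \<open>a\<close> is a multiple of \<open>w\<close> modulo \<open>F\<close>, and cancelling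
  \<open>w\<close> in the first equation exhibits \<open>s\<close> as a multiple of
  \<open>h\<close>.\<close>

lemma deep_divisor:
  assumes h: "h \<in> A" and reg: "\<And>a. a \<in> A ==> h * a \<in> gen A {F} ==> a \<in> gen A {F}"
  shows "deep (gen A {F, h})"
  unfolding deep_def
proof (intro conjI ballI impI)
  show "ideal_in A (gen A {F, h})" using h by (intro gen_ideal) auto
  fix s assume s: "s \<in> A" "\<forall>m\<in>M. m * s \<in> gen A {F, h}"
  obtain p a where a: "w * s = p * F + a * h" "p \<in> A" "a \<in> A" using s(2) in_M h by (fastforce simp: gen2)
  obtain q b where b: "z * s = q * F + b * h" "q \<in> A" "b \<in> A" using s(2) in_M h by (fastforce simp: gen2)
  have "h * (z * a - w * b) = z * (a * h) - w * (b * h)" by (simp add: algebra_simps)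
  also have "\<dots> = z * (w * s - p * F) - w * (z * s - q * F)" using a b by (simp add: algebra_simps)
  also have "\<dots> = (w * q - z * p) * F" by (simp add: algebra_simps)
  also have "\<dots> \<in> gen A {F}" using a b by (auto simp: gen1)
  finally have "z * a - w * b \<in> gen A {F}" using reg a b by auto
  then obtain c where c: "z * a - w * b = c * F" "c \<in> A" by (auto simp: gen1)
  then have "z * a = c * F + b * w" by (simp add: algebra_simps)
  then have "z * a \<in> gen A {F, w}" using c b by (auto simp: gen2)
  then have "a \<in> gen A {F, w}" using prime_idealD(3)[OF prime_Fw, of z a] z_power_notin[of 1] a by auto
  then obtain d e where d: "a = d * F + e * w" "d \<in> A" "e \<in> A" by (auto simp: gen2)
  have "w * (s - e * h) = (p + d * h) * F" using a d by (simp add: algebra_simps)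
  then have "w * (s - e * h) \<in> gen A {F}" using a d h by (auto simp: gen1)
  then have "s - e * h \<in> gen A {F}" using w_regular_mod_F s d h by auto
  then obtain f where "s - e * h = f * F" "f \<in> A" by (auto simp: gen1)
  then have "s = f * F + e * h" by (simp add: algebra_simps)
  then show "s \<in> gen A {F, h}" using \<open>f \<in> A\<close> d h by (auto simp: gen2)
qed

end

text \<open>The freedom in \<open>n\<close> serves to find a parameter that avoids the zero divisors of a quotient.\<close>

locale regular_pencil = local_domain A M for A :: "'a::field set" and M +
  fixes F y z :: 'a
  assumes sys: "regular_system A M F (y + of_nat n * z) z"
begin

lemma AA [simp, intro]: "F \<in> A" "z \<in> A" "y \<in> A"
  using regular_system.FA[OF sys] regular_system.zA[OF sys] regular_system.wA[OF sys[of 0]] by auto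

lemma prime_F: "prime_ideal A (gen A {F})"
  by (rule regular_system.prime_F[OF sys[of 0]])

lemma deep_divisor:
  "h \<in> A ==> (\<And>a. a \<in> A ==> h * a \<in> gen A {F} ==> a \<in> gen A {F}) ==> deep (gen A {F, h})"
  by (rule regular_system.deep_divisor[OF sys[of 0]])

text \<open>Otherwise every \<open>y + of_nat n * z\<close> kills some class outside
  \<open>I\<close>. Classes killed by different members of the pencil are independent, like
  eigenvectors for different eigenvalues, and an infinite sequence of them contradicts the chain
  condition.\<close>

lemma regular_parameter_exists:
  assumes I: "deep I" and FI: "F \<in> I"
  obtains n where "\<And>s. s \<in> A ==> (y + of_nat n * z) * s \<in> I ==> s \<in> I"
proof (rule ccontr)
  assume "\<not> thesis"
  then have "\<forall>n. \<exists>s. s \<in> A \<and> (y + of_nat n * z) * s \<in> I \<and> s \<notin> I" using that by blast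
  then obtain s where s: "\<And>n. s n \<in> A" "\<And>n. (y + of_nat n * z) * s n \<in> I" "\<And>n. s n \<notin> I" by metis
  have id: "ideal_in A I" using I by (simp add: deep_def)
  have IA: "I \<subseteq> A" using id by (auto simp: ideal_in_def)
  \<comment> \<open>Multiplying by the last member of the pencil removes the last term, so induction
    applies to the others; comparing with the member that kills \<open>s i\<close> leaves
    \<open>of_nat (n - i) * z\<close>. So \<open>z\<close>, then \<open>y\<close>, and with
    \<open>F\<close> all of \<open>M\<close>, multiply \<open>r i * s i\<close> into
    \<open>I\<close>, and depth puts it in \<open>I\<close>.\<close>
  have indep: "(\<Sum>i<n. r i * s i) \<in> I ==> (\<And>i. r i \<in> A) ==> i < n ==> r i * s i \<in> I" for n r i
  proof (induction n arbitrary: r i)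
    case (Suc n)
    have wA: "y + of_nat k * z \<in> A" for k by auto
    let ?w = "\<lambda>k. y + of_nat k * z"
    have "?w n * (\<Sum>i<Suc n. r i * s i) \<in> I" by (rule idealD(4)[OF id wA Suc(2)])
    moreover have "r n * (?w n * s n) \<in> I" by (rule idealD(4)[OF id Suc(3) s(2)])
    ultimately have "?w n * (\<Sum>i<Suc n. r i * s i) - r n * (?w n * s n) \<in> I" by (rule ideal_diff[OF id])
    also have "?w n * (\<Sum>i<Suc n. r i * s i) - r n * (?w n * s n) = (\<Sum>i<n. (r i * ?w n) * s i)"
      by (simp add: sum_distrib_left algebra_simps)
    finally have sm: "(\<Sum>i<n. (r i * ?w n) * s i) \<in> I" .
    have small: "r i * s i \<in> I" if "i < n" for i
    proof -
      have 1: "(r i * ?w n) * s i \<in> I" by (rule Suc(1)[OF sm _ that]) (use Suc(3) wA in auto)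
      have 2: "r i * (?w i * s i) \<in> I" by (rule idealD(4)[OF id Suc(3) s(2)])
      have "(r i * ?w n) * s i - r i * (?w i * s i) = of_nat (n - i) * (z * (r i * s i))"
        using that by (simp add: of_nat_diff algebra_simps)
      then have "of_nat (n - i) * (z * (r i * s i)) \<in> I" using ideal_diff[OF id 1 2] by simp
      then have z: "z * (r i * s i) \<in> I"
        using unit_cancel[OF id, of "of_nat (n - i)"] of_nat_notin_M[of "n - i"] that by auto
      have "y * (r i * s i) = r i * (?w i * s i) - of_nat i * (z * (r i * s i))" by (simp add: algebra_simps)
      also have "\<dots> \<in> I" by (intro ideal_diff[OF id] 2 idealD(4)[OF id _ z]) auto
      finally have y: "y * (r i * s i) \<in> I" .
      show ?thesis
      proof (rule deepD(2)[OF I])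
        show "r i * s i \<in> A" using Suc(3) s by auto
        fix m assume "m \<in> M"
        then obtain a b c where m: "m = a * F + b * y + c * z" "a \<in> A" "b \<in> A" "c \<in> A"
          using regular_system.M_gen[OF sys[of 0]] by (auto simp: gen3)
        have "m * (r i * s i) = (a * (r i * s i)) * F + b * (y * (r i * s i)) + c * (z * (r i * s i))"
          by (simp add: m algebra_simps)
        also have "\<dots> \<in> I"
          using Suc(3)[of i] s(1)[of i] m
          by (intro idealD(3)[OF id idealD(3)[OF id idealD(4)[OF id _ FI] idealD(4)[OF id _ y]]
              idealD(4)[OF id _ z]]) auto
        finally show "m * (r i * s i) \<in> I" .
      qed
    qed
    have "(\<Sum>i<n. r i * s i) \<in> I" by (rule ideal_in_sum[OF id]) (use small in auto)
    then have "(\<Sum>i<Suc n. r i * s i) - (\<Sum>i<n. r i * s i) \<in> I" by (rule ideal_diff[OF id Suc(2)])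
    then have "r n * s n \<in> I" by simp
    then show ?case using small Suc(4) by (cases "i = n") auto
  qed simp
  obtain n where n: "s n \<in> gen A (I \<union> s ` {..<n})" by (rule acc_gen[OF noetherian s(1) IA])
  have "\<exists>b r. b \<in> I \<and> (\<forall>i. r i \<in> A) \<and> a = b + (\<Sum>i<n. r i * s i)" if "a \<in> gen A (I \<union> s ` {..<n})" for a
    using that
  proof induction
    case zero
    then show ?case using idealD(2)[OF id] by (intro exI[of _ 0] exI[of _ "\<lambda>_. 0"]) auto
  next
    case (step r t a)
    then obtain b q where bq: "b \<in> I" "\<forall>i. q i \<in> A" "a = b + (\<Sum>i<n. q i * s i)" by blast
    from step(2) show ?case
    proof
      assume "t \<in> I"
      then have "r * t + b \<in> I" using step(1) bq by (intro idealD(3)[OF id] idealD(4)[OF id])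
      then show ?thesis using bq by (intro exI[of _ "r * t + b"] exI[of _ q]) auto
    next
      assume "t \<in> s ` {..<n}"
      then obtain j where j: "j < n" "t = s j" by auto
      have "(\<Sum>i<n. (q i + (if i = j then r else 0)) * s i) = (\<Sum>i<n. q i * s i) + r * t"
        using j by (simp add: distrib_right sum.distrib if_distrib[of "\<lambda>x. x * _"] cong: if_cong)
      then show ?thesis using bq step(1)
        by (intro exI[of _ b] exI[of _ "\<lambda>i. q i + (if i = j then r else 0)"]) auto
    qed
  qed
  from this[OF n] obtain b r where br: "b \<in> I" "\<And>i. r i \<in> A" "s n = b + (\<Sum>i<n. r i * s i)" by blast
  let ?r = "\<lambda>i. if i = n then - 1 else r i"
  have "(\<Sum>i<Suc n. ?r i * s i) = - b"
    using br(3) by (simp add: algebra_simps)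
  then have "(\<Sum>i<Suc n. ?r i * s i) \<in> I" using ideal_uminus[OF id br(1)] by simp
  from indep[OF this, of n] br(2) have "- s n \<in> I" by auto
  then show False using ideal_uminus[OF id, of "- s n"] s(3) by auto
qed

text \<open>Modulo \<open>F\<close> and a parameter \<open>w\<close> that is regular modulo \<open>I\<close> the ring is a discrete
  valuation ring, where the image of \<open>I\<close> is principal; a generator lifts by Nakayama's lemma.\<close>

lemma deep_principal:
  assumes I: "deep I" and FI: "F \<in> I"
  obtains g where "g \<in> I" "I = gen A {F, g}"
proof -
  obtain n where n: "\<And>s. s \<in> A ==> (y + of_nat n * z) * s \<in> I ==> s \<in> I"
    using regular_parameter_exists[OF assms] by blast
  define w where "w = y + of_nat n * z"
  interpret S: regular_system A M F w z unfolding w_def by (rule sys)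
  have wreg: "s \<in> A ==> w * s \<in> I ==> s \<in> I" for s using n by (simp add: w_def)
  have id: "ideal_in A I" using I by (simp add: deep_def)
  have IA: "a \<in> I ==> a \<in> A" for a using id by (auto simp: ideal_in_def)
  let ?L = "gen A {F, w}"
  note L = S.Fw_ideal
  \<comment> \<open>This is where regularity of \<open>w\<close> modulo \<open>I\<close> enters: the
    quotient by \<open>w\<close> of an element of \<open>I\<close> stays in
    \<open>I\<close>.\<close>
  have step: "\<exists>b\<in>I. a - w * b \<in> gen A {F}" if a: "a \<in> I" "a \<in> ?L" for a
  proof -
    obtain p q where pq: "a = p * F + q * w" "p \<in> A" "q \<in> A" using a(2) by (auto simp: gen2)
    then have "w * q = a - p * F" by simp
    also have "\<dots> \<in> I" using pq FI by (intro ideal_diff[OF id that(1)] idealD(4)[OF id])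
    finally have "q \<in> I" using wreg pq by blast
    moreover have "a - w * q \<in> gen A {F}" using pq by (auto simp: gen1)
    ultimately show ?thesis by blast
  qed
  show ?thesis
  proof (cases "I \<subseteq> ?L")
    case True
    \<comment> \<open>By \<open>step\<close> every element of \<open>I\<close> is now
      \<open>w\<close> times an element of \<open>I\<close>, modulo \<open>F\<close>. So
      \<open>F\<close> alone generates, and it also serves as the second generator.\<close>
    have "I \<subseteq> gen A {F}" by (rule nakayama[OF id S.F_ideal S.in_M(2)]) (use True step in auto)
    moreover have "gen A {F} \<subseteq> I" using FI by (intro gen_least[OF id]) auto
    ultimately show ?thesis using that[of F] FI by auto
  next
    case False
    define ok where "ok k \<longleftrightarrow> (\<exists>a\<in>I. \<exists>u\<in>A. u \<notin> M \<and> a - u * z ^ k \<in> ?L)" for k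
    have ok: "\<exists>k u. u \<in> A \<and> u \<notin> M \<and> a - u * z ^ k \<in> ?L \<and> ok k" if "a \<in> I" "a \<notin> ?L" for a
      using S.unit_times_power[OF IA[OF that(1)] that(2)] that(1) unfolding ok_def by metis
    \<comment> \<open>The least valuation occurring on the image of \<open>I\<close>; an element
      that attains it generates the image.\<close>
    define k where "k = (LEAST k. ok k)"
    have "\<exists>k. ok k" using False ok by blast
    then have "ok k" unfolding k_def by (metis LeastI)
    then obtain g u where g: "g \<in> I" "u \<in> A" "u \<notin> M" "g - u * z ^ k \<in> ?L" by (auto simp: ok_def)
    have G: "ideal_in A (gen A {F, g})" using IA[OF g(1)] by (intro gen_ideal) auto
    have "I \<subseteq> gen A {F, g}"
    proof (rule nakayama[OF id G S.in_M(2)])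
      fix a assume a: "a \<in> I"
      have "\<exists>r\<in>A. a - r * z ^ k \<in> ?L"
      proof (cases "a \<in> ?L")
        case True
        then show ?thesis by (auto intro!: bexI[of _ 0])
      next
        case False
        then obtain l v where v: "v \<in> A" "a - v * z ^ l \<in> ?L" "ok l" using ok[OF a] by blast
        then have "k \<le> l" unfolding k_def by (intro Least_le)
        then have "v * z ^ l = (v * z ^ (l - k)) * z ^ k" by (simp add: mult.assoc power_add[symmetric])
        then show ?thesis using v by (intro bexI[of _ "v * z ^ (l - k)"]) (auto simp: mult.assoc)
      qed
      then obtain r where r: "r \<in> A" "a - r * z ^ k \<in> ?L" by blast
      let ?q = "r * inverse u"
      have qA: "?q \<in> A" using r g inverse_closed by auto
      have "(a - r * z ^ k) - ?q * (g - u * z ^ k) \<in> ?L"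
        by (intro ideal_diff[OF L] idealD(4)[OF L qA] r g)
      moreover have "(a - r * z ^ k) - ?q * (g - u * z ^ k) = a - ?q * g"
        using notin_M_nonzero[OF g(3)] by (simp add: field_simps)
      ultimately have qL: "a - ?q * g \<in> ?L" by (simp only:)
      \<comment> \<open>The remainder lies both in \<open>I\<close> and in \<open>?L\<close>, so
        \<open>step\<close> makes it divisible by \<open>w\<close> inside \<open>I\<close>, as
        Nakayama's lemma requires.\<close>
      have "a - ?q * g \<in> I" by (intro ideal_diff[OF id a] idealD(4)[OF id qA g(1)])
      then obtain b where b: "b \<in> I" "a - ?q * g - w * b \<in> gen A {F}" using step qL by blast
      have "a - ?q * g - w * b \<in> gen A {F, g}" using b(2) gen_mono[of "{F}" "{F, g}" A] by auto
      moreover have "?q * g \<in> gen A {F, g}"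
        using gen_incl[of "{F, g}"] by (intro idealD(4)[OF G qA]) auto
      ultimately have "(a - ?q * g - w * b) + ?q * g \<in> gen A {F, g}" by (rule idealD(3)[OF G])
      then show "\<exists>n\<in>I. a - w * n \<in> gen A {F, g}" using b(1) by (auto simp: algebra_simps)
    qed
    moreover have "gen A {F, g} \<subseteq> I" using FI g by (intro gen_least[OF id]) auto
    ultimately show ?thesis using that g by auto
  qed
qed

text \<open>The surface has dimension two. Both primes are principal modulo \<open>F\<close>, with
  generators \<open>a\<close> and \<open>b\<close>. From \<open>a = c * b\<close> and
  \<open>b\<close> outside \<open>P\<close> it follows that \<open>c\<close> is a multiple of
  \<open>a\<close>, so \<open>a\<close> is killed by a unit \<open>1 - d * b\<close> modulo
  \<open>F\<close>, and \<open>P\<close> collapses to the ideal of \<open>F\<close>.\<close>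

lemma no_prime_chain:
  assumes P: "prime_ideal A P" and Q: "prime_ideal A Q" and FP: "F \<in> P" and h: "h \<in> P" "h \<notin> gen A {F}"
    and chain: "P \<subset> Q" "Q \<subset> M"
  shows False
proof -
  have idP: "ideal_in A P" and idQ: "ideal_in A Q" using P Q by (auto simp: prime_ideal_def)
  obtain a where a: "a \<in> P" "P = gen A {F, a}"
    using deep_principal[OF prime_deep[OF P] FP] chain by auto
  obtain b where b: "b \<in> Q" "Q = gen A {F, b}"
    using deep_principal[OF prime_deep[OF Q]] chain FP by auto
  have aA: "a \<in> A" and bA: "b \<in> A" using a b idealD(1)[OF idP] idealD(1)[OF idQ] by auto
  have "a \<in> gen A {F, b}" using a(1) chain b(2) by auto
  then obtain p c where c: "a = p * F + c * b" "p \<in> A" "c \<in> A" using bA by (auto simp: gen2)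
  have "c * b = a - p * F" using c by simp
  also have "\<dots> \<in> P" using c by (intro ideal_diff[OF idP a(1)] idealD(4)[OF idP] FP)
  finally have cb: "c \<in> P \<or> b \<in> P" using prime_idealD(3)[OF P c(3) bA] by blast
  have "b \<notin> P"
  proof
    assume "b \<in> P"
    then have "Q \<subseteq> P" unfolding b(2) using FP by (intro gen_least[OF idP]) auto
    then show False using chain by auto
  qed
  then have "c \<in> gen A {F, a}" using cb a(2) by simp
  then obtain q d where d: "c = q * F + d * a" "q \<in> A" "d \<in> A" using aA by (auto simp: gen2)
  have pF: "a - c * b = p * F" using c(1) by simp
  have qF: "c - d * a = q * F" using d(1) by simp
  have "(1 - d * b) * a = (a - c * b) + (c - d * a) * b" by (simp add: algebra_simps)
  also have "\<dots> = (p + q * b) * F" unfolding pF qF by (simp add: algebra_simps)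
  finally have "(1 - d * b) * a = (p + q * b) * F" .
  then have "(1 - d * b) * a \<in> gen A {F}" using c(2,3) d(2,3) bA by (simp add: gen1I)
  moreover have "1 - d * b \<notin> M"
    using chain b(1) d(3) by (intro one_minus_notin_M idealD(4)[OF M_ideal]) auto
  ultimately have "a \<in> gen A {F}"
    using unit_cancel[OF prime_idealD(1)[OF prime_F], of "1 - d * b" a] d(3) bA by auto
  then have "P \<subseteq> gen A {F}" unfolding a(2) using gen_incl[of "{F}"]
    by (intro gen_least[OF prime_idealD(1)[OF prime_F]]) auto
  then show False using h by auto
qed

end

section \<open>Forms and the Zariski topology\<close>

definition monomial :: "(4 \<Rightarrow> nat) \<Rightarrow> complex^4 \<Rightarrow> complex" where
  "monomial a v = (\<Prod>i\<in>UNIV. (v $ i) ^ a i)"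

lemma form_altdef: "form d F \<longleftrightarrow> (\<exists>c. \<forall>v. F v = (\<Sum>a\<in>exponents d. c a * monomial a v))"
  by (simp add: form_def monomial_def)

lemma form_monomial: "a \<in> exponents d ==> form d (monomial a)"
  unfolding form_altdef
  by (intro exI[of _ "\<lambda>b. if b = a then 1 else 0"]) (simp add: finite_exponents if_distrib[of "\<lambda>x. x * _"] cong: if_cong)

lemma form_const: "form 0 (\<lambda>_. c)"
proof -
  have "exponents 0 = {\<lambda>_. 0}" by (auto simp: exponents_def)
  then show ?thesis unfolding form_altdef by (intro exI[of _ "\<lambda>_. c"]) (simp add: monomial_def)
qed

lemma form_coord: "form 1 (\<lambda>v. v $ i)"
proof -
  have "(\<lambda>k. if k = i then 1 else 0) \<in> exponents 1" by (simp add: exponents_def)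
  from form_monomial[OF this] have "form 1 (monomial (\<lambda>k. if k = i then 1 else 0))" .
  moreover have "monomial (\<lambda>k. if k = i then 1 else 0) = (\<lambda>v. v $ i)"
  proof
    fix v :: "complex^4"
    have "(\<Prod>k\<in>UNIV. (v $ k) ^ (if k = i then 1 else 0)) = (\<Prod>k\<in>UNIV. if k = i then v $ k else 1)"
      by (rule prod.cong) auto
    then show "monomial (\<lambda>k. if k = i then 1 else 0) v = v $ i" by (simp add: monomial_def)
  qed
  ultimately show ?thesis by simp
qed

lemma form_add: "form d F ==> form d G ==> form d (\<lambda>v. F v + G v)"
  unfolding form_altdef
proof (elim exE)
  fix b c
  assume "\<forall>v. F v = (\<Sum>a\<in>exponents d. b a * monomial a v)" "\<forall>v. G v = (\<Sum>a\<in>exponents d. c a * monomial a v)"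
  then show "\<exists>c. \<forall>v. F v + G v = (\<Sum>a\<in>exponents d. c a * monomial a v)"
    by (intro exI[of _ "\<lambda>a. b a + c a"]) (simp add: distrib_right sum.distrib)
qed

lemma form_mult:
  assumes "form d F" "form e G" shows "form (d + e) (\<lambda>v. F v * G v)"
proof -
  obtain b c where bc: "\<And>v. F v = (\<Sum>a\<in>exponents d. b a * monomial a v)"
      "\<And>v. G v = (\<Sum>a\<in>exponents e. c a * monomial a v)"
    using assms unfolding form_altdef by blast
  define E where "E = exponents d \<times> exponents e"
  define s where "s x = (case x of (a, a') \<Rightarrow> (\<lambda>i. a i + a' i))" for x :: "(4 \<Rightarrow> nat) \<times> (4 \<Rightarrow> nat)"
  have "F v * G v = (\<Sum>x\<in>exponents (d + e). (\<Sum>y\<in>{y \<in> E. s y = x}. b (fst y) * c (snd y)) * monomial x v)" for v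
  proof -
    have "F v * G v = (\<Sum>y\<in>E. b (fst y) * c (snd y) * monomial (s y) v)"
      by (simp add: bc sum_product sum.cartesian_product E_def s_def monomial_def power_add prod.distrib
          case_prod_unfold ac_simps)
    also have "\<dots> = (\<Sum>x\<in>exponents (d + e). \<Sum>y\<in>{y \<in> E. s y = x}. b (fst y) * c (snd y) * monomial (s y) v)"
      by (rule sum.group[symmetric])
        (auto simp: E_def finite_exponents s_def, auto simp: exponents_def sum.distrib)
    also have "\<dots> = (\<Sum>x\<in>exponents (d + e). (\<Sum>y\<in>{y \<in> E. s y = x}. b (fst y) * c (snd y)) * monomial x v)"
      by (simp add: sum_distrib_right)
    finally show ?thesis .
  qed
  then show ?thesis unfolding form_altdef
    by (intro exI[of _ "\<lambda>x. \<Sum>y\<in>{y \<in> E. s y = x}. b (fst y) * c (snd y)"]) simp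
qed

lemma form_cmult: "form d F ==> form d (\<lambda>v. c * F v)"
  using form_mult[OF form_const[of c], of d F] by simp

lemma form_scale:
  assumes "form d F" shows "F (c *s v) = c ^ d * F v"
proof -
  obtain b where b: "\<And>v. F v = (\<Sum>a\<in>exponents d. b a * monomial a v)" using assms unfolding form_altdef by blast
  have "monomial a (c *s v) = c ^ d * monomial a v" if "a \<in> exponents d" for a
    using that by (simp add: monomial_def power_mult_distrib prod.distrib power_sum[symmetric] exponents_def)
  then show ?thesis by (simp add: b sum_distrib_left ac_simps)
qed

lemma form_on_line:
  assumes "form d F" obtains p where "\<And>t. F (u + t *s w) = poly p t"
proof -
  obtain b where b: "\<And>v. F v = (\<Sum>a\<in>exponents d. b a * monomial a v)" using assms unfolding form_altdef by blast
  show ?thesis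
  proof
    show "F (u + t *s w) = poly (\<Sum>a\<in>exponents d. smult (b a) (\<Prod>i\<in>UNIV. [:u $ i, w $ i:] ^ a i)) t" for t
      by (simp add: b poly_sum poly_prod monomial_def)
  qed
qed

text \<open>On the line joining a point where \<open>F\<close> is nonzero to one where
  \<open>G\<close> is nonzero, both forms become nonzero polynomials in one variable.\<close>

lemma form_mult_eq_0:
  assumes F: "form d F" and G: "form e G" and FG: "\<And>v. F v * G v = 0"
  shows "(\<forall>v. F v = 0) \<or> (\<forall>v. G v = 0)"
proof (rule ccontr)
  assume "\<not> ?thesis"
  then obtain u w where uw: "F u \<noteq> 0" "G w \<noteq> 0" by auto
  obtain p where p: "\<And>t. F (u + t *s (w - u)) = poly p t" using form_on_line[OF F] by metis
  obtain q where q: "\<And>t. G (u + t *s (w - u)) = poly q t" using form_on_line[OF G] by metis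
  have "poly p 0 \<noteq> 0" using uw(1) p[of 0] by simp
  moreover have "poly q 1 \<noteq> 0" using uw(2) q[of 1] by simp
  ultimately have "p * q \<noteq> 0" by auto
  moreover have "poly (p * q) t = 0" for t using FG p q by (metis poly_mult)
  ultimately show False using poly_all_0_iff_0 by blast
qed

section \<open>Homogeneous coordinates and basic open sets\<close>

lemma coords_nonzero: "v \<in> coords p ==> v \<noteq> 0"
  by (simp add: coords_def)

lemma coords_nonempty: obtains v where "v \<in> coords p"
proof -
  obtain v where "v \<noteq> 0" "Rep_p3 p = range (\<lambda>c. c *s v)" using Rep_p3[of p] by auto
  then have "v \<in> coords p" unfolding coords_def by (auto intro: range_eqI[of _ _ 1])
  then show ?thesis by (rule that)
qed

lemma coords_scale:
  assumes "v \<in> coords p" "w \<in> coords p" obtains c where "c \<noteq> 0" "w = c *s v"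
proof -
  obtain u where u: "u \<noteq> 0" "Rep_p3 p = range (\<lambda>c. c *s u)" using Rep_p3[of p] by auto
  then obtain a b where ab: "v = a *s u" "w = b *s u" using assms unfolding coords_def by auto
  have "a \<noteq> 0" "b \<noteq> 0" using assms ab coords_nonzero by force+
  then show ?thesis using that[of "b / a"] ab by simp
qed

definition proj :: "complex^4 \<Rightarrow> p3" where
  "proj v = Abs_p3 (range (\<lambda>c. c *s v))"

lemma coords_proj: "v \<noteq> 0 ==> coords (proj v) = {c *s v | c. c \<noteq> 0}"
  unfolding coords_def proj_def by (subst Abs_p3_inverse) auto

lemma in_coords_proj: "v \<noteq> 0 ==> v \<in> coords (proj v)"
  by (auto simp: coords_proj intro: exI[of _ 1])

lemma coords_inj: "v \<in> coords p ==> v \<in> coords q ==> p = q"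
proof -
  assume v: "v \<in> coords p" "v \<in> coords q"
  have "Rep_p3 r = range (\<lambda>c. c *s v)" if "v \<in> coords r" for r
  proof -
    have vr: "v \<in> coords r" by (rule that)
    obtain u where u: "u \<noteq> 0" "Rep_p3 r = range (\<lambda>c. c *s u)" using Rep_p3[of r] by auto
    then obtain a where a: "v = a *s u" using vr unfolding coords_def by auto
    then have "a \<noteq> 0" using coords_nonzero[OF vr] by auto
    then have "c *s u = (c / a) *s v" for c using a by simp
    then have "range (\<lambda>c. c *s u) \<subseteq> range (\<lambda>c. c *s v)" by auto
    then show ?thesis using u a by auto
  qed
  then show ?thesis using v Rep_p3_inject by metis
qed

lemma proj_eq: "v \<in> coords p ==> proj v = p"
  using coords_inj in_coords_proj coords_nonzero by blast

definition basic :: "(complex^4 \<Rightarrow> complex) \<Rightarrow> p3 set" where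
  "basic F = {p. \<forall>v\<in>coords p. F v \<noteq> 0}"

lemma in_basic_iff:
  assumes "form d F" "v \<in> coords p" shows "p \<in> basic F \<longleftrightarrow> F v \<noteq> 0"
proof
  assume "F v \<noteq> 0"
  show "p \<in> basic F" unfolding basic_def
  proof (intro CollectI ballI)
    fix w assume "w \<in> coords p"
    then obtain c where "c \<noteq> 0" "w = c *s v" using coords_scale assms(2) by metis
    then show "F w \<noteq> 0" using form_scale[OF assms(1)] \<open>F v \<noteq> 0\<close> by simp
  qed
qed (use assms(2) in \<open>auto simp: basic_def\<close>)

lemma zariski_altdef: "zariski = topology_generated_by {basic F | F. \<exists>d. form d F}"
  by (simp add: zariski_def basic_def)

lemma openin_basic: "form d F ==> zopen (basic F)"
  unfolding zariski_altdef by (rule topology_generated_by_Basis) auto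

lemma basic_mult: "basic F \<inter> basic G = basic (\<lambda>v. F v * G v)"
  by (auto simp: basic_def)

lemma basic_one: "basic (\<lambda>_. 1) = UNIV"
  by (auto simp: basic_def)

text \<open>Forms can be multiplied, so the sets generating the topology are closed under finite
  intersections and already form a basis.\<close>

lemma basic_neighbourhood:
  assumes "zopen U" "p \<in> U"
  obtains d F where "form d F" "p \<in> basic F" "basic F \<subseteq> U"
proof -
  have "generate_topology_on {basic F | F. \<exists>d. form d F} U"
    using assms(1) by (simp add: zariski_altdef openin_topology_generated_by_iff)
  then have "\<forall>p\<in>U. \<exists>d F. form d F \<and> p \<in> basic F \<and> basic F \<subseteq> U"
  proof induction
    case (Int U V)
    show ?case
    proof
      fix p assume "p \<in> U \<inter> V"
      then obtain d F e G where "form d F" "p \<in> basic F" "basic F \<subseteq> U" "form e G" "p \<in> basic G" "basic G \<subseteq> V"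
        using Int by (metis IntD1 IntD2)
      then show "\<exists>d F. form d F \<and> p \<in> basic F \<and> basic F \<subseteq> U \<inter> V"
        using form_mult[of d F e G] basic_mult[of F G] by (intro exI[of _ "d + e"] exI[of _ "\<lambda>v. F v * G v"]) auto
    qed
  next
    case (UN K)
    then show ?case by (meson Union_iff Union_upper subset_trans)
  qed auto
  then show ?thesis using assms(2) that by blast
qed

lemma openin_zariski_UNIV [simp]: "zopen UNIV"
  using openin_basic[OF form_const[of 1]] by (simp add: basic_one)

lemma topspace_zariski [simp]: "topspace zariski = UNIV"
  using openin_subset[OF openin_zariski_UNIV] by auto

lemma openin_zariski_Int [intro]: "zopen U ==> zopen V ==> zopen (U \<inter> V)"
  by (rule openin_Int)

lemma openin_zariski_subopen: "(\<And>p. p \<in> U ==> \<exists>V. zopen V \<and> p \<in> V \<and> V \<subseteq> U) ==> zopen U"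
  using openin_subopen by blast

text \<open>Multiplying \<open>F\<close> by a form \<open>E\<close> whose nonvanishing set lies
  inside \<open>U\<close> gives a product that vanishes everywhere.\<close>

lemma form_zero_on_open:
  assumes F: "form d F" and U: "zopen U" "U \<noteq> {}" and zero: "\<And>p v. p \<in> U ==> v \<in> coords p ==> F v = 0"
  shows "F v = 0"
proof -
  obtain p where "p \<in> U" using U by auto
  then obtain e E where E: "form e E" "p \<in> basic E" "basic E \<subseteq> U" using basic_neighbourhood[OF U(1)] by metis
  obtain u where u: "u \<in> coords p" by (rule coords_nonempty)
  have Eu: "E u \<noteq> 0" using E u by (auto simp: basic_def)
  have EF: "E v * F v = 0" if "v \<noteq> 0" for v
  proof (cases "E v = 0")
    case False
    then have "proj v \<in> basic E" using in_basic_iff[OF E(1) in_coords_proj[OF that]] by simp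
    then show ?thesis using zero[of "proj v" v] E(3) in_coords_proj[OF that] by auto
  qed simp
  have "E v * F v = 0" for v
  proof (cases "v = 0")
    case True
    have "E (0 *s u) * F (0 *s u) = 0 ^ e * 0 ^ d * (E u * F u)"
      unfolding form_scale[OF E(1)] form_scale[OF F] by simp
    then show ?thesis using EF[of u] coords_nonzero[OF u] True by simp
  qed (rule EF)
  then have "\<forall>v. F v = 0" using form_mult_eq_0[OF E(1) F] Eu by blast
  then show ?thesis by simp
qed

lemma zariski_irreducible:
  assumes "zopen U" "U \<noteq> {}" "zopen V" "V \<noteq> {}" shows "U \<inter> V \<noteq> {}"
proof
  assume UV: "U \<inter> V = {}"
  obtain p where "p \<in> V" using assms by auto
  then obtain e E where E: "form e E" "p \<in> basic E" "basic E \<subseteq> V" using basic_neighbourhood assms(3) by metis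
  obtain u where u: "u \<in> coords p" by (rule coords_nonempty)
  have "E v = 0" if "q \<in> U" "v \<in> coords q" for q v
    using in_basic_iff[OF E(1) that(2)] E(3) UV that(1) by auto
  then have "E u = 0" using form_zero_on_open[OF E(1) assms(1,2)] by blast
  then show False using E u by (auto simp: basic_def)
qed

section \<open>The function field\<close>

text \<open>The sections of \<open>OP\<close> without the normalisation to 0 outside
  \<open>U\<close>, so that one function can be considered on several open sets at once.\<close>

definition regular_on :: "p3 set \<Rightarrow> (p3 \<Rightarrow> complex) \<Rightarrow> bool" where
  "regular_on U f \<longleftrightarrow> (\<forall>p\<in>U. \<exists>V d G H. zopen V \<and> p \<in> V \<and> V \<subseteq> U \<and> form d G \<and> form d H \<and>
          (\<forall>q\<in>V. \<forall>v\<in>coords q. H v \<noteq> 0 \<and> f q = G v / H v))"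

lemma regular_onE:
  assumes "regular_on U f" "p \<in> U"
  obtains V d G H where "zopen V" "p \<in> V" "V \<subseteq> U" "form d G" "form d H"
    "\<forall>q\<in>V. \<forall>v\<in>coords q. H v \<noteq> 0 \<and> f q = G v / H v"
  using assms(1)[unfolded regular_on_def, THEN bspec, OF assms(2)]
  by (elim exE conjE) (rule that)

lemma Sec_OP: "f \<in> Sec OP U \<longleftrightarrow> regular_on U f \<and> (\<forall>p. p \<notin> U \<longrightarrow> f p = 0)"
  by (simp add: OP_def regular_on_def)

lemma regular_on_open: "regular_on U f ==> zopen U"
  unfolding regular_on_def by (rule openin_zariski_subopen) meson

lemma regular_on_subset:
  assumes "regular_on U f" "zopen V" "V \<subseteq> U" shows "regular_on V f"
  unfolding regular_on_def
proof
  fix p assume p: "p \<in> V"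
  then have "p \<in> U" using assms(3) by auto
  then obtain W d G H where "zopen W" "p \<in> W" "W \<subseteq> U" "form d G" "form d H"
    "\<forall>q\<in>W. \<forall>v\<in>coords q. H v \<noteq> 0 \<and> f q = G v / H v" by (rule regular_onE[OF assms(1)])
  then show "\<exists>W d G H. zopen W \<and> p \<in> W \<and> W \<subseteq> V \<and> form d G \<and> form d H \<and>
          (\<forall>q\<in>W. \<forall>v\<in>coords q. H v \<noteq> 0 \<and> f q = G v / H v)"
    using p assms(2) by (intro exI[of _ "W \<inter> V"] exI[of _ d] exI[of _ G] exI[of _ H]) auto
qed

lemma regular_on_cong:
  assumes "\<And>q. q \<in> U ==> f q = g q" shows "regular_on U f \<longleftrightarrow> regular_on U g"
proof -
  have "(V \<subseteq> U \<and> form d G \<and> form d H \<and> (\<forall>q\<in>V. \<forall>v\<in>coords q. H v \<noteq> 0 \<and> f q = G v / H v)) \<longleftrightarrow>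
    (V \<subseteq> U \<and> form d G \<and> form d H \<and> (\<forall>q\<in>V. \<forall>v\<in>coords q. H v \<noteq> 0 \<and> g q = G v / H v))" for V d G H
    using assms by (metis subsetD)
  then show ?thesis unfolding regular_on_def by simp
qed

lemma regular_on_const: "zopen U ==> regular_on U (\<lambda>_. c)"
  unfolding regular_on_def
  by (intro ballI exI[of _ U] exI[of _ 0] exI[of _ "\<lambda>_. c"] exI[of _ "\<lambda>_. 1"]) (auto simp: form_const)

lemma regular_on_combine:
  assumes f: "regular_on U f" and g: "regular_on U g"
    and A: "\<And>d G H d' G' H'. form d G ==> form d H ==> form d' G' ==> form d' H' ==>
      form (d + d') (A G H G' H') \<and> (\<forall>v. H v \<noteq> 0 \<longrightarrow> H' v \<noteq> 0 \<longrightarrow> op (G v / H v) (G' v / H' v) = A G H G' H' v / (H v * H' v))"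
  shows "regular_on U (\<lambda>p. op (f p) (g p))"
  unfolding regular_on_def
proof
  fix p assume p: "p \<in> U"
  obtain V d G H where V: "zopen V" "p \<in> V" "V \<subseteq> U" "form d G" "form d H"
    "\<forall>q\<in>V. \<forall>v\<in>coords q. H v \<noteq> 0 \<and> f q = G v / H v" by (rule regular_onE[OF f p])
  obtain W e G' H' where W: "zopen W" "p \<in> W" "W \<subseteq> U" "form e G'" "form e H'"
    "\<forall>q\<in>W. \<forall>v\<in>coords q. H' v \<noteq> 0 \<and> g q = G' v / H' v" by (rule regular_onE[OF g p])
  show "\<exists>V d G H. zopen V \<and> p \<in> V \<and> V \<subseteq> U \<and> form d G \<and> form d H \<and>
          (\<forall>q\<in>V. \<forall>v\<in>coords q. H v \<noteq> 0 \<and> op (f q) (g q) = G v / H v)"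
    using V W A[OF V(4,5) W(4,5)] form_mult[OF V(5) W(5)]
    by (intro exI[of _ "V \<inter> W"] exI[of _ "d + e"] exI[of _ "A G H G' H'"] exI[of _ "\<lambda>v. H v * H' v"]) auto
qed

lemma regular_on_add: "regular_on U f ==> regular_on U g ==> regular_on U (\<lambda>p. f p + g p)"
  apply (rule regular_on_combine[where A = "\<lambda>G H G' H' v. G v * H' v + H v * G' v"], assumption, assumption)
  by (auto intro: form_add form_mult simp: field_simps)

lemma regular_on_mult: "regular_on U f ==> regular_on U g ==> regular_on U (\<lambda>p. f p * g p)"
  by (rule regular_on_combine[where A = "\<lambda>G H G' H' v. G v * G' v"]) (auto intro: form_mult)

lemma regular_on_uminus: "regular_on U f ==> regular_on U (\<lambda>p. - f p)"
  using regular_on_mult[OF regular_on_const[of U "- 1"], of f] by (simp add: regular_on_open)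

lemma regular_on_diff: "regular_on U f ==> regular_on U g ==> regular_on U (\<lambda>p. f p - g p)"
  using regular_on_add[of U f "\<lambda>p. - g p"] regular_on_uminus by auto

lemma openin_nonzero:
  assumes "regular_on U f" shows "zopen {p \<in> U. f p \<noteq> 0}"
proof (rule openin_zariski_subopen)
  fix p assume p: "p \<in> {p \<in> U. f p \<noteq> 0}"
  then have "p \<in> U" by auto
  then obtain V d G H where V: "zopen V" "p \<in> V" "V \<subseteq> U" "form d G" "form d H"
    "\<forall>q\<in>V. \<forall>v\<in>coords q. H v \<noteq> 0 \<and> f q = G v / H v" by (rule regular_onE[OF assms(1)])
  have "V \<inter> basic G \<subseteq> {p \<in> U. f p \<noteq> 0}"
  proof
    fix q assume q: "q \<in> V \<inter> basic G"
    obtain v where "v \<in> coords q" by (rule coords_nonempty)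
    then show "q \<in> {p \<in> U. f p \<noteq> 0}" using q V by (auto simp: basic_def)
  qed
  moreover have "p \<in> basic G" using p V by (auto simp: basic_def)
  ultimately show "\<exists>V. zopen V \<and> p \<in> V \<and> V \<subseteq> {p \<in> U. f p \<noteq> 0}"
    using V openin_basic[OF V(4)] by (intro exI[of _ "V \<inter> basic G"]) auto
qed

lemma regular_on_inverse:
  assumes "regular_on U f" "\<And>p. p \<in> U ==> f p \<noteq> 0" shows "regular_on U (\<lambda>p. inverse (f p))"
  unfolding regular_on_def
proof
  fix p assume p: "p \<in> U"
  then have "p \<in> U" by auto
  then obtain V d G H where V: "zopen V" "p \<in> V" "V \<subseteq> U" "form d G" "form d H"
    "\<forall>q\<in>V. \<forall>v\<in>coords q. H v \<noteq> 0 \<and> f q = G v / H v" by (rule regular_onE[OF assms(1)])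
  have "\<forall>q\<in>V. \<forall>v\<in>coords q. G v \<noteq> 0 \<and> inverse (f q) = H v / G v"
    using V assms(2) by (force simp: field_simps)
  then show "\<exists>V d G H. zopen V \<and> p \<in> V \<and> V \<subseteq> U \<and> form d G \<and> form d H \<and>
          (\<forall>q\<in>V. \<forall>v\<in>coords q. H v \<noteq> 0 \<and> inverse (f q) = G v / H v)"
    using V by blast
qed

text \<open>The difference is nonzero on an open set disjoint from \<open>W\<close>, and two
  nonempty open sets always meet.\<close>

lemma regular_on_identity:
  assumes "regular_on U f" "regular_on U g" "zopen W" "W \<noteq> {}" "\<And>q. q \<in> W ==> f q = g q" "p \<in> U"
  shows "f p = g p"
proof -
  let ?h = "\<lambda>p. f p - g p"
  have h: "regular_on U ?h" using assms regular_on_diff by blast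
  have "{q \<in> U. ?h q \<noteq> 0} \<inter> W = {}" using assms(5) by auto
  then have "{q \<in> U. ?h q \<noteq> 0} = {}"
    using zariski_irreducible[OF openin_nonzero[OF h] _ assms(3,4)] by blast
  then show ?thesis using assms(6) by auto
qed

text \<open>Reflexive only at functions that are regular on some nonempty open set, which is why the
  quotient type is partial.\<close>

definition ratrel :: "(p3 \<Rightarrow> complex) \<Rightarrow> (p3 \<Rightarrow> complex) \<Rightarrow> bool" where
  "ratrel f g \<longleftrightarrow> (\<exists>U. U \<noteq> {} \<and> regular_on U f \<and> regular_on U g \<and> (\<forall>q\<in>U. f q = g q))"

lemma ratrel_refl_iff: "ratrel f f \<longleftrightarrow> (\<exists>U. U \<noteq> {} \<and> regular_on U f)"
  by (auto simp: ratrel_def)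

lemma regular_common:
  assumes "U \<noteq> {}" "regular_on U f" "V \<noteq> {}" "regular_on V g"
  shows "U \<inter> V \<noteq> {} \<and> regular_on (U \<inter> V) f \<and> regular_on (U \<inter> V) g"
  using assms zariski_irreducible[of U V] regular_on_subset[of U f "U \<inter> V"] regular_on_subset[of V g "U \<inter> V"]
    regular_on_open by blast

lemma ratrel_trans: "ratrel f g ==> ratrel g h ==> ratrel f h"
proof -
  assume "ratrel f g" "ratrel g h"
  then obtain U V where "U \<noteq> {}" "regular_on U f" "\<forall>q\<in>U. f q = g q" "V \<noteq> {}" "regular_on V h" "\<forall>q\<in>V. g q = h q"
    unfolding ratrel_def by blast
  with regular_common[of U f V h] show ?thesis unfolding ratrel_def by (intro exI[of _ "U \<inter> V"]) auto
qed

quotient_type ratfun = "p3 \<Rightarrow> complex" / partial: ratrel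
proof (rule part_equivpI)
  show "\<exists>x. ratrel x x" using regular_on_const[of UNIV 0] by (auto simp: ratrel_def)
  show "symp ratrel" by (rule sympI) (auto simp: ratrel_def)
  show "transp ratrel" by (rule transpI) (rule ratrel_trans)
qed

lemma ratrel_op2:
  assumes "ratrel f f'" "ratrel g g'"
    and "\<And>U f g. regular_on U f ==> regular_on U g ==> regular_on U (\<lambda>p. op (f p) (g p))"
  shows "ratrel (\<lambda>p. op (f p) (g p)) (\<lambda>p. op (f' p) (g' p))"
proof -
  obtain U where U: "U \<noteq> {}" "regular_on U f" "regular_on U f'" "\<forall>q\<in>U. f q = f' q" using assms(1) by (auto simp: ratrel_def)
  obtain V where V: "V \<noteq> {}" "regular_on V g" "regular_on V g'" "\<forall>q\<in>V. g q = g' q" using assms(2) by (auto simp: ratrel_def)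
  from regular_common[OF U(1,2) V(1,2)] regular_common[OF U(1,3) V(1,3)] assms(3) U V show ?thesis
    unfolding ratrel_def by (intro exI[of _ "U \<inter> V"]) auto
qed

lemma ratrel_add: "ratrel f f' ==> ratrel g g' ==> ratrel (\<lambda>p. f p + g p) (\<lambda>p. f' p + g' p)"
  by (rule ratrel_op2[where op = "(+)"]) (auto intro: regular_on_add)

lemma ratrel_diff: "ratrel f f' ==> ratrel g g' ==> ratrel (\<lambda>p. f p - g p) (\<lambda>p. f' p - g' p)"
  by (rule ratrel_op2[where op = "(-)"]) (auto intro: regular_on_diff)

lemma ratrel_mult: "ratrel f f' ==> ratrel g g' ==> ratrel (\<lambda>p. f p * g p) (\<lambda>p. f' p * g' p)"
  by (rule ratrel_op2[where op = "(*)"]) (auto intro: regular_on_mult)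

lemma ratrel_zero: "ratrel (\<lambda>_. 0) (\<lambda>_. 0)"
  using regular_on_const[of UNIV 0] by (auto simp: ratrel_def)

lemma ratrel_inverse:
  assumes "ratrel f f'" shows "ratrel (\<lambda>p. inverse (f p)) (\<lambda>p. inverse (f' p))"
proof -
  obtain U where U: "U \<noteq> {}" "regular_on U f" "regular_on U f'" "\<forall>q\<in>U. f q = f' q" using assms by (auto simp: ratrel_def)
  define V where "V = {q \<in> U. f q \<noteq> 0}"
  show ?thesis
  proof (cases "V = {}")
    \<comment> \<open>By the convention \<open>inverse 0 = 0\<close> the inverse of the zero
      function is again the zero function, which is regular.\<close>
    case True
    then have "regular_on U (\<lambda>p. inverse (f p)) \<longleftrightarrow> regular_on U (\<lambda>_. 0)"
      by (intro regular_on_cong) (auto simp: V_def)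
    moreover have "regular_on U (\<lambda>p. inverse (f' p)) \<longleftrightarrow> regular_on U (\<lambda>_. 0)"
      using True U by (intro regular_on_cong) (auto simp: V_def)
    ultimately show ?thesis using U regular_on_const[OF regular_on_open[OF U(2)], of 0] by (auto simp: ratrel_def)
  next
    case False
    have V: "zopen V" unfolding V_def by (rule openin_nonzero[OF U(2)])
    have "regular_on V f" "regular_on V f'" using regular_on_subset U V by (auto simp: V_def)
    then have "regular_on V (\<lambda>p. inverse (f p))" "regular_on V (\<lambda>p. inverse (f' p))"
      using U by (auto intro!: regular_on_inverse simp: V_def)
    then show ?thesis using False U unfolding ratrel_def by (intro exI[of _ V]) (auto simp: V_def)
  qed
qed

instantiation ratfun :: field
begin

lift_definition zero_ratfun :: ratfun is "\<lambda>_. 0" by (rule ratrel_zero)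
lift_definition one_ratfun :: ratfun is "\<lambda>_. 1"
  using regular_on_const[of UNIV 1] by (auto simp: ratrel_def)
lift_definition plus_ratfun :: "ratfun \<Rightarrow> ratfun \<Rightarrow> ratfun" is "\<lambda>f g p. f p + g p" by (rule ratrel_add)
lift_definition minus_ratfun :: "ratfun \<Rightarrow> ratfun \<Rightarrow> ratfun" is "\<lambda>f g p. f p - g p" by (rule ratrel_diff)
lift_definition times_ratfun :: "ratfun \<Rightarrow> ratfun \<Rightarrow> ratfun" is "\<lambda>f g p. f p * g p" by (rule ratrel_mult)
lift_definition uminus_ratfun :: "ratfun \<Rightarrow> ratfun" is "\<lambda>f p. - f p"
  using ratrel_diff[OF ratrel_zero] by simp
lift_definition inverse_ratfun :: "ratfun \<Rightarrow> ratfun" is "\<lambda>f p. inverse (f p)" by (rule ratrel_inverse)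
lift_definition divide_ratfun :: "ratfun \<Rightarrow> ratfun \<Rightarrow> ratfun" is "\<lambda>f g p. f p / g p"
  unfolding divide_inverse by (intro ratrel_mult ratrel_inverse)

instance
proof
  fix a b c :: ratfun
  show "a + b + c = a + (b + c)" by transfer (simp add: add.assoc ratrel_add)
  show "a + b = b + a" by transfer (simp add: add.commute ratrel_add)
  show "0 + a = a" by transfer simp
  show "- a + a = 0" by transfer (simp add: ratrel_zero)
  show "a - b = a + - b" by transfer (simp add: ratrel_diff)
  show "a * b * c = a * (b * c)" by transfer (simp add: mult.assoc ratrel_mult)
  show "a * b = b * a" by transfer (simp add: mult.commute ratrel_mult)
  show "1 * a = a" by transfer simp
  show "(a + b) * c = a * c + b * c" by transfer (simp add: distrib_right ratrel_add ratrel_mult)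
  show "(0::ratfun) \<noteq> 1" by transfer (auto simp: ratrel_def)
  show "a \<noteq> 0 ==> inverse a * a = 1"
  proof transfer
    fix f assume f: "ratrel f f" "\<not> ratrel f (\<lambda>_. 0)"
    obtain U where U: "U \<noteq> {}" "regular_on U f" using f by (auto simp: ratrel_def)
    define V where "V = {q \<in> U. f q \<noteq> 0}"
    have V: "zopen V" unfolding V_def by (rule openin_nonzero[OF U(2)])
    have "V \<noteq> {}"
      using f(2) U regular_on_const[OF regular_on_open[OF U(2)], of 0] unfolding ratrel_def V_def by blast
    have "regular_on V f" using regular_on_subset U V by (auto simp: V_def)
    then have "regular_on V (\<lambda>p. inverse (f p) * f p)"
      by (intro regular_on_mult regular_on_inverse) (auto simp: V_def)
    then show "ratrel (\<lambda>p. inverse (f p) * f p) (\<lambda>_. 1)"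
      unfolding ratrel_def using \<open>V \<noteq> {}\<close> regular_on_const[OF V, of 1] by (intro exI[of _ V]) (auto simp: V_def)
  qed
  show "a div b = a * inverse b"
    by transfer (simp add: divide_inverse ratrel_mult ratrel_inverse)
  show "inverse (0::ratfun) = 0" by transfer (simp add: ratrel_zero)
qed

end

lemma germ_eq_iff:
  assumes "regular_on U f" "U \<noteq> {}" "regular_on V g" "V \<noteq> {}"
  shows "abs_ratfun f = abs_ratfun g \<longleftrightarrow> (\<forall>q\<in>U \<inter> V. f q = g q)"
proof -
  have "abs_ratfun f = abs_ratfun g \<longleftrightarrow> ratrel f g"
    using Quotient3_rel[OF Quotient3_ratfun, of f g] assms by (auto simp: ratrel_def)
  also have "\<dots> \<longleftrightarrow> (\<forall>q\<in>U \<inter> V. f q = g q)"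
  proof
    have c: "regular_on (U \<inter> V) f" "regular_on (U \<inter> V) g" "U \<inter> V \<noteq> {}" using regular_common assms by blast+
    show "\<forall>q\<in>U \<inter> V. f q = g q" if "ratrel f g"
    proof -
      obtain W where "W \<noteq> {}" "regular_on W f" "\<forall>q\<in>W. f q = g q" using \<open>ratrel f g\<close> by (auto simp: ratrel_def)
      then show ?thesis using regular_on_identity[OF c(1,2), of W] regular_on_open by blast
    qed
    show "ratrel f g" if "\<forall>q\<in>U \<inter> V. f q = g q" using c that unfolding ratrel_def by blast
  qed
  finally show ?thesis .
qed

section \<open>Local rings\<close>

abbreviation germ :: "(p3 \<Rightarrow> complex) \<Rightarrow> ratfun" where "germ \<equiv> abs_ratfun"

lemma germ_add: "regular_on U f ==> U \<noteq> {} ==> regular_on V g ==> V \<noteq> {} ==> germ (\<lambda>p. f p + g p) = germ f + germ g"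
  by (rule plus_ratfun.abs_eq[symmetric]) (auto simp: ratrel_refl_iff)

lemma germ_mult: "regular_on U f ==> U \<noteq> {} ==> regular_on V g ==> V \<noteq> {} ==> germ (\<lambda>p. f p * g p) = germ f * germ g"
  by (rule times_ratfun.abs_eq[symmetric]) (auto simp: ratrel_refl_iff)

lemma germ_inverse: "regular_on U f ==> U \<noteq> {} ==> germ (\<lambda>p. inverse (f p)) = inverse (germ f)"
  by (rule inverse_ratfun.abs_eq[symmetric]) (auto simp: ratrel_refl_iff)

definition cst :: "complex \<Rightarrow> ratfun" where "cst c = germ (\<lambda>_. c)"

interpretation cst: complex_algebra cst
proof
  show "cst 1 = 1" unfolding cst_def by (rule one_ratfun.abs_eq[symmetric])
  show "cst (a + b) = cst a + cst b" "cst (a * b) = cst a * cst b" for a b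
    using germ_add[of UNIV "\<lambda>_. a" UNIV "\<lambda>_. b"] germ_mult[of UNIV "\<lambda>_. a" UNIV "\<lambda>_. b"]
    by (simp_all add: cst_def regular_on_const)
qed

definition \<O> :: "p3 \<Rightarrow> ratfun set" where
  "\<O> p = {germ f | U f. p \<in> U \<and> regular_on U f}"

text \<open>The value is independent of the regular representative by the identity theorem; it is
  meaningful for elements of the local ring at \<open>p\<close>.\<close>

definition val :: "p3 \<Rightarrow> ratfun \<Rightarrow> complex" where
  "val p k = (THE c. \<exists>U f. p \<in> U \<and> regular_on U f \<and> k = germ f \<and> c = f p)"

definition max_ideal :: "p3 \<Rightarrow> ratfun set" where
  "max_ideal p = {k \<in> \<O> p. val p k = 0}"

lemma stalk_ringI: "regular_on U f ==> p \<in> U ==> germ f \<in> \<O> p"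
  by (auto simp: \<O>_def)

lemma stalk_ringE:
  assumes "k \<in> \<O> p" obtains U f where "p \<in> U" "regular_on U f" "k = germ f"
  using assms by (auto simp: \<O>_def)

lemma val_germ: "regular_on U f ==> p \<in> U ==> val p (germ f) = f p"
  unfolding val_def
proof (rule the_equality)
  assume f: "regular_on U f" "p \<in> U"
  then show "\<exists>U g. p \<in> U \<and> regular_on U g \<and> germ f = germ g \<and> f p = g p" by blast
  fix c assume "\<exists>U g. p \<in> U \<and> regular_on U g \<and> germ f = germ g \<and> c = g p"
  then obtain V g where g: "p \<in> V" "regular_on V g" "germ f = germ g" "c = g p" by blast
  then have "U \<noteq> {}" "V \<noteq> {}" using f by auto
  then have "\<forall>q\<in>U \<inter> V. f q = g q" using germ_eq_iff[OF f(1) _ g(2)] g(3) by simp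
  then show "c = f p" using f(2) g(1,4) by simp
qed

lemma stalk_ring2E:
  assumes "k \<in> \<O> p" "l \<in> \<O> p"
  obtains U f g where "p \<in> U" "regular_on U f" "k = germ f" "regular_on U g" "l = germ g"
proof -
  obtain U f where f: "p \<in> U" "regular_on U f" "k = germ f" using assms(1) by (rule stalk_ringE)
  obtain V g where g: "p \<in> V" "regular_on V g" "l = germ g" using assms(2) by (rule stalk_ringE)
  from f g regular_common[of U f V g] show ?thesis by (intro that[of "U \<inter> V" f g]) auto
qed

lemma stalk_ring_add_val:
  assumes "k \<in> \<O> p" "l \<in> \<O> p"
  shows "k + l \<in> \<O> p \<and> val p (k + l) = val p k + val p l"
proof -
  obtain U f g where *: "p \<in> U" "regular_on U f" "k = germ f" "regular_on U g" "l = germ g"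
    using assms by (rule stalk_ring2E)
  then have "U \<noteq> {}" by auto
  then have "k + l = germ (\<lambda>q. f q + g q)" using germ_add[OF *(2) _ *(4)] *(3,5) by simp
  then show ?thesis using * regular_on_add[OF *(2,4)] by (auto intro!: stalk_ringI simp: val_germ)
qed

lemma stalk_ring_mult_val:
  assumes "k \<in> \<O> p" "l \<in> \<O> p"
  shows "k * l \<in> \<O> p \<and> val p (k * l) = val p k * val p l"
proof -
  obtain U f g where *: "p \<in> U" "regular_on U f" "k = germ f" "regular_on U g" "l = germ g"
    using assms by (rule stalk_ring2E)
  then have "U \<noteq> {}" by auto
  then have "k * l = germ (\<lambda>q. f q * g q)" using germ_mult[OF *(2) _ *(4)] *(3,5) by simp
  then show ?thesis using * regular_on_mult[OF *(2,4)] by (auto intro!: stalk_ringI simp: val_germ)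
qed

lemma cst_stalk_ring [simp]: "cst c \<in> \<O> p"
  unfolding cst_def by (rule stalk_ringI[of UNIV]) (auto intro: regular_on_const)

lemma val_cst [simp]: "val p (cst c) = c"
  unfolding cst_def by (rule val_germ[of UNIV]) (auto intro: regular_on_const)

interpretation stalk: subring "\<O> p" for p
proof
  show "1 \<in> \<O> p" using cst_stalk_ring[of 1 p] by simp
  show "a * b \<in> \<O> p" if "a \<in> \<O> p" "b \<in> \<O> p" for a b
    using stalk_ring_mult_val that by blast
  show "a - b \<in> \<O> p" if "a \<in> \<O> p" "b \<in> \<O> p" for a b
  proof -
    have eq: "a - b = a + cst (- 1) * b" by (simp add: cst.cst_uminus)
    have "cst (- 1) * b \<in> \<O> p" using stalk_ring_mult_val[of "cst (- 1)" p b] that(2) by simp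
    then show ?thesis unfolding eq using stalk_ring_add_val[OF that(1)] by blast
  qed
qed

lemma val_add [simp]: "a \<in> \<O> p ==> b \<in> \<O> p ==> val p (a + b) = val p a + val p b"
  using stalk_ring_add_val by blast

lemma val_mult [simp]: "a \<in> \<O> p ==> b \<in> \<O> p ==> val p (a * b) = val p a * val p b"
  using stalk_ring_mult_val by blast

lemma val_0 [simp]: "val p 0 = 0" using val_cst[of p 0] by simp
lemma val_1 [simp]: "val p 1 = 1" using val_cst[of p 1] by simp

lemma val_uminus [simp]: "a \<in> \<O> p ==> val p (- a) = - val p a"
  using val_add[of a p "- a"] by (simp add: eq_neg_iff_add_eq_0 add.commute)

lemma val_diff [simp]: "a \<in> \<O> p ==> b \<in> \<O> p ==> val p (a - b) = val p a - val p b"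
  using val_add[of a p "- b"] by simp

lemma val_of_nat [simp]: "val p (of_nat n) = of_nat n"
  by (induction n) auto

lemma val_sum: "(\<And>i. i \<in> S ==> f i \<in> \<O> p) ==> val p (\<Sum>i\<in>S. f i) = (\<Sum>i\<in>S. val p (f i))"
  by (induction S rule: infinite_finite_induct) (auto simp: stalk.sum_closed)

lemma val_prod: "(\<And>i. i \<in> S ==> f i \<in> \<O> p) ==> val p (\<Prod>i\<in>S. f i) = (\<Prod>i\<in>S. val p (f i))"
  by (induction S rule: infinite_finite_induct) (auto simp: stalk.prod_closed)

lemma val_power [simp]: "a \<in> \<O> p ==> val p (a ^ n) = val p a ^ n"
  by (induction n) auto

lemma stalk_ring_inverse:
  assumes "k \<in> \<O> p" "val p k \<noteq> 0" shows "inverse k \<in> \<O> p"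
proof -
  obtain U f where f: "p \<in> U" "regular_on U f" "k = germ f" using assms(1) by (rule stalk_ringE)
  define V where "V = {q \<in> U. f q \<noteq> 0}"
  have V: "zopen V" unfolding V_def by (rule openin_nonzero[OF f(2)])
  have pV: "p \<in> V" using assms f val_germ[OF f(2,1)] by (simp add: V_def)
  have fV: "regular_on V f" using regular_on_subset f V by (auto simp: V_def)
  then have "regular_on V (\<lambda>q. inverse (f q))" by (intro regular_on_inverse) (auto simp: V_def)
  then have "germ (\<lambda>q. inverse (f q)) \<in> \<O> p" using pV by (rule stalk_ringI)
  moreover have "V \<noteq> {}" using pV by auto
  ultimately show ?thesis using germ_inverse[OF fV] f(3) by simp
qed

lemma stalk_ring_open:
  assumes "k \<in> \<O> p"
  obtains U where "zopen U" "p \<in> U" "\<And>q. q \<in> U ==> k \<in> \<O> q"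
  using assms stalk_ringI regular_on_open by (metis stalk_ringE)

lemma openin_val_nonzero: "zopen {q. k \<in> \<O> q \<and> val q k \<noteq> 0}"
proof (rule openin_zariski_subopen)
  fix p assume p: "p \<in> {q. k \<in> \<O> q \<and> val q k \<noteq> 0}"
  then have "k \<in> \<O> p" by simp
  then obtain U f where f: "p \<in> U" "regular_on U f" "k = germ f" by (rule stalk_ringE)
  then show "\<exists>V. zopen V \<and> p \<in> V \<and> V \<subseteq> {q. k \<in> \<O> q \<and> val q k \<noteq> 0}"
    using openin_nonzero[OF f(2)] p val_germ[OF f(2)] stalk_ringI[OF f(2)]
    by (intro exI[of _ "{q \<in> U. f q \<noteq> 0}"]) auto
qed

lemma unit_neighbourhood:
  assumes "k \<in> \<O> p" "val p k \<noteq> 0"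
  obtains U where "zopen U" "p \<in> U" "\<And>q. q \<in> U ==> k \<in> \<O> q \<and> val q k \<noteq> 0"
  using that[OF openin_val_nonzero[of k]] assms by blast

section \<open>Sections recovered from rational functions\<close>

definition section_of :: "p3 set \<Rightarrow> ratfun \<Rightarrow> p3 \<Rightarrow> complex" where
  "section_of U k = (\<lambda>q. if q \<in> U then val q k else 0)"

lemma section_of:
  assumes "zopen U" "\<And>q. q \<in> U ==> k \<in> \<O> q"
  shows "section_of U k \<in> Sec OP U" "U \<noteq> {} ==> germ (section_of U k) = k"
proof -
  have "regular_on U (section_of U k)"
    unfolding regular_on_def
  proof
    fix p assume p: "p \<in> U"
    obtain W f where f: "p \<in> W" "regular_on W f" "k = germ f" using assms(2)[OF p] by (rule stalk_ringE)
    have fU: "regular_on (U \<inter> W) f"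
      by (rule regular_on_subset[OF f(2)]) (use assms regular_on_open[OF f(2)] in auto)
    have "p \<in> U \<inter> W" using p f(1) by simp
    then obtain V d G H where V: "zopen V" "p \<in> V" "V \<subseteq> U \<inter> W" "form d G" "form d H"
      "\<forall>q\<in>V. \<forall>v\<in>coords q. H v \<noteq> 0 \<and> f q = G v / H v" by (rule regular_onE[OF fU])
    have "section_of U k q = f q" if "q \<in> V" for q
      using that V f val_germ[OF f(2), of q] by (auto simp: section_of_def)
    then show "\<exists>V d G H. zopen V \<and> p \<in> V \<and> V \<subseteq> U \<and> form d G \<and> form d H \<and>
          (\<forall>q\<in>V. \<forall>v\<in>coords q. H v \<noteq> 0 \<and> section_of U k q = G v / H v)"
      using V by (intro exI[of _ V] exI[of _ d] exI[of _ G] exI[of _ H]) auto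
  qed
  then show S: "section_of U k \<in> Sec OP U" by (simp add: Sec_OP section_of_def)
  assume "U \<noteq> {}"
  then obtain p where p: "p \<in> U" by auto
  obtain W f where f: "p \<in> W" "regular_on W f" "k = germ f" using assms(2)[OF p] by (rule stalk_ringE)
  have "germ (section_of U k) = germ f"
    by (subst germ_eq_iff[of U _ W]) (use S f val_germ[OF f(2)] p in \<open>auto simp: Sec_OP section_of_def\<close>)
  then show "germ (section_of U k) = k" using f by simp
qed

lemma Sec_OP_open: "f \<in> Sec OP U ==> zopen U"
  using regular_on_open by (auto simp: Sec_OP)

lemma Sec_OP_germ: "f \<in> Sec OP U ==> q \<in> U ==> germ f \<in> \<O> q"
  by (auto simp: Sec_OP intro: stalk_ringI)

lemma Sec_OP_val: "f \<in> Sec OP U ==> q \<in> U ==> val q (germ f) = f q"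
  by (auto simp: Sec_OP intro: val_germ)

lemma Sec_OP_eqI:
  assumes "f \<in> Sec OP U" "g \<in> Sec OP U" "germ f = germ g" shows "f = g"
proof
  fix p show "f p = g p"
  proof (cases "p \<in> U")
    case True
    then show ?thesis using Sec_OP_val[of f U p] Sec_OP_val[of g U p] assms by simp
  qed (use assms in \<open>auto simp: Sec_OP\<close>)
qed

lemma OP_ops:
  "Res OP V f = (\<lambda>p. if p \<in> V then f p else 0)" "Add OP W f g = (\<lambda>p. f p + g p)" "Smul OP W f g = (\<lambda>p. f p * g p)"
  by (simp_all add: OP_def)

lemma Res_OP:
  assumes "f \<in> Sec OP U" "zopen V" "V \<subseteq> U"
  shows "Res OP V f \<in> Sec OP V" "V \<noteq> {} ==> germ (Res OP V f) = germ f"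
proof -
  let ?r = "\<lambda>p. if p \<in> V then f p else 0"
  have f: "regular_on V f" using assms regular_on_subset by (auto simp: Sec_OP)
  have "regular_on V ?r \<longleftrightarrow> regular_on V f" by (rule regular_on_cong) auto
  then have r: "regular_on V ?r" using f by simp
  then show "Res OP V f \<in> Sec OP V" by (simp add: OP_ops Sec_OP)
  assume "V \<noteq> {}"
  then show "germ (Res OP V f) = germ f"
    using germ_eq_iff[OF r _ f] by (simp add: OP_ops)
qed

lemma Add_OP:
  assumes "f \<in> Sec OP U" "g \<in> Sec OP U"
  shows "Add OP W f g \<in> Sec OP U" "U \<noteq> {} ==> germ (Add OP W f g) = germ f + germ g"
proof -
  show "Add OP W f g \<in> Sec OP U"
    using assms regular_on_add[of U f g] by (simp add: OP_ops Sec_OP)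
  show "U \<noteq> {} ==> germ (Add OP W f g) = germ f + germ g"
    using assms germ_add[of U f U g] by (simp add: OP_ops Sec_OP)
qed

lemma Smul_OP:
  assumes "f \<in> Sec OP U" "g \<in> Sec OP U"
  shows "Smul OP W f g \<in> Sec OP U" "U \<noteq> {} ==> germ (Smul OP W f g) = germ f * germ g"
proof -
  show "Smul OP W f g \<in> Sec OP U"
    using assms regular_on_mult[of U f g] by (simp add: OP_ops Sec_OP)
  show "U \<noteq> {} ==> germ (Smul OP W f g) = germ f * germ g"
    using assms germ_mult[of U f U g] by (simp add: OP_ops Sec_OP)
qed

section \<open>Affine charts\<close>

lemma noethE:
  assumes "noeth R" "ideal_in R I" obtains S where "finite S" "S \<subseteq> I" "I = gen R S"
  using assms(1)[unfolded noeth_def, rule_format, OF assms(2)] by (elim exE conjE) (rule that)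

text \<open>On \<open>chart j\<close> the result does not depend on the chosen representative: it is
  the one whose \<open>j\<close>-th coordinate is 1.\<close>

definition nrm :: "4 \<Rightarrow> p3 \<Rightarrow> complex^4" where
  "nrm j p = (let v = (SOME v. v \<in> coords p) in \<chi> i. v $ i / v $ j)"

definition chart :: "4 \<Rightarrow> p3 set" where
  "chart j = basic (\<lambda>v. v $ j)"

lemma in_chart: "v \<in> coords p ==> p \<in> chart j \<longleftrightarrow> v $ j \<noteq> 0"
  unfolding chart_def by (rule in_basic_iff[OF form_coord])

lemma openin_chart: "zopen (chart j)"
  unfolding chart_def by (rule openin_basic[OF form_coord])

lemma nrm_eq:
  assumes v: "v \<in> coords p" and p: "p \<in> chart j"
  shows "nrm j p = (1 / v $ j) *s v"
proof -
  define u where "u = (SOME u. u \<in> coords p)"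
  have u: "u \<in> coords p" unfolding u_def using v by (rule someI)
  obtain c where c: "c \<noteq> 0" "v = c *s u" using u v by (rule coords_scale)
  then show ?thesis unfolding nrm_def Let_def u_def[symmetric] by (simp add: vec_eq_iff)
qed

lemma nrm_coords:
  assumes "p \<in> chart j" shows "nrm j p \<in> coords p" "nrm j p $ j = 1"
proof -
  obtain v where v: "v \<in> coords p" by (rule coords_nonempty)
  then have nz: "v $ j \<noteq> 0" using assms in_chart by blast
  have "coords p = {c *s v | c. c \<noteq> 0}" using coords_proj[OF coords_nonzero[OF v]] proj_eq[OF v] by simp
  then have "(1 / v $ j) *s v \<in> coords p" using nz by auto
  then show "nrm j p \<in> coords p" "nrm j p $ j = 1" using nrm_eq[OF v assms] nz by auto
qed

lemma chart_cover: obtains j where "p \<in> chart j"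
proof -
  obtain v where v: "v \<in> coords p" by (rule coords_nonempty)
  then obtain j where "v $ j \<noteq> 0" using coords_nonzero by (metis vec_eq_iff zero_index)
  then show ?thesis using that in_chart[OF v] by blast
qed

lemma proj_in_chart:
  assumes "v $ j \<noteq> 0"
  shows "proj v \<in> chart j" "nrm j (proj v) = (1 / v $ j) *s v"
proof -
  have "v \<noteq> 0" using assms by auto
  note * = in_coords_proj[OF this]
  show "proj v \<in> chart j" using in_chart[OF *] assms by simp
  then show "nrm j (proj v) = (1 / v $ j) *s v" by (rule nrm_eq[OF *])
qed

lemma chart_point:
  assumes "v $ j = 1"
  shows "proj v \<in> chart j" "nrm j (proj v) = v"
  using proj_in_chart[of v j] assms by auto

lemma proj_nrm: "p \<in> chart j ==> proj (nrm j p) = p"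
  by (rule proj_eq[OF nrm_coords(1)])

lemma nrm_inj: "p \<in> chart j ==> q \<in> chart j ==> nrm j p = nrm j q ==> p = q"
  by (metis proj_nrm)

lemma chart_nonempty: "chart j \<noteq> {}"
  using chart_point(1)[of "\<chi> i. 1" j] by auto

definition Yc :: "4 \<Rightarrow> 4 \<Rightarrow> ratfun" where
  "Yc j i = germ (\<lambda>p. nrm j p $ i)"

definition chart_ring :: "4 \<Rightarrow> ratfun set" where
  "chart_ring j = alg cst (range (Yc j))"

lemma regular_nrm: "regular_on (chart j) (\<lambda>p. nrm j p $ i)"
  unfolding regular_on_def
proof
  fix p assume "p \<in> chart j"
  have *: "v $ j \<noteq> 0 \<and> nrm j q $ i = v $ i / v $ j" if "q \<in> chart j" "v \<in> coords q" for q v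
    using that in_chart[OF that(2)] nrm_eq[OF that(2,1)] by auto
  show "\<exists>V d G H. zopen V \<and> p \<in> V \<and> V \<subseteq> chart j \<and> form d G \<and> form d H \<and>
          (\<forall>q\<in>V. \<forall>v\<in>coords q. H v \<noteq> 0 \<and> nrm j q $ i = G v / H v)"
    by (rule exI[of _ "chart j"], rule exI[of _ 1], rule exI[of _ "\<lambda>v. v $ i"],
        rule exI[of _ "\<lambda>v. v $ j"]) (use \<open>p \<in> chart j\<close> openin_chart * in \<open>auto simp: form_coord[simplified]\<close>)
qed

lemma Yc_stalk_ring: "q \<in> chart j ==> Yc j i \<in> \<O> q"
  unfolding Yc_def by (rule stalk_ringI[OF regular_nrm])

lemma val_Yc: "q \<in> chart j ==> val q (Yc j i) = nrm j q $ i"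
  unfolding Yc_def by (rule val_germ[OF regular_nrm])

lemma ratfun_eqI:
  assumes "zopen U" "U \<noteq> {}" "\<And>q. q \<in> U ==> k \<in> \<O> q" "\<And>q. q \<in> U ==> l \<in> \<O> q"
    "\<And>q. q \<in> U ==> val q k = val q l"
  shows "k = l"
proof -
  have "section_of U k = section_of U l" using assms(5) by (auto simp: section_of_def)
  moreover have "germ (section_of U k) = k" by (rule section_of(2)[OF assms(1,3,2)])
  moreover have "germ (section_of U l) = l" by (rule section_of(2)[OF assms(1,4,2)])
  ultimately show ?thesis by metis
qed

lemma Yc_self: "Yc j j = 1"
  by (rule ratfun_eqI[OF openin_chart[of j] chart_nonempty]) (simp_all add: Yc_stalk_ring val_Yc nrm_coords(2))

interpretation chart: subring "chart_ring j" for j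
  unfolding chart_ring_def by (rule cst.subring_alg)

lemma cst_chart_ring [simp]: "cst c \<in> chart_ring j"
  by (simp add: chart_ring_def alg.cst)

lemma Yc_chart_ring [simp]: "Yc j i \<in> chart_ring j"
  by (simp add: chart_ring_def alg.gen)

lemma chart_ring_induct [consumes 1, case_names cst Yc add mult]:
  assumes "f \<in> chart_ring j" "\<And>c. Q (cst c)" "\<And>i. Q (Yc j i)"
    "\<And>a b. a \<in> chart_ring j ==> b \<in> chart_ring j ==> Q a ==> Q b ==> Q (a + b)"
    "\<And>a b. a \<in> chart_ring j ==> b \<in> chart_ring j ==> Q a ==> Q b ==> Q (a * b)"
  shows "Q f"
  using assms(1) unfolding chart_ring_def by induction (use assms in \<open>auto simp: chart_ring_def\<close>)

lemma chart_ring_stalk: "f \<in> chart_ring j ==> q \<in> chart j ==> f \<in> \<O> q"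
  by (induction rule: chart_ring_induct) (auto simp: Yc_stalk_ring)

lemma chart_ring_eqI:
  "f \<in> chart_ring j ==> g \<in> chart_ring j ==> (\<And>q. q \<in> chart j ==> val q f = val q g) ==> f = g"
  by (rule ratfun_eqI[OF openin_chart chart_nonempty]) (auto intro: chart_ring_stalk)

lemma noeth_chart_ring: "noeth (chart_ring j)"
  unfolding chart_ring_def by (rule cst.noeth_alg) simp

lemma form_dehomogenize:
  assumes "form d G" obtains g where "g \<in> chart_ring j" "\<And>q. q \<in> chart j ==> val q g = G (nrm j q)"
proof -
  obtain c where c: "\<And>v. G v = (\<Sum>a\<in>exponents d. c a * monomial a v)" using assms unfolding form_altdef by blast
  define m where "m a = (\<Prod>i\<in>UNIV. Yc j i ^ a i)" for a
  have m: "m a \<in> chart_ring j" for a unfolding m_def by (rule chart.prod_closed) auto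
  have vm: "val q (m a) = monomial a (nrm j q)" if "q \<in> chart j" for q a
    using that by (simp add: m_def val_prod monomial_def val_Yc Yc_stalk_ring)
  show ?thesis
  proof
    show "(\<Sum>a\<in>exponents d. cst (c a) * m a) \<in> chart_ring j" using m by (intro chart.sum_closed) auto
    show "val q (\<Sum>a\<in>exponents d. cst (c a) * m a) = G (nrm j q)" if "q \<in> chart j" for q
    proof -
      have "m a \<in> \<O> q" for a by (rule chart_ring_stalk[OF m that])
      then show ?thesis using that by (simp add: val_sum c vm)
    qed
  qed
qed

text \<open>The local ring is a localization of the coordinate ring of the chart: numerator and
  denominator of a local quotient of forms are dehomogenized.\<close>

lemma stalk_fraction:
  assumes k: "k \<in> \<O> p" and p: "p \<in> chart j"
  obtains g h where "g \<in> chart_ring j" "h \<in> chart_ring j" "val p h \<noteq> 0" "h * k = g"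
proof -
  obtain U f where f: "p \<in> U" "regular_on U f" "k = germ f" using k by (rule stalk_ringE)
  obtain V d G H where V: "zopen V" "p \<in> V" "V \<subseteq> U" "form d G" "form d H"
    "\<forall>q\<in>V. \<forall>v\<in>coords q. H v \<noteq> 0 \<and> f q = G v / H v" by (rule regular_onE[OF f(2,1)])
  obtain g where g: "g \<in> chart_ring j" "\<And>q. q \<in> chart j ==> val q g = G (nrm j q)"
    using form_dehomogenize[OF V(4)] by blast
  obtain h where h: "h \<in> chart_ring j" "\<And>q. q \<in> chart j ==> val q h = H (nrm j q)"
    using form_dehomogenize[OF V(5)] by blast
  have kq: "k \<in> \<O> q" if "q \<in> V" for q using that V f stalk_ringI by auto
  have "h * k = g"
  proof (rule ratfun_eqI)
    show "zopen (V \<inter> chart j)" using V openin_chart by auto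
    show "V \<inter> chart j \<noteq> {}" using V p by auto
    fix q assume q: "q \<in> V \<inter> chart j"
    have 1: "h \<in> \<O> q" "g \<in> \<O> q" "k \<in> \<O> q" using q g h kq chart_ring_stalk by auto
    then show "h * k \<in> \<O> q" "g \<in> \<O> q" by auto
    have "val q k = f q" using q V(3) f val_germ[OF f(2)] by auto
    then show "val q (h * k) = val q g" using 1 q V(6)[rule_format, of q "nrm j q"] g(2) h(2) nrm_coords(1) by auto
  qed
  moreover have "val p h \<noteq> 0" using h(2)[OF p] V nrm_coords(1)[OF p] by auto
  ultimately show ?thesis using that g h by blast
qed

lemma chart_basic_neighbourhood:
  assumes "zopen V" "p \<in> V" "p \<in> chart j"
  obtains f where "f \<in> chart_ring j" "val p f \<noteq> 0" "\<And>q. q \<in> chart j ==> val q f \<noteq> 0 ==> q \<in> V"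
proof -
  obtain d F where F: "form d F" "p \<in> basic F" "basic F \<subseteq> V" using basic_neighbourhood assms(1,2) by metis
  obtain f where f: "f \<in> chart_ring j" "\<And>q. q \<in> chart j ==> val q f = F (nrm j q)"
    using form_dehomogenize[OF F(1)] by blast
  have "q \<in> basic F \<longleftrightarrow> val q f \<noteq> 0" if "q \<in> chart j" for q
    using in_basic_iff[OF F(1) nrm_coords(1)[OF that]] f(2)[OF that] by simp
  then show ?thesis using that f F assms(3) by blast
qed

lemma max_ideal_ideal: "ideal_in (\<O> p) (max_ideal p)"
  by (auto simp: ideal_in_def max_ideal_def)

lemma inverse_mult_cancel: "h \<noteq> 0 ==> h * k = g ==> k = inverse h * g" for h :: "'a::field"
  by auto

text \<open>Generators of the contraction of \<open>I\<close> to the coordinate ring of a chart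
  generate \<open>I\<close>, because each element of \<open>I\<close> becomes a member of the
  contraction after multiplication by a unit of the local ring.\<close>

lemma noeth_stalk_ring: "noeth (\<O> p)"
  unfolding noeth_def
proof (intro allI impI)
  obtain j where p: "p \<in> chart j" by (rule chart_cover)
  fix I assume I: "ideal_in (\<O> p) I"
  have sub: "chart_ring j \<subseteq> \<O> p" using chart_ring_stalk p by blast
  have "ideal_in (chart_ring j) (I \<inter> chart_ring j)"
    using I sub by (auto simp: ideal_in_def)
  then obtain S where S: "finite S" "S \<subseteq> I \<inter> chart_ring j" "I \<inter> chart_ring j = gen (chart_ring j) S"
    by (rule noethE[OF noeth_chart_ring])
  have Ssub: "S \<subseteq> \<O> p" using S sub by blast
  have G: "ideal_in (\<O> p) (gen (\<O> p) S)" by (rule stalk.gen_ideal[OF Ssub])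
  have "gen (chart_ring j) S \<subseteq> gen (\<O> p) S"
  proof
    fix x assume "x \<in> gen (chart_ring j) S"
    then show "x \<in> gen (\<O> p) S" by induction (use sub in \<open>auto intro: gen.intros\<close>)
  qed
  have "I \<subseteq> gen (\<O> p) S"
  proof
    fix k assume k: "k \<in> I"
    then have kp: "k \<in> \<O> p" using I by (auto simp: ideal_in_def)
    obtain g h where gh: "g \<in> chart_ring j" "h \<in> chart_ring j" "val p h \<noteq> 0" "h * k = g"
      using stalk_fraction[OF kp p] by blast
    have hp: "h \<in> \<O> p" using gh sub by auto
    have "g \<in> I" using idealD(4)[OF I hp k] gh by simp
    then have "g \<in> gen (\<O> p) S" using gh S(3) \<open>gen (chart_ring j) S \<subseteq> _\<close> by auto
    then have "inverse h * g \<in> gen (\<O> p) S"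
      using idealD(4)[OF G stalk_ring_inverse[OF hp gh(3)]] by simp
    moreover have "h \<noteq> 0" using gh(3) by auto
    ultimately show "k \<in> gen (\<O> p) S" using inverse_mult_cancel gh(4) by metis
  qed
  moreover have "gen (\<O> p) S \<subseteq> I" using S by (intro gen_least[OF I]) auto
  ultimately show "\<exists>S. finite S \<and> S \<subseteq> I \<and> I = gen (\<O> p) S" using S by blast
qed

interpretation loc: local_domain "\<O> p" "max_ideal p" for p
proof
  show "ideal_in (\<O> p) (max_ideal p)" by (rule max_ideal_ideal)
  show "1 \<notin> max_ideal p" by (simp add: max_ideal_def)
  show "inverse a \<in> \<O> p" if "a \<in> \<O> p" "a \<notin> max_ideal p" for a
    using that stalk_ring_inverse by (auto simp: max_ideal_def)
  show "of_nat n \<notin> max_ideal p" if "n > 0" for n using that by (simp add: max_ideal_def)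
  show "noeth (\<O> p)" by (rule noeth_stalk_ring)
qed

section \<open>Local coordinates centred at a point\<close>

definition xc :: "4 \<Rightarrow> p3 \<Rightarrow> 4 \<Rightarrow> ratfun" where
  "xc j p i = Yc j i - cst (nrm j p $ i)"

lemma xc_chart_ring [simp]: "xc j p i \<in> chart_ring j"
  by (simp add: xc_def)

lemma val_xc: "q \<in> chart j ==> val q (xc j p i) = nrm j q $ i - nrm j p $ i"
  by (simp add: xc_def Yc_stalk_ring val_Yc)

lemma xc_stalk_ring [simp]: "q \<in> chart j ==> xc j p i \<in> \<O> q"
  by (rule chart_ring_stalk[OF xc_chart_ring])

lemma xc_self: "p \<in> chart j ==> xc j p j = 0"
  by (simp add: xc_def Yc_self nrm_coords)

lemma xc_max_ideal: "p \<in> chart j ==> xc j p i \<in> max_ideal p"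
  by (simp add: max_ideal_def val_xc)

text \<open>A polynomial minus its value at \<open>p\<close> is a combination of the centred
  coordinates, by induction on its construction. A general element of the local ring differs from a
  polynomial by a unit factor.\<close>

lemma max_ideal_gen:
  assumes p: "p \<in> chart j"
  shows "max_ideal p = gen (\<O> p) (xc j p ` (UNIV - {j}))"
proof
  let ?G = "gen (\<O> p) (xc j p ` (UNIV - {j}))"
  have G: "ideal_in (\<O> p) ?G" using p by (intro stalk.gen_ideal) auto
  show "?G \<subseteq> max_ideal p" using p by (intro gen_least[OF max_ideal_ideal]) (auto simp: xc_max_ideal)
  have xG: "xc j p i \<in> ?G" for i
    using stalk.gen_incl[of "xc j p ` (UNIV - {j})" p] idealD(2)[OF G] xc_self[OF p] by (cases "i = j") auto
  have f: "f - cst (val p f) \<in> ?G" if "f \<in> chart_ring j" for f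
    using that
  proof (induction rule: chart_ring_induct)
    case (cst c)
    then show ?case using idealD(2)[OF G] by simp
  next
    case (Yc i)
    then show ?case using xG[of i] by (simp add: xc_def val_Yc p)
  next
    case (add a b)
    have "(a - cst (val p a)) + (b - cst (val p b)) \<in> ?G" by (rule idealD(3)[OF G add(3,4)])
    moreover have "(a - cst (val p a)) + (b - cst (val p b)) = a + b - cst (val p (a + b))"
      using add chart_ring_stalk p by (simp add: cst.cst_add)
    ultimately show ?case by simp
  next
    case (mult a b)
    have ab: "a \<in> \<O> p" "b \<in> \<O> p" using mult chart_ring_stalk p by auto
    have "b * (a - cst (val p a)) + cst (val p a) * (b - cst (val p b)) \<in> ?G"
      using ab by (intro idealD(3)[OF G idealD(4)[OF G _ mult(3)] idealD(4)[OF G _ mult(4)]]) auto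
    moreover have "b * (a - cst (val p a)) + cst (val p a) * (b - cst (val p b)) = a * b - cst (val p (a * b))"
      using ab by (simp add: cst.cst_mult algebra_simps)
    ultimately show ?case by simp
  qed
  show "max_ideal p \<subseteq> ?G"
  proof
    fix k assume k: "k \<in> max_ideal p"
    then have kp: "k \<in> \<O> p" "val p k = 0" by (auto simp: max_ideal_def)
    obtain g h where gh: "g \<in> chart_ring j" "h \<in> chart_ring j" "val p h \<noteq> 0" "h * k = g"
      using stalk_fraction[OF kp(1) p] by blast
    have hp: "h \<in> \<O> p" using gh chart_ring_stalk p by blast
    have "val p g = 0" using gh(4)[symmetric] hp kp by simp
    then have "h * k \<in> ?G" using f[OF gh(1)] gh(4) by simp
    then show "k \<in> ?G" using loc.unit_cancel[OF G hp] gh(3) by (simp add: max_ideal_def)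
  qed
qed

lemma gen_subring_mono: "R \<subseteq> R' ==> gen R S \<subseteq> gen R' S"
proof
  fix x assume "R \<subseteq> R'" "x \<in> gen R S"
  from this(2) show "x \<in> gen R' S" by induction (use \<open>R \<subseteq> R'\<close> in \<open>auto intro: gen.intros\<close>)
qed

text \<open>A combination with coefficients in the local ring has finitely many denominators, and
  their product is still nonzero at \<open>p\<close>.\<close>

lemma gen_clear:
  assumes p: "p \<in> chart j" and L: "L \<subseteq> chart_ring j" and f: "f \<in> gen (\<O> p) L"
  obtains h where "h \<in> chart_ring j" "val p h \<noteq> 0" "h * f \<in> gen (chart_ring j) L"
proof -
  let ?G = "gen (chart_ring j) L"
  have sub: "chart_ring j \<subseteq> \<O> p" using chart_ring_stalk p by blast
  have G: "ideal_in (chart_ring j) ?G" by (rule chart.gen_ideal[OF L])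
  have "\<exists>h\<in>chart_ring j. val p h \<noteq> 0 \<and> h * f \<in> ?G"
    using f
  proof induction
    case zero
    show ?case using idealD(2)[OF G] by (intro bexI[of _ 1]) auto
  next
    case (step r l a)
    then obtain h where h: "h \<in> chart_ring j" "val p h \<noteq> 0" "h * a \<in> ?G" by blast
    obtain u v where uv: "u \<in> chart_ring j" "v \<in> chart_ring j" "val p v \<noteq> 0" "v * r = u"
      using stalk_fraction[OF step(1) p] by blast
    have l: "l \<in> ?G" using step(2) chart.gen_incl by blast
    have "h * u * l + v * (h * a) \<in> ?G"
      using h uv by (intro idealD(3)[OF G idealD(4)[OF G _ l] idealD(4)[OF G _ h(3)]]) auto
    then have "(h * v) * (r * l + a) \<in> ?G" by (simp add: uv(4)[symmetric] algebra_simps)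
    moreover have "val p (h * v) \<noteq> 0" using h uv sub by (simp add: subset_iff)
    ultimately show ?case using h uv by (intro bexI[of _ "h * v"]) auto
  qed
  then show ?thesis using that by blast
qed

text \<open>The map \<open>\<tau>\<close> below is a polynomial retraction of the chart onto the common zeros of \<open>L\<close>.
  Substitution along it is a ring homomorphism into a domain with kernel generated by \<open>L\<close>.\<close>

lemma retraction_prime:
  assumes p: "p \<in> chart j" and s: "\<And>i. s i \<in> chart_ring j" "s j = 1" "\<And>i. val p (s i) = nrm j p $ i"
    and L: "L \<subseteq> chart_ring j" "\<And>i. Yc j i - s i \<in> gen (chart_ring j) L"
    and \<tau>_def: "\<tau> = (\<lambda>q. proj (\<chi> i. val q (s i)))"
    and L0: "\<And>l q. l \<in> L ==> q \<in> chart j ==> val (\<tau> q) l = 0"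
  shows "prime_ideal (\<O> p) (gen (\<O> p) L)"
    and "\<And>f. f \<in> chart_ring j ==> f \<in> gen (\<O> p) L \<longleftrightarrow> (\<forall>q\<in>chart j. val (\<tau> q) f = 0)"
proof -
  let ?G = "gen (chart_ring j) L" and ?S = "gen (\<O> p) L"
  have sub: "chart_ring j \<subseteq> \<O> p" using chart_ring_stalk p by blast
  have G: "ideal_in (chart_ring j) ?G" by (rule chart.gen_ideal[OF L(1)])
  have S: "ideal_in (\<O> p) ?S" using L(1) sub by (intro stalk.gen_ideal) auto
  have \<tau>: "\<tau> q \<in> chart j" "nrm j (\<tau> q) = (\<chi> i. val q (s i))" if "q \<in> chart j" for q
    unfolding \<tau>_def using chart_point[of "\<chi> i. val q (s i)" j] s(2) by auto
  have \<tau>p: "\<tau> p = p" using proj_nrm[OF p] s(3) by (simp add: \<tau>_def)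
  \<comment> \<open>Substitution along \<open>\<tau>\<close> is obtained together with the
    congruence modulo \<open>L\<close> by induction on the polynomial, since polynomials here are
    functions without a normal form.\<close>
  have ex: "\<exists>g\<in>chart_ring j. (\<forall>q\<in>chart j. val q g = val (\<tau> q) f) \<and> f - g \<in> ?G" if "f \<in> chart_ring j" for f
    using that
  proof (induction rule: chart_ring_induct)
    case (cst c)
    show ?case using idealD(2)[OF G] by (intro bexI[of _ "cst c"]) auto
  next
    case (Yc i)
    show ?case using L(2)[of i] \<tau> s(1) by (intro bexI[of _ "s i"]) (auto simp: val_Yc)
  next
    case (add a b)
    then obtain g h where g: "g \<in> chart_ring j" "\<forall>q\<in>chart j. val q g = val (\<tau> q) a" "a - g \<in> ?G"
      and h: "h \<in> chart_ring j" "\<forall>q\<in>chart j. val q h = val (\<tau> q) b" "b - h \<in> ?G" by blast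
    have "(a - g) + (b - h) \<in> ?G" by (rule idealD(3)[OF G g(3) h(3)])
    then have "a + b - (g + h) \<in> ?G" by (simp add: algebra_simps)
    moreover have "val q (g + h) = val (\<tau> q) (a + b)" if "q \<in> chart j" for q
      using that g h add(1,2) \<tau>(1)[OF that] chart_ring_stalk[of _ j] by simp
    ultimately show ?case using g(1) h(1) by (intro bexI[of _ "g + h"]) auto
  next
    case (mult a b)
    then obtain g h where g: "g \<in> chart_ring j" "\<forall>q\<in>chart j. val q g = val (\<tau> q) a" "a - g \<in> ?G"
      and h: "h \<in> chart_ring j" "\<forall>q\<in>chart j. val q h = val (\<tau> q) b" "b - h \<in> ?G" by blast
    have "b * (a - g) + g * (b - h) \<in> ?G"
      by (rule idealD(3)[OF G idealD(4)[OF G mult(2) g(3)] idealD(4)[OF G g(1) h(3)]])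
    then have "a * b - (g * h) \<in> ?G" by (simp add: algebra_simps)
    moreover have "val q (g * h) = val (\<tau> q) (a * b)" if "q \<in> chart j" for q
      using that g h mult(1,2) \<tau>(1)[OF that] chart_ring_stalk[of _ j] by simp
    ultimately show ?case using g(1) h(1) by (intro bexI[of _ "g * h"]) auto
  qed
  \<comment> \<open>The choice is harmless: elements of the chart ring are determined by their
    values, and the values of \<open>\<pi> f\<close> are prescribed.\<close>
  define \<pi> where "\<pi> f = (SOME g. g \<in> chart_ring j \<and> (\<forall>q\<in>chart j. val q g = val (\<tau> q) f) \<and> f - g \<in> ?G)" for f
  have \<pi>: "\<pi> f \<in> chart_ring j" "\<And>q. q \<in> chart j ==> val q (\<pi> f) = val (\<tau> q) f" "f - \<pi> f \<in> ?G"
    if "f \<in> chart_ring j" for f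
  proof -
    have "\<pi> f \<in> chart_ring j \<and> (\<forall>q\<in>chart j. val q (\<pi> f) = val (\<tau> q) f) \<and> f - \<pi> f \<in> ?G"
      unfolding \<pi>_def by (rule someI_ex) (use ex[OF that] in blast)
    then show "\<pi> f \<in> chart_ring j" "\<And>q. q \<in> chart j ==> val q (\<pi> f) = val (\<tau> q) f" "f - \<pi> f \<in> ?G" by auto
  qed
  have \<pi>_mult: "\<pi> (f * g) = \<pi> f * \<pi> g" if "f \<in> chart_ring j" "g \<in> chart_ring j" for f g
  proof (rule chart_ring_eqI[of _ j])
    show "\<pi> (f * g) \<in> chart_ring j" "\<pi> f * \<pi> g \<in> chart_ring j" using that \<pi>(1) by auto
    fix q assume q: "q \<in> chart j"
    have "\<pi> f \<in> \<O> q" "\<pi> g \<in> \<O> q" "f \<in> \<O> (\<tau> q)" "g \<in> \<O> (\<tau> q)"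
      using chart_ring_stalk q \<tau>(1) that \<pi>(1) by blast+
    then show "val q (\<pi> (f * g)) = val q (\<pi> f * \<pi> g)"
      using that \<pi>(2)[OF _ q] by simp
  qed
  have \<pi>_0: "\<pi> f = 0 \<longleftrightarrow> (\<forall>q\<in>chart j. val (\<tau> q) f = 0)" if "f \<in> chart_ring j" for f
  proof -
    have "\<pi> f = 0 \<longleftrightarrow> (\<forall>q\<in>chart j. val q (\<pi> f) = 0)"
      using chart_ring_eqI[of "\<pi> f" j 0] \<pi>(1)[OF that] by auto
    then show ?thesis using \<pi>(2)[OF that] by simp
  qed
  have GS: "?G \<subseteq> ?S" by (rule gen_subring_mono[OF sub])
  have \<pi>G: "\<pi> f = 0" if "f \<in> ?G" for f
  proof -
    have fc: "f \<in> chart_ring j" using idealD(1)[OF G that] .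
    have "\<forall>q\<in>chart j. val (\<tau> q) f = 0"
      using that
    proof induction
      case (step r l a)
      have "r \<in> \<O> (\<tau> q)" "l \<in> \<O> (\<tau> q)" "a \<in> \<O> (\<tau> q)" if "q \<in> chart j" for q
        using step L(1) idealD(1)[OF G] \<tau>(1)[OF that] chart_ring_stalk by blast+
      then show ?case using step L0 by simp
    qed simp
    then show ?thesis using \<pi>_0[OF fc] by simp
  qed
  \<comment> \<open>\<open>\<tau>\<close> fixes \<open>p\<close>, so a denominator that is nonzero
    at \<open>p\<close> does not become zero under the substitution.\<close>
  have \<pi>_nz: "\<pi> h \<noteq> 0" if "h \<in> chart_ring j" "val p h \<noteq> 0" for h
    using \<pi>(2)[OF that(1) p] that(2) \<tau>p by auto
  have S_iff: "f \<in> ?S \<longleftrightarrow> \<pi> f = 0" if f: "f \<in> chart_ring j" for f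
  proof
    assume "f \<in> ?S"
    then obtain h where h: "h \<in> chart_ring j" "val p h \<noteq> 0" "h * f \<in> ?G" by (rule gen_clear[OF p L(1)])
    then have "\<pi> h * \<pi> f = 0" using \<pi>G[OF h(3)] \<pi>_mult[OF h(1) f] by simp
    then show "\<pi> f = 0" using \<pi>_nz h by auto
  next
    assume "\<pi> f = 0"
    then show "f \<in> ?S" using \<pi>(3)[OF f] GS by auto
  qed
  show "f \<in> ?S \<longleftrightarrow> (\<forall>q\<in>chart j. val (\<tau> q) f = 0)" if "f \<in> chart_ring j" for f
    using S_iff[OF that] \<pi>_0[OF that] by simp
  show "prime_ideal (\<O> p) ?S"
    unfolding prime_ideal_def
  proof (intro conjI ballI impI S)
    show "1 \<notin> ?S" using S_iff[of 1] \<pi>_nz[of 1] by auto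
    fix a b assume ab: "a \<in> \<O> p" "b \<in> \<O> p" "a * b \<in> ?S"
    obtain g h where gh: "g \<in> chart_ring j" "h \<in> chart_ring j" "val p h \<noteq> 0" "h * a = g"
      using stalk_fraction[OF ab(1) p] by blast
    obtain u v where uv: "u \<in> chart_ring j" "v \<in> chart_ring j" "val p v \<noteq> 0" "v * b = u"
      using stalk_fraction[OF ab(2) p] by blast
    have "(h * v) * (a * b) \<in> ?S" using gh uv sub by (intro idealD(4)[OF S _ ab(3)]) auto
    then have "g * u \<in> ?S" by (simp add: gh(4)[symmetric] uv(4)[symmetric] ac_simps)
    then have "\<pi> g * \<pi> u = 0" using S_iff[of "g * u"] gh uv \<pi>_mult by auto
    then have "h * a \<in> ?S \<or> v * b \<in> ?S" using S_iff gh uv by auto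
    then show "a \<in> ?S \<or> b \<in> ?S"
      using loc.unit_cancel[OF S, of h a] loc.unit_cancel[OF S, of v b] gh uv sub
      by (auto simp: max_ideal_def)
  qed
qed

lemma three_other_indices:
  assumes "a \<noteq> (j::4)" obtains b c where "UNIV = {j, a, b, c}" "b \<noteq> j" "b \<noteq> a" "c \<noteq> j" "c \<noteq> a" "b \<noteq> c"
proof -
  have "card (UNIV - {j, a}) = 2" using assms by (subst card_Diff_subset) auto
  then obtain b c where "UNIV - {j, a} = {b, c}" "b \<noteq> c" by (auto simp: card_2_iff)
  then show ?thesis using that[of b c] by blast
qed

text \<open>The coefficient \<open>b a\<close> is a unit, so \<open>F\<close> can replace the
  coordinate \<open>xc j p a\<close> among the three generators of the maximal ideal. The two
  remaining coordinates give the pencil, and their ideals are prime because they cut out a plane and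
  a line.\<close>

lemma pencil_from_linear_part:
  assumes p: "p \<in> chart j" and F: "F = (\<Sum>i\<in>UNIV - {j}. b i * xc j p i)"
    and b: "\<And>i. b i \<in> \<O> p" and a: "a \<noteq> j" "b a \<notin> max_ideal p"
  obtains y z where "regular_pencil (\<O> p) (max_ideal p) F y z"
proof -
  obtain i k where ik: "UNIV = {j, a, i, k}" "i \<noteq> j" "i \<noteq> a" "k \<noteq> j" "k \<noteq> a" "i \<noteq> k"
    using three_other_indices[OF a(1)] by blast
  let ?A = "\<O> p"
  have UNIVj: "UNIV - {j} = {a, i, k}" using ik a(1) by auto
  define z where "z = xc j p k"
  define x where "x = xc j p a"
  have xz: "x \<in> ?A" "z \<in> ?A" "xc j p i \<in> ?A" using p by (auto simp: x_def z_def)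
  have F3: "F = b a * x + b i * xc j p i + b k * z"
    unfolding F UNIVj using ik a by (simp add: x_def z_def add.assoc)
  have FA: "F \<in> ?A" unfolding F3 using b xz by auto
  have Mgen: "max_ideal p = gen ?A {x, xc j p i, z}"
    using max_ideal_gen[OF p] by (simp add: UNIVj x_def z_def)
  have "regular_system ?A (max_ideal p) F (xc j p i + of_nat n * z) z" for n
  proof -
    define w where "w = xc j p i + of_nat n * z"
    have wA: "w \<in> ?A" using xz by (simp add: w_def)
    have wc: "w \<in> chart_ring j" "z \<in> chart_ring j" "x \<in> chart_ring j" by (simp_all add: w_def z_def x_def)
    \<comment> \<open>Coordinate \<open>i\<close> is solved from \<open>w = 0\<close> and the others
      are kept, which retracts the chart onto that plane.\<close>
    define s where "s l = (if l = i then cst (nrm j p $ i) - of_nat n * z else Yc j l)" for l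
    define \<tau> where "\<tau> = (\<lambda>q. proj (\<chi> l. val q (s l)))"
    \<comment> \<open>The same for the line \<open>w = z = 0\<close>, on which the coordinates
      \<open>i\<close> and \<open>k\<close> have the values they have at \<open>p\<close>.\<close>
    define t where "t l = (if l = i then cst (nrm j p $ i) else if l = k then cst (nrm j p $ k) else Yc j l)" for l
    define \<sigma> where "\<sigma> = (\<lambda>q. proj (\<chi> l. val q (t l)))"
    have \<tau>: "nrm j (\<tau> q) = (\<chi> l. val q (s l))" "\<tau> q \<in> chart j" if "q \<in> chart j" for q
      unfolding \<tau>_def using chart_point[of "\<chi> l. val q (s l)" j] ik by (auto simp: s_def Yc_self)
    have \<sigma>: "nrm j (\<sigma> q) = (\<chi> l. val q (t l))" "\<sigma> q \<in> chart j" if "q \<in> chart j" for q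
      unfolding \<sigma>_def using chart_point[of "\<chi> l. val q (t l)" j] ik by (auto simp: t_def Yc_self)
    have vz: "val q z = nrm j q $ k - nrm j p $ k" "val q w = nrm j q $ i - nrm j p $ i + of_nat n * (nrm j q $ k - nrm j p $ k)"
      "val q x = nrm j q $ a - nrm j p $ a" if "q \<in> chart j" for q
      using that by (auto simp: z_def w_def x_def val_xc)
    have zq: "z \<in> \<O> q" if "q \<in> chart j" for q using that by (simp add: z_def)
    have s1: "s l \<in> chart_ring j" "val p (s l) = nrm j p $ l" for l
      using p wc vz zq[OF p] by (auto simp: s_def val_Yc)
    have s2: "s j = 1" using ik by (simp add: s_def Yc_self)
    have s3: "{w} \<subseteq> chart_ring j" using wc by simp
    have s4: "Yc j l - s l \<in> gen (chart_ring j) {w}" for l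
    proof (cases "l = i")
      case True
      then have "Yc j l - s l = w" by (simp add: s_def w_def xc_def)
      then show ?thesis using chart.gen_incl by auto
    qed (simp add: s_def gen.zero)
    have s5: "val (\<tau> q) l = 0" if "l \<in> {w}" "q \<in> chart j" for l q
      using that ik \<tau>[OF that(2)] vz zq by (auto simp: s_def val_Yc)
    note 1 = retraction_prime[OF p s1(1) s2 s1(2) s3 s4 \<tau>_def s5]
    have t1: "t l \<in> chart_ring j" "val p (t l) = nrm j p $ l" for l
      using p by (auto simp: t_def val_Yc)
    have t2: "t j = 1" using ik by (simp add: t_def Yc_self)
    have t3: "{w, z} \<subseteq> chart_ring j" using wc by simp
    have t4: "Yc j l - t l \<in> gen (chart_ring j) {w, z}" for l
    proof -
      have "1 * w + (- of_nat n) * z \<in> gen (chart_ring j) {w, z}" "0 * w + 1 * z \<in> gen (chart_ring j) {w, z}"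
        using wc by (intro chart.gen2I; simp)+
      moreover have "Yc j i - t i = 1 * w + (- of_nat n) * z" "Yc j k - t k = 0 * w + 1 * z"
        using ik by (simp_all add: t_def w_def z_def xc_def)
      moreover have "Yc j l - t l = 0" if "l \<noteq> i" "l \<noteq> k" using that by (simp add: t_def)
      ultimately show ?thesis by (metis gen.zero)
    qed
    have t5: "val (\<sigma> q) l = 0" if "l \<in> {w, z}" "q \<in> chart j" for l q
      using that ik \<sigma>[OF that(2)] vz by (auto simp: t_def)
    note 2 = retraction_prime[OF p t1(1) t2 t1(2) t3 t4 \<sigma>_def t5]
    \<comment> \<open>A test point displaced from \<open>p\<close> in the directions
      \<open>a\<close> and \<open>k\<close>: after the retraction \<open>\<tau>\<close> it still has
      \<open>z = 1\<close>, and after \<open>\<sigma>\<close> it still has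
      \<open>x = 1\<close>.\<close>
    define v where "v = nrm j p + axis a 1 + axis k 1"
    have "v $ j = 1" using ik a nrm_coords[OF p] by (simp add: v_def axis_def)
    define q where "q = proj v"
    have q: "q \<in> chart j" "nrm j q = v" using chart_point[OF \<open>v $ j = 1\<close>] by (auto simp: q_def)
    have vv: "v $ k = nrm j p $ k + 1" "v $ a = nrm j p $ a + 1" using ik a by (simp_all add: v_def axis_def)
    have z_notin: "z \<notin> gen ?A {w}"
    proof -
      have "val (\<tau> q) z = 1" using vz(1)[OF \<tau>(2)[OF q(1)]] \<tau>[OF q(1)] ik q vv by (simp add: s_def val_Yc)
      then show ?thesis using 1(2)[of z] wc q(1) by force
    qed
    have x_notin: "x \<notin> gen ?A {w, z}"
    proof -
      have "val (\<sigma> q) x = 1" using vz(3)[OF \<sigma>(2)[OF q(1)]] \<sigma>[OF q(1)] ik q vv by (simp add: t_def val_Yc)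
      then show ?thesis using 2(2)[of x] wc q(1) by force
    qed
    have WZ: "ideal_in ?A (gen ?A {w, z})" using 2(1) by (simp add: prime_ideal_def)
    have inWZ: "w \<in> gen ?A {w, z}" "z \<in> gen ?A {w, z}" using stalk.gen_incl[of "{w, z}" p] by auto
    have xi: "xc j p i = w - of_nat n * z" by (simp add: w_def)
    have rest: "b i * xc j p i + b k * z \<in> I" if "ideal_in ?A I" "w \<in> I" "z \<in> I" for I
      unfolding xi using that b
      by (intro idealD(3)[OF that(1)] idealD(4)[OF that(1)] stalk.ideal_diff[OF that(1)]) auto
    have F_notin: "F \<notin> gen ?A {w, z}"
    proof
      assume "F \<in> gen ?A {w, z}"
      then have "F - (b i * xc j p i + b k * z) \<in> gen ?A {w, z}" using rest[OF WZ inWZ] by (rule stalk.ideal_diff[OF WZ])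
      then have "b a * x \<in> gen ?A {w, z}" by (simp add: F3)
      then show False using loc.unit_cancel[OF WZ b a(2)] x_notin by blast
    qed
    have FWZ: "ideal_in ?A (gen ?A {F, w, z})" using FA wA xz by (intro stalk.gen_ideal) auto
    have in3: "F \<in> gen ?A {F, w, z}" "w \<in> gen ?A {F, w, z}" "z \<in> gen ?A {F, w, z}"
      using stalk.gen_incl[of "{F, w, z}" p] by auto
    have xiF: "xc j p i \<in> gen ?A {F, w, z}"
      unfolding xi by (intro stalk.ideal_diff[OF FWZ in3(2)] idealD(4)[OF FWZ _ in3(3)]) auto
    have "F - (b i * xc j p i + b k * z) \<in> gen ?A {F, w, z}"
      by (rule stalk.ideal_diff[OF FWZ in3(1) rest[OF FWZ in3(2,3)]])
    then have "b a * x \<in> gen ?A {F, w, z}" by (simp add: F3)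
    then have xF: "x \<in> gen ?A {F, w, z}" by (rule loc.unit_cancel[OF FWZ b a(2)])
    have MF: "max_ideal p = gen ?A {F, w, z}"
    proof
      show "max_ideal p \<subseteq> gen ?A {F, w, z}" unfolding Mgen using xF xiF in3 by (intro gen_least[OF FWZ]) auto
      have zM: "z \<in> max_ideal p" and xiM: "xc j p i \<in> max_ideal p" and xM: "x \<in> max_ideal p"
        using p by (simp_all add: z_def x_def xc_max_ideal)
      note Mi = max_ideal_ideal[of p]
      have "w \<in> max_ideal p" unfolding w_def
        by (intro idealD(3)[OF Mi xiM] idealD(4)[OF Mi _ zM]) auto
      moreover have "F \<in> max_ideal p" unfolding F3
        by (intro idealD(3)[OF Mi idealD(3)[OF Mi idealD(4)[OF Mi b xM] idealD(4)[OF Mi b xiM]] idealD(4)[OF Mi b zM]])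
      ultimately show "gen ?A {F, w, z} \<subseteq> max_ideal p" using zM by (intro gen_least[OF Mi]) auto
    qed
    have "w \<noteq> 0"
    proof
      define u where "u = nrm j p + axis i 1"
      have u: "u $ j = 1" using ik nrm_coords[OF p] by (simp add: u_def axis_def)
      assume "w = 0"
      then have "val (proj u) w = 0" by simp
      moreover have "val (proj u) w = 1"
        using vz(2)[OF chart_point(1)[OF u]] chart_point(2)[OF u] ik by (simp add: u_def axis_def)
      ultimately show False by simp
    qed
    then show ?thesis unfolding w_def[symmetric]
      using 1(1) 2(1) z_notin F_notin MF FA wA xz by unfold_locales
  qed
  then show ?thesis using that loc.local_domain_axioms by (intro that) (auto simp: regular_pencil_def regular_pencil_axioms_def)
qed

section \<open>The tangent direction of a smooth point\<close>

text \<open>Regular functions are continuous for the classical topology, which links the complex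
  derivative in the definition of smoothness to the Zariski setting. The direction \<open>m\<close>
  may be the index \<open>j\<close> of the chart, so the moving points have to be
  renormalized.\<close>

lemma val_tendsto:
  fixes v :: "complex^4"
  assumes v: "v $ j = 1" and w: "\<And>t. w t = v + axis m t" and k: "k \<in> \<O> (proj v)"
  shows "((\<lambda>t. val (proj (w t)) k) \<longlongrightarrow> val (proj v) k) (at 0)"
    and "\<forall>\<^sub>F t in at 0. k \<in> \<O> (proj (w t))"
proof -
  note p = chart_point[OF v]
  have wt: "((\<lambda>t. w t $ i) \<longlongrightarrow> v $ i) (at 0)" for i
  proof -
    have "w t $ i = v $ i + (if i = m then t else 0)" for t by (simp add: w axis_def)
    moreover have "((\<lambda>t. v $ i + (if i = m then t else 0)) \<longlongrightarrow> v $ i + (if i = m then 0 else 0)) (at 0)"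
      by (cases "i = m") (auto intro!: tendsto_eq_intros)
    ultimately show ?thesis by simp
  qed
  have ev: "\<forall>\<^sub>F t in at 0. w t $ j \<noteq> 0"
    using tendsto_imp_eventually_ne[OF wt[of j], of 0] v by simp
  have chart_ev: "\<forall>\<^sub>F t in at 0. proj (w t) \<in> chart j \<and> nrm j (proj (w t)) = (1 / w t $ j) *s w t"
    using ev by eventually_elim (use proj_in_chart in blast)
  have f: "((\<lambda>t. val (proj (w t)) f) \<longlongrightarrow> val (proj v) f) (at 0)" if "f \<in> chart_ring j" for f
    using that
  proof (induction rule: chart_ring_induct)
    case (Yc i)
    have "((\<lambda>t. w t $ i / w t $ j) \<longlongrightarrow> v $ i / v $ j) (at 0)" by (rule tendsto_divide[OF wt wt]) (simp add: v)
    moreover have "\<forall>\<^sub>F t in at 0. w t $ i / w t $ j = val (proj (w t)) (Yc j i)"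
      using chart_ev by eventually_elim (simp add: val_Yc)
    ultimately have "((\<lambda>t. val (proj (w t)) (Yc j i)) \<longlongrightarrow> v $ i / v $ j) (at 0)" by (rule Lim_transform_eventually)
    then show ?case using p v by (simp add: val_Yc)
  next
    case (add a b)
    have "((\<lambda>t. val (proj (w t)) a + val (proj (w t)) b) \<longlongrightarrow> val (proj v) a + val (proj v) b) (at 0)"
      by (rule tendsto_add[OF add(3,4)])
    moreover have "\<forall>\<^sub>F t in at 0. val (proj (w t)) a + val (proj (w t)) b = val (proj (w t)) (a + b)"
      using chart_ev by eventually_elim (use add chart_ring_stalk in auto)
    ultimately have "((\<lambda>t. val (proj (w t)) (a + b)) \<longlongrightarrow> val (proj v) a + val (proj v) b) (at 0)"
      by (rule Lim_transform_eventually)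
    then show ?case using add(1,2) p chart_ring_stalk by simp
  next
    case (mult a b)
    have "((\<lambda>t. val (proj (w t)) a * val (proj (w t)) b) \<longlongrightarrow> val (proj v) a * val (proj v) b) (at 0)"
      by (rule tendsto_mult[OF mult(3,4)])
    moreover have "\<forall>\<^sub>F t in at 0. val (proj (w t)) a * val (proj (w t)) b = val (proj (w t)) (a * b)"
      using chart_ev by eventually_elim (use mult chart_ring_stalk in auto)
    ultimately have "((\<lambda>t. val (proj (w t)) (a * b)) \<longlongrightarrow> val (proj v) a * val (proj v) b) (at 0)"
      by (rule Lim_transform_eventually)
    then show ?case using mult(1,2) p chart_ring_stalk by simp
  qed simp
  obtain g h where gh: "g \<in> chart_ring j" "h \<in> chart_ring j" "val (proj v) h \<noteq> 0" "h * k = g"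
    using stalk_fraction[OF k p(1)] by blast
  have "h \<noteq> 0" using gh by auto
  then have kgh: "k = inverse h * g" using inverse_mult_cancel gh(4) by blast
  have hev: "\<forall>\<^sub>F t in at 0. val (proj (w t)) h \<noteq> 0" by (rule tendsto_imp_eventually_ne[OF f[OF gh(2)] gh(3)])
  have good: "\<forall>\<^sub>F t in at 0. k \<in> \<O> (proj (w t)) \<and> val (proj (w t)) g / val (proj (w t)) h = val (proj (w t)) k"
    using chart_ev hev
  proof eventually_elim
    case (elim t)
    then have hg: "h \<in> \<O> (proj (w t))" "g \<in> \<O> (proj (w t))" using gh chart_ring_stalk by auto
    then have kt: "k \<in> \<O> (proj (w t))" unfolding kgh using elim stalk_ring_inverse by auto
    then have "val (proj (w t)) h * val (proj (w t)) k = val (proj (w t)) g" using hg gh(4) val_mult by metis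
    then show ?case using kt elim by (auto simp: field_simps)
  qed
  then show "\<forall>\<^sub>F t in at 0. k \<in> \<O> (proj (w t))" by eventually_elim simp
  have "((\<lambda>t. val (proj (w t)) g / val (proj (w t)) h) \<longlongrightarrow> val (proj v) g / val (proj v) h) (at 0)"
    by (rule tendsto_divide[OF f[OF gh(1)] f[OF gh(2)] gh(3)])
  moreover have "\<forall>\<^sub>F t in at 0. val (proj (w t)) g / val (proj (w t)) h = val (proj (w t)) k"
    using good by eventually_elim simp
  ultimately have "((\<lambda>t. val (proj (w t)) k) \<longlongrightarrow> val (proj v) g / val (proj v) h) (at 0)"
    by (rule Lim_transform_eventually)
  moreover have "val (proj v) h * val (proj v) k = val (proj v) g"
    using gh k chart_ring_stalk[OF gh(2) p(1)] val_mult by metis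
  then have "val (proj v) g / val (proj v) h = val (proj v) k" using gh(3) by (auto simp: field_simps)
  ultimately show "((\<lambda>t. val (proj (w t)) k) \<longlongrightarrow> val (proj v) k) (at 0)" by simp
qed

text \<open>If all coefficients \<open>b i\<close> vanished at \<open>p\<close>, then
  \<open>F\<close> along the line would be \<open>t\<close> times a function tending to 0, and its
  derivative at 0 would vanish.\<close>

lemma gradient_unit_coefficient:
  assumes F: "form d F" and p: "p \<in> chart j" and f: "f \<in> chart_ring j" "\<And>q. q \<in> chart j ==> val q f = F (nrm j q)"
    and b: "f = (\<Sum>i\<in>UNIV - {j}. b i * xc j p i)" "\<And>i. b i \<in> \<O> p"
    and grad: "deriv (\<lambda>t. F (nrm j p + axis m t)) 0 \<noteq> 0"
  obtains a where "a \<noteq> j" "b a \<notin> max_ideal p"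
proof (rule ccontr)
  assume "\<not> thesis"
  then have *: "\<not> (a \<noteq> j \<and> b a \<notin> max_ideal p)" for a using that by blast
  have bM: "b i \<in> max_ideal p" if "i \<noteq> j" for i using that *[of i] by blast
  define v where "v = nrm j p"
  have v: "v $ j = 1" and pv: "proj v = p" using nrm_coords[OF p] proj_nrm[OF p] by (auto simp: v_def)
  define w where "w t = v + axis m t" for t
  have bt: "((\<lambda>t. val (proj (w t)) (b i)) \<longlongrightarrow> 0) (at 0)" "\<forall>\<^sub>F t in at 0. b i \<in> \<O> (proj (w t))"
    if "i \<noteq> j" for i
    using val_tendsto[OF v w_def, of "b i"] b(2) bM[OF that] by (auto simp: pv max_ideal_def)
  have wj: "w t $ j = 1 + (if j = m then t else 0)" for t by (simp add: w_def axis_def v)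
  have wjt: "((\<lambda>t. w t $ j) \<longlongrightarrow> 1 + (if j = m then 0 else 0)) (at 0)"
    unfolding wj by (cases "j = m") (auto intro!: tendsto_eq_intros)
  then have wjt1: "((\<lambda>t. w t $ j) \<longlongrightarrow> 1) (at 0)" by simp
  have ev: "\<forall>\<^sub>F t in at 0. w t $ j \<noteq> 0" using tendsto_imp_eventually_ne[OF wjt1, of 0] by simp
  \<comment> \<open>The \<open>i\<close>-th affine coordinate changes by
    \<open>t * c i / w t $ j\<close> along the line. The second term of \<open>c i\<close> comes
    from the renormalization when \<open>m = j\<close>.\<close>
  define c where "c i = (if i = m then 1 else 0) - v $ i * (if j = m then 1 else 0)" for i
  define \<phi> where "\<phi> t = (w t $ j) ^ d * (\<Sum>i\<in>UNIV - {j}. val (proj (w t)) (b i) * (c i / w t $ j))" for t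
  have "(\<phi> \<longlongrightarrow> 1 ^ d * (\<Sum>i\<in>UNIV - {j}. 0 * (c i / 1))) (at 0)"
    unfolding \<phi>_def by (intro tendsto_intros wjt1 bt) auto
  then have \<phi>0: "(\<phi> \<longlongrightarrow> 0) (at 0)" by simp
  have all: "\<forall>\<^sub>F t in at 0. \<forall>i\<in>UNIV - {j}. b i \<in> \<O> (proj (w t))"
    using bt(2) by (subst eventually_ball_finite_distrib) auto
  have Fw: "\<forall>\<^sub>F t in at 0. F (w t) = t * \<phi> t"
    using ev all
  proof eventually_elim
    case (elim t)
    let ?q = "proj (w t)"
    note q = proj_in_chart[OF elim(1)]
    have "F (w t) = F ((w t $ j) *s nrm j ?q)" using q elim by (simp add: vector_smult_assoc)
    also have "\<dots> = (w t $ j) ^ d * val ?q f" by (simp only: form_scale[OF F] f(2)[OF q(1)])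
    also have "val ?q f = (\<Sum>i\<in>UNIV - {j}. val ?q (b i * xc j p i))"
      unfolding b(1) using elim q by (intro val_sum) auto
    also have "\<dots> = (\<Sum>i\<in>UNIV - {j}. val ?q (b i) * (t * (c i / w t $ j)))"
    proof (rule sum.cong[OF refl])
      fix i assume i: "i \<in> UNIV - {j}"
      have "nrm j ?q $ i - v $ i = (w t $ i - v $ i * w t $ j) / w t $ j"
        using q elim by (simp add: field_simps)
      also have "w t $ i - v $ i * w t $ j = t * c i" by (simp add: wj c_def) (simp add: w_def axis_def algebra_simps)
      finally have "nrm j ?q $ i - v $ i = t * (c i / w t $ j)" by simp
      then show "val ?q (b i * xc j p i) = val ?q (b i) * (t * (c i / w t $ j))"
        using elim i q by (simp add: val_xc v_def)
    qed
    finally show ?case by (simp add: \<phi>_def sum_distrib_left ac_simps)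
  qed
  have F0: "F v = 0"
  proof -
    have "val p f = (\<Sum>i\<in>UNIV - {j}. val p (b i * xc j p i))" unfolding b(1) using b(2) p by (intro val_sum) auto
    also have "\<dots> = 0" using b(2) p by (simp add: val_xc)
    finally show ?thesis using f(2)[OF p] by (simp add: v_def)
  qed
  have w0: "w 0 = v" by (simp add: w_def axis_def vec_eq_iff)
  have "((\<lambda>t. F (w t)) has_field_derivative 0) (at 0)"
    unfolding has_field_derivative_iff
  proof (rule Lim_transform_eventually[OF \<phi>0])
    have "\<forall>\<^sub>F t in at 0. t \<noteq> (0::complex)" by (simp add: eventually_at_filter)
    with Fw show "\<forall>\<^sub>F t in at 0. \<phi> t = (F (w t) - F (w 0)) / (t - 0)"
      by eventually_elim (use F0 in \<open>simp add: w0\<close>)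
  qed
  then have "deriv (\<lambda>t. F (w t)) 0 = 0" by (rule DERIV_imp_deriv)
  then show False using grad by (simp add: w_def v_def)
qed

theorem smooth_point_pencil:
  assumes F: "form d F" and smooth: "\<And>v. v \<noteq> 0 ==> F v = 0 ==> \<exists>i. deriv (\<lambda>t. F (v + axis i t)) 0 \<noteq> 0"
    and p: "p \<in> chart j" and f: "f \<in> chart_ring j" "\<And>q. q \<in> chart j ==> val q f = F (nrm j q)"
    and fM: "f \<in> max_ideal p"
  obtains y z where "regular_pencil (\<O> p) (max_ideal p) f y z"
proof -
  let ?A = "\<O> p"
  have "F (nrm j p) = 0" using f(2)[OF p] fM by (simp add: max_ideal_def)
  then obtain m where m: "deriv (\<lambda>t. F (nrm j p + axis m t)) 0 \<noteq> 0"
    using smooth coords_nonzero[OF nrm_coords(1)[OF p]] by blast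
  have "\<exists>b. (\<forall>i. b i \<in> ?A) \<and> k = (\<Sum>i\<in>UNIV - {j}. b i * xc j p i)" if "k \<in> gen ?A (xc j p ` (UNIV - {j}))" for k
    using that
  proof induction
    case zero
    show ?case by (intro exI[of _ "\<lambda>_. 0"]) auto
  next
    case (step r s a)
    then obtain b where b: "\<forall>i. b i \<in> ?A" "a = (\<Sum>i\<in>UNIV - {j}. b i * xc j p i)" by blast
    obtain l where l: "l \<noteq> j" "s = xc j p l" using step(2) by auto
    have "r * s + a = (\<Sum>i\<in>UNIV - {j}. (b i + (if i = l then r else 0)) * xc j p i)"
      using l by (simp add: b(2) distrib_right sum.distrib if_distrib[of "\<lambda>x. x * _"] cong: if_cong)
    then show ?case using b step(1) by (intro exI[of _ "\<lambda>i. b i + (if i = l then r else 0)"]) auto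
  qed
  then obtain b where b: "\<And>i. b i \<in> ?A" "f = (\<Sum>i\<in>UNIV - {j}. b i * xc j p i)"
    using fM max_ideal_gen[OF p] by blast
  obtain a where a: "a \<noteq> j" "b a \<notin> max_ideal p"
    using gradient_unit_coefficient[OF F p f b(2,1) m] by blast
  show ?thesis using pencil_from_linear_part[OF p b(2,1) a] that by blast
qed

section \<open>Zeros of ideals and closed sets\<close>

text \<open>The prime ideal found by the abstract version contains each coordinate minus a constant.
  These constants are the coordinates of a point where all of \<open>I\<close> vanishes and
  \<open>e\<close> does not.\<close>

theorem chart_nullstellensatz:
  assumes I: "ideal_in (chart_ring j) I" and e: "e \<in> chart_ring j"
    and zeros: "\<And>q. q \<in> chart j ==> val q e \<noteq> 0 ==> \<exists>b\<in>I. val q b \<noteq> 0"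
  obtains k where "e ^ k \<in> I"
proof (rule ccontr)
  assume "\<not> thesis"
  then have "\<And>k. e ^ k \<notin> I" using that by blast
  then obtain Q where Q: "prime_ideal (chart_ring j) Q" "I \<subseteq> Q" "e \<notin> Q"
    "\<And>y. y \<in> range (Yc j) ==> \<exists>c. y - cst c \<in> Q"
    using cst.nullstellensatz[of "range (Yc j)" I e] I e unfolding chart_ring_def by (metis finite finite_imageI)
  have Qid: "ideal_in (chart_ring j) Q" using Q(1) by (simp add: prime_ideal_def)
  have no_cst: "c = 0" if "cst c \<in> Q" for c
  proof (rule ccontr)
    assume "c \<noteq> 0"
    have "cst (1 / c) * cst c \<in> Q" by (rule idealD(4)[OF Qid _ that]) simp
    then have "1 \<in> Q" using \<open>c \<noteq> 0\<close> by (simp add: cst.cst_mult[symmetric])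
    then show False using Q(1) by (simp add: prime_ideal_def)
  qed
  have "\<exists>c. Yc j i - cst c \<in> Q" for i using Q(4)[of "Yc j i"] by blast
  then obtain c where c: "\<And>i. Yc j i - cst (c i) \<in> Q" by metis
  define v where "v = (\<chi> i. c i)"
  \<comment> \<open>The \<open>j\<close>-th coordinate function is the constant 1, so the constants
    describe a point of the chart.\<close>
  have "cst (1 - c j) \<in> Q" using c[of j] by (simp add: Yc_self cst.cst_diff)
  then have "v $ j = 1" using no_cst[of "1 - c j"] by (simp add: v_def)
  define q where "q = proj v"
  have q: "q \<in> chart j" "nrm j q = v" using chart_point[OF \<open>v $ j = 1\<close>] by (auto simp: q_def)
  have f: "f - cst (val q f) \<in> Q" if "f \<in> chart_ring j" for f
    using that
  proof (induction rule: chart_ring_induct)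
    case (cst c)
    then show ?case using idealD(2)[OF Qid] by simp
  next
    case (Yc i)
    then show ?case using c[of i] q by (simp add: val_Yc v_def)
  next
    case (add a b)
    have "(a - cst (val q a)) + (b - cst (val q b)) \<in> Q" by (rule idealD(3)[OF Qid add(3,4)])
    moreover have "(a - cst (val q a)) + (b - cst (val q b)) = a + b - cst (val q (a + b))"
      using add chart_ring_stalk q by (simp add: cst.cst_add)
    ultimately show ?case by simp
  next
    case (mult a b)
    have "b * (a - cst (val q a)) + cst (val q a) * (b - cst (val q b)) \<in> Q"
      using mult by (intro idealD(3)[OF Qid idealD(4)[OF Qid _ mult(3)] idealD(4)[OF Qid _ mult(4)]]) auto
    moreover have "b * (a - cst (val q a)) + cst (val q a) * (b - cst (val q b)) = a * b - cst (val q (a * b))"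
      using mult(1,2) chart_ring_stalk q(1) by (simp add: cst.cst_mult algebra_simps)
    ultimately show ?case by simp
  qed
  have "val q e \<noteq> 0"
  proof
    assume "val q e = 0"
    then show False using f[OF e] Q(3) by simp
  qed
  then obtain b where b: "b \<in> I" "val q b \<noteq> 0" using zeros[OF q(1)] by blast
  have bQ: "b \<in> Q" and bc: "b \<in> chart_ring j" using b Q(2) idealD(1)[OF I] by auto
  have "b - (b - cst (val q b)) \<in> Q" by (rule chart.ideal_diff[OF Qid bQ f[OF bc]])
  then show False using no_cst b(2) by simp
qed

section \<open>Irreducible closed sets\<close>

lemma closedin_zariski_point: "closedin zariski {p}"
proof -
  have "zopen (- {p})"
  proof (rule openin_zariski_subopen)
    fix q assume q: "q \<in> - {p}"
    obtain j where qj: "q \<in> chart j" by (rule chart_cover)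
    show "\<exists>V. zopen V \<and> q \<in> V \<and> V \<subseteq> - {p}"
    proof (cases "p \<in> chart j")
      case True
      then have "nrm j q \<noteq> nrm j p" using nrm_inj[OF qj True] q by auto
      then obtain i where "nrm j q $ i \<noteq> nrm j p $ i" by (metis vec_eq_iff)
      then have "val q (xc j p i) \<noteq> 0" "val p (xc j p i) = 0" using qj True by (auto simp: val_xc)
      then show ?thesis using qj
        by (intro exI[of _ "{q. xc j p i \<in> \<O> q \<and> val q (xc j p i) \<noteq> 0}"]) (auto intro: openin_val_nonzero)
    next
      case False
      then show ?thesis using qj openin_chart[of j] by (intro exI[of _ "chart j"]) auto
    qed
  qed
  then show ?thesis unfolding closedin_def by (simp add: Compl_eq_Diff_UNIV[symmetric])
qed

lemma irreducible_point: "irreducible_closed zariski {p}"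
  unfolding irreducible_closed_def using closedin_zariski_point by auto

lemma closedin_zariski_Compl: "closedin zariski Z \<longleftrightarrow> zopen (- Z)"
  unfolding closedin_def by (simp add: Compl_eq_Diff_UNIV)

text \<open>Some chart contains infinitely many points of \<open>S\<close>. Among the closed subsets
  of \<open>S\<close> with this property one is minimal on the chart, because its vanishing ideal
  can be taken maximal. Of two closed sets covering it one keeps infinitely many points, hence by
  minimality the whole part in the chart.\<close>

lemma infinite_closed_irreducible:
  assumes S: "closedin zariski S" "infinite S"
  obtains Z where "irreducible_closed zariski Z" "Z \<subseteq> S" "infinite Z"
proof -
  have "S = (\<Union>j. S \<inter> chart j)" using chart_cover by blast
  then obtain j where j: "infinite (S \<inter> chart j)" using S(2) by (metis finite_UN finite)
  define I where "I Z = {f \<in> chart_ring j. \<forall>q\<in>Z \<inter> chart j. val q f = 0}" for Z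
  define \<Z> where "\<Z> = {Z. closedin zariski Z \<and> Z \<subseteq> S \<and> infinite (Z \<inter> chart j)}"
  have Iid: "ideal_in (chart_ring j) (I Z)" for Z
    using chart_ring_stalk by (auto simp: ideal_in_def I_def)
  have Iinj: "Z \<inter> chart j \<subseteq> Y" if YZ: "closedin zariski Y" "I Y \<subseteq> I Z" for Y Z
  proof
    fix q assume q: "q \<in> Z \<inter> chart j"
    show "q \<in> Y"
    proof (rule ccontr)
      assume "q \<notin> Y"
      then obtain f where f: "f \<in> chart_ring j" "val q f \<noteq> 0" "\<And>q. q \<in> chart j ==> val q f \<noteq> 0 ==> q \<in> - Y"
        using chart_basic_neighbourhood[of "- Y" q j] YZ(1) q by (auto simp: closedin_zariski_Compl)
      then have "f \<in> I Y" by (auto simp: I_def)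
      then show False using YZ(2) f(2) q by (auto simp: I_def)
    qed
  qed
  have ne: "I ` \<Z> \<noteq> {}" using S(1) j by (auto simp: \<Z>_def)
  obtain M where M: "M \<in> I ` \<Z>" "\<And>J. J \<in> I ` \<Z> ==> M \<subseteq> J ==> J = M"
    using chart.maximal_ideal_exists[OF noeth_chart_ring ne] Iid by blast
  then obtain Z where Z: "Z \<in> \<Z>" "M = I Z" by auto
  have min: "Z \<inter> chart j \<subseteq> Y" if "closedin zariski Y" "Y \<subseteq> Z" "infinite (Y \<inter> chart j)" for Y
  proof -
    have "Y \<in> \<Z>" using that Z by (auto simp: \<Z>_def)
    moreover have "I Z \<subseteq> I Y" using that by (auto simp: I_def)
    ultimately have "I Y = I Z" using M(2) Z(2) by blast
    then show ?thesis using Iinj[OF that(1)] by blast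
  qed
  \<comment> \<open>Minimality controls only the part of \<open>Z\<close> inside the chart, so the
    closure of that part is taken.\<close>
  define W where "W = zariski closure_of (Z \<inter> chart j)"
  have Zc: "closedin zariski Z" "Z \<subseteq> S" "infinite (Z \<inter> chart j)" using Z by (auto simp: \<Z>_def)
  have W: "closedin zariski W" "W \<subseteq> Z" "Z \<inter> chart j \<subseteq> W"
    unfolding W_def using closure_of_minimal[OF _ Zc(1), of "Z \<inter> chart j"]
      closure_of_subset[of "Z \<inter> chart j" zariski] by auto
  have "irreducible_closed zariski W"
    unfolding irreducible_closed_def
  proof (intro conjI allI impI)
    show "closedin zariski W" by (rule W)
    have "Z \<inter> chart j \<noteq> {}" using Zc(3) by auto
    then show "W \<noteq> {}" using W(3) by auto
    fix A B assume AB: "closedin zariski A \<and> closedin zariski B \<and> W \<subseteq> A \<union> B"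
    have half: "W \<subseteq> Y" if "closedin zariski Y" "infinite (Z \<inter> Y \<inter> chart j)" for Y
    proof -
      have "Z \<inter> chart j \<subseteq> Z \<inter> Y" using that Zc by (intro min) auto
      then show ?thesis unfolding W_def using that(1) by (intro closure_of_minimal) auto
    qed
    have "Z \<inter> chart j \<subseteq> (Z \<inter> A \<inter> chart j) \<union> (Z \<inter> B \<inter> chart j)" using AB W(3) by auto
    then have "infinite (Z \<inter> A \<inter> chart j) \<or> infinite (Z \<inter> B \<inter> chart j)"
      using Zc(3) by (meson finite_Un finite_subset)
    then show "W \<subseteq> A \<or> W \<subseteq> B" using half AB by blast
  qed
  moreover have "infinite W" using W(3) Zc(3) finite_subset by blast
  ultimately show ?thesis using that W Zc by blast
qed

section \<open>Prime ideals of irreducible closed sets at a point\<close>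

definition vanishing_ideal :: "p3 \<Rightarrow> p3 set \<Rightarrow> ratfun set" where
  "vanishing_ideal p Z = {k \<in> \<O> p. \<exists>U. zopen U \<and> p \<in> U \<and> (\<forall>q\<in>U. k \<in> \<O> q) \<and> (\<forall>q\<in>U \<inter> Z. val q k = 0)}"

lemma vanishing_idealE:
  assumes "k \<in> vanishing_ideal p Z"
  obtains U where "zopen U" "p \<in> U" "\<And>q. q \<in> U ==> k \<in> \<O> q" "\<And>q. q \<in> U ==> q \<in> Z ==> val q k = 0"
  using assms by (auto simp: vanishing_ideal_def)

lemma vanishing_idealI:
  assumes "zopen U" "p \<in> U" "\<And>q. q \<in> U ==> k \<in> \<O> q" "\<And>q. q \<in> U ==> q \<in> Z ==> val q k = 0"
  shows "k \<in> vanishing_ideal p Z"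
  using assms by (auto simp: vanishing_ideal_def)

lemma vanishing_ideal_ideal: "ideal_in (\<O> p) (vanishing_ideal p Z)"
  unfolding ideal_in_def
proof (intro conjI ballI)
  show "vanishing_ideal p Z \<subseteq> \<O> p" by (auto simp: vanishing_ideal_def)
  show "0 \<in> vanishing_ideal p Z" by (rule vanishing_idealI[of UNIV]) auto
  fix a assume "a \<in> vanishing_ideal p Z"
  then obtain U where U: "zopen U" "p \<in> U" "\<And>q. q \<in> U ==> a \<in> \<O> q" "\<And>q. q \<in> U ==> q \<in> Z ==> val q a = 0"
    by (rule vanishing_idealE) blast
  show "a + b \<in> vanishing_ideal p Z" if b: "b \<in> vanishing_ideal p Z" for b
  proof -
    obtain V where V: "zopen V" "p \<in> V" "\<And>q. q \<in> V ==> b \<in> \<O> q" "\<And>q. q \<in> V ==> q \<in> Z ==> val q b = 0"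
      using b by (rule vanishing_idealE) blast
    show ?thesis by (rule vanishing_idealI[of "U \<inter> V"]) (use U V in auto)
  qed
  show "r * a \<in> vanishing_ideal p Z" if r: "r \<in> \<O> p" for r
  proof -
    obtain V where V: "zopen V" "p \<in> V" "\<And>q. q \<in> V ==> r \<in> \<O> q"
      using r by (rule stalk_ring_open) blast
    show ?thesis by (rule vanishing_idealI[of "U \<inter> V"]) (use U V in auto)
  qed
qed

lemma vanishing_ideal_prime:
  assumes Z: "irreducible_closed zariski Z" and p: "p \<in> Z"
  shows "prime_ideal (\<O> p) (vanishing_ideal p Z)"
  unfolding prime_ideal_def
proof (intro conjI ballI impI vanishing_ideal_ideal)
  show "1 \<notin> vanishing_ideal p Z" using p by (auto simp: vanishing_ideal_def)
  fix a b assume ab: "a \<in> \<O> p" "b \<in> \<O> p" "a * b \<in> vanishing_ideal p Z"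
  obtain U where U: "zopen U" "p \<in> U" "\<And>q. q \<in> U ==> a * b \<in> \<O> q"
      "\<And>q. q \<in> U ==> q \<in> Z ==> val q (a * b) = 0"
    using ab(3) by (rule vanishing_idealE) blast
  obtain V where V: "zopen V" "p \<in> V" "\<And>q. q \<in> V ==> a \<in> \<O> q"
    using ab(1) by (rule stalk_ring_open) blast
  obtain W where W: "zopen W" "p \<in> W" "\<And>q. q \<in> W ==> b \<in> \<O> q"
    using ab(2) by (rule stalk_ring_open) blast
  define N where "N = U \<inter> V \<inter> W"
  have N: "zopen N" "p \<in> N" using U V W by (auto simp: N_def)
  \<comment> \<open>Adding the complement of the neighbourhood to the zero set of \<open>k\<close>
    makes it closed in the whole space; \<open>p\<close> lies in \<open>Z\<close> but not in that
    complement.\<close>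
  define A where "A k = - (N \<inter> {q. k \<in> \<O> q \<and> val q k \<noteq> 0})" for k
  have A: "closedin zariski (A k)" for k
    unfolding A_def closedin_zariski_Compl using N(1) openin_val_nonzero[of k] by auto
  have "Z \<subseteq> A a \<union> A b"
    using U(4) V(3) W(3) by (fastforce simp: A_def N_def)
  then have "Z \<subseteq> A a \<or> Z \<subseteq> A b" using Z A unfolding irreducible_closed_def by blast
  then show "a \<in> vanishing_ideal p Z \<or> b \<in> vanishing_ideal p Z"
  proof
    assume "Z \<subseteq> A a"
    then have "a \<in> vanishing_ideal p Z" by (intro vanishing_idealI[OF N]) (auto simp: A_def N_def V(3))
    then show ?thesis ..
  next
    assume "Z \<subseteq> A b"
    then have "b \<in> vanishing_ideal p Z" by (intro vanishing_idealI[OF N]) (auto simp: A_def N_def W(3))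
    then show ?thesis ..
  qed
qed

text \<open>A form that vanishes on \<open>Z\<close> but not at some point of \<open>Y\<close>
  separates the two ideals. Vanishing on \<open>Y\<close> near \<open>p\<close> would spread to all
  of \<open>Y\<close>, because \<open>Y\<close> is irreducible.\<close>

lemma vanishing_ideal_strict:
  assumes Y: "irreducible_closed zariski Y" and Z: "closedin zariski Z" "Z \<subset> Y" and p: "p \<in> Z"
  shows "vanishing_ideal p Y \<subset> vanishing_ideal p Z"
proof
  show "vanishing_ideal p Y \<subseteq> vanishing_ideal p Z" using Z(2) by (auto simp: vanishing_ideal_def)
  show "vanishing_ideal p Y \<noteq> vanishing_ideal p Z"
  proof
    assume eq: "vanishing_ideal p Y = vanishing_ideal p Z"
    obtain q where q: "q \<in> Y" "q \<notin> Z" using Z(2) by auto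
    obtain d F where F: "form d F" "q \<in> basic F" "basic F \<subseteq> - Z"
      using basic_neighbourhood[of "- Z" q] Z(1) q(2) by (auto simp: closedin_zariski_Compl)
    obtain j where j: "p \<in> chart j" by (rule chart_cover)
    obtain f where f: "f \<in> chart_ring j" "\<And>q. q \<in> chart j ==> val q f = F (nrm j q)"
      using form_dehomogenize[OF F(1)] by blast
    have bF: "r \<in> basic F \<longleftrightarrow> val r f \<noteq> 0" if "r \<in> chart j" for r
      using in_basic_iff[OF F(1) nrm_coords(1)[OF that]] f(2)[OF that] by simp
    have "f \<in> vanishing_ideal p Z"
    proof (rule vanishing_idealI[OF openin_chart j])
      show "f \<in> \<O> q" if "q \<in> chart j" for q using f(1) that by (rule chart_ring_stalk)
      show "val q f = 0" if "q \<in> chart j" "q \<in> Z" for q using bF[OF that(1)] that(2) F(3) by blast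
    qed
    then have "f \<in> vanishing_ideal p Y" using eq by simp
    then obtain U where U: "zopen U" "p \<in> U" "\<And>q. q \<in> U ==> q \<in> Y ==> val q f = 0"
      by (rule vanishing_idealE) blast
    have "Y \<subseteq> - (U \<inter> chart j) \<union> - basic F" using U(3) bF by auto
    moreover have "closedin zariski (- (U \<inter> chart j))" "closedin zariski (- basic F)"
      unfolding closedin_zariski_Compl using U(1) openin_chart[of j] openin_basic[OF F(1)] by auto
    ultimately have "Y \<subseteq> - (U \<inter> chart j) \<or> Y \<subseteq> - basic F" using Y unfolding irreducible_closed_def by blast
    then show False using q F U(2) j p Z(2) by auto
  qed
qed

section \<open>Stalks of ideal sheaves\<close>

lemma section_of_eq:
  assumes "zopen U" "f \<in> Sec OP V" "U \<subseteq> V" "U \<noteq> {}"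
  shows "section_of U (germ f) = Res OP U f"
proof
  show "section_of U (germ f) q = Res OP U f q" for q
    using Sec_OP_val[OF assms(2), of q] assms(3) by (auto simp: section_of_def OP_ops)
qed

text \<open>Since projective space is irreducible, restriction to a smaller nonempty open set does
  not change the germ in the function field, so the stalk is an honest subset of that field.\<close>

definition stalk :: "ideal \<Rightarrow> p3 \<Rightarrow> ratfun set" where
  "stalk I p = {germ f | U f. zopen U \<and> p \<in> U \<and> f \<in> Sec OP U \<and> f \<in> I U}"

lemma stalk_atI: "zopen U ==> p \<in> U ==> f \<in> Sec OP U ==> f \<in> I U ==> germ f \<in> stalk I p"
  by (auto simp: stalk_def)

lemma stalk_atE:
  assumes "k \<in> stalk I p"
  obtains U f where "zopen U" "p \<in> U" "f \<in> Sec OP U" "f \<in> I U" "k = germ f"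
  using assms by (auto simp: stalk_def)

lemma stalk_at_subset: "stalk I p \<subseteq> \<O> p"
  by (auto simp: stalk_def Sec_OP_germ)

definition sheaf_of :: "(p3 \<Rightarrow> ratfun set) \<Rightarrow> ideal" where
  "sheaf_of J U = {f \<in> Sec OP U. \<forall>q\<in>U. germ f \<in> J q}"

text \<open>A closed subscheme without the condition of finite type. Sums and products are first
  recognized as ideal sheaves, and their finite generation is a separate question.\<close>

locale ideal_sheaf =
  fixes I :: ideal
  assumes sub: "I U \<subseteq> Sec OP U"
    and zero: "zopen U ==> (\<lambda>_. 0) \<in> I U"
    and add: "zopen U ==> f \<in> I U ==> g \<in> I U ==> Add OP U f g \<in> I U"
    and smul: "zopen U ==> a \<in> Sec OP U ==> f \<in> I U ==> Smul OP U a f \<in> I U"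
    and res: "zopen U ==> f \<in> I U ==> zopen V ==> V \<subseteq> U ==> Res OP V f \<in> I V"
    and glue: "localize OP I U \<subseteq> I U"
begin

lemma Sec: "f \<in> I U ==> f \<in> Sec OP U"
  using sub by blast

lemma germ_stalk: "f \<in> I U ==> p \<in> U ==> germ f \<in> stalk I p"
  using stalk_atI[of U p f I] Sec Sec_OP_open by blast

text \<open>The gluing condition \<open>glue\<close> makes membership in an ideal sheaf local, and
  germs that agree in the function field agree as sections. All later computations with ideal
  sheaves become computations in local rings.\<close>

lemma mem_iff: "f \<in> I U \<longleftrightarrow> f \<in> Sec OP U \<and> (\<forall>q\<in>U. germ f \<in> stalk I q)"
proof (intro iffI conjI ballI; (elim conjE)?)
  show "f \<in> Sec OP U" if "f \<in> I U" using that by (rule Sec)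
  show "germ f \<in> stalk I q" if "f \<in> I U" "q \<in> U" for q using that by (rule germ_stalk)
  assume f: "f \<in> Sec OP U" "\<forall>q\<in>U. germ f \<in> stalk I q"
  have "\<exists>V. zopen V \<and> p \<in> V \<and> V \<subseteq> U \<and> Res OP V f \<in> I V" if p: "p \<in> U" for p
  proof -
    have "germ f \<in> stalk I p" using f(2) p by blast
    then obtain W g where g: "zopen W" "p \<in> W" "g \<in> Sec OP W" "g \<in> I W" "germ f = germ g"
      by (rule stalk_atE)
    have V: "zopen (U \<inter> W)" "U \<inter> W \<noteq> {}" using Sec_OP_open[OF f(1)] g(1,2) p by auto
    have "Res OP (U \<inter> W) f = Res OP (U \<inter> W) g"
      using Res_OP[OF f(1) V(1)] Res_OP[OF g(3) V(1)] V(2) g(5) by (intro Sec_OP_eqI[of _ "U \<inter> W"]) auto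
    moreover have "Res OP (U \<inter> W) g \<in> I (U \<inter> W)" by (rule res[OF g(1,4) V(1)]) simp
    ultimately show ?thesis using V p g(2) by (intro exI[of _ "U \<inter> W"]) auto
  qed
  then have "f \<in> localize OP I U" using f(1) by (simp add: localize_def)
  then show "f \<in> I U" using glue by blast
qed

lemma section_mem:
  assumes "zopen U" "\<And>q. q \<in> U ==> k \<in> stalk I q"
  shows "section_of U k \<in> I U"
proof (cases "U = {}")
  case True
  then have "section_of U k = (\<lambda>_. 0)" by (auto simp: section_of_def)
  then show ?thesis using zero[OF assms(1)] by simp
next
  case False
  have k: "\<And>q. q \<in> U ==> k \<in> \<O> q" using assms(2) stalk_at_subset by blast
  show ?thesis using section_of[OF assms(1) k] False assms(2) by (simp add: mem_iff)
qed

lemma stalk_open: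
  assumes "k \<in> stalk I p"
  obtains U where "zopen U" "p \<in> U" "\<And>q. q \<in> U ==> k \<in> stalk I q"
proof -
  obtain U f where f: "zopen U" "p \<in> U" "f \<in> Sec OP U" "f \<in> I U" "k = germ f"
    using assms by (rule stalk_atE)
  show ?thesis by (rule that[OF f(1,2)]) (use germ_stalk[OF f(4)] f(5) in auto)
qed

lemma stalk_ideal: "ideal_in (\<O> p) (stalk I p)"
  unfolding ideal_in_def
proof (intro conjI ballI)
  show "stalk I p \<subseteq> \<O> p" by (rule stalk_at_subset)
  have "germ (\<lambda>_. 0) \<in> stalk I p" using germ_stalk[OF zero[OF openin_zariski_UNIV]] by simp
  then show "0 \<in> stalk I p" using cst.cst_0 by (simp add: cst_def)
  fix a assume "a \<in> stalk I p"
  then obtain U f where f: "zopen U" "p \<in> U" "f \<in> Sec OP U" "f \<in> I U" "a = germ f"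
    by (rule stalk_atE)
  show "a + b \<in> stalk I p" if b: "b \<in> stalk I p" for b
  proof -
    obtain V g where g: "zopen V" "p \<in> V" "g \<in> Sec OP V" "g \<in> I V" "b = germ g"
      using b by (rule stalk_atE)
    let ?W = "U \<inter> V"
    have W: "zopen ?W" "p \<in> ?W" using f g by auto
    then have W': "?W \<noteq> {}" by blast
    have fg: "Res OP ?W f \<in> I ?W" "Res OP ?W g \<in> I ?W" using res f g W by auto
    have "germ (Add OP ?W (Res OP ?W f) (Res OP ?W g)) = a + b"
      using Add_OP(2)[OF Sec[OF fg(1)] Sec[OF fg(2)] W'] Res_OP(2)[OF f(3) W(1) _ W'] Res_OP(2)[OF g(3) W(1) _ W'] f(5) g(5)
      by simp
    then show ?thesis using germ_stalk[OF add[OF W(1) fg] W(2)] by simp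
  qed
  show "r * a \<in> stalk I p" if r: "r \<in> \<O> p" for r
  proof -
    obtain V where V: "zopen V" "p \<in> V" "\<And>q. q \<in> V ==> r \<in> \<O> q"
      using r by (rule stalk_ring_open) blast
    let ?W = "U \<inter> V"
    have W: "zopen ?W" "p \<in> ?W" using f V by auto
    then have W': "?W \<noteq> {}" by blast
    have r: "section_of ?W r \<in> Sec OP ?W" "germ (section_of ?W r) = r" using section_of[OF W(1)] V W' by auto
    have fW: "Res OP ?W f \<in> I ?W" using res f W by auto
    have "germ (Smul OP ?W (section_of ?W r) (Res OP ?W f)) = r * a"
      using Smul_OP(2)[OF r(1) Sec[OF fW] W'] Res_OP(2)[OF f(3) W(1) _ W'] f(5) r(2) by simp
    then show ?thesis using germ_stalk[OF smul[OF W(1) r(1) fW] W(2)] by simp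
  qed
qed

end

lemma ideal_sheaf_le_iff:
  assumes "ideal_sheaf I" "ideal_sheaf J"
  shows "I \<le> J \<longleftrightarrow> (\<forall>p. stalk I p \<subseteq> stalk J p)"
proof
  assume "I \<le> J"
  then show "\<forall>p. stalk I p \<subseteq> stalk J p" by (fastforce simp: stalk_def le_fun_def)
next
  assume "\<forall>p. stalk I p \<subseteq> stalk J p"
  then show "I \<le> J"
    using ideal_sheaf.mem_iff[OF assms(1)] ideal_sheaf.mem_iff[OF assms(2)] by (auto simp: le_fun_def subset_iff)
qed

lemma ideal_sheaf_eqI:
  assumes "ideal_sheaf I" "ideal_sheaf J" "\<And>p. stalk I p = stalk J p"
  shows "I = J"
proof (rule antisym)
  show "I \<le> J" using ideal_sheaf_le_iff[OF assms(1,2)] assms(3) by simp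
  show "J \<le> I" using ideal_sheaf_le_iff[OF assms(2,1)] assms(3) by simp
qed

text \<open>The second hypothesis is what makes a family of ideals come from a sheaf: an element of
  \<open>J p\<close> must spread to a section near \<open>p\<close>.\<close>

lemma sheaf_of_ideal_sheaf:
  assumes id: "\<And>p. ideal_in (\<O> p) (J p)"
    and op: "\<And>p k. k \<in> J p ==> \<exists>U. zopen U \<and> p \<in> U \<and> (\<forall>q\<in>U. k \<in> J q)"
  shows "ideal_sheaf (sheaf_of J)" "stalk (sheaf_of J) p = J p"
proof -
  show "ideal_sheaf (sheaf_of J)"
  proof
    fix U
    show "sheaf_of J U \<subseteq> Sec OP U" by (auto simp: sheaf_of_def)
    have g0: "germ (\<lambda>_. 0) = 0" using cst.cst_0 by (simp add: cst_def)
    have res: "Res OP V f \<in> sheaf_of J V" if "f \<in> sheaf_of J U" "zopen V" "V \<subseteq> U" for V f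
    proof -
      have f: "f \<in> Sec OP U" "\<And>q. q \<in> U ==> germ f \<in> J q" using that(1) by (auto simp: sheaf_of_def)
      show ?thesis unfolding sheaf_of_def
      proof (intro CollectI conjI ballI)
        show "Res OP V f \<in> Sec OP V" by (rule Res_OP(1)[OF f(1) that(2,3)])
        fix q assume "q \<in> V"
        then have "V \<noteq> {}" "q \<in> U" using that(3) by auto
        then show "germ (Res OP V f) \<in> J q" using Res_OP(2)[OF f(1) that(2,3)] f(2) by simp
      qed
    qed
    show "localize OP (sheaf_of J) U \<subseteq> sheaf_of J U"
    proof
      fix f assume "f \<in> localize OP (sheaf_of J) U"
      then have f: "f \<in> Sec OP U" "\<And>p. p \<in> U ==> \<exists>V. zopen V \<and> p \<in> V \<and> V \<subseteq> U \<and> Res OP V f \<in> sheaf_of J V"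
        by (auto simp: localize_def)
      show "f \<in> sheaf_of J U" unfolding sheaf_of_def
      proof (intro CollectI conjI ballI f(1))
        fix q assume "q \<in> U"
        then obtain V where V: "zopen V" "q \<in> V" "V \<subseteq> U" "Res OP V f \<in> sheaf_of J V" using f(2) by blast
        then have "V \<noteq> {}" by auto
        then have "germ (Res OP V f) = germ f" using Res_OP(2)[OF f(1) V(1,3)] by simp
        then show "germ f \<in> J q" using V(2,4) by (auto simp: sheaf_of_def)
      qed
    qed
    assume U: "zopen U"
    show "(\<lambda>_. 0) \<in> sheaf_of J U"
      using regular_on_const[OF U, of 0] idealD(2)[OF id] by (simp add: sheaf_of_def Sec_OP g0)
    show "Res OP V f \<in> sheaf_of J V" if "f \<in> sheaf_of J U" "zopen V" "V \<subseteq> U" for V f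
      using res[OF that] .
    fix f assume "f \<in> sheaf_of J U"
    then have f: "f \<in> Sec OP U" "\<And>q. q \<in> U ==> germ f \<in> J q" by (auto simp: sheaf_of_def)
    show "Add OP U f g \<in> sheaf_of J U" if "g \<in> sheaf_of J U" for g
    proof -
      have g: "g \<in> Sec OP U" "\<And>q. q \<in> U ==> germ g \<in> J q" using that by (auto simp: sheaf_of_def)
      have "germ (Add OP U f g) \<in> J q" if q: "q \<in> U" for q
      proof -
        have "U \<noteq> {}" using q by auto
        then show ?thesis using Add_OP(2)[OF f(1) g(1)] idealD(3)[OF id f(2)[OF q] g(2)[OF q]] by simp
      qed
      then show ?thesis using Add_OP(1)[OF f(1) g(1)] by (simp add: sheaf_of_def)
    qed
    show "Smul OP U a f \<in> sheaf_of J U" if "a \<in> Sec OP U" for a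
    proof -
      have "germ (Smul OP U a f) \<in> J q" if q: "q \<in> U" for q
      proof -
        have "U \<noteq> {}" using q by auto
        then show ?thesis
          using Smul_OP(2)[OF \<open>a \<in> Sec OP U\<close> f(1)] idealD(4)[OF id Sec_OP_germ[OF \<open>a \<in> Sec OP U\<close> q] f(2)[OF q]] by simp
      qed
      then show ?thesis using Smul_OP(1)[OF that f(1)] by (simp add: sheaf_of_def)
    qed
  qed
  show "stalk (sheaf_of J) p = J p"
  proof
    show "stalk (sheaf_of J) p \<subseteq> J p" by (auto simp: stalk_def sheaf_of_def)
    show "J p \<subseteq> stalk (sheaf_of J) p"
    proof
      fix k assume k: "k \<in> J p"
      obtain U where U: "zopen U" "p \<in> U" "\<And>q. q \<in> U ==> k \<in> J q" using op[OF k] by blast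
      have kq: "\<And>q. q \<in> U ==> k \<in> \<O> q" using U(3) idealD(1)[OF id] by blast
      have s: "section_of U k \<in> Sec OP U" "germ (section_of U k) = k"
        using section_of[OF U(1) kq] U(2) by auto
      have "section_of U k \<in> sheaf_of J U" using s U(3) by (simp add: sheaf_of_def)
      then have "germ (section_of U k) \<in> stalk (sheaf_of J) p" by (rule stalk_atI[OF U(1,2) s(1)])
      then show "k \<in> stalk (sheaf_of J) p" using s(2) by simp
    qed
  qed
qed

text \<open>Sheafification changes no stalk, so it can be computed from the stalks of the presheaf
  \<open>N\<close>.\<close>

lemma localize_eq_sheaf_of:
  assumes res: "\<And>W V f. zopen W ==> f \<in> N W ==> f \<in> Sec OP W ==> zopen V ==> V \<subseteq> W ==> Res OP V f \<in> N V"
  shows "localize OP N = sheaf_of (stalk N)"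
proof (intro ext set_eqI iffI)
  fix U f assume "f \<in> localize OP N U"
  then have f: "f \<in> Sec OP U" "\<And>p. p \<in> U ==> \<exists>V. zopen V \<and> p \<in> V \<and> V \<subseteq> U \<and> Res OP V f \<in> N V"
    by (auto simp: localize_def)
  show "f \<in> sheaf_of (stalk N) U" unfolding sheaf_of_def
  proof (intro CollectI conjI ballI f(1))
    fix q assume "q \<in> U"
    then obtain V where V: "zopen V" "q \<in> V" "V \<subseteq> U" "Res OP V f \<in> N V" using f(2) by blast
    then have "V \<noteq> {}" by auto
    then have "germ (Res OP V f) = germ f" using Res_OP(2)[OF f(1) V(1,3)] by simp
    then show "germ f \<in> stalk N q" using stalk_atI[of V q "Res OP V f" N] V(1,2,4) Res_OP(1)[OF f(1) V(1,3)] by simp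
  qed
next
  fix U f assume "f \<in> sheaf_of (stalk N) U"
  then have f: "f \<in> Sec OP U" "\<And>q. q \<in> U ==> germ f \<in> stalk N q" by (auto simp: sheaf_of_def)
  have "\<exists>V. zopen V \<and> p \<in> V \<and> V \<subseteq> U \<and> Res OP V f \<in> N V" if p: "p \<in> U" for p
  proof -
    obtain W g where g: "zopen W" "p \<in> W" "g \<in> Sec OP W" "g \<in> N W" "germ f = germ g"
      using f(2)[OF p] by (rule stalk_atE)
    have V: "zopen (U \<inter> W)" "U \<inter> W \<noteq> {}" using Sec_OP_open[OF f(1)] g(1,2) p by auto
    have "Res OP (U \<inter> W) f = Res OP (U \<inter> W) g"
      using Res_OP[OF f(1) V(1)] Res_OP[OF g(3) V(1)] V(2) g(5) by (intro Sec_OP_eqI[of _ "U \<inter> W"]) auto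
    moreover have "Res OP (U \<inter> W) g \<in> N (U \<inter> W)" by (rule res[OF g(1,4,3) V(1)]) simp
    ultimately show ?thesis using V p g(2) by (intro exI[of _ "U \<inter> W"]) auto
  qed
  then show "f \<in> localize OP N U" using f(1) by (simp add: localize_def)
qed

lemma localize_ideal_sheaf:
  assumes "\<And>W V f. zopen W ==> f \<in> N W ==> f \<in> Sec OP W ==> zopen V ==> V \<subseteq> W ==> Res OP V f \<in> N V"
    and "\<And>p. ideal_in (\<O> p) (stalk N p)"
  shows "ideal_sheaf (localize OP N)" "stalk (localize OP N) p = stalk N p"
proof -
  have op: "\<exists>U. zopen U \<and> p \<in> U \<and> (\<forall>q\<in>U. k \<in> stalk N q)" if "k \<in> stalk N p" for p k
    using that by (rule stalk_atE) (blast intro: stalk_atI)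
  show "ideal_sheaf (localize OP N)" "stalk (localize OP N) p = stalk N p"
    using sheaf_of_ideal_sheaf[of "stalk N", OF assms(2) op] localize_eq_sheaf_of[of N, OF assms(1)] by auto
qed

lemma ideal_sheaf_Sec_OP: "ideal_sheaf (Sec OP)" and stalk_at_Sec_OP: "stalk (Sec OP) p = \<O> p"
proof -
  have eq: "Sec OP = sheaf_of \<O>"
    by (intro ext set_eqI) (auto simp: sheaf_of_def Sec_OP_germ)
  have op: "\<exists>U. zopen U \<and> p \<in> U \<and> (\<forall>q\<in>U. k \<in> \<O> q)" if "k \<in> \<O> p" for p k
    using that by (rule stalk_ring_open) blast
  show "ideal_sheaf (Sec OP)" "stalk (Sec OP) p = \<O> p"
    unfolding eq using sheaf_of_ideal_sheaf[OF stalk.whole_ideal op] by auto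
qed

lemma Res_Add_Smul_OP:
  "V \<subseteq> W ==> Res OP V (Add OP W f g) = Add OP V (Res OP V f) (Res OP V g)"
  "V \<subseteq> W ==> Res OP V (Smul OP W f g) = Smul OP V (Res OP V f) (Res OP V g)"
  "V \<subseteq> W ==> Res OP V (Res OP W f) = Res OP V f"
  by (rule ext, auto simp: OP_ops)+

section \<open>Schemes of finite type\<close>

definition fin_type :: "(p3 \<Rightarrow> ratfun set) \<Rightarrow> bool" where
  "fin_type J \<longleftrightarrow> (\<forall>p. \<exists>U S. zopen U \<and> p \<in> U \<and> finite S \<and> (\<forall>q\<in>U. S \<subseteq> J q \<and> J q = gen (\<O> q) S))"

lemma fin_typeE:
  assumes "fin_type J"
  obtains U S where "zopen U" "p \<in> U" "finite S" "\<And>q. q \<in> U ==> S \<subseteq> J q" "\<And>q. q \<in> U ==> J q = gen (\<O> q) S"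
  using assms[unfolded fin_type_def, THEN spec, of p] by (elim exE conjE) (rule that, auto)

lemma gen_stalk_open:
  assumes "x \<in> gen (\<O> p) T"
  obtains U where "zopen U" "p \<in> U" "\<And>q. q \<in> U ==> x \<in> gen (\<O> q) T"
proof -
  have "\<exists>U. zopen U \<and> p \<in> U \<and> (\<forall>q\<in>U. x \<in> gen (\<O> q) T)"
    using assms
  proof induction
    case zero
    show ?case by (intro exI[of _ UNIV]) (auto intro: gen.zero)
  next
    case (step r t a)
    then obtain U where U: "zopen U" "p \<in> U" "\<forall>q\<in>U. a \<in> gen (\<O> q) T" by blast
    obtain V where V: "zopen V" "p \<in> V" "\<And>q. q \<in> V ==> r \<in> \<O> q"
      using step(1) by (rule stalk_ring_open) blast
    show ?case using U V step(2) by (intro exI[of _ "U \<inter> V"]) (auto intro: gen.step)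
  qed
  then show ?thesis using that by blast
qed

lemma gen_finite_stalk_open:
  assumes "finite S" "S \<subseteq> gen (\<O> p) T"
  obtains U where "zopen U" "p \<in> U" "\<And>q. q \<in> U ==> S \<subseteq> gen (\<O> q) T"
proof -
  have "\<exists>U. zopen U \<and> p \<in> U \<and> (\<forall>q\<in>U. S \<subseteq> gen (\<O> q) T)"
    using assms
  proof (induction S rule: finite_induct)
    case empty
    show ?case by (intro exI[of _ UNIV]) auto
  next
    case (insert x S)
    then obtain U where U: "zopen U" "p \<in> U" "\<forall>q\<in>U. S \<subseteq> gen (\<O> q) T" by auto
    have "x \<in> gen (\<O> p) T" using insert by simp
    then obtain V where V: "zopen V" "p \<in> V" "\<And>q. q \<in> V ==> x \<in> gen (\<O> q) T"
      by (rule gen_stalk_open) blast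
    show ?case using U V by (intro exI[of _ "U \<inter> V"]) auto
  qed
  then show ?thesis using that by blast
qed

lemma (in ideal_sheaf) finite_stalk_open:
  assumes "finite S" "S \<subseteq> stalk I p"
  obtains U where "zopen U" "p \<in> U" "\<And>q. q \<in> U ==> S \<subseteq> stalk I q"
proof -
  have "\<exists>U. zopen U \<and> p \<in> U \<and> (\<forall>q\<in>U. S \<subseteq> stalk I q)"
    using assms
  proof (induction S rule: finite_induct)
    case empty
    show ?case by (intro exI[of _ UNIV]) auto
  next
    case (insert x S)
    then obtain U where U: "zopen U" "p \<in> U" "\<forall>q\<in>U. S \<subseteq> stalk I q" by auto
    have "x \<in> stalk I p" using insert by simp
    then obtain V where V: "zopen V" "p \<in> V" "\<And>q. q \<in> V ==> x \<in> stalk I q"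
      by (rule stalk_open) blast
    show ?case using U V by (intro exI[of _ "U \<inter> V"]) auto
  qed
  then show ?thesis using that by blast
qed

lemma (in ideal_sheaf) generators_near:
  assumes ft: "fin_type (stalk I)" and T: "finite T" "stalk I p = gen (\<O> p) T" "T \<subseteq> stalk I p"
  obtains U where "zopen U" "p \<in> U" "\<And>q. q \<in> U ==> T \<subseteq> stalk I q"
    "\<And>q. q \<in> U ==> stalk I q = gen (\<O> q) T"
proof -
  obtain U S where U: "zopen U" "p \<in> U" "finite S" "\<And>q. q \<in> U ==> S \<subseteq> stalk I q"
    "\<And>q. q \<in> U ==> stalk I q = gen (\<O> q) S" by (rule fin_typeE[OF ft, of p]) blast
  have "S \<subseteq> gen (\<O> p) T" using U(2,4) T by blast
  then obtain V where V: "zopen V" "p \<in> V" "\<And>q. q \<in> V ==> S \<subseteq> gen (\<O> q) T"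
    by (rule gen_finite_stalk_open[OF U(3)]) blast
  obtain W where W: "zopen W" "p \<in> W" "\<And>q. q \<in> W ==> T \<subseteq> stalk I q"
    by (rule finite_stalk_open[OF T(1,3)]) blast
  show ?thesis
  proof (rule that[of "U \<inter> V \<inter> W"])
    show "zopen (U \<inter> V \<inter> W)" "p \<in> U \<inter> V \<inter> W" using U V W by auto
    fix q assume q: "q \<in> U \<inter> V \<inter> W"
    show Tq: "T \<subseteq> stalk I q" using W(3) q by blast
    have Tr: "T \<subseteq> \<O> q" using Tq stalk_at_subset by blast
    show "stalk I q = gen (\<O> q) T"
    proof
      show "gen (\<O> q) T \<subseteq> stalk I q" by (rule gen_least[OF stalk_ideal Tq])
      have "stalk I q = gen (\<O> q) S" using U(5) q by blast
      also have "\<dots> \<subseteq> gen (\<O> q) T" using V(3) q by (intro gen_least[OF stalk.gen_ideal[OF Tr]]) blast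
      finally show "stalk I q \<subseteq> gen (\<O> q) T" .
    qed
  qed
qed

lemma add_closure_OP_germ:
  assumes "x \<in> add_closure OP W {Smul OP W a (Res OP W s) | a s. a \<in> Sec OP W \<and> s \<in> S}"
    and "zopen W" "W \<subseteq> U" "S \<subseteq> Sec OP U" "q \<in> W"
  shows "x \<in> Sec OP W \<and> germ x \<in> gen (\<O> q) (germ ` S)"
  using assms(1)
proof induction
  have W: "W \<noteq> {}" using assms(5) by auto
  {
    case (base x)
    then obtain a s where as: "x = Smul OP W a (Res OP W s)" "a \<in> Sec OP W" "s \<in> S" by blast
    then have s: "s \<in> Sec OP U" using assms(4) by blast
    note r = Res_OP[OF s assms(2,3)]
    have "germ a * germ s + 0 \<in> gen (\<O> q) (germ ` S)"
      using as Sec_OP_germ[OF as(2) assms(5)] by (intro gen.step gen.zero) auto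
    then show ?case using Smul_OP[OF as(2) r(1)] r(2) W as(1) by simp
  next
    case (add x y)
    have G: "ideal_in (\<O> q) (gen (\<O> q) (germ ` S))"
      using assms(3,4,5) Sec_OP_germ by (intro stalk.gen_ideal) blast
    show ?case using add.IH Add_OP[of x W y] W idealD(3)[OF G] by auto
  }
qed

lemma closed_subscheme_ideal_sheaf: "closed_subscheme I ==> ideal_sheaf I"
  unfolding closed_subscheme_def by unfold_locales (auto simp: image_subset_iff)

lemma closed_subscheme_iff: "closed_subscheme I \<longleftrightarrow> ideal_sheaf I \<and> fin_type (stalk I)"
proof
  assume C: "closed_subscheme I"
  then interpret ideal_sheaf I by (rule closed_subscheme_ideal_sheaf)
  have "fin_type (stalk I)" unfolding fin_type_def
  proof
    fix p
    let ?N = "\<lambda>S W. add_closure OP W {Smul OP W a (Res OP W s) | a s. a \<in> Sec OP W \<and> s \<in> S}"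
    have "\<exists>U S. zopen U \<and> p \<in> U \<and> finite S \<and> S \<subseteq> I U \<and>
        (\<forall>V. zopen V \<and> V \<subseteq> U \<longrightarrow> I V = localize OP (?N S) V)"
      using C unfolding closed_subscheme_def by simp
    then obtain U S where U: "zopen U" "p \<in> U" "finite S" "S \<subseteq> I U"
      "\<forall>V. zopen V \<and> V \<subseteq> U \<longrightarrow> I V = localize OP (?N S) V" by (elim exE conjE)
    have SU: "S \<subseteq> Sec OP U" using U(4) Sec by blast
    have "germ ` S \<subseteq> stalk I q \<and> stalk I q = gen (\<O> q) (germ ` S)" if q: "q \<in> U" for q
    proof
      show S: "germ ` S \<subseteq> stalk I q" using U(4) germ_stalk q by blast
      show "stalk I q = gen (\<O> q) (germ ` S)"
      proof
        show "gen (\<O> q) (germ ` S) \<subseteq> stalk I q" by (rule gen_least[OF stalk_ideal S])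
        show "stalk I q \<subseteq> gen (\<O> q) (germ ` S)"
        proof
          fix k assume "k \<in> stalk I q"
          then obtain V f where f: "zopen V" "q \<in> V" "f \<in> Sec OP V" "f \<in> I V" "k = germ f" by (rule stalk_atE)
          let ?V = "U \<inter> V"
          have V: "zopen ?V" "q \<in> ?V" using f U q by auto
          have "Res OP ?V f \<in> I ?V" by (rule res[OF f(1,4) V(1)]) simp
          then have "Res OP ?V f \<in> localize OP (?N S) ?V" using U(5) V(1) by auto
          then obtain W where W: "zopen W" "q \<in> W" "W \<subseteq> ?V" "Res OP W (Res OP ?V f) \<in> ?N S W"
            unfolding localize_def using V(2) by blast
          have "germ (Res OP W (Res OP ?V f)) \<in> gen (\<O> q) (germ ` S)"
            using add_closure_OP_germ[OF W(4,1) _ SU W(2)] W(3) by blast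
          moreover have "Res OP W (Res OP ?V f) = Res OP W f" by (rule Res_Add_Smul_OP(3)[OF W(3)])
          moreover have "W \<subseteq> V" "W \<noteq> {}" using W by auto
          ultimately show "k \<in> gen (\<O> q) (germ ` S)" using Res_OP(2)[OF f(3) W(1)] f(5) by simp
        qed
      qed
    qed
    then show "\<exists>U S. zopen U \<and> p \<in> U \<and> finite S \<and> (\<forall>q\<in>U. S \<subseteq> stalk I q \<and> stalk I q = gen (\<O> q) S)"
      using U(1,2,3) by (intro exI[of _ U] exI[of _ "germ ` S"]) auto
  qed
  then show "ideal_sheaf I \<and> fin_type (stalk I)" using ideal_sheaf_axioms by simp
next
  assume A: "ideal_sheaf I \<and> fin_type (stalk I)"
  then interpret ideal_sheaf I by simp
  let ?N = "\<lambda>S W. add_closure OP W {Smul OP W a (Res OP W s) | a s. a \<in> Sec OP W \<and> s \<in> S}"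
  have "\<exists>U S. zopen U \<and> p \<in> U \<and> finite S \<and> S \<subseteq> I U \<and>
        (\<forall>V. zopen V \<and> V \<subseteq> U \<longrightarrow> I V = localize OP (?N S) V)" for p
  proof -
    obtain U S0 where U: "zopen U" "p \<in> U" "finite S0" "\<And>q. q \<in> U ==> S0 \<subseteq> stalk I q"
      "\<And>q. q \<in> U ==> stalk I q = gen (\<O> q) S0" by (rule fin_typeE[OF conjunct2[OF A], of p]) blast
    \<comment> \<open>The zero is added because \<open>add_closure\<close> of an empty set is empty:
      without any generator the zero section would be missing.\<close>
    define S where "S = insert 0 S0"
    have S: "S \<subseteq> stalk I q" "stalk I q \<subseteq> gen (\<O> q) S" if "q \<in> U" for q
      using U(4,5)[OF that] idealD(2)[OF stalk_ideal] gen_mono[of S0 S "\<O> q"] by (auto simp: S_def)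
    define T where "T = section_of U ` S"
    have TI: "T \<subseteq> I U" unfolding T_def using section_mem[OF U(1)] S(1) by blast
    have T: "t \<in> I U" "t \<in> Sec OP U" if "t \<in> T" for t using TI that Sec by auto
    have N_I: "?N T W \<subseteq> I W" if W: "zopen W" "W \<subseteq> U" for W
    proof
      fix x assume "x \<in> ?N T W"
      then show "x \<in> I W"
      proof induction
        case (base x)
        then obtain a s where as: "x = Smul OP W a (Res OP W s)" "a \<in> Sec OP W" "s \<in> T" by blast
        show ?case unfolding as(1) by (rule smul[OF W(1) as(2) res[OF U(1) T(1)[OF as(3)] W]])
      next
        case (add x y)
        then show ?case using ideal_sheaf.add[OF ideal_sheaf_axioms W(1)] by blast
      qed
    qed
    \<comment> \<open>A combination in the local ring has finitely many regular coefficients, so it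
      is a combination of sections near \<open>q\<close>. The claim covers all smaller
      neighbourhoods so that the induction step can intersect them.\<close>
    have key: "\<exists>W0. zopen W0 \<and> q \<in> W0 \<and> (\<forall>W. zopen W \<and> W \<subseteq> W0 \<inter> U \<and> q \<in> W \<longrightarrow>
        section_of W x \<in> ?N T W \<and> (\<forall>r\<in>W. x \<in> \<O> r))" if x: "x \<in> gen (\<O> q) S" for x q
      using x
    proof induction
      case zero
      have "section_of W 0 \<in> ?N T W" if W: "zopen W" "W \<subseteq> U" for W
      proof (rule add_closure.base, intro CollectI exI conjI)
        show "section_of W 0 \<in> Sec OP W" by (rule section_of(1)[OF W(1)]) simp
        show "section_of U 0 \<in> T" by (auto simp: T_def S_def)
        show "section_of W 0 = Smul OP W (section_of W 0) (Res OP W (section_of U 0))"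
          by (auto simp: OP_ops section_of_def)
      qed
      then show ?case by (intro exI[of _ UNIV]) auto
    next
      case (step r s a)
      from step.IH obtain W1 where W1: "zopen W1" "q \<in> W1" "\<forall>W. zopen W \<and> W \<subseteq> W1 \<inter> U \<and> q \<in> W \<longrightarrow>
        section_of W a \<in> ?N T W \<and> (\<forall>r\<in>W. a \<in> \<O> r)" by (elim exE conjE)
      obtain W2 where W2: "zopen W2" "q \<in> W2" "\<And>q. q \<in> W2 ==> r \<in> \<O> q"
        using step(1) by (rule stalk_ring_open) blast
      have "section_of W (r * s + a) \<in> ?N T W \<and> (\<forall>t\<in>W. r * s + a \<in> \<O> t)"
        if W: "zopen W" "W \<subseteq> W1 \<inter> W2 \<inter> U" "q \<in> W" for W
      proof -
        have a: "section_of W a \<in> ?N T W" "\<And>t. t \<in> W ==> a \<in> \<O> t" using W1(3)[rule_format, of W] W by auto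
        have r: "t \<in> W ==> r \<in> \<O> t" for t using W2(3) W(2) by blast
        have s: "t \<in> W ==> s \<in> \<O> t" for t using S(1) stalk_at_subset step(2) W(2) by blast
        have "Smul OP W (section_of W r) (Res OP W (section_of U s)) \<in> ?N T W"
          using section_of(1)[OF W(1) r] step(2) by (intro add_closure.base) (auto simp: T_def)
        then have "Add OP W (Smul OP W (section_of W r) (Res OP W (section_of U s))) (section_of W a) \<in> ?N T W"
          using a(1) by (rule add_closure.add)
        moreover have "Add OP W (Smul OP W (section_of W r) (Res OP W (section_of U s))) (section_of W a) = section_of W (r * s + a)"
          using W(2) r s a(2) by (intro ext) (auto simp: OP_ops section_of_def)
        ultimately show ?thesis using r s a(2) by auto
      qed
      then show ?case using W1(1,2) W2(1,2) by (intro exI[of _ "W1 \<inter> W2"]) auto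
    qed
    have "I V = localize OP (?N T) V" if V: "zopen V" "V \<subseteq> U" for V
    proof
      show "localize OP (?N T) V \<subseteq> I V"
      proof
        fix f assume "f \<in> localize OP (?N T) V"
        then have f: "f \<in> Sec OP V" "\<And>p. p \<in> V ==> \<exists>W. zopen W \<and> p \<in> W \<and> W \<subseteq> V \<and> Res OP W f \<in> ?N T W"
          by (auto simp: localize_def)
        have "\<exists>W. zopen W \<and> p \<in> W \<and> W \<subseteq> V \<and> Res OP W f \<in> I W" if p: "p \<in> V" for p
        proof -
          obtain W where W: "zopen W" "p \<in> W" "W \<subseteq> V" "Res OP W f \<in> ?N T W" using f(2)[OF p] by (elim exE conjE)
          then have "Res OP W f \<in> I W" using N_I[OF W(1)] V(2) by blast
          then show ?thesis using W by blast
        qed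
        then have "f \<in> localize OP I V" using f(1) by (simp add: localize_def)
        then show "f \<in> I V" using glue by blast
      qed
      show "I V \<subseteq> localize OP (?N T) V"
      proof
        fix f assume f: "f \<in> I V"
        have "\<exists>W. zopen W \<and> q \<in> W \<and> W \<subseteq> V \<and> Res OP W f \<in> ?N T W" if q: "q \<in> V" for q
        proof -
          have "germ f \<in> gen (\<O> q) S" using germ_stalk[OF f q] S(2) V(2) q by blast
          from key[OF this] obtain W0 where W0: "zopen W0" "q \<in> W0"
            "\<forall>W. zopen W \<and> W \<subseteq> W0 \<inter> U \<and> q \<in> W \<longrightarrow>
              section_of W (germ f) \<in> ?N T W \<and> (\<forall>r\<in>W. germ f \<in> \<O> r)" by (elim exE conjE)
          let ?W = "W0 \<inter> V"
          have W: "zopen ?W" "q \<in> ?W" using W0(1,2) V(1) q by auto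
          have "section_of ?W (germ f) \<in> ?N T ?W" using W0(3)[rule_format, of ?W] W V(2) by auto
          moreover have "section_of ?W (germ f) = Res OP ?W f"
            by (rule section_of_eq[OF W(1) Sec[OF f]]) (use W in auto)
          ultimately show ?thesis using W by (intro exI[of _ ?W]) auto
        qed
        then show "f \<in> localize OP (?N T) V" using Sec[OF f] by (simp add: localize_def)
      qed
    qed
    then show ?thesis using U(1,2,3) TI by (intro exI[of _ U] exI[of _ T]) (auto simp: T_def S_def)
  qed
  then show "closed_subscheme I"
    unfolding closed_subscheme_def using sub zero add smul res glue by (auto simp: image_subset_iff)
qed

section \<open>Stalks of sums, products and hypersurfaces\<close>

lemma (in subring) sum_ideal:
  assumes I: "ideal_in R I" and J: "ideal_in R J" shows "ideal_in R {a + b | a b. a \<in> I \<and> b \<in> J}"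
  unfolding ideal_in_def
proof (intro conjI ballI)
  show "{a + b | a b. a \<in> I \<and> b \<in> J} \<subseteq> R" using idealD(1)[OF I] idealD(1)[OF J] by auto
  show "0 \<in> {a + b | a b. a \<in> I \<and> b \<in> J}" using idealD(2)[OF I] idealD(2)[OF J] by force
  fix x assume "x \<in> {a + b | a b. a \<in> I \<and> b \<in> J}"
  then obtain a b where x: "x = a + b" "a \<in> I" "b \<in> J" by auto
  show "x + y \<in> {a + b | a b. a \<in> I \<and> b \<in> J}" if y: "y \<in> {a + b | a b. a \<in> I \<and> b \<in> J}" for y
  proof -
    obtain c d where "y = c + d" "c \<in> I" "d \<in> J" using y by auto
    then have "x + y = (a + c) + (b + d) \<and> a + c \<in> I \<and> b + d \<in> J"
      using x idealD(3)[OF I] idealD(3)[OF J] by (auto simp: algebra_simps)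
    then show ?thesis by blast
  qed
  show "r * x \<in> {a + b | a b. a \<in> I \<and> b \<in> J}" if "r \<in> R" for r
  proof -
    have "r * x = r * a + r * b \<and> r * a \<in> I \<and> r * b \<in> J"
      using x that idealD(4)[OF I] idealD(4)[OF J] by (auto simp: distrib_left)
    then show ?thesis by blast
  qed
qed

lemma
  assumes Y: "ideal_sheaf Y" and Z: "ideal_sheaf Z"
  shows ideal_sheaf_scheme_inter: "ideal_sheaf (scheme_inter Y Z)"
    and stalk_scheme_inter: "stalk (scheme_inter Y Z) p = {a + b | a b. a \<in> stalk Y p \<and> b \<in> stalk Z p}"
proof -
  interpret Y: ideal_sheaf Y by fact
  interpret Z: ideal_sheaf Z by fact
  define N where "N U = {Add OP U f g | f g. f \<in> Y U \<and> g \<in> Z U}" for U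
  have res: "Res OP V f \<in> N V" if "zopen W" "f \<in> N W" "f \<in> Sec OP W" "zopen V" "V \<subseteq> W" for W V f
  proof -
    have fN: "f \<in> N W" by (rule that(2))
    then obtain g h where gh: "f = Add OP W g h" "g \<in> Y W" "h \<in> Z W" unfolding N_def by blast
    then have "Res OP V f = Add OP V (Res OP V g) (Res OP V h)" using that(5) by (simp add: Res_Add_Smul_OP)
    then show ?thesis using Y.res[OF that(1) gh(2) that(4,5)] Z.res[OF that(1) gh(3) that(4,5)] by (auto simp: N_def)
  qed
  have st: "stalk N p = {a + b | a b. a \<in> stalk Y p \<and> b \<in> stalk Z p}" for p
  proof
    show "stalk N p \<subseteq> {a + b | a b. a \<in> stalk Y p \<and> b \<in> stalk Z p}"
    proof
      fix k assume "k \<in> stalk N p"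
      then obtain U f where f: "zopen U" "p \<in> U" "f \<in> Sec OP U" "f \<in> N U" "k = germ f" by (rule stalk_atE)
      then obtain g h where gh: "f = Add OP U g h" "g \<in> Y U" "h \<in> Z U" by (auto simp: N_def)
      have "U \<noteq> {}" using f(2) by auto
      then have "k = germ g + germ h" using Add_OP(2)[OF Y.Sec[OF gh(2)] Z.Sec[OF gh(3)]] f(5) gh(1) by simp
      then show "k \<in> {a + b | a b. a \<in> stalk Y p \<and> b \<in> stalk Z p}"
        using Y.germ_stalk[OF gh(2) f(2)] Z.germ_stalk[OF gh(3) f(2)] by blast
    qed
    show "{a + b | a b. a \<in> stalk Y p \<and> b \<in> stalk Z p} \<subseteq> stalk N p"
    proof
      fix k assume "k \<in> {a + b | a b. a \<in> stalk Y p \<and> b \<in> stalk Z p}"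
      then obtain a b where k: "k = a + b" "a \<in> stalk Y p" "b \<in> stalk Z p" by auto
      obtain U where U: "zopen U" "p \<in> U" "\<And>q. q \<in> U ==> a \<in> stalk Y q" using k(2) by (rule Y.stalk_open) blast
      obtain V where V: "zopen V" "p \<in> V" "\<And>q. q \<in> V ==> b \<in> stalk Z q" using k(3) by (rule Z.stalk_open) blast
      let ?W = "U \<inter> V"
      have W: "zopen ?W" "p \<in> ?W" using U V by auto
      then have W': "?W \<noteq> {}" by blast
      have a: "section_of ?W a \<in> Y ?W" and b: "section_of ?W b \<in> Z ?W"
        using U V by (auto intro!: Y.section_mem[OF W(1)] Z.section_mem[OF W(1)])
      have ga: "germ (section_of ?W a) = a" using section_of(2)[OF W(1) _ W', of a] U(3) stalk_at_subset by blast
      have gb: "germ (section_of ?W b) = b" using section_of(2)[OF W(1) _ W', of b] V(3) stalk_at_subset by blast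
      have "Add OP ?W (section_of ?W a) (section_of ?W b) \<in> N ?W" using a b by (auto simp: N_def)
      moreover note A = Add_OP[OF Y.Sec[OF a] Z.Sec[OF b], of ?W]
      ultimately have "germ (Add OP ?W (section_of ?W a) (section_of ?W b)) \<in> stalk N p"
        using stalk_atI[OF W, of "Add OP ?W (section_of ?W a) (section_of ?W b)" N] by blast
      then show "k \<in> stalk N p" using A(2)[OF W'] ga gb k(1) by simp
    qed
  qed
  have id: "ideal_in (\<O> p) (stalk N p)" for p
    unfolding st by (rule stalk.sum_ideal[OF Y.stalk_ideal Z.stalk_ideal])
  have eq: "scheme_inter Y Z = localize OP N" by (simp add: scheme_inter_def N_def[abs_def])
  show "ideal_sheaf (scheme_inter Y Z)"
    unfolding eq by (rule localize_ideal_sheaf(1)) (use res id in auto)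
  have "stalk (localize OP N) p = stalk N p"
    by (rule localize_ideal_sheaf(2)) (use res id in auto)
  then show "stalk (scheme_inter Y Z) p = {a + b | a b. a \<in> stalk Y p \<and> b \<in> stalk Z p}"
    unfolding eq st .
qed

lemma as_module_ops [simp]:
  "Sec (as_module D) = D" "Res (as_module D) = Res OP" "Add (as_module D) = Add OP" "Smul (as_module D) = Smul OP"
  by (simp_all add: as_module_def)

lemma add_closure_cong: "Add M = Add M' ==> add_closure M U A = add_closure M' U A"
proof -
  assume eq: "Add M = Add M'"
  have "x \<in> add_closure M' U A" if "x \<in> add_closure M U A" for x
    using that by induction (auto intro: add_closure.intros simp: eq)
  moreover have "x \<in> add_closure M U A" if "x \<in> add_closure M' U A" for x
    using that by induction (auto intro: add_closure.base add_closure.add[of _ M, unfolded eq])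
  ultimately show ?thesis by blast
qed

lemma
  assumes C: "ideal_sheaf C" and D: "ideal_sheaf D"
  shows ideal_sheaf_product: "ideal_sheaf (ideal_mult C (as_module D))"
    and stalk_product: "stalk (ideal_mult C (as_module D)) p
      = gen (\<O> p) {a * b | a b. a \<in> stalk C p \<and> b \<in> stalk D p}"
proof -
  interpret C: ideal_sheaf C by fact
  interpret D: ideal_sheaf D by fact
  define N where "N U = add_closure OP U {Smul OP U a x | a x. a \<in> C U \<and> x \<in> D U}" for U
  have ND: "N U \<subseteq> D U" if U: "zopen U" for U
  proof
    fix x assume "x \<in> N U"
    then show "x \<in> D U" unfolding N_def
      by induction (auto intro: D.add[OF U] D.smul[OF U C.Sec])
  qed
  have eq: "ideal_mult C (as_module D) = localize OP N"
  proof (rule ext)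
    fix U
    have "localize (as_module D) N U = localize OP N U"
    proof
      show "localize (as_module D) N U \<subseteq> localize OP N U" using D.sub by (auto simp: localize_def)
      show "localize OP N U \<subseteq> localize (as_module D) N U"
      proof
        fix f assume "f \<in> localize OP N U"
        then have f: "f \<in> Sec OP U" "\<forall>p\<in>U. \<exists>V. zopen V \<and> p \<in> V \<and> V \<subseteq> U \<and> Res OP V f \<in> N V"
          by (auto simp: localize_def)
        then have "f \<in> localize OP D U" using ND unfolding localize_def by blast
        then have "f \<in> D U" using D.glue by blast
        then show "f \<in> localize (as_module D) N U" using f(2) by (simp add: localize_def)
      qed
    qed
    then show "ideal_mult C (as_module D) U = localize OP N U"
      by (simp add: ideal_mult_def N_def[abs_def] add_closure_cong[of "as_module D" OP])
  qed
  have res: "Res OP V f \<in> N V" if "zopen W" "f \<in> N W" "f \<in> Sec OP W" "zopen V" "V \<subseteq> W" for W V f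
    using that(2) unfolding N_def
  proof induction
    case (base x)
    then obtain a y where "x = Smul OP W a y" "a \<in> C W" "y \<in> D W" by blast
    then show ?case using C.res[OF that(1) _ that(4,5), of a] D.res[OF that(1) _ that(4,5), of y] that(5)
      by (intro add_closure.base) (auto simp: Res_Add_Smul_OP)
  next
    case (add x y)
    then show ?case using that(5) by (auto simp: Res_Add_Smul_OP intro: add_closure.add)
  qed
  have CDsub: "{a * b | a b. a \<in> stalk C p \<and> b \<in> stalk D p} \<subseteq> \<O> p" for p
    using stalk_at_subset by blast
  have st: "stalk N p = gen (\<O> p) {a * b | a b. a \<in> stalk C p \<and> b \<in> stalk D p}" for p
  proof
    let ?G = "gen (\<O> p) {a * b | a b. a \<in> stalk C p \<and> b \<in> stalk D p}"
    have G: "ideal_in (\<O> p) ?G" by (rule stalk.gen_ideal[OF CDsub])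
    show "stalk N p \<subseteq> ?G"
    proof
      fix k assume "k \<in> stalk N p"
      then obtain U f where f: "zopen U" "p \<in> U" "f \<in> Sec OP U" "f \<in> N U" "k = germ f" by (rule stalk_atE)
      have U: "U \<noteq> {}" using f(2) by auto
      have "f \<in> Sec OP U \<and> germ f \<in> ?G" using f(4) unfolding N_def
      proof induction
        case (base x)
        then obtain a y where ay: "x = Smul OP U a y" "a \<in> C U" "y \<in> D U" by blast
        note S = Smul_OP[OF C.Sec[OF ay(2)] D.Sec[OF ay(3)], of U]
        have "germ a * germ y \<in> ?G"
          using C.germ_stalk[OF ay(2) f(2)] D.germ_stalk[OF ay(3) f(2)]
            stalk.gen_incl[of "{a * b | a b. a \<in> stalk C p \<and> b \<in> stalk D p}" p] by blast
        then show ?case using S U ay(1) by simp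
      next
        case (add x y)
        then show ?case using Add_OP[of x U y U] U idealD(3)[OF G] by auto
      qed
      then show "k \<in> ?G" using f(5) by simp
    qed
    show "?G \<subseteq> stalk N p"
    proof
      fix k assume "k \<in> ?G"
      then show "k \<in> stalk N p"
      proof induction
        case zero
        have z: "(\<lambda>_. 0) \<in> C UNIV" "(\<lambda>_. 0) \<in> D UNIV" using C.zero D.zero by auto
        have "Smul OP UNIV (\<lambda>_. 0) (\<lambda>_. 0) \<in> N UNIV" unfolding N_def using z by (intro add_closure.base) blast
        then have "(\<lambda>_. 0) \<in> N UNIV" by (simp add: OP_ops)
        then have "germ (\<lambda>_. 0) \<in> stalk N p" using C.Sec[OF z(1)] by (intro stalk_atI[of UNIV]) auto
        then show ?case using cst.cst_0 by (simp add: cst_def)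
      next
        case (step r s x)
        obtain U f where f: "zopen U" "p \<in> U" "f \<in> Sec OP U" "f \<in> N U" "x = germ f"
          using step(4) by (rule stalk_atE)
        obtain a b where ab: "s = a * b" "a \<in> stalk C p" "b \<in> stalk D p" using step(2) by blast
        have ra: "r * a \<in> stalk C p" by (rule idealD(4)[OF C.stalk_ideal step(1) ab(2)])
        obtain V where V: "zopen V" "p \<in> V" "\<And>q. q \<in> V ==> r * a \<in> stalk C q" using ra by (rule C.stalk_open) blast
        obtain W where W: "zopen W" "p \<in> W" "\<And>q. q \<in> W ==> b \<in> stalk D q" using ab(3) by (rule D.stalk_open) blast
        let ?O = "U \<inter> V \<inter> W"
        have O: "zopen ?O" "p \<in> ?O" using f(1,2) V(1,2) W(1,2) by auto
        then have O': "?O \<noteq> {}" by blast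
        have 1: "section_of ?O (r * a) \<in> C ?O" by (rule C.section_mem[OF O(1)]) (use V(3) in blast)
        have 2: "section_of ?O b \<in> D ?O" by (rule D.section_mem[OF O(1)]) (use W(3) in blast)
        have g1: "germ (section_of ?O (r * a)) = r * a" using section_of(2)[OF O(1) _ O', of "r * a"] V(3) stalk_at_subset by blast
        have g2: "germ (section_of ?O b) = b" using section_of(2)[OF O(1) _ O', of b] W(3) stalk_at_subset by blast
        have 3: "Smul OP ?O (section_of ?O (r * a)) (section_of ?O b) \<in> N ?O" unfolding N_def using 1 2 by (intro add_closure.base) blast
        have 4: "Res OP ?O f \<in> N ?O" by (rule res[OF f(1,4,3) O(1)]) blast
        have 5: "Add OP ?O (Smul OP ?O (section_of ?O (r * a)) (section_of ?O b)) (Res OP ?O f) \<in> N ?O"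
          using 3 4 unfolding N_def by (rule add_closure.add)
        note S = Smul_OP[OF C.Sec[OF 1] D.Sec[OF 2], of ?O]
        have R: "Res OP ?O f \<in> Sec OP ?O" "germ (Res OP ?O f) = x" using Res_OP[OF f(3) O(1)] O' f(5) by auto
        note A = Add_OP[OF S(1) R(1), of ?O]
        have "germ (Add OP ?O (Smul OP ?O (section_of ?O (r * a)) (section_of ?O b)) (Res OP ?O f)) \<in> stalk N p"
          by (rule stalk_atI[OF O]) (rule A(1), rule 5)
        then show ?case using A(2)[OF O'] S(2)[OF O'] R(2) g1 g2 ab(1) by (simp add: mult.assoc)
      qed
    qed
  qed
  have id: "ideal_in (\<O> p) (stalk N p)" for p
    unfolding st by (rule stalk.gen_ideal[OF CDsub])
  show "ideal_sheaf (ideal_mult C (as_module D))"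
    unfolding eq by (rule localize_ideal_sheaf(1)) (use res id in auto)
  have "stalk (localize OP N) p = stalk N p"
    by (rule localize_ideal_sheaf(2)) (use res id in auto)
  then show "stalk (ideal_mult C (as_module D)) p = gen (\<O> p) {a * b | a b. a \<in> stalk C p \<and> b \<in> stalk D p}"
    unfolding eq st .
qed

lemma
  assumes "ideal_sheaf X" "ideal_sheaf C" "ideal_sheaf D"
  shows ideal_sheaf_div_add: "ideal_sheaf (div_add X C D)"
    and stalk_div_add: "stalk (div_add X C D) p = {u + x | u x.
      u \<in> gen (\<O> p) {a * b | a b. a \<in> stalk C p \<and> b \<in> stalk D p} \<and> x \<in> stalk X p}"
  unfolding div_add_def
  using ideal_sheaf_scheme_inter[OF ideal_sheaf_product[OF assms(2,3)] assms(1)]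
    stalk_scheme_inter[OF ideal_sheaf_product[OF assms(2,3)] assms(1)] stalk_product[OF assms(2,3)] by auto

text \<open>Modulo \<open>X\<close> the ideal of the divisor is generated by \<open>h\<close>, so
  multiplying an ideal by it amounts to multiplying by \<open>h\<close>.\<close>

lemma stalk_div_add_principal:
  assumes X: "ideal_sheaf X" and C: "ideal_sheaf C" and D: "ideal_sheaf D"
    and h: "h \<in> stalk D p" "stalk D p = {a * h + b | a b. a \<in> \<O> p \<and> b \<in> stalk X p}"
  shows "stalk (div_add X C D) p = {c * h + x | c x. c \<in> stalk C p \<and> x \<in> stalk X p}"
proof -
  let ?A = "\<O> p"
  let ?P = "{a * b | a b. a \<in> stalk C p \<and> b \<in> stalk D p}"
  let ?R = "{c * h + x | c x. c \<in> stalk C p \<and> x \<in> stalk X p}"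
  note Ci = ideal_sheaf.stalk_ideal[OF C, of p] and Xi = ideal_sheaf.stalk_ideal[OF X, of p]
  have "u \<in> ?R" if "u \<in> gen ?A ?P" for u
    using that
  proof induction
    case zero
    have "0 = 0 * h + 0 \<and> 0 \<in> stalk C p \<and> 0 \<in> stalk X p" using idealD(2)[OF Ci] idealD(2)[OF Xi] by simp
    then show ?case by blast
  next
    case (step r s u)
    obtain a b where ab: "s = a * b" "a \<in> stalk C p" "b \<in> stalk D p" using step(2) by blast
    obtain e x where ex: "b = e * h + x" "e \<in> ?A" "x \<in> stalk X p" using ab(3) h(2) by blast
    obtain c y where cy: "u = c * h + y" "c \<in> stalk C p" "y \<in> stalk X p" using step(4) by blast
    have aA: "a \<in> ?A" using ab(2) stalk_at_subset by blast
    have "r * s + u = ((r * e) * a + c) * h + ((r * a) * x + y)" by (simp add: ab ex cy algebra_simps)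
    moreover have "(r * e) * a + c \<in> stalk C p"
      using step(1) ex(2) by (intro idealD(3)[OF Ci idealD(4)[OF Ci _ ab(2)] cy(2)]) auto
    moreover have "(r * a) * x + y \<in> stalk X p"
      using step(1) aA by (intro idealD(3)[OF Xi idealD(4)[OF Xi _ ex(3)] cy(3)]) auto
    ultimately show ?case by blast
  qed
  note gR = this
  have 1: "u + x \<in> ?R" if ux: "u \<in> gen ?A ?P" "x \<in> stalk X p" for u x
  proof -
    obtain c y where cy: "u = c * h + y" "c \<in> stalk C p" "y \<in> stalk X p" using gR[OF ux(1)] by blast
    then have "u + x = c * h + (y + x) \<and> y + x \<in> stalk X p" using idealD(3)[OF Xi _ ux(2)] by (simp add: add.assoc)
    then show ?thesis using cy(2) by blast
  qed
  have 2: "c * h \<in> gen ?A ?P" if "c \<in> stalk C p" for c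
    using stalk.gen_incl[of ?P p] that h(1) by blast
  show ?thesis unfolding stalk_div_add[OF X C D] using 1 2 by blast
qed

lemma ideal_sheaf_div_mult:
  assumes "ideal_sheaf X" "ideal_sheaf D" shows "ideal_sheaf (div_mult X n D)"
  by (induction n) (auto intro: ideal_sheaf_Sec_OP ideal_sheaf_div_add assms)

lemma hypersurface_stalk:
  assumes F: "form d F" and f: "\<And>j. f j \<in> chart_ring j" "\<And>j q. q \<in> chart j ==> val q (f j) = F (nrm j q)"
  shows "ideal_sheaf (hypersurface d F)" "p \<in> chart j ==> stalk (hypersurface d F) p = gen (\<O> p) {f j}"
proof -
  define N where "N U = {f. \<exists>e G H. form e G \<and> form (d + e) H \<and>
     (\<forall>q\<in>U. \<forall>v\<in>coords q. H v \<noteq> 0 \<and> f q = F v * G v / H v)}" for U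
  have res: "Res OP V g \<in> N V" if "zopen W" "g \<in> N W" "g \<in> Sec OP W" "zopen V" "V \<subseteq> W" for W V g
  proof -
    have gN: "g \<in> N W" by (rule that(2))
    obtain e G H where gh: "form e G" "form (d + e) H" "\<forall>q\<in>W. \<forall>v\<in>coords q. H v \<noteq> 0 \<and> g q = F v * G v / H v"
      using gN unfolding N_def by (elim CollectE exE conjE)
    have "\<forall>q\<in>V. \<forall>v\<in>coords q. H v \<noteq> 0 \<and> Res OP V g q = F v * G v / H v" using gh(3) that(5) by (auto simp: OP_ops)
    then show ?thesis unfolding N_def using gh(1,2) by (intro CollectI exI conjI)
  qed
  have st: "stalk N p = gen (\<O> p) {f j}" if p: "p \<in> chart j" for p j
  proof
    have fp: "f j \<in> \<O> p" by (rule chart_ring_stalk[OF f(1) p])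
    show "stalk N p \<subseteq> gen (\<O> p) {f j}"
    proof
      fix k assume "k \<in> stalk N p"
      then obtain U g where g: "zopen U" "p \<in> U" "g \<in> Sec OP U" "g \<in> N U" "k = germ g" by (rule stalk_atE)
      obtain e G H where gh: "form e G" "form (d + e) H" "\<forall>q\<in>U. \<forall>v\<in>coords q. H v \<noteq> 0 \<and> g q = F v * G v / H v"
        using g(4) unfolding N_def by (elim CollectE exE conjE)
      obtain a where a: "a \<in> chart_ring j" "\<And>q. q \<in> chart j ==> val q a = G (nrm j q)"
        using form_dehomogenize[OF gh(1)] by blast
      obtain b where b: "b \<in> chart_ring j" "\<And>q. q \<in> chart j ==> val q b = H (nrm j q)"
        using form_dehomogenize[OF gh(2)] by blast
      have kq: "k \<in> \<O> q" if "q \<in> U" for q using Sec_OP_germ[OF g(3) that] g(5) by simp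
      have "b * k = f j * a"
      proof (rule ratfun_eqI)
        show "zopen (U \<inter> chart j)" "U \<inter> chart j \<noteq> {}" using g(1,2) openin_chart p by auto
        fix q assume q: "q \<in> U \<inter> chart j"
        have s: "b \<in> \<O> q" "a \<in> \<O> q" "k \<in> \<O> q" "f j \<in> \<O> q"
          using q a(1) b(1) kq chart_ring_stalk chart_ring_stalk[OF f(1)[of j], of q] by auto
        then show "b * k \<in> \<O> q" "f j * a \<in> \<O> q" by auto
        have "val q k = g q" using Sec_OP_val[OF g(3)] q g(5) by auto
        moreover have "H (nrm j q) \<noteq> 0 \<and> g q = F (nrm j q) * G (nrm j q) / H (nrm j q)"
          using gh(3) q nrm_coords(1) by auto
        ultimately show "val q (b * k) = val q (f j * a)" using s a(2) b(2) f(2) q by simp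
      qed
      have bp: "b \<in> \<O> p" "a \<in> \<O> p" using a b p chart_ring_stalk by auto
      have "val p b \<noteq> 0" using b(2)[OF p] gh(3) g(2) nrm_coords(1)[OF p] by auto
      then have "b \<noteq> 0" "inverse b \<in> \<O> p" using stalk_ring_inverse[OF bp(1)] by auto
      then have "k = (inverse b * a) * f j" using \<open>b * k = f j * a\<close> inverse_mult_cancel[of b k "f j * a"] by (simp add: ac_simps)
      then show "k \<in> gen (\<O> p) {f j}"
        using stalk.gen1I[OF fp, of "inverse b * a"] \<open>inverse b \<in> _\<close> bp(2) by auto
    qed
    show "gen (\<O> p) {f j} \<subseteq> stalk N p"
    proof
      fix k assume "k \<in> gen (\<O> p) {f j}"
      then obtain r where r: "k = r * f j" "r \<in> \<O> p" using fp by (auto simp: stalk.gen1)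
      obtain U u where u: "p \<in> U" "regular_on U u" "r = germ u" using r(2) by (rule stalk_ringE)
      obtain V e G H where V: "zopen V" "p \<in> V" "V \<subseteq> U" "form e G" "form e H"
        "\<forall>q\<in>V. \<forall>v\<in>coords q. H v \<noteq> 0 \<and> u q = G v / H v" by (rule regular_onE[OF u(2,1)])
      let ?W = "V \<inter> chart j"
      have W: "zopen ?W" "p \<in> ?W" using V(1,2) p openin_chart by auto
      then have W': "?W \<noteq> {}" by blast
      have rq: "r \<in> \<O> q" "f j \<in> \<O> q" "val q r = u q" if "q \<in> ?W" for q
        using that V(3) u stalk_ringI[OF u(2)] val_germ[OF u(2)] chart_ring_stalk[OF f(1)] by auto
      then have kq: "k \<in> \<O> q" if "q \<in> ?W" for q using r(1) that by auto
      have s: "section_of ?W k \<in> Sec OP ?W" "germ (section_of ?W k) = k"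
        using section_of[OF W(1), of k] kq W' by blast+
      \<comment> \<open>The factor \<open>v $ j ^ d\<close> restores the degree lost by
        dehomogenizing: \<open>F\<close> at the normalized coordinates is
        \<open>F v / v $ j ^ d\<close>.\<close>
      obtain D where D: "\<And>v. D v = v $ j ^ d" "form d D"
      proof -
        have "form n (\<lambda>v. v $ j ^ n)" for n
        proof (induction n)
          case 0
          then show ?case using form_const[of 1] by simp
        next
          case (Suc n)
          then show ?case using form_mult[OF form_coord Suc, of j] by simp
        qed
        then show ?thesis by (intro that[of "\<lambda>v. v $ j ^ d"]) auto
      qed
      have "section_of ?W k q = F v * G v / (D v * H v) \<and> D v * H v \<noteq> 0" if q: "q \<in> ?W" and v: "v \<in> coords q" for q v
      proof -
        have vj: "v $ j \<noteq> 0" using in_chart[OF v] q by simp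
        have "F (nrm j q) = F v / v $ j ^ d" using nrm_eq[OF v] q form_scale[OF F] by (simp add: power_divide)
        moreover have "section_of ?W k q = u q * F (nrm j q)"
          using q rq[OF q] f(2)[of q j] by (simp add: section_of_def r(1))
        moreover have "H v \<noteq> 0 \<and> u q = G v / H v" using V(6) q v by blast
        ultimately show ?thesis using vj by (simp add: D(1) ac_simps)
      qed
      then have "section_of ?W k \<in> N ?W"
        unfolding N_def using V(4) form_mult[OF D(2) V(5)] by blast
      with s(1) have "germ (section_of ?W k) \<in> stalk N p" by (rule stalk_atI[OF W])
      then show "k \<in> stalk N p" using s(2) by simp
    qed
  qed
  have id: "ideal_in (\<O> p) (stalk N p)" for p
  proof -
    obtain j where j: "p \<in> chart j" by (rule chart_cover)
    show ?thesis unfolding st[OF j] using chart_ring_stalk[OF f(1) j] by (intro stalk.gen_ideal) auto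
  qed
  have eq: "hypersurface d F = localize OP N" by (simp add: hypersurface_def N_def[abs_def])
  show "ideal_sheaf (hypersurface d F)"
    unfolding eq by (rule localize_ideal_sheaf(1)) (use res id in auto)
  have "stalk (localize OP N) p = stalk N p"
    by (rule localize_ideal_sheaf(2)) (use res id in auto)
  then show "stalk (hypersurface d F) p = gen (\<O> p) {f j}" if "p \<in> chart j"
    unfolding eq using st[OF that] by simp
qed

section \<open>Smooth surfaces\<close>

text \<open>All that is kept of smoothness is the pencil of parameters at each point of the surface;
  \<open>eqn j\<close> is the equation dehomogenized on \<open>chart j\<close>.\<close>

locale surface = ideal_sheaf X for X +
  fixes eqn :: "4 \<Rightarrow> ratfun"
  assumes eqn_chart_ring: "eqn j \<in> chart_ring j"
    and stalk_eqn: "q \<in> chart j ==> stalk X q = gen (\<O> q) {eqn j}"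
    and pencil: "q \<in> chart j ==> eqn j \<in> max_ideal q ==> \<exists>y z. regular_pencil (\<O> q) (max_ideal q) (eqn j) y z"
    and eqn_nonzero: "eqn j \<noteq> 0"

lemma smooth_surface_locale:
  assumes "smooth_surface d X" obtains eqn where "surface X eqn"
proof -
  obtain F where F: "form d F" "X = hypersurface d F"
    "\<And>v. v \<noteq> 0 ==> F v = 0 ==> \<exists>i. deriv (\<lambda>t. F (v + axis i t)) 0 \<noteq> 0"
    using assms unfolding smooth_surface_def by blast
  have "\<exists>g. g \<in> chart_ring j \<and> (\<forall>q. q \<in> chart j \<longrightarrow> val q g = F (nrm j q))" for j
    using form_dehomogenize[OF F(1), of j] by metis
  then obtain f where f: "\<And>j. f j \<in> chart_ring j" "\<And>j q. q \<in> chart j ==> val q (f j) = F (nrm j q)" by metis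
  note st = hypersurface_stalk[OF F(1) f]
  have pen: "\<exists>y z. regular_pencil (\<O> q) (max_ideal q) (f j) y z" if "q \<in> chart j" "f j \<in> max_ideal q" for q j
    using smooth_point_pencil[OF F(1,3) that(1) f that(2)] by metis
  \<comment> \<open>If the equation were zero, every point of the chart would lie on the surface,
    while the equation never lies in the ideal of the other two parameters.\<close>
  have nz: "f j \<noteq> 0" for j
  proof
    assume 0: "f j = 0"
    obtain q where q: "q \<in> chart j" using chart_nonempty by blast
    have "f j \<in> max_ideal q" using 0 idealD(2)[OF max_ideal_ideal] by simp
    then obtain y z where "regular_pencil (\<O> q) (max_ideal q) (f j) y z" using pen q by blast
    then have "f j \<notin> gen (\<O> q) {y + of_nat 0 * z, z}"
      using regular_pencil.sys regular_system.F_notin by blast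
    then show False using 0 gen.zero[of "\<O> q" "{y + of_nat 0 * z, z}"] by simp
  qed
  have "surface X f"
    unfolding surface_def surface_axioms_def F(2) using st f(1) pen nz by auto
  then show ?thesis by (rule that)
qed

context surface
begin

lemma eqn_stalk: "q \<in> chart j ==> eqn j \<in> \<O> q"
  by (rule chart_ring_stalk[OF eqn_chart_ring])

lemma eqn_in: "q \<in> chart j ==> eqn j \<in> stalk X q"
  using stalk_eqn[of q j] stalk.gen_incl[of "{eqn j}" q] by auto

lemma off_surface:
  assumes "q \<in> chart j" "eqn j \<notin> max_ideal q" shows "stalk X q = \<O> q"
  using loc.unit_cancel[OF stalk_ideal eqn_stalk[OF assms(1)] assms(2), of 1] eqn_in[OF assms(1)]
    stalk.ideal_one[OF stalk_ideal] by simp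

end

definition divisor_equation :: "ideal \<Rightarrow> ideal \<Rightarrow> p3 \<Rightarrow> ratfun \<Rightarrow> bool" where
  "divisor_equation X D q h \<longleftrightarrow> h \<in> stalk D q \<and>
     stalk D q = {a * h + b | a b. a \<in> \<O> q \<and> b \<in> stalk X q} \<and>
     (\<forall>g\<in>\<O> q. g * h \<in> stalk X q \<longrightarrow> g \<in> stalk X q)"

lemma effective_divisor_equation:
  assumes X: "ideal_sheaf X" and D: "effective_divisor X D"
  obtains U h where "zopen U" "p \<in> U" "\<And>q. q \<in> U ==> divisor_equation X D q h"
proof -
  interpret X: ideal_sheaf X by fact
  have "closed_subscheme D" and XD: "X \<le> D" using D by (auto simp: effective_divisor_def)
  then interpret D: ideal_sheaf D by (simp add: closed_subscheme_ideal_sheaf)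
  let ?N = "\<lambda>f W. {Add OP W (Smul OP W a (Res OP W f)) b | a b. a \<in> Sec OP W \<and> b \<in> X W}"
  have "\<exists>U. zopen U \<and> p \<in> U \<and> (\<exists>f\<in>D U. \<forall>V. zopen V \<and> V \<subseteq> U \<longrightarrow> D V = localize OP (?N f) V \<and>
          (\<forall>g\<in>Sec OP V. Smul OP V g (Res OP V f) \<in> X V \<longrightarrow> g \<in> X V))"
    using D unfolding effective_divisor_def by blast
  then obtain U f where U: "zopen U" "p \<in> U" "f \<in> D U"
    and f: "\<forall>V. zopen V \<and> V \<subseteq> U \<longrightarrow> D V = localize OP (?N f) V \<and>
          (\<forall>g\<in>Sec OP V. Smul OP V g (Res OP V f) \<in> X V \<longrightarrow> g \<in> X V)" by (elim exE conjE bexE)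
  have XDp: "stalk X q \<subseteq> stalk D q" for q using ideal_sheaf_le_iff[OF X D.ideal_sheaf_axioms] XD by blast
  define h where "h = germ f"
  have fS: "f \<in> Sec OP U" by (rule D.Sec[OF U(3)])
  show ?thesis
  proof (rule that[OF U(1,2)])
    fix q assume q: "q \<in> U"
    show "divisor_equation X D q h" unfolding divisor_equation_def
    proof (intro conjI ballI impI)
      show hD: "h \<in> stalk D q" unfolding h_def by (rule D.germ_stalk[OF U(3) q])
      show "stalk D q = {a * h + b | a b. a \<in> \<O> q \<and> b \<in> stalk X q}"
      proof
        show "stalk D q \<subseteq> {a * h + b | a b. a \<in> \<O> q \<and> b \<in> stalk X q}"
        proof
          fix k assume "k \<in> stalk D q"
          then obtain V g where g: "zopen V" "q \<in> V" "g \<in> Sec OP V" "g \<in> D V" "k = germ g" by (rule stalk_atE)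
          let ?V = "U \<inter> V"
          have V: "zopen ?V" "q \<in> ?V" using g U q by auto
          have "Res OP ?V g \<in> D ?V" by (rule D.res[OF g(1,4) V(1)]) simp
          then have "Res OP ?V g \<in> localize OP (?N f) ?V" using f V(1) by auto
          then obtain W where W: "zopen W" "q \<in> W" "W \<subseteq> ?V" "Res OP W (Res OP ?V g) \<in> ?N f W"
            unfolding localize_def using V(2) by blast
          then obtain a b where ab: "Res OP W (Res OP ?V g) = Add OP W (Smul OP W a (Res OP W f)) b" "a \<in> Sec OP W" "b \<in> X W" by blast
          have WU: "W \<subseteq> U" "W \<subseteq> V" "W \<noteq> {}" using W(2,3) by auto
          have "Res OP W (Res OP ?V g) = Res OP W g" by (rule Res_Add_Smul_OP(3)[OF W(3)])
          then have "k = germ (Res OP W (Res OP ?V g))" using Res_OP(2)[OF g(3) W(1) WU(2,3)] g(5) by simp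
          also have "\<dots> = germ a * h + germ b"
            unfolding ab(1) using Smul_OP[OF ab(2) Res_OP(1)[OF fS W(1) WU(1)], of W] WU(3)
              Add_OP(2)[of _ W b W] X.Sec[OF ab(3)] Res_OP(2)[OF fS W(1) WU(1,3)] by (simp add: h_def)
          finally show "k \<in> {a * h + b | a b. a \<in> \<O> q \<and> b \<in> stalk X q}"
            using Sec_OP_germ[OF ab(2) W(2)] X.germ_stalk[OF ab(3) W(2)] by blast
        qed
        show "{a * h + b | a b. a \<in> \<O> q \<and> b \<in> stalk X q} \<subseteq> stalk D q"
          using idealD(3)[OF D.stalk_ideal idealD(4)[OF D.stalk_ideal _ hD]] XDp by blast
      qed
      fix g assume g: "g \<in> \<O> q" "g * h \<in> stalk X q"
      obtain V where V: "zopen V" "q \<in> V" "\<And>r. r \<in> V ==> g \<in> \<O> r" using g(1) by (rule stalk_ring_open) blast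
      obtain W where W: "zopen W" "q \<in> W" "\<And>r. r \<in> W ==> g * h \<in> stalk X r" using g(2) by (rule X.stalk_open) blast
      let ?O = "U \<inter> V \<inter> W"
      have O: "zopen ?O" "q \<in> ?O" using U(1) V(1,2) W(1,2) q by auto
      then have O': "?O \<noteq> {}" by blast
      have s: "section_of ?O g \<in> Sec OP ?O" "germ (section_of ?O g) = g" using section_of[OF O(1), of g] V(3) O' by auto
      have R: "Res OP ?O f \<in> Sec OP ?O" "germ (Res OP ?O f) = h" using Res_OP[OF fS O(1)] O' by (auto simp: h_def)
      note S = Smul_OP[OF s(1) R(1), of ?O]
      have "Smul OP ?O (section_of ?O g) (Res OP ?O f) \<in> X ?O"
        using S O' s(2) R(2) W(3) by (simp add: X.mem_iff)
      moreover have "?O \<subseteq> U" by blast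
      ultimately have "section_of ?O g \<in> X ?O" using f O(1) s(1) by blast
      then show "g \<in> stalk X q" using X.germ_stalk[OF _ O(2)] s(2) by metis
    qed
  qed
qed

lemma points_iff: "ideal_sheaf Y ==> p \<in> points Y \<longleftrightarrow> stalk Y p \<subseteq> max_ideal p"
proof -
  assume "ideal_sheaf Y"
  then interpret ideal_sheaf Y .
  show ?thesis
  proof
    assume p: "p \<in> points Y"
    show "stalk Y p \<subseteq> max_ideal p"
    proof
      fix k assume "k \<in> stalk Y p"
      then obtain U f where f: "zopen U" "p \<in> U" "f \<in> Sec OP U" "f \<in> Y U" "k = germ f" by (rule stalk_atE)
      then have "f p = 0" using p by (auto simp: points_def)
      then show "k \<in> max_ideal p" using f Sec_OP_germ[OF f(3,2)] Sec_OP_val[OF f(3,2)] by (simp add: max_ideal_def)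
    qed
  next
    assume M: "stalk Y p \<subseteq> max_ideal p"
    have "f p = 0" if "f \<in> Y U" "p \<in> U" for f U
      using germ_stalk[OF that] M Sec_OP_val[OF Sec[OF that(1)] that(2)] by (auto simp: max_ideal_def)
    then show "p \<in> points Y" by (auto simp: points_def)
  qed
qed

lemma points_iff_one: "ideal_sheaf Y ==> p \<in> points Y \<longleftrightarrow> 1 \<notin> stalk Y p"
  using points_iff[of Y p] loc.proper_ideal_le_M[OF ideal_sheaf.stalk_ideal, of Y p] loc.one_notin_M[of p] by blast

lemma quot_support_iff:
  assumes I: "ideal_sheaf I" and J: "ideal_sheaf J"
  shows "quot_support I J = {p. \<not> stalk J p \<subseteq> stalk I p}"
proof -
  interpret I: ideal_sheaf I by fact
  interpret J: ideal_sheaf J by fact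
  have "(\<exists>U. p \<in> U \<and> (\<exists>f\<in>J U. \<forall>V. zopen V \<and> p \<in> V \<and> V \<subseteq> U \<longrightarrow> Res OP V f \<notin> I V)) \<longleftrightarrow>
      \<not> stalk J p \<subseteq> stalk I p" for p
  proof
    assume "\<exists>U. p \<in> U \<and> (\<exists>f\<in>J U. \<forall>V. zopen V \<and> p \<in> V \<and> V \<subseteq> U \<longrightarrow> Res OP V f \<notin> I V)"
    then obtain U f where f: "p \<in> U" "f \<in> J U" "\<And>V. zopen V ==> p \<in> V ==> V \<subseteq> U ==> Res OP V f \<notin> I V" by blast
    have "germ f \<notin> stalk I p"
    proof
      assume "germ f \<in> stalk I p"
      then obtain V where V: "zopen V" "p \<in> V" "\<And>q. q \<in> V ==> germ f \<in> stalk I q" by (rule I.stalk_open) blast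
      let ?W = "U \<inter> V"
      have W: "zopen ?W" "p \<in> ?W" using V f(1) Sec_OP_open[OF J.Sec[OF f(2)]] by auto
      then have "section_of ?W (germ f) \<in> I ?W" using V(3) by (intro I.section_mem) auto
      moreover have "section_of ?W (germ f) = Res OP ?W f" by (rule section_of_eq[OF W(1) J.Sec[OF f(2)]]) (use W in auto)
      ultimately show False using f(3)[OF W] by auto
    qed
    then show "\<not> stalk J p \<subseteq> stalk I p" using J.germ_stalk[OF f(2,1)] by blast
  next
    assume "\<not> stalk J p \<subseteq> stalk I p"
    then obtain k where k: "k \<in> stalk J p" "k \<notin> stalk I p" by blast
    obtain U f where f: "zopen U" "p \<in> U" "f \<in> Sec OP U" "f \<in> J U" "k = germ f" using k(1) by (rule stalk_atE)
    have "Res OP V f \<notin> I V" if "zopen V" "p \<in> V" "V \<subseteq> U" for V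
    proof
      assume "Res OP V f \<in> I V"
      then have "germ (Res OP V f) \<in> stalk I p" using I.germ_stalk that(2) by blast
      moreover have "V \<noteq> {}" using that(2) by auto
      ultimately show False using Res_OP(2)[OF f(3) that(1,3)] f(5) k(2) by simp
    qed
    then show "\<exists>U. p \<in> U \<and> (\<exists>f\<in>J U. \<forall>V. zopen V \<and> p \<in> V \<and> V \<subseteq> U \<longrightarrow> Res OP V f \<notin> I V)"
      using f(2,4) by blast
  qed
  then show ?thesis by (simp add: quot_support_def)
qed

section \<open>Curves\<close>

lemma finite_avoid:
  assumes "finite S" shows "zopen (- (S - {p}))"
proof -
  have "closedin zariski (\<Union>q\<in>S - {p}. {q})"
    using assms closedin_zariski_point by (intro closedin_Union) auto
  then show ?thesis by (simp add: closedin_zariski_Compl)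
qed

lemma punctured_unit:
  assumes "p \<in> chart j" "q \<in> chart j" "q \<noteq> p" obtains i where "i \<noteq> j" "xc j p i \<notin> max_ideal q"
proof -
  have "nrm j q \<noteq> nrm j p" using nrm_inj[OF assms(2,1)] assms(3) by blast
  then obtain i where i: "nrm j q $ i \<noteq> nrm j p $ i" by (metis vec_eq_iff)
  then have "i \<noteq> j" using nrm_coords(2) assms(1,2) by metis
  moreover have "xc j p i \<notin> max_ideal q" using i by (simp add: max_ideal_def val_xc assms)
  ultimately show ?thesis by (rule that)
qed

text \<open>An element \<open>s\<close> violating depth at \<open>p\<close> can be added to the
  ideal at \<open>p\<close> alone. The result is still coherent, and the corresponding subsheaf of
  the structure sheaf is supported at the one point \<open>p\<close>, contrary to purity.\<close>

lemma curve_deep: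
  assumes C: "curve C" shows "loc.deep p (stalk C p)"
proof (rule ccontr)
  have "closed_subscheme C" using C by (simp add: curve_def)
  then interpret C: ideal_sheaf C by (rule closed_subscheme_ideal_sheaf)
  have ft: "fin_type (stalk C)" using \<open>closed_subscheme C\<close> by (simp add: closed_subscheme_iff)
  assume "\<not> loc.deep p (stalk C p)"
  then obtain s where s: "s \<in> \<O> p" "\<forall>m\<in>max_ideal p. m * s \<in> stalk C p" "s \<notin> stalk C p"
    unfolding loc.deep_def using C.stalk_ideal by blast
  obtain j where p: "p \<in> chart j" by (rule chart_cover)
  obtain U S where U: "zopen U" "p \<in> U" "finite S" "\<And>q. q \<in> U ==> S \<subseteq> stalk C q"
    "\<And>q. q \<in> U ==> stalk C q = gen (\<O> q) S" by (rule fin_typeE[OF ft, of p]) blast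
  obtain V where V: "zopen V" "p \<in> V" "\<And>q. q \<in> V ==> s \<in> \<O> q" using s(1) by (rule stalk_ring_open) blast
  have "(\<lambda>i. xc j p i * s) ` UNIV \<subseteq> stalk C p" using s(2) xc_max_ideal[OF p] by blast
  then obtain W where W: "zopen W" "p \<in> W" "\<And>q. q \<in> W ==> (\<lambda>i. xc j p i * s) ` UNIV \<subseteq> stalk C q"
    using C.finite_stalk_open[of "(\<lambda>i. xc j p i * s) ` UNIV" p] by (metis finite finite_imageI)
  define Q where "Q = U \<inter> V \<inter> W \<inter> chart j"
  have Q: "zopen Q" "p \<in> Q" using U V W p openin_chart[of j] by (auto simp: Q_def)
  have sq: "s \<in> stalk C q" if q: "q \<in> Q" "q \<noteq> p" for q
  proof -
    obtain i where "xc j p i \<notin> max_ideal q" using punctured_unit[OF p, of q] q by (auto simp: Q_def)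
    moreover have "xc j p i * s \<in> stalk C q" using W(3) q by (auto simp: Q_def)
    ultimately show ?thesis using loc.unit_cancel[OF C.stalk_ideal, of "xc j p i" q s] q by (auto simp: Q_def)
  qed
  \<comment> \<open>Near \<open>p\<close> this is the ideal generated by \<open>S\<close> and
    \<open>s\<close> at every point, because off \<open>p\<close> some centred coordinate is a unit
    and puts \<open>s\<close> into the stalk of \<open>C\<close>. This is why \<open>J\<close> is a
    sheaf of finite type.\<close>
  define J where "J q = (if q = p then gen (\<O> q) (insert s S) else stalk C q)" for q
  have SO: "insert s S \<subseteq> \<O> q" if "q \<in> Q" for q
    using that U(4) V(3) stalk_at_subset by (fastforce simp: Q_def)
  have JO: "J q = gen (\<O> q) (insert s S)" if q: "q \<in> Q" for q
  proof (cases "q = p")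
    case False
    have "insert s S \<subseteq> stalk C q" using sq[OF q False] U(4) q by (auto simp: Q_def)
    then have "gen (\<O> q) (insert s S) \<subseteq> stalk C q" by (rule gen_least[OF C.stalk_ideal])
    moreover have "stalk C q \<subseteq> gen (\<O> q) (insert s S)"
      using U(5) q gen_mono[of S "insert s S" "\<O> q"] by (auto simp: Q_def)
    ultimately show ?thesis using False by (simp add: J_def)
  qed (simp add: J_def)
  have Jid: "ideal_in (\<O> q) (J q)" for q
    using stalk.gen_ideal[OF SO[OF Q(2)]] C.stalk_ideal by (simp add: J_def)
  have Jopen: "\<exists>U. zopen U \<and> q \<in> U \<and> (\<forall>r\<in>U. k \<in> J r)" if k: "k \<in> J q" for q k
  proof (cases "q = p")
    case True
    then have "k \<in> gen (\<O> p) (insert s S)" using k by (simp add: J_def)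
    then obtain N where N: "zopen N" "p \<in> N" "\<And>r. r \<in> N ==> k \<in> gen (\<O> r) (insert s S)"
      by (rule gen_stalk_open) blast
    then show ?thesis using Q JO True by (intro exI[of _ "N \<inter> Q"]) auto
  next
    case False
    then have "k \<in> stalk C q" using k by (simp add: J_def)
    then obtain N where N: "zopen N" "q \<in> N" "\<And>r. r \<in> N ==> k \<in> stalk C r" by (rule C.stalk_open) blast
    have "zopen (- {p})" using closedin_zariski_point closedin_zariski_Compl by blast
    then show ?thesis using N False by (intro exI[of _ "N \<inter> - {p}"]) (auto simp: J_def)
  qed
  note Js = sheaf_of_ideal_sheaf[of J, OF Jid Jopen]
  have "fin_type J" unfolding fin_type_def
  proof
    fix q
    show "\<exists>U S. zopen U \<and> q \<in> U \<and> finite S \<and> (\<forall>r\<in>U. S \<subseteq> J r \<and> J r = gen (\<O> r) S)"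
    proof (cases "q = p")
      case True
      have "insert s S \<subseteq> J r" if "r \<in> Q" for r using JO[OF that] stalk.gen_incl[of "insert s S" r] by simp
      then show ?thesis using Q JO U(3) True by (intro exI[of _ Q] exI[of _ "insert s S"]) auto
    next
      case False
      obtain N T where N: "zopen N" "q \<in> N" "finite T" "\<And>r. r \<in> N ==> T \<subseteq> stalk C r"
        "\<And>r. r \<in> N ==> stalk C r = gen (\<O> r) T" by (rule fin_typeE[OF ft, of q]) blast
      have "zopen (- {p})" using closedin_zariski_point closedin_zariski_Compl by blast
      then have "zopen (N \<inter> - {p})" using N(1) by blast
      then show ?thesis using N False by (intro exI[of _ "N \<inter> - {p}"] exI[of _ T]) (auto simp: J_def)
    qed
  qed
  moreover have "stalk (sheaf_of J) = J" by (rule ext) (rule Js(2))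
  ultimately have cl: "closed_subscheme (sheaf_of J)" using Js(1) by (simp add: closed_subscheme_iff)
  have CJ: "stalk C q \<subseteq> J q" for q
    using JO[OF Q(2)] U(2,5) gen_mono[of S "insert s S" "\<O> p"] by (auto simp: J_def)
  then have "C \<le> sheaf_of J" using ideal_sheaf_le_iff[OF C.ideal_sheaf_axioms Js(1)] Js(2) by simp
  moreover have "s \<in> J p" using stalk.gen_incl[of "insert s S" p] by (simp add: J_def)
  then have "sheaf_of J \<noteq> C" using Js(2)[of p] s(3) by auto
  ultimately have "has_krull_dim (subtopology zariski (quot_support C (sheaf_of J))) 1"
    using C cl unfolding curve_def by blast
  moreover have "quot_support C (sheaf_of J) \<subseteq> {p}"
  proof
    fix q assume "q \<in> quot_support C (sheaf_of J)"
    then have "\<not> J q \<subseteq> stalk C q" using quot_support_iff[OF C.ideal_sheaf_axioms Js(1)] Js(2) by simp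
    then show "q \<in> {p}" by (auto simp: J_def split: if_splits)
  qed
  ultimately obtain Z where Z: "\<forall>i\<le>1. irreducible_closed (subtopology zariski (quot_support C (sheaf_of J))) (Z i)"
      "\<forall>i<(1::nat). Z i \<subset> Z (Suc i)"
    unfolding has_krull_dim_def irreducible_chain_def by blast
  have "Z 0 \<noteq> {}" "Z 1 \<subseteq> {p}" "Z 0 \<subset> Z 1"
    using Z(1)[rule_format, of 0] Z(1)[rule_format, of 1] Z(2)[rule_format, of 0] \<open>quot_support C _ \<subseteq> {p}\<close>
      closedin_subset[of "subtopology zariski (quot_support C (sheaf_of J))" "Z 1"]
    by (auto simp: irreducible_closed_def)
  then show False by blast
qed

text \<open>Sections over a punctured neighbourhood: the Nullstellensatz shows that a section which
  belongs to an ideal away from a point does so at that point after multiplication by a power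
  of each coordinate.\<close>

lemma coordinate_power_kills:
  assumes I: "closed_subscheme I" and U: "zopen U" "p \<in> U" and p: "p \<in> chart j"
    and s: "s \<in> \<O> p" "\<And>q. q \<in> U ==> q \<noteq> p ==> s \<in> stalk I q"
  shows "\<exists>k. xc j p i ^ k * s \<in> stalk I p"
proof -
  interpret I: ideal_sheaf I by (rule closed_subscheme_ideal_sheaf[OF I])
  have ft: "fin_type (stalk I)" using I by (simp add: closed_subscheme_iff)
  obtain V T where V: "zopen V" "p \<in> V" "finite T" "\<And>q. q \<in> V ==> T \<subseteq> stalk I q"
    "\<And>q. q \<in> V ==> stalk I q = gen (\<O> q) T" by (rule fin_typeE[OF ft, of p]) blast
  have "zopen (U \<inter> V)" "p \<in> U \<inter> V" using U V by auto
  then obtain B where B: "B \<in> chart_ring j" "val p B \<noteq> 0" "\<And>q. q \<in> chart j ==> val q B \<noteq> 0 ==> q \<in> U \<inter> V"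
    using chart_basic_neighbourhood[OF _ _ p, of "U \<inter> V"] by metis
  obtain g h where gh: "g \<in> chart_ring j" "h \<in> chart_ring j" "val p h \<noteq> 0" "h * s = g"
    using stalk_fraction[OF s(1) p] by blast
  have Tp: "t \<in> \<O> p" if "t \<in> T" for t using V(2,4) stalk_at_subset that by blast
  have "\<exists>n d. n \<in> chart_ring j \<and> d \<in> chart_ring j \<and> val p d \<noteq> 0 \<and> d * t = n" if "t \<in> T" for t
    using stalk_fraction[OF Tp[OF that] p] by metis
  then obtain num den where nd: "\<And>t. t \<in> T ==> num t \<in> chart_ring j" "\<And>t. t \<in> T ==> den t \<in> chart_ring j"
    "\<And>t. t \<in> T ==> val p (den t) \<noteq> 0" "\<And>t. t \<in> T ==> den t * t = num t" by metis
  define L where "L = num ` T"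
  have L: "L \<subseteq> chart_ring j" using nd(1) by (auto simp: L_def)
  define G where "G = gen (chart_ring j) L"
  have Gid: "ideal_in (chart_ring j) G" unfolding G_def by (rule chart.gen_ideal[OF L])
  \<comment> \<open>The conductor of \<open>g\<close> into \<open>G\<close>. It is nonzero at each
    point where \<open>s\<close> lies in the ideal and the denominators do not vanish.\<close>
  define b where "b = {c \<in> chart_ring j. c * g \<in> G}"
  have bid: "ideal_in (chart_ring j) b"
    unfolding ideal_in_def
  proof (intro conjI ballI)
    show "b \<subseteq> chart_ring j" by (auto simp: b_def)
    show "0 \<in> b" using idealD(2)[OF Gid] by (simp add: b_def)
    fix a assume a: "a \<in> b"
    show "a + c \<in> b" if c: "c \<in> b" for c
      using a c idealD(3)[OF Gid, of "a * g" "c * g"] by (auto simp: b_def distrib_right)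
    show "r * a \<in> b" if r: "r \<in> chart_ring j" for r
      using a r idealD(4)[OF Gid r, of "a * g"] by (auto simp: b_def mult.assoc)
  qed
  \<comment> \<open>\<open>B\<close> confines attention to the neighbourhood on which everything is
    known, the other factors are the denominators. The coordinate \<open>xc j p i\<close> multiplied
    on later excludes \<open>p\<close> itself.\<close>
  define D where "D = B * h * (\<Prod>t\<in>T. den t)"
  have denT: "(\<Prod>t\<in>T. den t) \<in> chart_ring j" using nd(2) by (intro chart.prod_closed)
  have Dc: "D \<in> chart_ring j" unfolding D_def using B gh denT by auto
  have valD: "val q D = val q B * val q h * (\<Prod>t\<in>T. val q (den t))" if q: "q \<in> chart j" for q
  proof -
    have "val q (\<Prod>t\<in>T. den t) = (\<Prod>t\<in>T. val q (den t))"
      using nd(2) chart_ring_stalk q by (intro val_prod) blast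
    then show ?thesis unfolding D_def using B(1) gh(2) denT chart_ring_stalk[OF _ q] by simp
  qed
  have zeros: "\<exists>c\<in>b. val q c \<noteq> 0" if q: "q \<in> chart j" "val q (D * xc j p i) \<noteq> 0" for q
  proof -
    have nz: "val q B \<noteq> 0" "val q h \<noteq> 0" "\<And>t. t \<in> T ==> val q (den t) \<noteq> 0" "val q (xc j p i) \<noteq> 0"
      using q(2) valD[OF q(1)] chart_ring_stalk[OF Dc q(1)] q(1) V(3) by auto
    have qUV: "q \<in> U" "q \<in> V" using B(3)[OF q(1) nz(1)] by auto
    have "q \<noteq> p" using nz(4) p by (auto simp: val_xc)
    then have "s \<in> stalk I q" using s(2) qUV by blast
    then have sG: "s \<in> gen (\<O> q) T" using V(5) qUV by blast
    have LG: "ideal_in (\<O> q) (gen (\<O> q) L)"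
      using L chart_ring_stalk[OF _ q(1)] by (intro stalk.gen_ideal) blast
    have "t \<in> gen (\<O> q) L" if t: "t \<in> T" for t
    proof -
      have "den t * t \<in> gen (\<O> q) L" using nd(4)[OF t] stalk.gen_incl[of L q] t by (auto simp: L_def)
      moreover have "den t \<notin> max_ideal q" using nz(3)[OF t] by (simp add: max_ideal_def)
      ultimately show ?thesis using loc.unit_cancel[OF LG chart_ring_stalk[OF nd(2)[OF t] q(1)]] by blast
    qed
    then have "gen (\<O> q) T \<subseteq> gen (\<O> q) L" by (intro gen_least[OF LG]) blast
    then have "h * s \<in> gen (\<O> q) L" using sG idealD(4)[OF LG chart_ring_stalk[OF gh(2) q(1)]] by blast
    then have "g \<in> gen (\<O> q) L" by (simp add: gh(4))
    then obtain c where "c \<in> chart_ring j" "val q c \<noteq> 0" "c * g \<in> gen (chart_ring j) L" by (rule gen_clear[OF q(1) L])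
    then show ?thesis by (intro bexI[of _ c]) (auto simp: b_def G_def)
  qed
  have xD: "D * xc j p i \<in> chart_ring j" using Dc by simp
  obtain k where "(D * xc j p i) ^ k \<in> b" by (rule chart_nullstellensatz[OF bid xD zeros])
  then have inG: "(D * xc j p i) ^ k * g \<in> G" by (simp add: b_def)
  have sub: "chart_ring j \<subseteq> \<O> p" using chart_ring_stalk[OF _ p] by blast
  have LI: "L \<subseteq> stalk I p"
  proof
    fix l assume "l \<in> L"
    then obtain t where t: "t \<in> T" "l = den t * t" using nd(4) by (auto simp: L_def)
    then show "l \<in> stalk I p" using idealD(4)[OF I.stalk_ideal, of "den t" p t] nd(2) sub V(2,4) by blast
  qed
  have "G \<subseteq> stalk I p"
    unfolding G_def using gen_subring_mono[OF sub, of L] gen_least[OF I.stalk_ideal LI] by blast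
  then have "(D ^ k * h) * (xc j p i ^ k * s) \<in> stalk I p"
    using inG by (auto simp: gh(4)[symmetric] power_mult_distrib ac_simps)
  moreover have "D ^ k * h \<notin> max_ideal p"
    using valD[OF p] B(2) gh(2,3) nd(3) V(3) chart_ring_stalk[OF Dc p] chart_ring_stalk[OF gh(2) p]
    by (simp add: max_ideal_def)
  ultimately have "xc j p i ^ k * s \<in> stalk I p"
    using loc.unit_cancel[OF I.stalk_ideal, of "D ^ k * h" p] Dc gh(2) sub by blast
  then show ?thesis by blast
qed

text \<open>Depth one at \<open>p\<close> means that membership in the ideal extends over the
  puncture: by the Nullstellensatz powers of all coordinates multiply \<open>s\<close> into the
  ideal, and \<open>deep_nilpotent\<close> removes them.\<close>

lemma deep_extension:
  assumes I: "closed_subscheme I" and deep: "loc.deep p (stalk I p)" and U: "zopen U" "p \<in> U"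
    and s: "s \<in> \<O> p" "\<And>q. q \<in> U ==> q \<noteq> p ==> s \<in> stalk I q"
  shows "s \<in> stalk I p"
proof -
  obtain j where p: "p \<in> chart j" by (rule chart_cover)
  show ?thesis
    by (rule loc.deep_nilpotent[OF deep _ _ max_ideal_gen[OF p] s(1)])
      (use coordinate_power_kills[OF I U p s] p in auto)
qed

section \<open>Dimension of closed sets and the local criterion for curves\<close>

lemma irreducible_closed_subtopology:
  assumes S: "closedin zariski S"
  shows "irreducible_closed (subtopology zariski S) Z \<longleftrightarrow> irreducible_closed zariski Z \<and> Z \<subseteq> S"
proof -
  have cl: "closedin (subtopology zariski S) A \<longleftrightarrow> closedin zariski A \<and> A \<subseteq> S" for A
    by (rule closedin_closed_subtopology[OF S])
  show ?thesis
  proof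
    assume Z: "irreducible_closed (subtopology zariski S) Z"
    then have Zc: "closedin zariski Z" "Z \<subseteq> S" "Z \<noteq> {}" using cl by (auto simp: irreducible_closed_def)
    have "Z \<subseteq> A \<or> Z \<subseteq> B" if AB: "closedin zariski A" "closedin zariski B" "Z \<subseteq> A \<union> B" for A B
    proof -
      have "closedin (subtopology zariski S) (A \<inter> S)" "closedin (subtopology zariski S) (B \<inter> S)"
        unfolding cl using AB S by auto
      moreover have "Z \<subseteq> (A \<inter> S) \<union> (B \<inter> S)" using AB Zc by auto
      ultimately have "Z \<subseteq> A \<inter> S \<or> Z \<subseteq> B \<inter> S" using Z unfolding irreducible_closed_def by blast
      then show ?thesis by auto
    qed
    then show "irreducible_closed zariski Z \<and> Z \<subseteq> S" using Zc by (auto simp: irreducible_closed_def)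
  next
    assume Z: "irreducible_closed zariski Z \<and> Z \<subseteq> S"
    then show "irreducible_closed (subtopology zariski S) Z"
      unfolding irreducible_closed_def cl by blast
  qed
qed

text \<open>Dimension at most one, in a form that obviously passes to subsets and also holds for the
  empty set.\<close>

definition no_surface :: "p3 set \<Rightarrow> bool" where
  "no_surface S \<longleftrightarrow> \<not> (\<exists>Z :: nat \<Rightarrow> p3 set. (\<forall>i\<le>2. irreducible_closed zariski (Z i)) \<and> (\<forall>i<2. Z i \<subset> Z (Suc i)) \<and> Z 2 \<subseteq> S)"

text \<open>Containment of \<open>J\<close> in \<open>I\<close> need only be tested on finitely many
  generators of \<open>J\<close>, and each test is an open condition.\<close>

lemma closedin_support:
  assumes I: "ideal_sheaf I" and J: "ideal_sheaf J" "fin_type (stalk J)"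
  shows "closedin zariski {p. \<not> stalk J p \<subseteq> stalk I p}"
proof -
  interpret I: ideal_sheaf I by fact
  interpret J: ideal_sheaf J by fact
  have "zopen {p. stalk J p \<subseteq> stalk I p}"
  proof (rule openin_zariski_subopen)
    fix p assume "p \<in> {p. stalk J p \<subseteq> stalk I p}"
    then have p: "stalk J p \<subseteq> stalk I p" by simp
    obtain V T where V: "zopen V" "p \<in> V" "finite T" "\<And>q. q \<in> V ==> T \<subseteq> stalk J q"
      "\<And>q. q \<in> V ==> stalk J q = gen (\<O> q) T" by (rule fin_typeE[OF J(2), of p]) blast
    have "T \<subseteq> stalk I p" using V(2,4) p by blast
    then obtain W where W: "zopen W" "p \<in> W" "\<And>q. q \<in> W ==> T \<subseteq> stalk I q"
      by (rule I.finite_stalk_open[OF V(3)]) blast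
    have "V \<inter> W \<subseteq> {p. stalk J p \<subseteq> stalk I p}"
    proof
      fix q assume "q \<in> V \<inter> W"
      then have that: "q \<in> V" "q \<in> W" by auto
      show "q \<in> {p. stalk J p \<subseteq> stalk I p}"
        using V(5)[OF that(1)] gen_least[OF I.stalk_ideal W(3)[OF that(2)]] by simp
    qed
    then show "\<exists>V. zopen V \<and> p \<in> V \<and> V \<subseteq> {p. stalk J p \<subseteq> stalk I p}"
      using V(1,2) W(1,2) by (intro exI[of _ "V \<inter> W"]) blast
  qed
  moreover have "- {p. \<not> stalk J p \<subseteq> stalk I p} = {p. stalk J p \<subseteq> stalk I p}" by auto
  ultimately show ?thesis by (simp add: closedin_zariski_Compl)
qed

text \<open>The converse to purity. Depth forbids nonzero subsheaves with finite support, by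
  \<open>deep_extension\<close>; an infinite closed support contains an infinite irreducible set and
  hence a chain of length one, and \<open>no_surface\<close> forbids a longer one.\<close>

lemma curveI:
  assumes I: "closed_subscheme I" and deep: "\<And>p. loc.deep p (stalk I p)" and dim: "no_surface (points I)"
  shows "curve I"
  unfolding curve_def
proof (intro conjI allI impI I)
  fix J assume J: "closed_subscheme J \<and> I \<le> J \<and> J \<noteq> I"
  interpret I: ideal_sheaf I by (rule closed_subscheme_ideal_sheaf[OF I])
  interpret J: ideal_sheaf J using J closed_subscheme_ideal_sheaf by blast
  define S where "S = quot_support I J"
  have S: "S = {p. \<not> stalk J p \<subseteq> stalk I p}"
    unfolding S_def by (rule quot_support_iff[OF I.ideal_sheaf_axioms J.ideal_sheaf_axioms])
  have cS: "closedin zariski S"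
    unfolding S using J by (intro closedin_support[OF I.ideal_sheaf_axioms J.ideal_sheaf_axioms]) (simp add: closed_subscheme_iff)
  have "S \<noteq> {}"
  proof
    assume "S = {}"
    then have "J \<le> I" using ideal_sheaf_le_iff[OF J.ideal_sheaf_axioms I.ideal_sheaf_axioms] S by auto
    then show False using J by auto
  qed
  have inf: "infinite S"
  proof
    assume fin: "finite S"
    obtain p where p: "p \<in> S" using \<open>S \<noteq> {}\<close> by auto
    then obtain s where s: "s \<in> stalk J p" "s \<notin> stalk I p" using S by auto
    obtain U where U: "zopen U" "p \<in> U" "\<And>q. q \<in> U ==> s \<in> stalk J q" using s(1) by (rule J.stalk_open) blast
    have "zopen (U \<inter> - (S - {p}))" using U(1) finite_avoid[OF fin] by blast
    then have "s \<in> stalk I p"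
    proof (rule deep_extension[OF I deep])
      show "p \<in> U \<inter> - (S - {p})" using U(2) by auto
      show "s \<in> \<O> p" using s(1) stalk_at_subset by blast
      show "s \<in> stalk I q" if "q \<in> U \<inter> - (S - {p})" "q \<noteq> p" for q
      proof -
        have "q \<notin> S" using that by blast
        then have "stalk J q \<subseteq> stalk I q" by (simp add: S)
        then show ?thesis using U(3) that(1) by blast
      qed
    qed
    then show False using s(2) by simp
  qed
  have SI: "S \<subseteq> points I"
  proof
    fix p assume "p \<in> S"
    then have "stalk I p \<noteq> \<O> p" using stalk_at_subset[of J p] by (auto simp: S)
    then have "1 \<notin> stalk I p" using stalk.ideal_one[OF I.stalk_ideal] by blast
    then show "p \<in> points I" using points_iff_one[OF I.ideal_sheaf_axioms] by blast
  qed
  have "irreducible_chain (subtopology zariski S) 1"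
  proof -
    obtain Z where Z: "irreducible_closed zariski Z" "Z \<subseteq> S" "infinite Z"
      using infinite_closed_irreducible[OF cS inf] by blast
    obtain p where p: "p \<in> Z" using Z(3) by (metis finite.emptyI ex_in_conv)
    have "{p} \<noteq> Z" using Z(3) by auto
    then have "{p} \<subset> Z" using p by auto
    moreover have "irreducible_closed zariski {p}" by (rule irreducible_point)
    ultimately show ?thesis
      unfolding irreducible_chain_def irreducible_closed_subtopology[OF cS]
      using Z(1,2) p by (intro exI[of _ "\<lambda>i. if i = 0 then {p} else Z"]) auto
  qed
  moreover have "\<not> irreducible_chain (subtopology zariski S) (Suc 1)"
  proof
    assume "irreducible_chain (subtopology zariski S) (Suc 1)"
    then obtain Z where Z: "\<forall>i\<le>2. irreducible_closed (subtopology zariski S) (Z i)" "\<forall>i<2. Z i \<subset> Z (Suc i)"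
      unfolding irreducible_chain_def by (auto simp: numeral_2_eq_2)
    then show False using dim SI unfolding no_surface_def irreducible_closed_subtopology[OF cS]
      by (metis order_refl subset_trans)
  qed
  ultimately show "has_krull_dim (subtopology zariski (quot_support I J)) 1"
    unfolding has_krull_dim_def S_def by simp
qed

lemma closed_subscheme_Sec_OP: "closed_subscheme (Sec OP)"
  unfolding closed_subscheme_iff fin_type_def stalk_at_Sec_OP
  using ideal_sheaf_Sec_OP stalk.gen1[of 1]
  by (auto intro!: exI[of _ UNIV] exI[of _ "{1}"])

lemma closedin_points: "ideal_sheaf I ==> closedin zariski (points I)"
proof -
  assume I: "ideal_sheaf I"
  have "points I = {p. \<not> stalk (Sec OP) p \<subseteq> stalk I p}"
    using points_iff_one[OF I] stalk.ideal_one[OF ideal_sheaf.stalk_ideal[OF I]] stalk_at_Sec_OP by blast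
  then show ?thesis
    using closedin_support[OF I ideal_sheaf_Sec_OP] closed_subscheme_Sec_OP by (simp add: closed_subscheme_iff)
qed

text \<open>Purity is applied to the whole structure sheaf of \<open>C\<close>, whose support is the
  set of points of \<open>C\<close>.\<close>

lemma curve_no_surface:
  assumes C: "curve C" shows "no_surface (points C)"
proof (cases "C = Sec OP")
  case True
  then have "points C = {}" using points_iff_one[OF ideal_sheaf_Sec_OP] stalk_at_Sec_OP by auto
  then show ?thesis unfolding no_surface_def irreducible_closed_def by auto
next
  case False
  have cl: "closed_subscheme C" using C by (simp add: curve_def)
  then interpret C: ideal_sheaf C by (rule closed_subscheme_ideal_sheaf)
  have "C \<le> Sec OP" using C.sub by (auto simp: le_fun_def)
  then have dim: "has_krull_dim (subtopology zariski (quot_support C (Sec OP))) 1"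
    using C closed_subscheme_Sec_OP False unfolding curve_def by metis
  have "quot_support C (Sec OP) = points C"
    unfolding quot_support_iff[OF C.ideal_sheaf_axioms ideal_sheaf_Sec_OP] stalk_at_Sec_OP
    using points_iff_one[OF C.ideal_sheaf_axioms] stalk.ideal_one[OF C.stalk_ideal] by blast
  then have "\<not> irreducible_chain (subtopology zariski (points C)) 2"
    using dim by (simp add: has_krull_dim_def numeral_2_eq_2)
  then show ?thesis
    unfolding no_surface_def irreducible_chain_def irreducible_closed_subtopology[OF closedin_points[OF C.ideal_sheaf_axioms]]
  proof (rule contrapos_nn)
    assume "\<exists>Z :: nat \<Rightarrow> p3 set. (\<forall>i\<le>2. irreducible_closed zariski (Z i)) \<and> (\<forall>i<2. Z i \<subset> Z (Suc i)) \<and> Z 2 \<subseteq> points C"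
    then obtain Z :: "nat \<Rightarrow> p3 set" where Z: "\<forall>i\<le>2. irreducible_closed zariski (Z i)" "\<forall>i<2. Z i \<subset> Z (Suc i)" "Z 2 \<subseteq> points C" by blast
    have "Z 0 \<subset> Z 1" "Z 1 \<subset> Z 2" using Z(2)[rule_format, of 0] Z(2)[rule_format, of 1] by (auto simp: numeral_2_eq_2)
    then have "Z i \<subseteq> points C" if "i \<le> 2" for i
    proof -
      have "i = 0 \<or> i = 1 \<or> i = 2" using that by linarith
      then show ?thesis using Z(3) \<open>Z 0 \<subset> Z 1\<close> \<open>Z 1 \<subset> Z 2\<close> by blast
    qed
    then show "\<exists>Z. (\<forall>i\<le>2. irreducible_closed zariski (Z i) \<and> Z i \<subseteq> points C) \<and> (\<forall>i<2. Z i \<subset> Z (Suc i))"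
      using Z by blast
  qed
qed

lemma no_surface_Un:
  assumes "closedin zariski A" "closedin zariski B" "no_surface A" "no_surface B" shows "no_surface (A \<union> B)"
  unfolding no_surface_def
proof
  assume "\<exists>Z :: nat \<Rightarrow> p3 set. (\<forall>i\<le>2. irreducible_closed zariski (Z i)) \<and> (\<forall>i<2. Z i \<subset> Z (Suc i)) \<and> Z 2 \<subseteq> A \<union> B"
  then obtain Z :: "nat \<Rightarrow> p3 set" where Z: "\<forall>i\<le>2. irreducible_closed zariski (Z i)" "\<forall>i<2. Z i \<subset> Z (Suc i)" "Z 2 \<subseteq> A \<union> B" by blast
  have "irreducible_closed zariski (Z 2)" using Z(1) by blast
  then have "Z 2 \<subseteq> A \<or> Z 2 \<subseteq> B" using assms(1,2) Z(3) unfolding irreducible_closed_def by blast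
  then show False using assms(3,4) Z(1,2) unfolding no_surface_def by blast
qed

section \<open>Divisors on a smooth surface\<close>

context surface
begin

lemma divisor_stalk_gen:
  assumes q: "q \<in> chart j" and h: "divisor_equation X D q h"
  shows "stalk D q = gen (\<O> q) {eqn j, h}" "h \<in> \<O> q" "eqn j \<in> stalk D q"
proof -
  have D: "stalk D q = {a * h + b | a b. a \<in> \<O> q \<and> b \<in> stalk X q}" and hD: "h \<in> stalk D q"
    using h by (auto simp: divisor_equation_def)
  show hA: "h \<in> \<O> q" using hD stalk_at_subset by blast
  have "stalk X q = {r * eqn j | r. r \<in> \<O> q}" using stalk_eqn[OF q] stalk.gen1[OF eqn_stalk[OF q]] by simp
  then have "stalk D q = {r * eqn j + a * h | r a. r \<in> \<O> q \<and> a \<in> \<O> q}"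
    unfolding D by (auto simp: add.commute) (metis add.commute)+
  then show 1: "stalk D q = gen (\<O> q) {eqn j, h}" using stalk.gen2[OF eqn_stalk[OF q] hA] by simp
  show "eqn j \<in> stalk D q" unfolding 1 using stalk.gen_incl[of "{eqn j, h}" q] by auto
qed

lemma divisor_deep:
  assumes D: "divisor_equation X D q h" shows "loc.deep q (stalk D q)"
proof -
  obtain j where q: "q \<in> chart j" by (rule chart_cover)
  note st = divisor_stalk_gen[OF q D]
  show ?thesis
  proof (cases "eqn j \<in> max_ideal q")
    case True
    then obtain y z where "regular_pencil (\<O> q) (max_ideal q) (eqn j) y z" using pencil[OF q] by blast
    then interpret P: regular_pencil "\<O> q" "max_ideal q" "eqn j" y z .
    show ?thesis unfolding st(1)
    proof (rule P.deep_divisor[OF st(2)])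
      fix a assume "a \<in> \<O> q" "h * a \<in> gen (\<O> q) {eqn j}"
      then show "a \<in> gen (\<O> q) {eqn j}"
        using D stalk_eqn[OF q] by (auto simp: divisor_equation_def mult.commute)
    qed
  next
    case False
    have "ideal_in (\<O> q) (stalk D q)" unfolding st(1) using st(2) eqn_stalk[OF q] by (intro stalk.gen_ideal) auto
    then have "stalk D q = \<O> q"
      using loc.unit_cancel[OF _ eqn_stalk[OF q] False, of _ 1] st(3) stalk.ideal_one by simp
    then show ?thesis using loc.deep_whole by simp
  qed
qed

text \<open>Three nested irreducible closed subsets of \<open>D\<close> give two nested primes
  strictly below the maximal ideal at a common point. Both contain \<open>eqn j\<close> and a local
  equation \<open>h\<close>, and \<open>h\<close> is no multiple of \<open>eqn j\<close>, since a
  nonzerodivisor modulo \<open>X\<close> that lies in the ideal of \<open>X\<close> forces that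
  ideal to be everything.\<close>

lemma divisor_no_surface:
  assumes D: "ideal_sheaf D" and XD: "X \<le> D" and h: "\<And>p. \<exists>U h. zopen U \<and> p \<in> U \<and> (\<forall>q\<in>U. divisor_equation X D q h)"
  shows "no_surface (points D)"
  unfolding no_surface_def
proof
  interpret D: ideal_sheaf D by fact
  assume "\<exists>Z :: nat \<Rightarrow> p3 set. (\<forall>i\<le>2. irreducible_closed zariski (Z i)) \<and> (\<forall>i<2. Z i \<subset> Z (Suc i)) \<and> Z 2 \<subseteq> points D"
  then obtain Z :: "nat \<Rightarrow> p3 set" where Z: "\<forall>i\<le>2. irreducible_closed zariski (Z i)" "\<forall>i<2. Z i \<subset> Z (Suc i)" "Z 2 \<subseteq> points D" by blast
  have lt: "Z 0 \<subset> Z 1" "Z 1 \<subset> Z 2" using Z(2)[rule_format, of 0] Z(2)[rule_format, of 1] by (auto simp: numeral_2_eq_2)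
  have irr: "irreducible_closed zariski (Z 0)" "irreducible_closed zariski (Z 1)" "irreducible_closed zariski (Z 2)" using Z(1) by auto
  then have cl: "closedin zariski (Z 0)" "closedin zariski (Z 1)" "closedin zariski (Z 2)" by (auto simp: irreducible_closed_def)
  obtain p where p: "p \<in> Z 0" using irr(1) by (auto simp: irreducible_closed_def)
  obtain j where j: "p \<in> chart j" by (rule chart_cover)
  obtain U h where U: "zopen U" "p \<in> U" "\<forall>q\<in>U. divisor_equation X D q h" using h by blast
  note st = divisor_stalk_gen[OF j U(3)[rule_format, OF U(2)]]
  have pD: "p \<in> points D" using p lt Z(3) by blast
  then have DM: "stalk D p \<subseteq> max_ideal p" using points_iff[OF D] by blast
  then have "eqn j \<in> max_ideal p" using st(3) by blast
  then obtain y z where "regular_pencil (\<O> p) (max_ideal p) (eqn j) y z" using pencil[OF j] by blast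
  then interpret P: regular_pencil "\<O> p" "max_ideal p" "eqn j" y z .
  have van: "k \<in> vanishing_ideal p (Z 2)" if "k \<in> stalk D p" for k
  proof -
    obtain V where V: "zopen V" "p \<in> V" "\<And>q. q \<in> V ==> k \<in> stalk D q" using \<open>k \<in> stalk D p\<close> by (rule D.stalk_open) blast
    show ?thesis
    proof (rule vanishing_idealI[OF V(1,2)])
      show "k \<in> \<O> q" if "q \<in> V" for q using V(3)[OF that] stalk_at_subset by blast
      show "val q k = 0" if "q \<in> V" "q \<in> Z 2" for q
        using V(3)[OF that(1)] Z(3) that(2) points_iff[OF D, of q] by (auto simp: max_ideal_def)
    qed
  qed
  have "h \<notin> gen (\<O> p) {eqn j}"
  proof
    assume "h \<in> gen (\<O> p) {eqn j}"
    then have "1 \<in> gen (\<O> p) {eqn j}"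
      using U(2,3) stalk_eqn[OF j] by (auto simp: divisor_equation_def)
    then show False using prime_idealD(2)[OF P.prime_F] by blast
  qed
  moreover have "h \<in> stalk D p" using U(2,3) by (auto simp: divisor_equation_def)
  moreover have "vanishing_ideal p (Z 0) \<subseteq> max_ideal p" using p by (auto simp: vanishing_ideal_def max_ideal_def)
  then have "vanishing_ideal p (Z 1) \<subset> max_ideal p"
    using vanishing_ideal_strict[OF irr(2) cl(1) lt(1) p] by blast
  moreover have "vanishing_ideal p (Z 2) \<subset> vanishing_ideal p (Z 1)"
    using vanishing_ideal_strict[OF irr(3) cl(2) lt(2)] p lt(1) by blast
  moreover have "p \<in> Z 1" "p \<in> Z 2" using p lt by auto
  ultimately show False
    using P.no_prime_chain[OF vanishing_ideal_prime[OF irr(3), of p] vanishing_ideal_prime[OF irr(2), of p]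
      van[OF st(3)] van[of h]] by blast
qed

lemma effective_divisor_curve:
  assumes D: "effective_divisor X D" shows "curve D"
proof -
  have cl: "closed_subscheme D" and XD: "X \<le> D" using D by (auto simp: effective_divisor_def)
  have h: "\<exists>U h. zopen U \<and> p \<in> U \<and> (\<forall>q\<in>U. divisor_equation X D q h)" for p
    using effective_divisor_equation[OF ideal_sheaf_axioms D] by metis
  show ?thesis
  proof (rule curveI[OF cl])
    show "loc.deep p (stalk D p)" for p using h[of p] divisor_deep by blast
    show "no_surface (points D)"
      by (rule divisor_no_surface[OF closed_subscheme_ideal_sheaf[OF cl] XD h])
  qed
qed

text \<open>Outside a small closed set, two functions without a common prime factor on the surface
  at one point remain so: the conductor of one into the other is finitely generated.\<close>

lemma not_divisible_near:
  assumes p: "p \<in> chart j" and prime: "prime_ideal (\<O> p) (gen (\<O> p) {eqn j})"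
    and g: "g \<in> \<O> p" "g \<notin> gen (\<O> p) {eqn j}"
  obtains W where "zopen W" "p \<in> W" "W \<subseteq> chart j"
    "\<And>q. q \<in> W ==> g \<in> \<O> q" "\<And>q. q \<in> W ==> eqn j \<in> max_ideal q ==> g \<notin> gen (\<O> q) {eqn j}"
proof -
  let ?f = "eqn j"
  have sub: "chart_ring j \<subseteq> \<O> q" if "q \<in> chart j" for q using chart_ring_stalk[OF _ that] by blast
  obtain n h where nh: "n \<in> chart_ring j" "h \<in> chart_ring j" "val p h \<noteq> 0" "h * g = n"
    using stalk_fraction[OF g(1) p] by blast
  define G where "G = gen (chart_ring j) {?f}"
  have Gid: "ideal_in (chart_ring j) G" unfolding G_def by (rule chart.gen_ideal) (simp add: eqn_chart_ring)
  have fid: "ideal_in (\<O> q) (gen (\<O> q) {?f})" if "q \<in> chart j" for q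
    using eqn_stalk[OF that] by (intro stalk.gen_ideal) auto
  have GS: "G \<subseteq> gen (\<O> q) {?f}" if "q \<in> chart j" for q
    unfolding G_def by (rule gen_subring_mono[OF sub[OF that]])
  \<comment> \<open>The conductor of the numerator \<open>n\<close> into the ideal of the surface,
    taken over the whole chart so that its generators serve all nearby points.\<close>
  define b where "b = {c \<in> chart_ring j. c * n \<in> G}"
  have bid: "ideal_in (chart_ring j) b"
    unfolding ideal_in_def
  proof (intro conjI ballI)
    show "b \<subseteq> chart_ring j" by (auto simp: b_def)
    show "0 \<in> b" using idealD(2)[OF Gid] by (simp add: b_def)
    fix a assume a: "a \<in> b"
    show "a + c \<in> b" if c: "c \<in> b" for c
      using a c idealD(3)[OF Gid, of "a * n" "c * n"] by (auto simp: b_def distrib_right)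
    show "r * a \<in> b" if r: "r \<in> chart_ring j" for r
      using a r idealD(4)[OF Gid r, of "a * n"] by (auto simp: b_def mult.assoc)
  qed
  obtain S where S: "finite S" "S \<subseteq> b" "b = gen (chart_ring j) S" by (rule noethE[OF noeth_chart_ring bid])
  have np: "n \<notin> gen (\<O> p) {?f}"
    using g(2) loc.unit_cancel[OF fid[OF p], of h g] nh sub[OF p] by (auto simp: max_ideal_def)
  have "\<exists>d\<in>chart_ring j. val p d \<noteq> 0 \<and> d * s \<in> G" if s: "s \<in> S" for s
  proof -
    have sb: "s \<in> chart_ring j" "s * n \<in> G" using s S(2) by (auto simp: b_def)
    then have "s \<in> gen (\<O> p) {?f}"
      using prime_idealD(3)[OF prime, of s n] GS[OF p] np sub[OF p] nh(1) by blast
    then show ?thesis using gen_clear[OF p, of "{?f}" s] eqn_chart_ring unfolding G_def by (metis empty_subsetI insert_subset)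
  qed
  then obtain d where d: "\<And>s. s \<in> S ==> d s \<in> chart_ring j \<and> val p (d s) \<noteq> 0 \<and> d s * s \<in> G" by metis
  \<comment> \<open>At \<open>p\<close> the conductor lies in the prime generated by
    \<open>eqn j\<close>. Clearing the denominators of its finitely many generators by
    \<open>D\<close> gives \<open>D * c \<in> G\<close> for every \<open>c\<close> in
    \<open>b\<close>, so where \<open>D\<close> is nonzero every such \<open>c\<close> vanishes on
    the surface.\<close>
  define D where "D = (\<Prod>s\<in>S. d s)"
  have Dc: "D \<in> chart_ring j" unfolding D_def using d by (intro chart.prod_closed) auto
  have "val p D = (\<Prod>s\<in>S. val p (d s))" unfolding D_def using d sub[OF p] by (intro val_prod) blast
  then have Dp: "val p D \<noteq> 0" using d S(1) by simp
  have DsG: "D * s \<in> G" if s: "s \<in> S" for s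
  proof -
    have "D = (\<Prod>t\<in>S - {s}. d t) * d s" unfolding D_def using S(1) s by (simp add: prod.remove mult.commute)
    then have "D * s = (\<Prod>t\<in>S - {s}. d t) * (d s * s)" by (simp add: mult.assoc)
    also have "\<dots> \<in> G" using d[OF s] d by (intro idealD(4)[OF Gid chart.prod_closed]) blast+
    finally show ?thesis .
  qed
  have DbG: "D * c \<in> G" if "c \<in> b" for c
    using that unfolding S(3)
  proof induction
    case zero
    then show ?case using idealD(2)[OF Gid] by simp
  next
    case (step r s a)
    have "r * (D * s) + D * a \<in> G" by (rule idealD(3)[OF Gid idealD(4)[OF Gid step(1) DsG[OF step(2)]] step(4)])
    then show ?case by (simp add: algebra_simps)
  qed
  define W where "W = {q. D \<in> \<O> q \<and> val q D \<noteq> 0} \<inter> {q. h \<in> \<O> q \<and> val q h \<noteq> 0} \<inter> chart j"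
  show ?thesis
  proof (rule that[of W])
    show "zopen W" unfolding W_def using openin_val_nonzero openin_chart by blast
    show "p \<in> W" using p Dp nh(2,3) Dc sub[OF p] by (auto simp: W_def)
    show "W \<subseteq> chart j" by (auto simp: W_def)
    fix q assume q: "q \<in> W"
    then have qj: "q \<in> chart j" and Dq: "val q D \<noteq> 0" and hq: "h \<in> \<O> q" "val q h \<noteq> 0" by (auto simp: W_def)
    have "h \<noteq> 0" using hq by auto
    then have "g = inverse h * n" using inverse_mult_cancel nh(4) by blast
    then show gq: "g \<in> \<O> q" using stalk_ring_inverse[OF hq] sub[OF qj] nh(1) by auto
    assume fq: "?f \<in> max_ideal q"
    show "g \<notin> gen (\<O> q) {?f}"
    proof
      assume "g \<in> gen (\<O> q) {?f}"
      then have "n \<in> gen (\<O> q) {?f}" using idealD(4)[OF fid[OF qj] hq(1)] nh(4) by blast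
      then obtain c where c: "c \<in> chart_ring j" "val q c \<noteq> 0" "c * n \<in> gen (chart_ring j) {?f}"
        using gen_clear[OF qj, of "{?f}" n] eqn_chart_ring by (metis empty_subsetI insert_subset)
      then have "c \<in> b" by (simp add: b_def G_def)
      then have "D * c \<in> gen (\<O> q) {?f}" using DbG GS[OF qj] by blast
      also have "gen (\<O> q) {?f} \<subseteq> max_ideal q" using fq by (intro gen_least[OF max_ideal_ideal]) auto
      finally have "val q (D * c) = 0" by (simp add: max_ideal_def)
      then show False using Dq c(1,2) Dc sub[OF qj] by (simp add: subset_iff)
    qed
  qed
qed

end

section \<open>The sum of a curve and an effective divisor\<close>

locale divisor_sum = surface X eqn for X eqn +
  fixes C E :: ideal
  assumes curve_C: "curve C" and X_le_C: "X \<le> C" and divisor_E: "effective_divisor X E"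
    and finite_inter: "finite (points (scheme_inter C E))"
begin

abbreviation "D \<equiv> div_add X C E"

lemma closed_C: "closed_subscheme C" and closed_E: "closed_subscheme E" and X_le_E: "X \<le> E"
  using curve_C divisor_E by (auto simp: curve_def effective_divisor_def)

sublocale C: ideal_sheaf C by (rule closed_subscheme_ideal_sheaf[OF closed_C])
sublocale E: ideal_sheaf E by (rule closed_subscheme_ideal_sheaf[OF closed_E])
sublocale D: ideal_sheaf D
  by (rule ideal_sheaf_div_add[OF ideal_sheaf_axioms C.ideal_sheaf_axioms E.ideal_sheaf_axioms])
sublocale CE: ideal_sheaf "scheme_inter C E"
  by (rule ideal_sheaf_scheme_inter[OF C.ideal_sheaf_axioms E.ideal_sheaf_axioms])

lemma X_C: "stalk X p \<subseteq> stalk C p"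
  using ideal_sheaf_le_iff[OF ideal_sheaf_axioms C.ideal_sheaf_axioms] X_le_C by blast

lemma X_E: "stalk X p \<subseteq> stalk E p"
  using ideal_sheaf_le_iff[OF ideal_sheaf_axioms E.ideal_sheaf_axioms] X_le_E by blast

lemma stalk_CE: "stalk (scheme_inter C E) p = {a + b | a b. a \<in> stalk C p \<and> b \<in> stalk E p}"
  by (rule stalk_scheme_inter[OF C.ideal_sheaf_axioms E.ideal_sheaf_axioms])

lemma C_CE: "stalk C p \<subseteq> stalk (scheme_inter C E) p"
proof
  fix k assume "k \<in> stalk C p"
  then have "k = k + 0 \<and> k \<in> stalk C p \<and> 0 \<in> stalk E p" using idealD(2)[OF E.stalk_ideal] by simp
  then show "k \<in> stalk (scheme_inter C E) p" unfolding stalk_CE by blast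
qed

lemma E_CE: "stalk E p \<subseteq> stalk (scheme_inter C E) p"
proof
  fix k assume "k \<in> stalk E p"
  then have "k = 0 + k \<and> 0 \<in> stalk C p \<and> k \<in> stalk E p" using idealD(2)[OF C.stalk_ideal] by simp
  then show "k \<in> stalk (scheme_inter C E) p" unfolding stalk_CE by blast
qed

lemma equationE:
  obtains U h where "zopen U" "p \<in> U" "\<And>q. q \<in> U ==> divisor_equation X E q h"
  using effective_divisor_equation[OF ideal_sheaf_axioms divisor_E] by metis

text \<open>Near \<open>p\<close>, but off \<open>p\<close>, the two subschemes are disjoint, so 1
  is a sum of an element of the ideal of \<open>C\<close> and a multiple of the equation modulo
  \<open>X\<close>; there \<open>a\<close> lies in the ideal of \<open>C\<close>. Depth of
  \<open>C\<close> carries this over to \<open>p\<close>.\<close>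

lemma equation_regular_on_C:
  assumes h: "divisor_equation X E p h" and a: "a \<in> \<O> p" "a * h \<in> stalk C p"
  shows "a \<in> stalk C p"
proof -
  have hE: "h \<in> stalk E p" using h unfolding divisor_equation_def by (rule conjunct1)
  \<comment> \<open>\<open>h\<close> is an equation at \<open>p\<close> only, whereas
    \<open>e\<close> defines \<open>E\<close> on a whole neighbourhood; at \<open>p\<close> it is a
    multiple of \<open>h\<close> modulo \<open>X\<close>.\<close>
  obtain U e where U: "zopen U" "p \<in> U" "\<And>q. q \<in> U ==> divisor_equation X E q e" by (rule equationE[of p]) blast
  have st: "stalk E p = {r * h + x | r x. r \<in> \<O> p \<and> x \<in> stalk X p}" using h by (simp add: divisor_equation_def)
  have eE: "e \<in> stalk E p" using U(3)[OF U(2)] unfolding divisor_equation_def by (rule conjunct1)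
  then obtain r x where rx: "e = r * h + x" "r \<in> \<O> p" "x \<in> stalk X p" using st by blast
  have "a * e = r * (a * h) + a * x" by (simp add: rx(1) algebra_simps)
  also have "\<dots> \<in> stalk C p"
    using X_C[of p] rx a by (intro idealD(3)[OF C.stalk_ideal idealD(4)[OF C.stalk_ideal] idealD(4)[OF C.stalk_ideal]]) auto
  finally have ae: "a * e \<in> stalk C p" .
  obtain V where V: "zopen V" "p \<in> V" "\<And>q. q \<in> V ==> a * e \<in> stalk C q" using ae by (rule C.stalk_open) blast
  obtain W where W: "zopen W" "p \<in> W" "\<And>q. q \<in> W ==> a \<in> \<O> q" using a(1) by (rule stalk_ring_open) blast
  define N where "N = U \<inter> V \<inter> W \<inter> - (points (scheme_inter C E) - {p})"
  have N: "zopen N" "p \<in> N" unfolding N_def by (intro openin_Int U V W finite_avoid[OF finite_inter]) (use U V W in blast)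
  show ?thesis
  proof (rule deep_extension[OF closed_C curve_deep[OF curve_C] N a(1)])
    fix q assume q: "q \<in> N" "q \<noteq> p"
    have aq: "a \<in> \<O> q" "a * e \<in> stalk C q" and eq: "divisor_equation X E q e"
      using q U(3) V(3) W(3) by (auto simp: N_def)
    have "q \<notin> points (scheme_inter C E)" using q by (auto simp: N_def)
    then have "1 \<in> stalk (scheme_inter C E) q" using points_iff_one[OF CE.ideal_sheaf_axioms] by blast
    then obtain c b where cb: "1 = c + b" "c \<in> stalk C q" "b \<in> stalk E q" unfolding stalk_CE by blast
    obtain r x where rx: "b = r * e + x" "r \<in> \<O> q" "x \<in> stalk X q"
      using cb(3) eq unfolding divisor_equation_def by blast
    have "a = a * (c + b)" using cb(1) by (metis mult.right_neutral)
    also have "\<dots> = a * c + (r * (a * e) + a * x)" by (simp add: rx(1) algebra_simps)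
    also have "\<dots> \<in> stalk C q"
      using X_C[of q] cb(2) rx aq
      by (intro idealD(3)[OF C.stalk_ideal idealD(4)[OF C.stalk_ideal]
            idealD(3)[OF C.stalk_ideal idealD(4)[OF C.stalk_ideal] idealD(4)[OF C.stalk_ideal]]]) auto
    finally show "a \<in> stalk C q" .
  qed
qed

lemma stalk_D:
  assumes "divisor_equation X E p h"
  shows "stalk D p = {c * h + x | c x. c \<in> stalk C p \<and> x \<in> stalk X p}"
  using assms by (intro stalk_div_add_principal[OF ideal_sheaf_axioms C.ideal_sheaf_axioms E.ideal_sheaf_axioms])
    (auto simp: divisor_equation_def)

lemma X_D: "stalk X p \<subseteq> stalk D p"
proof
  fix x assume x: "x \<in> stalk X p"
  obtain U h where h: "p \<in> U" "\<And>q. q \<in> U ==> divisor_equation X E q h" by (rule equationE[of p]) blast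
  have "x = 0 * h + x \<and> 0 \<in> stalk C p \<and> x \<in> stalk X p" using x idealD(2)[OF C.stalk_ideal] by simp
  then show "x \<in> stalk D p" unfolding stalk_D[OF h(2)[OF h(1)]] by blast
qed

text \<open>An element \<open>a * h + b\<close> of the ideal of \<open>E\<close> lies in that of
  \<open>C\<close> only if \<open>a * h\<close> does. Then \<open>a\<close> does, because
  \<open>h\<close> can be cancelled modulo \<open>C\<close>, and this is the description of
  \<open>D\<close>.\<close>

lemma stalk_D_inter: "stalk D p = stalk C p \<inter> stalk E p"
proof -
  obtain U h where U: "p \<in> U" "\<And>q. q \<in> U ==> divisor_equation X E q h" by (rule equationE[of p]) blast
  have h: "divisor_equation X E p h" by (rule U(2)[OF U(1)])
  then have hE: "h \<in> stalk E p" "stalk E p = {a * h + b | a b. a \<in> \<O> p \<and> b \<in> stalk X p}"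
    unfolding divisor_equation_def by blast+
  then have hp: "h \<in> \<O> p" using stalk_at_subset by blast
  show ?thesis
  proof
    show "stalk D p \<subseteq> stalk C p \<inter> stalk E p"
    proof
      fix k assume "k \<in> stalk D p"
      then obtain c x where k: "k = c * h + x" "c \<in> stalk C p" "x \<in> stalk X p" unfolding stalk_D[OF h] by blast
      have xC: "x \<in> stalk C p" and xE: "x \<in> stalk E p" using k X_C X_E by auto
      have "k \<in> stalk C p" unfolding k(1)
        by (rule idealD(3)[OF C.stalk_ideal idealD(5)[OF C.stalk_ideal hp k(2)] xC])
      moreover have "c \<in> \<O> p" using k(2) stalk_at_subset by blast
      then have "k \<in> stalk E p" unfolding k(1)
        by (intro idealD(3)[OF E.stalk_ideal idealD(4)[OF E.stalk_ideal _ hE(1)] xE])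
      ultimately show "k \<in> stalk C p \<inter> stalk E p" by blast
    qed
    show "stalk C p \<inter> stalk E p \<subseteq> stalk D p"
    proof
      fix k assume k: "k \<in> stalk C p \<inter> stalk E p"
      then obtain a b where ab: "k = a * h + b" "a \<in> \<O> p" "b \<in> stalk X p" using hE(2) by blast
      have "k - b \<in> stalk C p" using k ab(3) X_C by (intro stalk.ideal_diff[OF C.stalk_ideal]) auto
      then have "a \<in> stalk C p" using equation_regular_on_C[OF h ab(2)] ab(1) by simp
      then show "k \<in> stalk D p" unfolding stalk_D[OF h] using ab by blast
    qed
  qed
qed

lemma closed_D: "closed_subscheme D"
  unfolding closed_subscheme_iff
proof (intro conjI D.ideal_sheaf_axioms)
  show "fin_type (stalk D)" unfolding fin_type_def
  proof
    fix p
    obtain j where p: "p \<in> chart j" by (rule chart_cover)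
    have ft: "fin_type (stalk C)" using closed_C by (simp add: closed_subscheme_iff)
    obtain U h where U: "zopen U" "p \<in> U" "\<And>q. q \<in> U ==> divisor_equation X E q h" by (rule equationE[of p]) blast
    obtain V S where V: "zopen V" "p \<in> V" "finite S" "\<And>q. q \<in> V ==> S \<subseteq> stalk C q"
      "\<And>q. q \<in> V ==> stalk C q = gen (\<O> q) S" by (rule fin_typeE[OF ft, of p]) blast
    define T where "T = insert (eqn j) ((\<lambda>s. s * h) ` S)"
    have "T \<subseteq> stalk D q \<and> stalk D q = gen (\<O> q) T" if q: "q \<in> U \<inter> V \<inter> chart j" for q
    proof
      have h: "divisor_equation X E q h" and qj: "q \<in> chart j" using q U(3) by auto
      have "eqn j \<in> stalk D q" using eqn_in[OF qj] X_D by blast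
      moreover have "s * h \<in> stalk D q" if "s \<in> S" for s
      proof -
        have "s * h = s * h + 0 \<and> s \<in> stalk C q \<and> 0 \<in> stalk X q" using V(4) q that idealD(2)[OF stalk_ideal] by auto
        then show ?thesis unfolding stalk_D[OF h] by blast
      qed
      ultimately show T: "T \<subseteq> stalk D q" by (auto simp: T_def)
      have Tr: "T \<subseteq> \<O> q" using T stalk_at_subset by blast
      note G = stalk.gen_ideal[OF Tr]
      have Tin: "t \<in> gen (\<O> q) T" if "t \<in> T" for t using stalk.gen_incl[of T q] that by blast
      have "c * h \<in> gen (\<O> q) T" if "c \<in> gen (\<O> q) S" for c
        using that
      proof induction
        case zero
        then show ?case using idealD(2)[OF G] by simp
      next
        case (step r s a)
        have "r * (s * h) + a * h \<in> gen (\<O> q) T"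
          using step by (intro idealD(3)[OF G idealD(4)[OF G step(1) Tin]]) (auto simp: T_def)
        then show ?case by (simp add: algebra_simps)
      qed
      moreover have "x \<in> gen (\<O> q) T" if "x \<in> stalk X q" for x
        using that stalk_eqn[OF qj] gen_mono[of "{eqn j}" T "\<O> q"] by (auto simp: T_def)
      ultimately have "stalk D q \<subseteq> gen (\<O> q) T"
        unfolding stalk_D[OF h] using V(5)[of q] q idealD(3)[OF G] by auto
      moreover have "gen (\<O> q) T \<subseteq> stalk D q" by (rule gen_least[OF D.stalk_ideal T])
      ultimately show "stalk D q = gen (\<O> q) T" by blast
    qed
    moreover have "zopen (U \<inter> V \<inter> chart j)" "p \<in> U \<inter> V \<inter> chart j" using U V p openin_chart[of j] by auto
    moreover have "finite T" using V(3) by (simp add: T_def)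
    ultimately show "\<exists>U S. zopen U \<and> p \<in> U \<and> finite S \<and> (\<forall>q\<in>U. S \<subseteq> stalk D q \<and> stalk D q = gen (\<O> q) S)"
      by blast
  qed
qed

lemma deep_D: "loc.deep p (stalk D p)"
  unfolding loc.deep_def
proof (intro conjI ballI impI D.stalk_ideal)
  fix s assume s: "s \<in> \<O> p" "\<forall>m\<in>max_ideal p. m * s \<in> stalk D p"
  obtain U h where "p \<in> U" "\<And>q. q \<in> U ==> divisor_equation X E q h" by (rule equationE[of p]) blast
  then have "loc.deep p (stalk E p)" using divisor_deep by blast
  moreover have "loc.deep p (stalk C p)" by (rule curve_deep[OF curve_C])
  ultimately show "s \<in> stalk D p" using s unfolding loc.deep_def stalk_D_inter by blast
qed

lemma curve_D: "curve D"
proof (rule curveI[OF closed_D deep_D])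
  have pts: "points D \<subseteq> points C \<union> points E"
  proof
    fix p assume "p \<in> points D"
    then have "1 \<notin> stalk D p" using points_iff_one[OF D.ideal_sheaf_axioms] by blast
    then show "p \<in> points C \<union> points E"
      unfolding stalk_D_inter using points_iff_one[OF C.ideal_sheaf_axioms] points_iff_one[OF E.ideal_sheaf_axioms] by blast
  qed
  have "no_surface (points C \<union> points E)"
    using no_surface_Un[OF closedin_points[OF C.ideal_sheaf_axioms] closedin_points[OF E.ideal_sheaf_axioms]
        curve_no_surface[OF curve_C] curve_no_surface[OF effective_divisor_curve[OF divisor_E]]] .
  then show "no_surface (points D)" using pts unfolding no_surface_def by blast
qed

text \<open>The curve \<open>C\<close> is locally defined on the surface by one equation \<open>g\<close>, and \<open>D\<close> by \<open>g * h\<close>.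
  Either \<open>eqn, g * h\<close> is a regular sequence, so that all its relations are trivial,
  or \<open>C\<close> and \<open>D\<close> agree with the surface.\<close>

lemma local_equations:
  obtains W j g h where "zopen W" "p \<in> W" "W \<subseteq> chart j"
    "\<And>q. q \<in> W ==> g \<in> \<O> q \<and> h \<in> \<O> q"
    "\<And>q. q \<in> W ==> stalk C q = gen (\<O> q) {eqn j, g}"
    "\<And>q. q \<in> W ==> stalk D q = gen (\<O> q) {eqn j, g * h}"
    "(\<forall>q\<in>W. \<forall>a\<in>\<O> q. \<forall>b\<in>\<O> q. a * eqn j + b * (g * h) = 0 \<longrightarrow> a \<in> stalk D q \<and> b \<in> stalk D q)
      \<or> (\<forall>q\<in>W. stalk C q = stalk D q)"
proof -
  obtain j where p: "p \<in> chart j" by (rule chart_cover)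
  obtain U h where U: "zopen U" "p \<in> U" "\<And>q. q \<in> U ==> divisor_equation X E q h" by (rule equationE[of p]) blast
  let ?F = "eqn j"
  have ft: "fin_type (stalk C)" using closed_C by (simp add: closed_subscheme_iff)
  have hq: "h \<in> \<O> q" if "q \<in> U" for q using U(3)[OF that] stalk_at_subset unfolding divisor_equation_def by blast
  have D_gen: "stalk D q = gen (\<O> q) {?F, g * h}"
    if q: "q \<in> U" "q \<in> chart j" "g \<in> \<O> q" "stalk C q = gen (\<O> q) {?F, g}" for q g
  proof
    have F: "?F \<in> \<O> q" by (rule eqn_stalk[OF q(2)])
    have gh: "g * h \<in> \<O> q" using q(3) hq[OF q(1)] by auto
    have "g \<in> stalk C q" using q(4) stalk.gen_incl[of "{?F, g}" q] by auto
    then have "g * h = g * h + 0 \<and> g \<in> stalk C q \<and> 0 \<in> stalk X q" using idealD(2)[OF stalk_ideal] by simp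
    then have "g * h \<in> stalk D q" unfolding stalk_D[OF U(3)[OF q(1)]] by blast
    then show "gen (\<O> q) {?F, g * h} \<subseteq> stalk D q"
      using eqn_in[OF q(2)] X_D by (intro gen_least[OF D.stalk_ideal]) auto
    show "stalk D q \<subseteq> gen (\<O> q) {?F, g * h}"
    proof
      fix k assume "k \<in> stalk D q"
      then obtain c x where k: "k = c * h + x" "c \<in> stalk C q" "x \<in> stalk X q"
        unfolding stalk_D[OF U(3)[OF q(1)]] by blast
      obtain a b where c: "c = a * ?F + b * g" "a \<in> \<O> q" "b \<in> \<O> q"
        using k(2) unfolding q(4) stalk.gen2[OF F q(3)] by blast
      obtain r where r: "x = r * ?F" "r \<in> \<O> q" using k(3) unfolding stalk_eqn[OF q(2)] stalk.gen1[OF F] by blast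
      have eq: "k = (a * h + r) * ?F + b * (g * h)" by (simp add: k(1) c(1) r(1) algebra_simps)
      show "k \<in> gen (\<O> q) {?F, g * h}"
        unfolding eq using c r hq[OF q(1)] by (intro stalk.gen2I[OF F gh]) auto
    qed
  qed
  show ?thesis
  proof (cases "?F \<in> max_ideal p")
    case False
    then obtain V where V: "zopen V" "p \<in> V" "\<And>q. q \<in> V ==> ?F \<in> \<O> q \<and> val q ?F \<noteq> 0"
      using unit_neighbourhood[OF eqn_stalk[OF p]] eqn_stalk[OF p] by (auto simp: max_ideal_def)
    define W where "W = U \<inter> V \<inter> chart j"
    have W: "zopen W" "p \<in> W" "W \<subseteq> chart j" using U V p openin_chart[of j] by (auto simp: W_def)
    have whole: "stalk X q = \<O> q" if "q \<in> W" for q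
      using off_surface[of q j] V(3)[of q] that by (auto simp: W_def max_ideal_def)
    have CD: "stalk C q = \<O> q" "stalk D q = \<O> q" if "q \<in> W" for q
      using whole[OF that] X_C X_D stalk_at_subset by blast+
    \<comment> \<open>Off the surface \<open>eqn j\<close> is a unit and generates everything, so
      any second generator will do, in particular 0.\<close>
    have C0: "stalk C q = gen (\<O> q) {?F, 0}" if q: "q \<in> W" for q
    proof -
      have "gen (\<O> q) {?F} \<subseteq> gen (\<O> q) {?F, 0}" by (rule gen_mono) auto
      moreover have "gen (\<O> q) {?F, 0} \<subseteq> \<O> q"
        using eqn_stalk[of q j] W(3) q by (intro gen_least[OF stalk.whole_ideal]) auto
      moreover have "gen (\<O> q) {?F} = \<O> q" using whole[OF q] stalk_eqn[of q j] W(3) q by auto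
      ultimately show ?thesis using CD(1)[OF q] by blast
    qed
    show ?thesis
    proof (rule that[OF W, of 0 h])
      show "0 \<in> \<O> q \<and> h \<in> \<O> q" if "q \<in> W" for q using that hq by (auto simp: W_def)
      show "stalk C q = gen (\<O> q) {?F, 0}" if "q \<in> W" for q by (rule C0[OF that])
      show "stalk D q = gen (\<O> q) {?F, 0 * h}" if "q \<in> W" for q
        by (rule D_gen) (use that C0 in \<open>auto simp: W_def\<close>)
      show "(\<forall>q\<in>W. \<forall>a\<in>\<O> q. \<forall>b\<in>\<O> q. a * ?F + b * (0 * h) = 0 \<longrightarrow> a \<in> stalk D q \<and> b \<in> stalk D q)
        \<or> (\<forall>q\<in>W. stalk C q = stalk D q)" using CD by auto
    qed
  next
    case True
    then obtain y z where "regular_pencil (\<O> p) (max_ideal p) ?F y z" using pencil[OF p] by blast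
    then interpret P: regular_pencil "\<O> p" "max_ideal p" ?F y z .
    have FC: "?F \<in> stalk C p" using eqn_in[OF p] X_C by blast
    obtain g where g: "g \<in> stalk C p" "stalk C p = gen (\<O> p) {?F, g}"
      using P.deep_principal[OF curve_deep[OF curve_C] FC] by blast
    have gp: "g \<in> \<O> p" using g(1) stalk_at_subset by blast
    have fin: "finite {?F, g}" "{?F, g} \<subseteq> stalk C p" using g(1) FC by auto
    obtain V where V: "zopen V" "p \<in> V" "\<And>q. q \<in> V ==> {?F, g} \<subseteq> stalk C q"
      "\<And>q. q \<in> V ==> stalk C q = gen (\<O> q) {?F, g}"
      by (rule C.generators_near[OF ft fin(1) g(2) fin(2)]) blast
    have gq: "g \<in> \<O> q" if "q \<in> V" for q using V(3)[OF that] stalk_at_subset by blast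
    show ?thesis
    proof (cases "g \<in> gen (\<O> p) {?F}")
      case True
      \<comment> \<open>Here the ideals of \<open>C\<close> and \<open>X\<close> coincide near
        \<open>p\<close>, and the ideal of \<open>D\<close> lies between them.\<close>
      have "stalk C p \<subseteq> stalk X p"
        unfolding g(2) using True stalk_eqn[OF p] eqn_in[OF p] by (intro gen_least[OF stalk_ideal]) auto
      then have "stalk C p = gen (\<O> p) {?F}" using X_C[of p] stalk_eqn[OF p] by auto
      then obtain N where N: "zopen N" "p \<in> N"
        "\<And>q. q \<in> N ==> stalk C q = gen (\<O> q) {?F}"
        using C.generators_near[OF ft, of "{?F}" p] FC by (metis empty_subsetI finite.emptyI finite_insert insert_subset)
      define W where "W = U \<inter> V \<inter> N \<inter> chart j"
      have W: "zopen W" "p \<in> W" "W \<subseteq> chart j" using U V N p openin_chart[of j] by (auto simp: W_def)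
      have CD: "stalk C q = stalk D q" if q: "q \<in> W" for q
        using N(3)[of q] stalk_eqn[of q j] X_D[of q] stalk_D_inter[of q] q by (auto simp: W_def)
      show ?thesis
      proof (rule that[OF W])
        show "g \<in> \<O> q \<and> h \<in> \<O> q" if "q \<in> W" for q using that gq[of q] hq[of q] by (simp add: W_def)
        show "stalk C q = gen (\<O> q) {?F, g}" if "q \<in> W" for q using that V(4)[of q] by (simp add: W_def)
        show "stalk D q = gen (\<O> q) {?F, g * h}" if "q \<in> W" for q
          using D_gen[of q g] that gq[of q] V(4)[of q] by (simp add: W_def)
        show "(\<forall>q\<in>W. \<forall>a\<in>\<O> q. \<forall>b\<in>\<O> q. a * ?F + b * (g * h) = 0 \<longrightarrow> a \<in> stalk D q \<and> b \<in> stalk D q)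
          \<or> (\<forall>q\<in>W. stalk C q = stalk D q)" using CD by blast
      qed
    next
      case False
      obtain N where N: "zopen N" "p \<in> N" "N \<subseteq> chart j"
        "\<And>q. q \<in> N ==> g \<in> \<O> q" "\<And>q. q \<in> N ==> ?F \<in> max_ideal q ==> g \<notin> gen (\<O> q) {?F}"
        by (rule not_divisible_near[OF p P.prime_F gp False]) blast
      define W where "W = U \<inter> V \<inter> N"
      have W: "zopen W" "p \<in> W" "W \<subseteq> chart j" using U V N by (auto simp: W_def)
      \<comment> \<open>In a relation, \<open>h\<close> and then \<open>g\<close> cancel modulo
        \<open>eqn j\<close>, so \<open>b\<close> is a multiple \<open>c * eqn j\<close>; dividing
        by the nonzero \<open>eqn j\<close> gives \<open>a = - (c * (g * h))\<close>. Only the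
        Koszul relations remain, and their coefficients vanish on \<open>D\<close>.\<close>
      have triv: "a \<in> stalk D q \<and> b \<in> stalk D q"
        if q: "q \<in> W" and ab: "a \<in> \<O> q" "b \<in> \<O> q" "a * ?F + b * (g * h) = 0" for q a b
      proof (cases "?F \<in> max_ideal q")
        case Fq: True
        have qj: "q \<in> chart j" and qU: "q \<in> U" and qV: "q \<in> V" using q W(3) by (auto simp: W_def)
        obtain y' z' where "regular_pencil (\<O> q) (max_ideal q) ?F y' z'" using pencil[OF qj Fq] by blast
        then have prime: "prime_ideal (\<O> q) (gen (\<O> q) {?F})" by (rule regular_pencil.prime_F)
        have F: "?F \<in> \<O> q" by (rule eqn_stalk[OF qj])
        have "(b * g) * h = (- a) * ?F" using ab(3) by (simp add: eq_neg_iff_add_eq_0 add.commute mult.assoc)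
        then have "(b * g) * h \<in> stalk X q" unfolding stalk_eqn[OF qj] using stalk.gen1I[OF F, of "- a"] ab(1) by simp
        then have "b * g \<in> stalk X q" using U(3)[OF qU] ab(2) gq[OF qV] by (auto simp: divisor_equation_def)
        then have "b \<in> gen (\<O> q) {?F}"
          using prime_idealD(3)[OF prime ab(2) gq[OF qV]] N(5)[OF _ Fq] q stalk_eqn[OF qj] by (auto simp: W_def)
        then obtain c where c: "b = c * ?F" "c \<in> \<O> q" unfolding stalk.gen1[OF F] by blast
        have "(a + c * (g * h)) * ?F = 0" using ab(3) c(1) by (simp add: algebra_simps)
        then have "a = - (c * (g * h))" using eqn_nonzero[of j] by (simp add: eq_neg_iff_add_eq_0)
        also have "\<dots> \<in> stalk D q"
          unfolding D_gen[OF qU qj gq[OF qV] V(4)[OF qV]]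
          using stalk.gen2I[OF F, of "g * h" 0 "- c"] gq[OF qV] hq[OF qU] c(2) by simp
        finally have "a \<in> stalk D q" .
        moreover have "b \<in> stalk D q" using \<open>b \<in> gen (\<O> q) {?F}\<close> stalk_eqn[OF qj] X_D by blast
        ultimately show ?thesis by blast
      next
        case False
        have "stalk D q = \<O> q"
          using off_surface[OF _ False] W(3) q X_D[of q] stalk_at_subset[of D q] by blast
        then show ?thesis using ab by simp
      qed
      have gen: "stalk D q = gen (\<O> q) {?F, g * h}" if "q \<in> W" for q
        using D_gen[of q g] that W(3) gq[of q] V(4)[of q] by (auto simp: W_def)
      show ?thesis
      proof (rule that[OF W])
        show "g \<in> \<O> q \<and> h \<in> \<O> q" if "q \<in> W" for q using that gq[of q] hq[of q] by (simp add: W_def)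
        show "stalk C q = gen (\<O> q) {?F, g}" if "q \<in> W" for q using that V(4)[of q] by (simp add: W_def)
        show "stalk D q = gen (\<O> q) {?F, g * h}" if "q \<in> W" for q by (rule gen[OF that])
        show "(\<forall>q\<in>W. \<forall>a\<in>\<O> q. \<forall>b\<in>\<O> q. a * ?F + b * (g * h) = 0 \<longrightarrow> a \<in> stalk D q \<and> b \<in> stalk D q)
          \<or> (\<forall>q\<in>W. stalk C q = stalk D q)" using triv by blast
      qed
    qed
  qed
qed

end

section \<open>Normal sheaves\<close>

lemma Union_const: "(V0, x0) \<in> S ==> (\<And>V x. (V, x) \<in> S ==> G V x = R) ==> (\<Union>(V, x)\<in>S. G V x) = R"
  by fastforce

lemma uminus_one_section: "(\<lambda>p. if p \<in> W then - 1 else 0) = section_of W (- 1)"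
proof
  fix p
  have "val p (- 1) = - 1" using val_uminus[of 1 p] val_cst[of p 1] cst.cst_1 by simp
  then show "(if p \<in> W then - 1 else 0) = section_of W (- 1) p" by (simp add: section_of_def)
qed

lemma Diff_OP:
  assumes "f \<in> Sec OP W" "g \<in> Sec OP W"
  shows "Diff OP W f g \<in> Sec OP W" "W \<noteq> {} ==> germ (Diff OP W f g) = germ f - germ g"
proof -
  have m: "section_of W (- 1) \<in> Sec OP W" "W \<noteq> {} ==> germ (section_of W (- 1)) = - 1"
    using section_of[OF Sec_OP_open[OF assms(1)], of "- 1"] by auto
  show "Diff OP W f g \<in> Sec OP W"
    unfolding Diff_def uminus_one_section by (intro Add_OP(1) Smul_OP(1) assms m(1))
  assume "W \<noteq> {}"
  then show "germ (Diff OP W f g) = germ f - germ g"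
    unfolding Diff_def uminus_one_section
    using Add_OP(2)[OF assms(1) Smul_OP(1)[OF m(1) assms(2)]] Smul_OP(2)[OF m(1) assms(2)] m(2) by simp
qed

text \<open>A set of representatives indexed by a rational function instead of a section. It
  coincides with \<open>qgerm\<close> in the structure sheaf, and equality of classes is a
  congruence in the local ring.\<close>

definition cls :: "ideal \<Rightarrow> p3 \<Rightarrow> ratfun \<Rightarrow> (p3 set \<times> (p3 \<Rightarrow> complex)) set" where
  "cls Y p k = {(V, g). zopen V \<and> p \<in> V \<and> g \<in> Sec OP V \<and> germ g - k \<in> stalk Y p}"

text \<open>A section of the normal sheaf of \<open>Y\<close> over \<open>U\<close> is given by a family of maps \<open>h p\<close> from the
  stalk of the ideal to the local ring that are linear modulo the ideal and locally constant in \<open>p\<close>.\<close>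

definition hom_rep :: "ideal \<Rightarrow> p3 set \<Rightarrow> (p3 \<Rightarrow> ratfun \<Rightarrow> ratfun) \<Rightarrow> bool" where
  "hom_rep Y U h \<longleftrightarrow> zopen U \<and> (\<forall>p\<in>U. \<forall>k\<in>stalk Y p. h p k \<in> \<O> p \<and>
     (\<forall>l\<in>stalk Y p. h p (k + l) - (h p k + h p l) \<in> stalk Y p) \<and>
     (\<forall>r\<in>\<O> p. h p (r * k) - r * h p k \<in> stalk Y p) \<and>
     (\<exists>V c. zopen V \<and> p \<in> V \<and> V \<subseteq> U \<and>
        (\<forall>q\<in>V. k \<in> stalk Y q \<and> c \<in> \<O> q \<and> h q k - c \<in> stalk Y q)))"

definition hom_of :: "ideal \<Rightarrow> p3 set \<Rightarrow> (p3 \<Rightarrow> ratfun \<Rightarrow> ratfun) \<Rightarrow> nsec" where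
  "hom_of Y U h = (\<lambda>V a. if zopen V \<and> V \<subseteq> U \<and> a \<in> Y V
     then (\<lambda>p. if p \<in> V then cls Y p (h p (germ a)) else {}) else undefined)"

lemma hom_repD:
  assumes "hom_rep Y U h"
  shows "zopen U"
    "p \<in> U ==> k \<in> stalk Y p ==> h p k \<in> \<O> p"
    "p \<in> U ==> k \<in> stalk Y p ==> l \<in> stalk Y p ==> h p (k + l) - (h p k + h p l) \<in> stalk Y p"
    "p \<in> U ==> k \<in> stalk Y p ==> r \<in> \<O> p ==> h p (r * k) - r * h p k \<in> stalk Y p"
  using assms by (auto simp: hom_rep_def)

lemma hom_rep_const:
  assumes "hom_rep Y U h" "p \<in> U" "k \<in> stalk Y p"
  obtains V c where "zopen V" "p \<in> V" "V \<subseteq> U"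
    "\<And>q. q \<in> V ==> k \<in> stalk Y q \<and> c \<in> \<O> q \<and> h q k - c \<in> stalk Y q"
proof -
  have "\<exists>V c. zopen V \<and> p \<in> V \<and> V \<subseteq> U \<and>
        (\<forall>q\<in>V. k \<in> stalk Y q \<and> c \<in> \<O> q \<and> h q k - c \<in> stalk Y q)"
    using assms unfolding hom_rep_def by blast
  then show ?thesis by (elim exE conjE) (rule that, assumption, assumption, assumption, blast)
qed

lemma hom_rep_mono:
  assumes h: "hom_rep Y U h" and W: "zopen W" "W \<subseteq> U"
  shows "hom_rep Y W h"
  unfolding hom_rep_def
proof (intro conjI ballI W(1))
  fix p k assume p: "p \<in> W" and k: "k \<in> stalk Y p"
  have pU: "p \<in> U" using p W by blast
  show "h p k \<in> \<O> p" by (rule hom_repD(2)[OF h pU k])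
  show "h p (k + l) - (h p k + h p l) \<in> stalk Y p" if "l \<in> stalk Y p" for l by (rule hom_repD(3)[OF h pU k that])
  show "h p (r * k) - r * h p k \<in> stalk Y p" if "r \<in> \<O> p" for r by (rule hom_repD(4)[OF h pU k that])
  obtain V c where V: "zopen V" "p \<in> V" "V \<subseteq> U"
    "\<And>q. q \<in> V ==> k \<in> stalk Y q \<and> c \<in> \<O> q \<and> h q k - c \<in> stalk Y q"
    by (rule hom_rep_const[OF h pU k]) blast
  show "\<exists>V c. zopen V \<and> p \<in> V \<and> V \<subseteq> W \<and>
        (\<forall>q\<in>V. k \<in> stalk Y q \<and> c \<in> \<O> q \<and> h q k - c \<in> stalk Y q)"
    using V p W(1) by (intro exI[of _ "V \<inter> W"] exI[of _ c]) (auto intro: openin_Int)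
qed

lemma Res_structure_sheaf: "Res (structure_sheaf Y) V \<sigma> = (\<lambda>p. if p \<in> V then \<sigma> p else {})"
  by (simp add: structure_sheaf_def quot_def)

lemma structure_sheaf_empty:
  "\<sigma> p = {} ==> Add (structure_sheaf Y) U \<sigma> \<tau> p = {}" "\<sigma> p = {} ==> Smul (structure_sheaf Y) U a \<sigma> p = {}"
  by (simp_all add: structure_sheaf_def quot_def)

lemma Sec_normal_iff:
  "\<eta> \<in> Sec (normal Y) U \<longleftrightarrow> zopen U \<and>
     (\<forall>V. zopen V \<and> V \<subseteq> U \<longrightarrow> (\<forall>x\<in>Y V.
        \<eta> V x \<in> Sec (structure_sheaf Y) V \<and>
        (\<forall>y\<in>Y V. \<eta> V (Add OP V x y) = Add (structure_sheaf Y) V (\<eta> V x) (\<eta> V y)) \<and>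
        (\<forall>a\<in>Sec OP V. \<eta> V (Smul OP V a x) = Smul (structure_sheaf Y) V a (\<eta> V x)) \<and>
        (\<forall>W. zopen W \<and> W \<subseteq> V \<longrightarrow> \<eta> W (Res OP W x) = Res (structure_sheaf Y) W (\<eta> V x)))) \<and>
     (\<forall>V x. \<not> (zopen V \<and> V \<subseteq> U \<and> x \<in> Y V) \<longrightarrow> \<eta> V x = undefined)"
  unfolding normal_def sheaf_hom_def by (simp only: omodule.simps mem_Collect_eq as_module_ops)

lemma normal_ops:
  "Res (normal Y) V \<eta> = (\<lambda>W x. if W \<subseteq> V then \<eta> W x else undefined)"
  "Add (normal Y) U \<eta> \<theta> = (\<lambda>V x. if zopen V \<and> V \<subseteq> U \<and> x \<in> Y V
     then Add (structure_sheaf Y) V (\<eta> V x) (\<theta> V x) else undefined)"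
  "Smul (normal Y) U a \<eta> = (\<lambda>V x. if zopen V \<and> V \<subseteq> U \<and> x \<in> Y V
     then Smul (structure_sheaf Y) V (Res OP V a) (\<eta> V x) else undefined)"
  by (simp_all add: normal_def sheaf_hom_def as_module_def)

context ideal_sheaf
begin

lemma stalk_zero: "0 \<in> stalk I p"
  by (rule idealD(2)[OF stalk_ideal])

lemma stalk_in: "a \<in> stalk I p ==> a \<in> \<O> p"
  by (rule idealD(1)[OF stalk_ideal])

lemma stalk_add: "a \<in> stalk I p ==> b \<in> stalk I p ==> a + b \<in> stalk I p"
  by (rule idealD(3)[OF stalk_ideal])

lemma stalk_mult: "r \<in> \<O> p ==> a \<in> stalk I p ==> r * a \<in> stalk I p"
  by (rule idealD(4)[OF stalk_ideal])

lemma stalk_diff: "a \<in> stalk I p ==> b \<in> stalk I p ==> a - b \<in> stalk I p"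
  by (rule stalk.ideal_diff[OF stalk_ideal])

lemma stalk_commute: "a - b \<in> stalk I p ==> b - a \<in> stalk I p"
  using stalk_diff[OF stalk_zero, of "a - b" p] by simp

lemma stalk_trans: "a - b \<in> stalk I p ==> b - c \<in> stalk I p ==> a - c \<in> stalk I p"
  using stalk_add[of "a - b" p "b - c"] by simp

lemma hom_apply:
  "zopen V ==> V \<subseteq> U ==> a \<in> I V ==> hom_of I U h V a = (\<lambda>p. if p \<in> V then cls I p (h p (germ a)) else {})"
  by (simp add: hom_of_def)

lemma cls_self:
  assumes "k \<in> \<O> p"
  obtains V g where "(V, g) \<in> cls I p k" "germ g = k"
proof -
  obtain V where V: "zopen V" "p \<in> V" "\<And>q. q \<in> V ==> k \<in> \<O> q"
    using assms by (rule stalk_ring_open) blast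
  have "V \<noteq> {}" using V(2) by auto
  then have s: "section_of V k \<in> Sec OP V" "germ (section_of V k) = k" using section_of[OF V(1,3)] by auto
  show ?thesis by (rule that[OF _ s(2)]) (use V s stalk_zero in \<open>simp add: cls_def\<close>)
qed

lemma cls_eqI:
  assumes "k - l \<in> stalk I p" shows "cls I p k = cls I p l"
proof -
  have "germ g - k \<in> stalk I p \<longleftrightarrow> germ g - l \<in> stalk I p" for g
    using stalk_trans[OF _ assms] stalk_trans[OF _ stalk_commute[OF assms]] by blast
  then show ?thesis by (simp add: cls_def)
qed

lemma cls_eqD:
  assumes "cls I p k = cls I p l" "k \<in> \<O> p" shows "k - l \<in> stalk I p"
proof -
  obtain V g where "(V, g) \<in> cls I p k" and g: "germ g = k" by (rule cls_self[OF assms(2)])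
  then have "(V, g) \<in> cls I p l" using assms(1) by simp
  then show ?thesis using g by (simp add: cls_def)
qed

lemma qgerm_OP:
  assumes f: "f \<in> Sec OP U" and p: "p \<in> U"
  shows "qgerm OP I p U f = cls I p (germ f)"
proof -
  have "(V, g) \<in> qgerm OP I p U f \<longleftrightarrow> (V, g) \<in> cls I p (germ f)" for V g
  proof
    assume "(V, g) \<in> qgerm OP I p U f"
    then obtain W where V: "zopen V" "p \<in> V" "g \<in> Sec OP V"
      and W: "zopen W" "p \<in> W" "W \<subseteq> U \<inter> V" and d: "Diff OP W (Res OP W g) (Res OP W f) \<in> I W"
      by (auto simp: qgerm_def)
    have W': "W \<noteq> {}" "W \<subseteq> U" "W \<subseteq> V" using W by auto
    have "germ (Diff OP W (Res OP W g) (Res OP W f)) = germ g - germ f"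
      using Diff_OP(2)[OF Res_OP(1)[OF V(3) W(1) W'(3)] Res_OP(1)[OF f W(1) W'(2)] W'(1)]
        Res_OP(2)[OF V(3) W(1) W'(3,1)] Res_OP(2)[OF f W(1) W'(2,1)] by simp
    then show "(V, g) \<in> cls I p (germ f)" using germ_stalk[OF d W(2)] V by (simp add: cls_def)
  next
    assume "(V, g) \<in> cls I p (germ f)"
    then have V: "zopen V" "p \<in> V" "g \<in> Sec OP V" and d: "germ g - germ f \<in> stalk I p" by (auto simp: cls_def)
    obtain N where N: "zopen N" "p \<in> N" "\<And>q. q \<in> N ==> germ g - germ f \<in> stalk I q"
      by (rule stalk_open[OF d]) blast
    define W where "W = N \<inter> (U \<inter> V)"
    have W: "zopen W" "p \<in> W" "W \<subseteq> U" "W \<subseteq> V" "W \<noteq> {}"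
      using N V p Sec_OP_open[OF f] by (auto simp: W_def)
    have r: "Res OP W g \<in> Sec OP W" "Res OP W f \<in> Sec OP W" using Res_OP(1) V(3) f W by auto
    have "germ (Diff OP W (Res OP W g) (Res OP W f)) = germ g - germ f"
      using Diff_OP(2)[OF r W(5)] Res_OP(2)[OF V(3) W(1,4,5)] Res_OP(2)[OF f W(1,3,5)] by simp
    then have "Diff OP W (Res OP W g) (Res OP W f) \<in> I W"
      unfolding mem_iff using Diff_OP(1)[OF r] N(3) by (auto simp: W_def)
    then show "(V, g) \<in> qgerm OP I p U f" using V W by (auto simp: qgerm_def)
  qed
  then show ?thesis by auto
qed

lemma Sec_structure_sheaf:
  "\<sigma> \<in> Sec (structure_sheaf I) U \<longleftrightarrow> (\<forall>p\<in>U. \<exists>V k. zopen V \<and> p \<in> V \<and> V \<subseteq> U \<and>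
     (\<forall>q\<in>V. k \<in> \<O> q \<and> \<sigma> q = cls I q k)) \<and> (\<forall>p. p \<notin> U \<longrightarrow> \<sigma> p = {})"
proof -
  have "(\<exists>x. x \<in> Sec OP V \<and> (\<forall>q\<in>V. \<sigma> q = qgerm OP I q V x)) \<longleftrightarrow> (\<exists>k. \<forall>q\<in>V. k \<in> \<O> q \<and> \<sigma> q = cls I q k)"
    if V: "zopen V" "p \<in> V" for V p
  proof
    assume "\<exists>x. x \<in> Sec OP V \<and> (\<forall>q\<in>V. \<sigma> q = qgerm OP I q V x)"
    then obtain x where "x \<in> Sec OP V" "\<forall>q\<in>V. \<sigma> q = qgerm OP I q V x" by blast
    then show "\<exists>k. \<forall>q\<in>V. k \<in> \<O> q \<and> \<sigma> q = cls I q k"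
      using Sec_OP_germ qgerm_OP by (intro exI[of _ "germ x"]) simp
  next
    assume "\<exists>k. \<forall>q\<in>V. k \<in> \<O> q \<and> \<sigma> q = cls I q k"
    then obtain k where k: "\<forall>q\<in>V. k \<in> \<O> q \<and> \<sigma> q = cls I q k" by blast
    have "V \<noteq> {}" using V(2) by auto
    then have "section_of V k \<in> Sec OP V" "germ (section_of V k) = k" using section_of[OF V(1), of k] k by auto
    then show "\<exists>x. x \<in> Sec OP V \<and> (\<forall>q\<in>V. \<sigma> q = qgerm OP I q V x)"
      using k qgerm_OP by (intro exI[of _ "section_of V k"]) simp
  qed
  note eq = this
  have "(\<exists>V x. zopen V \<and> p \<in> V \<and> V \<subseteq> U \<and> x \<in> Sec OP V \<and> (\<forall>q\<in>V. \<sigma> q = qgerm OP I q V x)) \<longleftrightarrow>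
      (\<exists>V k. zopen V \<and> p \<in> V \<and> V \<subseteq> U \<and> (\<forall>q\<in>V. k \<in> \<O> q \<and> \<sigma> q = cls I q k))" for p
  proof (intro iffI; elim exE conjE)
    fix V x assume V: "zopen V" "p \<in> V" "V \<subseteq> U" and x: "x \<in> Sec OP V" "\<forall>q\<in>V. \<sigma> q = qgerm OP I q V x"
    have "\<exists>x. x \<in> Sec OP V \<and> (\<forall>q\<in>V. \<sigma> q = qgerm OP I q V x)" by (rule exI[of _ x]) (rule conjI[OF x])
    then obtain k where k: "\<forall>q\<in>V. k \<in> \<O> q \<and> \<sigma> q = cls I q k" unfolding eq[OF V(1,2)] ..
    show "\<exists>V k. zopen V \<and> p \<in> V \<and> V \<subseteq> U \<and> (\<forall>q\<in>V. k \<in> \<O> q \<and> \<sigma> q = cls I q k)"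
      by (rule exI[of _ V], rule exI[of _ k]) (intro conjI V k)
  next
    fix V k assume V: "zopen V" "p \<in> V" "V \<subseteq> U" and k: "\<forall>q\<in>V. k \<in> \<O> q \<and> \<sigma> q = cls I q k"
    have "\<exists>k. \<forall>q\<in>V. k \<in> \<O> q \<and> \<sigma> q = cls I q k" by (rule exI[of _ k]) (rule k)
    then obtain x where x: "x \<in> Sec OP V" "\<forall>q\<in>V. \<sigma> q = qgerm OP I q V x" unfolding eq[OF V(1,2), symmetric] by blast
    show "\<exists>V x. zopen V \<and> p \<in> V \<and> V \<subseteq> U \<and> x \<in> Sec OP V \<and> (\<forall>q\<in>V. \<sigma> q = qgerm OP I q V x)"
      by (rule exI[of _ V], rule exI[of _ x]) (intro conjI V x)
  qed
  then show ?thesis unfolding structure_sheaf_def quot_def by simp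
qed

lemma structure_sheafE:
  assumes "\<sigma> \<in> Sec (structure_sheaf I) U" "p \<in> U"
  obtains V k where "zopen V" "p \<in> V" "V \<subseteq> U" "\<forall>q\<in>V. k \<in> \<O> q \<and> \<sigma> q = cls I q k"
  using assms(1)[unfolded Sec_structure_sheaf, THEN conjunct1, THEN bspec, OF assms(2)]
  by (elim exE conjE) (rule that)

lemma structure_sheaf_off: "\<sigma> \<in> Sec (structure_sheaf I) U ==> p \<notin> U ==> \<sigma> p = {}"
  unfolding Sec_structure_sheaf by simp

lemma Add_structure_sheaf:
  assumes k: "k \<in> \<O> p" "l \<in> \<O> p" and s: "\<sigma> p = cls I p k" "\<tau> p = cls I p l"
  shows "Add (structure_sheaf I) U \<sigma> \<tau> p = cls I p (k + l)"
proof -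
  have "qgerm OP I p (V \<inter> W) (Add OP (V \<inter> W) (Res OP (V \<inter> W) x) (Res OP (V \<inter> W) y)) = cls I p (k + l)"
    if x: "(V, x) \<in> cls I p k" and y: "(W, y) \<in> cls I p l" for V x W y
  proof -
    have V: "x \<in> Sec OP V" "y \<in> Sec OP W" "zopen (V \<inter> W)" "p \<in> V \<inter> W" "V \<inter> W \<noteq> {}"
      and d: "germ x - k \<in> stalk I p" "germ y - l \<in> stalk I p" using x y by (auto simp: cls_def)
    have r: "Res OP (V \<inter> W) x \<in> Sec OP (V \<inter> W)" "Res OP (V \<inter> W) y \<in> Sec OP (V \<inter> W)" using Res_OP(1) V by auto
    have "germ (Add OP (V \<inter> W) (Res OP (V \<inter> W) x) (Res OP (V \<inter> W) y)) = germ x + germ y"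
      using Add_OP(2)[OF r V(5)] Res_OP(2)[OF V(1,3) _ V(5)] Res_OP(2)[OF V(2,3) _ V(5)] by simp
    moreover have "cls I p (germ x + germ y) = cls I p (k + l)"
      using stalk_add[OF d] by (intro cls_eqI) (simp add: algebra_simps)
    ultimately show ?thesis using qgerm_OP[OF Add_OP(1)[OF r] V(4)] by simp
  qed
  note * = this
  obtain V0 x0 where x0: "(V0, x0) \<in> cls I p k" by (rule cls_self[OF k(1)])
  obtain W0 y0 where y0: "(W0, y0) \<in> cls I p l" by (rule cls_self[OF k(2)])
  have "(\<Union>(W, y)\<in>cls I p l. qgerm OP I p (V \<inter> W) (Add OP (V \<inter> W) (Res OP (V \<inter> W) x) (Res OP (V \<inter> W) y))) = cls I p (k + l)"
    if "(V, x) \<in> cls I p k" for V x by (rule Union_const[OF y0]) (rule *[OF that])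
  then have "(\<Union>(V, x)\<in>cls I p k. \<Union>(W, y)\<in>cls I p l. qgerm OP I p (V \<inter> W) (Add OP (V \<inter> W) (Res OP (V \<inter> W) x) (Res OP (V \<inter> W) y))) = cls I p (k + l)"
    by (rule Union_const[OF x0])
  then show ?thesis by (simp add: structure_sheaf_def quot_def s)
qed

lemma Smul_structure_sheaf:
  assumes a: "a \<in> Sec OP U" "p \<in> U" and k: "k \<in> \<O> p" and s: "\<sigma> p = cls I p k"
  shows "Smul (structure_sheaf I) U a \<sigma> p = cls I p (germ a * k)"
proof -
  have "qgerm OP I p (U \<inter> V) (Smul OP (U \<inter> V) (Res OP (U \<inter> V) a) (Res OP (U \<inter> V) x)) = cls I p (germ a * k)"
    if x: "(V, x) \<in> cls I p k" for V x
  proof -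
    have V: "x \<in> Sec OP V" "zopen (U \<inter> V)" "p \<in> U \<inter> V" "U \<inter> V \<noteq> {}"
      and d: "germ x - k \<in> stalk I p" using x a Sec_OP_open[OF a(1)] by (auto simp: cls_def)
    have r: "Res OP (U \<inter> V) a \<in> Sec OP (U \<inter> V)" "Res OP (U \<inter> V) x \<in> Sec OP (U \<inter> V)" using Res_OP(1) V a by auto
    have "germ (Smul OP (U \<inter> V) (Res OP (U \<inter> V) a) (Res OP (U \<inter> V) x)) = germ a * germ x"
      using Smul_OP(2)[OF r V(4)] Res_OP(2)[OF V(1,2) _ V(4)] Res_OP(2)[OF a(1) V(2) _ V(4)] by simp
    moreover have "cls I p (germ a * germ x) = cls I p (germ a * k)"
      using stalk_mult[OF Sec_OP_germ[OF a] d] by (intro cls_eqI) (simp add: algebra_simps)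
    ultimately show ?thesis using qgerm_OP[OF Smul_OP(1)[OF r] V(3)] by simp
  qed
  note * = this
  obtain V0 x0 where x0: "(V0, x0) \<in> cls I p k" by (rule cls_self[OF k])
  have "(\<Union>(V, x)\<in>cls I p k. qgerm OP I p (U \<inter> V) (Smul OP (U \<inter> V) (Res OP (U \<inter> V) a) (Res OP (U \<inter> V) x))) = cls I p (germ a * k)"
    by (rule Union_const[OF x0]) (rule *)
  then show ?thesis by (simp add: structure_sheaf_def quot_def s)
qed

lemma hom_of_Sec:
  assumes h: "hom_rep I U h"
  shows "hom_of I U h \<in> Sec (normal I) U"
proof -
  have "hom_of I U h V x \<in> Sec (structure_sheaf I) V \<and>
        (\<forall>y\<in>I V. hom_of I U h V (Add OP V x y) = Add (structure_sheaf I) V (hom_of I U h V x) (hom_of I U h V y)) \<and>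
        (\<forall>a\<in>Sec OP V. hom_of I U h V (Smul OP V a x) = Smul (structure_sheaf I) V a (hom_of I U h V x)) \<and>
        (\<forall>W. zopen W \<and> W \<subseteq> V \<longrightarrow> hom_of I U h W (Res OP W x) = Res (structure_sheaf I) W (hom_of I U h V x))"
    if V: "zopen V" "V \<subseteq> U" and x: "x \<in> I V" for V x
  proof -
    have xp: "germ x \<in> stalk I p" "p \<in> U" "V \<noteq> {}" if "p \<in> V" for p using germ_stalk[OF x that] that V by auto
    show ?thesis
  proof (intro conjI ballI allI impI)
    show "hom_of I U h V x \<in> Sec (structure_sheaf I) V"
      unfolding Sec_structure_sheaf
    proof (intro conjI ballI allI impI)
      fix p assume p: "p \<in> V"
      obtain W c where W: "zopen W" "p \<in> W" "W \<subseteq> U"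
        "\<And>q. q \<in> W ==> germ x \<in> stalk I q \<and> c \<in> \<O> q \<and> h q (germ x) - c \<in> stalk I q"
        by (rule hom_rep_const[OF h xp(2,1)[OF p]]) blast
      have "c \<in> \<O> q \<and> hom_of I U h V x q = cls I q c" if "q \<in> V \<inter> W" for q
        using W(4)[of q] that cls_eqI by (simp add: hom_apply[OF V x])
      then show "\<exists>W k. zopen W \<and> p \<in> W \<and> W \<subseteq> V \<and> (\<forall>q\<in>W. k \<in> \<O> q \<and> hom_of I U h V x q = cls I q k)"
        using V W p by (intro exI[of _ "V \<inter> W"] exI[of _ c]) (auto intro: openin_Int)
    qed (simp add: hom_apply[OF V x])
    fix y assume y: "y \<in> I V"
    show "hom_of I U h V (Add OP V x y) = Add (structure_sheaf I) V (hom_of I U h V x) (hom_of I U h V y)"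
    proof
      fix p
      show "hom_of I U h V (Add OP V x y) p = Add (structure_sheaf I) V (hom_of I U h V x) (hom_of I U h V y) p"
      proof (cases "p \<in> V")
        case True
        note X = xp[OF True]
        have Y: "germ y \<in> stalk I p" by (rule germ_stalk[OF y True])
        have "hom_of I U h V (Add OP V x y) p = cls I p (h p (germ x + germ y))"
          using True Add_OP(2)[OF Sec[OF x] Sec[OF y] X(3)] by (simp add: hom_apply[OF V add[OF V(1) x y]])
        also have "\<dots> = cls I p (h p (germ x) + h p (germ y))" by (rule cls_eqI[OF hom_repD(3)[OF h X(2,1) Y]])
        also have "\<dots> = Add (structure_sheaf I) V (hom_of I U h V x) (hom_of I U h V y) p"
          by (rule sym[OF Add_structure_sheaf[OF hom_repD(2)[OF h X(2,1)] hom_repD(2)[OF h X(2) Y]]])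
            (simp_all add: hom_apply[OF V x] hom_apply[OF V y] True)
        finally show ?thesis .
      qed (simp add: hom_apply[OF V add[OF V(1) x y]] structure_sheaf_empty hom_apply[OF V x])
    qed
  next
    fix a assume a: "a \<in> Sec OP V"
    show "hom_of I U h V (Smul OP V a x) = Smul (structure_sheaf I) V a (hom_of I U h V x)"
    proof
      fix p
      show "hom_of I U h V (Smul OP V a x) p = Smul (structure_sheaf I) V a (hom_of I U h V x) p"
      proof (cases "p \<in> V")
        case True
        note X = xp[OF True]
        have "hom_of I U h V (Smul OP V a x) p = cls I p (h p (germ a * germ x))"
          using True Smul_OP(2)[OF a Sec[OF x] X(3)] by (simp add: hom_apply[OF V smul[OF V(1) a x]])
        also have "\<dots> = cls I p (germ a * h p (germ x))" by (rule cls_eqI[OF hom_repD(4)[OF h X(2,1) Sec_OP_germ[OF a True]]])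
        also have "\<dots> = Smul (structure_sheaf I) V a (hom_of I U h V x) p"
          by (rule sym[OF Smul_structure_sheaf[OF a True hom_repD(2)[OF h X(2,1)]]])
            (simp add: hom_apply[OF V x] True)
        finally show ?thesis .
      qed (simp add: hom_apply[OF V smul[OF V(1) a x]] structure_sheaf_empty hom_apply[OF V x])
    qed
  next
    fix W assume W: "zopen W \<and> W \<subseteq> V"
    have rx: "Res OP W x \<in> I W" using res[OF V(1) x] W by blast
    have g: "germ (Res OP W x) = germ x" if "p \<in> W" for p using Res_OP(2)[OF Sec[OF x]] W that by blast
    have WU: "zopen W" "W \<subseteq> U" using W V by auto
    show "hom_of I U h W (Res OP W x) = Res (structure_sheaf I) W (hom_of I U h V x)"
      unfolding hom_apply[OF V x] hom_apply[OF WU rx] Res_structure_sheaf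
      using g W by (auto simp: fun_eq_iff)
  qed
  qed
  note * = this
  show ?thesis
    unfolding Sec_normal_iff
  proof (rule conjI[OF hom_repD(1)[OF h]], rule conjI; intro allI impI ballI)
    show "hom_of I U h V x = undefined" if "\<not> (zopen V \<and> V \<subseteq> U \<and> x \<in> I V)" for V x
      using that by (simp only: hom_of_def if_False)
  qed (rule *; blast)
qed

text \<open>A value of \<open>\<eta>\<close> is a class, and a representative has to be chosen for
  each germ separately. Linearity and local constancy can therefore be expected only modulo the
  ideal, which is the form they have in \<open>hom_rep\<close>.\<close>

lemma Sec_normalE:
  assumes \<eta>: "\<eta> \<in> Sec (normal I) U"
  obtains h where "hom_rep I U h" "\<eta> = hom_of I U h"
proof -
  note N = \<eta>[unfolded Sec_normal_iff]
  note N1 = N[THEN conjunct2, THEN conjunct1, THEN spec, THEN mp, THEN bspec, OF conjI]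
  have U: "zopen U" by (rule N[THEN conjunct1])
  have S: "\<And>V x. zopen V ==> V \<subseteq> U ==> x \<in> I V ==> \<eta> V x \<in> Sec (structure_sheaf I) V"
    and A: "\<And>V x y. zopen V ==> V \<subseteq> U ==> x \<in> I V ==> y \<in> I V ==>
      \<eta> V (Add OP V x y) = Add (structure_sheaf I) V (\<eta> V x) (\<eta> V y)"
    and M: "\<And>V x a. zopen V ==> V \<subseteq> U ==> x \<in> I V ==> a \<in> Sec OP V ==>
      \<eta> V (Smul OP V a x) = Smul (structure_sheaf I) V a (\<eta> V x)"
    and R: "\<And>V x W. zopen V ==> V \<subseteq> U ==> x \<in> I V ==> zopen W ==> W \<subseteq> V ==>
      \<eta> W (Res OP W x) = Res (structure_sheaf I) W (\<eta> V x)"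
    and Z: "\<And>V x. \<not> (zopen V \<and> V \<subseteq> U \<and> x \<in> I V) ==> \<eta> V x = undefined"
    subgoal for V x using N1[of V x] by blast
    subgoal for V x y using N1[of V x] by blast
    subgoal for V x a using N1[of V x] by blast
    subgoal for V x W using N1[of V x] by blast
    subgoal for V x using N[THEN conjunct2, THEN conjunct2, THEN spec, THEN spec, of V x] by blast
    done
  \<comment> \<open>The candidates come from all sections with germ \<open>k\<close>. Compatibility
    of \<open>\<eta>\<close> with restriction makes their classes at \<open>p\<close> equal, so the
    choice in \<open>h\<close> is harmless.\<close>
  define P where "P p k c \<longleftrightarrow> c \<in> \<O> p \<and> (\<exists>V x. zopen V \<and> p \<in> V \<and> V \<subseteq> U \<and> x \<in> I V \<and> germ x = k \<and> \<eta> V x p = cls I p c)" for p k c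
  define h where "h p k = (SOME c. P p k c)" for p k
  have vals: "h p (germ x) \<in> \<O> p \<and> \<eta> V x p = cls I p (h p (germ x))"
    if V: "zopen V" "V \<subseteq> U" and x: "x \<in> I V" and p: "p \<in> V" for V x p
  proof -
    obtain N c where "zopen N" "p \<in> N" "N \<subseteq> V" "\<forall>q\<in>N. c \<in> \<O> q \<and> \<eta> V x q = cls I q c"
      by (rule structure_sheafE[OF S[OF V x] p])
    then have c: "c \<in> \<O> p" "\<eta> V x p = cls I p c" by auto
    have "P p (germ x) c" unfolding P_def
      by (rule conjI[OF c(1)], rule exI[of _ V], rule exI[of _ x]) (intro conjI V x p refl c(2))
    then have "P p (germ x) (h p (germ x))" unfolding h_def by (rule someI)
    then obtain V' x' where V': "zopen V'" "p \<in> V'" "V' \<subseteq> U" "x' \<in> I V'" "germ x' = germ x"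
      "\<eta> V' x' p = cls I p (h p (germ x))" and hp: "h p (germ x) \<in> \<O> p" unfolding P_def by (elim conjE exE) (rule that, assumption+)
    have W: "zopen (V \<inter> V')" "V \<inter> V' \<noteq> {}" using V V' p by auto
    have "Res OP (V \<inter> V') x = Res OP (V \<inter> V') x'"
      by (rule Sec_OP_eqI[of _ "V \<inter> V'"])
        (use Res_OP[OF Sec[OF x] W(1)] Res_OP[OF Sec[OF V'(4)] W(1)] W(2) V'(5) in auto)
    then have "Res (structure_sheaf I) (V \<inter> V') (\<eta> V x) = Res (structure_sheaf I) (V \<inter> V') (\<eta> V' x')"
      using R[OF V x W(1)] R[OF V'(1,3,4) W(1)] by simp
    then have "\<eta> V x p = \<eta> V' x' p" using p V'(2) unfolding Res_structure_sheaf by (auto dest!: fun_cong[of _ _ p])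
    then show ?thesis using V' hp by simp
  qed
  have near: "\<exists>V x. zopen V \<and> p \<in> V \<and> V \<subseteq> U \<and> V \<subseteq> N \<and> x \<in> I V \<and> germ x = k"
    if kp: "k \<in> stalk I p" and pN: "p \<in> U" "zopen N" "p \<in> N" for p k N
  proof -
    obtain V where V: "zopen V" "p \<in> V" "\<And>q. q \<in> V ==> k \<in> stalk I q" by (rule stalk_open[OF kp]) blast
    have W: "zopen (V \<inter> U \<inter> N)" "p \<in> V \<inter> U \<inter> N" using V U pN by auto
    have "section_of (V \<inter> U \<inter> N) k \<in> I (V \<inter> U \<inter> N)" using section_mem[OF W(1)] V by auto
    moreover have "germ (section_of (V \<inter> U \<inter> N) k) = k"
      using section_of(2)[OF W(1)] V(3) W(2) stalk_in by blast
    ultimately show ?thesis using W by blast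
  qed
  have rep: "hom_rep I U h" unfolding hom_rep_def
  proof (intro conjI ballI U)
    fix p k assume p: "p \<in> U" and k: "k \<in> stalk I p"
    obtain V x where V: "zopen V" "p \<in> V" "V \<subseteq> U" "x \<in> I V" and x: "germ x = k"
      using near[OF k p U p] by blast
    show "h p k \<in> \<O> p" using vals[OF V(1,3,4,2)] x by simp
    show "h p (k + l) - (h p k + h p l) \<in> stalk I p" if l: "l \<in> stalk I p" for l
    proof -
      obtain W y where W: "zopen W" "p \<in> W" "W \<subseteq> U" "W \<subseteq> V" "y \<in> I W" and y: "germ y = l"
        using near[OF l p V(1,2)] by blast
      have W': "W \<noteq> {}" using W(2) by auto
      have x': "Res OP W x \<in> I W" "germ (Res OP W x) = k"
        using res[OF V(1,4) W(1,4)] Res_OP(2)[OF Sec[OF V(4)] W(1,4) W'] x by auto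
      have gs: "germ (Add OP W (Res OP W x) y) = k + l" using Add_OP(2)[OF Sec[OF x'(1)] Sec[OF W(5)] W'] x'(2) y by simp
      note v1 = vals[OF W(1,3) x'(1) W(2), unfolded x'(2)] and v2 = vals[OF W(1,3,5,2), unfolded y]
        and v3 = vals[OF W(1,3) add[OF W(1) x'(1) W(5)] W(2), unfolded gs]
      have "cls I p (h p (k + l)) = Add (structure_sheaf I) W (\<eta> W (Res OP W x)) (\<eta> W y) p"
        using v3 A[OF W(1,3) x'(1) W(5)] by simp
      also have "\<dots> = cls I p (h p k + h p l)" using v1 v2 by (intro Add_structure_sheaf) auto
      finally show ?thesis using v3 by (intro cls_eqD) auto
    qed
    show "h p (r * k) - r * h p k \<in> stalk I p" if r: "r \<in> \<O> p" for r
    proof -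
      obtain N where N: "zopen N" "p \<in> N" "\<And>q. q \<in> N ==> r \<in> \<O> q" using r by (rule stalk_ring_open) blast
      obtain W y where W: "zopen W" "p \<in> W" "W \<subseteq> U" "W \<subseteq> N" "y \<in> I W" and y: "germ y = k"
        using near[OF k p N(1,2)] by blast
      have W': "W \<noteq> {}" using W(2) by auto
      have a: "section_of W r \<in> Sec OP W" "germ (section_of W r) = r"
        using section_of[OF W(1), of r] N(3) W(4) W' by auto
      have gs: "germ (Smul OP W (section_of W r) y) = r * k" using Smul_OP(2)[OF a(1) Sec[OF W(5)] W'] a(2) y by simp
      note v2 = vals[OF W(1,3,5,2), unfolded y]
        and v3 = vals[OF W(1,3) smul[OF W(1) a(1) W(5)] W(2), unfolded gs]
      have "cls I p (h p (r * k)) = Smul (structure_sheaf I) W (section_of W r) (\<eta> W y) p"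
        using v3 M[OF W(1,3,5) a(1)] by simp
      also have "\<dots> = cls I p (r * h p k)" using v2 Smul_structure_sheaf[OF a(1) W(2), of "h p k" "\<eta> W y"] a(2) by simp
      finally show ?thesis using v3 by (intro cls_eqD) auto
    qed
    obtain W c where W: "zopen W" "p \<in> W" "W \<subseteq> V" "\<forall>q\<in>W. c \<in> \<O> q \<and> \<eta> V x q = cls I q c"
      by (rule structure_sheafE[OF S[OF V(1,3,4)] V(2)])
    have "k \<in> stalk I q \<and> c \<in> \<O> q \<and> h q k - c \<in> stalk I q" if q: "q \<in> W" for q
    proof -
      have qV: "q \<in> V" using q W(3) by blast
      have v: "h q k \<in> \<O> q \<and> \<eta> V x q = cls I q (h q k)" using vals[OF V(1,3,4) qV] x by simp
      then have "h q k - c \<in> stalk I q" using bspec[OF W(4) q] by (intro cls_eqD) auto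
      then show ?thesis using bspec[OF W(4) q] germ_stalk[OF V(4) qV] x by simp
    qed
    then show "\<exists>V c. zopen V \<and> p \<in> V \<and> V \<subseteq> U \<and>
        (\<forall>q\<in>V. k \<in> stalk I q \<and> c \<in> \<O> q \<and> h q k - c \<in> stalk I q)"
      using W V(3) by (intro exI[of _ W] exI[of _ c]) auto
  qed
  have "\<eta> V x = hom_of I U h V x" for V x
  proof (cases "zopen V \<and> V \<subseteq> U \<and> x \<in> I V")
    case True
    then have V: "zopen V" "V \<subseteq> U" and x: "x \<in> I V" by auto
    have "\<eta> V x p = {}" if "p \<notin> V" for p by (rule structure_sheaf_off[OF S[OF V x] that])
    then show ?thesis unfolding hom_apply[OF V x] using vals[OF V x] by (intro ext) simp
  next
    case False
    then show ?thesis using Z[OF False] by (simp only: hom_of_def if_False)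
  qed
  then have "\<eta> = hom_of I U h" by (intro ext) simp
  with rep show ?thesis by (rule that)
qed

end

section \<open>Operations on representatives of normal sections\<close>

context ideal_sheaf
begin

lemma section_near:
  assumes k: "k \<in> stalk I p" and U: "zopen U" "p \<in> U"
  obtains V x where "zopen V" "p \<in> V" "V \<subseteq> U" "x \<in> I V" "germ x = k"
proof -
  obtain V where V: "zopen V" "p \<in> V" "\<And>q. q \<in> V ==> k \<in> stalk I q" by (rule stalk_open[OF k]) blast
  have W: "zopen (V \<inter> U)" "p \<in> V \<inter> U" using V U by auto
  have "section_of (V \<inter> U) k \<in> I (V \<inter> U)" using section_mem[OF W(1)] V by auto
  moreover have "germ (section_of (V \<inter> U) k) = k" using section_of(2)[OF W(1)] V(3) W(2) stalk_in by blast
  ultimately show ?thesis by (intro that[OF W]) auto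
qed

lemma hom_of_cong:
  assumes "\<And>p k. p \<in> U ==> k \<in> stalk I p ==> h p k - h' p k \<in> stalk I p"
  shows "hom_of I U h = hom_of I U h'"
proof (intro ext)
  fix V a p
  show "hom_of I U h V a p = hom_of I U h' V a p"
  proof (cases "zopen V \<and> V \<subseteq> U \<and> a \<in> I V")
    case True
    then show ?thesis
      using cls_eqI[OF assms[of p "germ a"]] germ_stalk[of a V p] by (auto simp: hom_apply)
  next
    case False
    then show ?thesis by (simp only: hom_of_def if_False)
  qed
qed

lemma hom_of_eqD:
  assumes eq: "hom_of I U h = hom_of I U h'" and h: "hom_rep I U h" and p: "p \<in> U" and k: "k \<in> stalk I p"
  shows "h p k - h' p k \<in> stalk I p"
proof -
  obtain V a where a: "zopen V" "p \<in> V" "V \<subseteq> U" "a \<in> I V" "germ a = k"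
    by (rule section_near[OF k hom_repD(1)[OF h] p])
  have "cls I p (h p k) = cls I p (h' p k)"
    using fun_cong[OF fun_cong[OF fun_cong[OF eq, of V], of a], of p] a by (simp add: hom_apply)
  then show ?thesis by (rule cls_eqD) (rule hom_repD(2)[OF h p k])
qed

lemma hom_rep_add:
  assumes h: "hom_rep I U h" "hom_rep I U h'"
  shows "hom_rep I U (\<lambda>p k. h p k + h' p k)"
  unfolding hom_rep_def
proof (intro conjI ballI hom_repD(1)[OF h(1)])
  fix p k assume p: "p \<in> U" and k: "k \<in> stalk I p"
  show "h p k + h' p k \<in> \<O> p" using hom_repD(2)[OF h(1) p k] hom_repD(2)[OF h(2) p k] by blast
  show "h p (k + l) + h' p (k + l) - (h p k + h' p k + (h p l + h' p l)) \<in> stalk I p" if l: "l \<in> stalk I p" for l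
    using stalk_add[OF hom_repD(3)[OF h(1) p k l] hom_repD(3)[OF h(2) p k l]] by (simp add: algebra_simps)
  show "h p (r * k) + h' p (r * k) - r * (h p k + h' p k) \<in> stalk I p" if r: "r \<in> \<O> p" for r
    using stalk_add[OF hom_repD(4)[OF h(1) p k r] hom_repD(4)[OF h(2) p k r]] by (simp add: algebra_simps)
  obtain V c where V: "zopen V" "p \<in> V" "V \<subseteq> U"
    "\<And>q. q \<in> V ==> k \<in> stalk I q \<and> c \<in> \<O> q \<and> h q k - c \<in> stalk I q"
    by (rule hom_rep_const[OF h(1) p k]) blast
  obtain W d where W: "zopen W" "p \<in> W" "W \<subseteq> U"
    "\<And>q. q \<in> W ==> k \<in> stalk I q \<and> d \<in> \<O> q \<and> h' q k - d \<in> stalk I q"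
    by (rule hom_rep_const[OF h(2) p k]) blast
  have "k \<in> stalk I q \<and> c + d \<in> \<O> q \<and> h q k + h' q k - (c + d) \<in> stalk I q" if q: "q \<in> V \<inter> W" for q
    using V(4)[of q] W(4)[of q] q stalk_add[of "h q k - c" q "h' q k - d"] by (auto simp: algebra_simps)
  then show "\<exists>V c. zopen V \<and> p \<in> V \<and> V \<subseteq> U \<and>
      (\<forall>q\<in>V. k \<in> stalk I q \<and> c \<in> \<O> q \<and> h q k + h' q k - c \<in> stalk I q)"
    using V(1-3) W(1-3) by (intro exI[of _ "V \<inter> W"] exI[of _ "c + d"]) (auto intro: openin_Int)
qed

lemma hom_rep_mult:
  assumes h: "hom_rep I U h" and a: "\<And>q. q \<in> U ==> a \<in> \<O> q"
  shows "hom_rep I U (\<lambda>p k. a * h p k)"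
  unfolding hom_rep_def
proof (intro conjI ballI hom_repD(1)[OF h(1)])
  fix p k assume p: "p \<in> U" and k: "k \<in> stalk I p"
  show "a * h p k \<in> \<O> p" using hom_repD(2)[OF h(1) p k] a[OF p] by blast
  show "a * h p (k + l) - (a * h p k + a * h p l) \<in> stalk I p" if l: "l \<in> stalk I p" for l
    using stalk_mult[OF a[OF p] hom_repD(3)[OF h(1) p k l]] by (simp add: algebra_simps)
  show "a * h p (r * k) - r * (a * h p k) \<in> stalk I p" if r: "r \<in> \<O> p" for r
    using stalk_mult[OF a[OF p] hom_repD(4)[OF h(1) p k r]] by (simp add: algebra_simps)
  obtain V c where V: "zopen V" "p \<in> V" "V \<subseteq> U"
    "\<And>q. q \<in> V ==> k \<in> stalk I q \<and> c \<in> \<O> q \<and> h q k - c \<in> stalk I q"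
    by (rule hom_rep_const[OF h(1) p k]) blast
  have "k \<in> stalk I q \<and> a * c \<in> \<O> q \<and> a * h q k - a * c \<in> stalk I q" if q: "q \<in> V" for q
  proof -
    have "a \<in> \<O> q" using a q V(3) by blast
    then show ?thesis using V(4)[OF q] stalk_mult[of a q "h q k - c"] by (auto simp: algebra_simps)
  qed
  then show "\<exists>V c. zopen V \<and> p \<in> V \<and> V \<subseteq> U \<and>
      (\<forall>q\<in>V. k \<in> stalk I q \<and> c \<in> \<O> q \<and> a * h q k - c \<in> stalk I q)"
    using V(1-3) by (intro exI[of _ V] exI[of _ "a * c"]) simp
qed

lemma hom_rep_diff:
  assumes h: "hom_rep I U h" "hom_rep I U h'"
  shows "hom_rep I U (\<lambda>p k. h p k - h' p k)"
proof -
  have "- 1 \<in> \<O> q" for q by blast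
  from hom_rep_add[OF h(1) hom_rep_mult[OF h(2) this]] show ?thesis by simp
qed

lemma Res_hom_of:
  assumes "W \<subseteq> U"
  shows "Res (normal I) W (hom_of I U h) = hom_of I W h"
  using assms by (intro ext) (auto simp: normal_ops hom_of_def)

lemma Add_hom_of:
  assumes h: "hom_rep I U h" "hom_rep I U h'"
  shows "Add (normal I) U (hom_of I U h) (hom_of I U h') = hom_of I U (\<lambda>p k. h p k + h' p k)"
proof (intro ext)
  fix V a p
  show "Add (normal I) U (hom_of I U h) (hom_of I U h') V a p = hom_of I U (\<lambda>p k. h p k + h' p k) V a p"
  proof (cases "zopen V \<and> V \<subseteq> U \<and> a \<in> I V")
    case True
    then have V: "zopen V" "V \<subseteq> U" and a: "a \<in> I V" by auto
    show ?thesis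
    proof (cases "p \<in> V")
      case p: True
      have pU: "p \<in> U" and k: "germ a \<in> stalk I p" using p V germ_stalk[OF a p] by auto
      show ?thesis
        using Add_structure_sheaf[OF hom_repD(2)[OF h(1) pU k] hom_repD(2)[OF h(2) pU k],
            of "hom_of I U h V a" "hom_of I U h' V a" V] True p
        by (simp add: normal_ops hom_apply[OF V a])
    next
      case False
      then show ?thesis using True by (simp add: normal_ops hom_apply[OF V a] structure_sheaf_empty)
    qed
  next
    case False
    then show ?thesis by (simp only: normal_ops hom_of_def if_False)
  qed
qed

lemma Smul_hom_of:
  assumes h: "hom_rep I U h" and b: "b \<in> Sec OP U"
  shows "Smul (normal I) U b (hom_of I U h) = hom_of I U (\<lambda>p k. germ b * h p k)"
proof (intro ext)
  fix V a p
  show "Smul (normal I) U b (hom_of I U h) V a p = hom_of I U (\<lambda>p k. germ b * h p k) V a p"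
  proof (cases "zopen V \<and> V \<subseteq> U \<and> a \<in> I V")
    case True
    then have V: "zopen V" "V \<subseteq> U" and a: "a \<in> I V" by auto
    show ?thesis
    proof (cases "p \<in> V")
      case p: True
      have pU: "p \<in> U" and k: "germ a \<in> stalk I p" and V0: "V \<noteq> {}" using p V germ_stalk[OF a p] by auto
      show ?thesis
        using Smul_structure_sheaf[OF Res_OP(1)[OF b V] p hom_repD(2)[OF h(1) pU k], of "hom_of I U h V a"]
          Res_OP(2)[OF b V V0] True p
        by (simp add: normal_ops hom_apply[OF V a])
    next
      case False
      then show ?thesis using True by (simp add: normal_ops hom_apply[OF V a] structure_sheaf_empty)
    qed
  next
    case False
    then show ?thesis by (simp only: normal_ops hom_of_def if_False)
  qed
qed

lemma Diff_hom_of: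
  assumes h: "hom_rep I U h" "hom_rep I U h'"
  shows "Diff (normal I) U (hom_of I U h) (hom_of I U h') = hom_of I U (\<lambda>p k. h p k - h' p k)"
proof -
  let ?m = "section_of U (- 1)"
  have m: "?m \<in> Sec OP U" "U \<noteq> {} ==> germ ?m = - 1"
    using section_of[OF hom_repD(1)[OF h(1)], of "- 1"] by auto
  have "Diff (normal I) U (hom_of I U h) (hom_of I U h') = hom_of I U (\<lambda>p k. h p k + germ ?m * h' p k)"
    unfolding Diff_def uminus_one_section Smul_hom_of[OF h(2) m(1)]
    by (rule Add_hom_of[OF h(1) hom_rep_mult[OF h(2) Sec_OP_germ[OF m(1)]]])
  also have "\<dots> = hom_of I U (\<lambda>p k. h p k - h' p k)"
  proof (rule hom_of_cong)
    fix p k assume "p \<in> U"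
    then have "germ ?m = - 1" using m(2) by blast
    then show "h p k + germ ?m * h' p k - (h p k - h' p k) \<in> stalk I p" using stalk_zero by simp
  qed
  finally show ?thesis .
qed

end

text \<open>The map \<open>h\<close> need not come from a section of the normal sheaf of \<open>Y\<close>: it may be given modulo
  \<open>Z\<close> only.\<close>

definition ncls :: "ideal \<Rightarrow> ideal \<Rightarrow> p3 \<Rightarrow> (p3 \<Rightarrow> ratfun \<Rightarrow> ratfun) \<Rightarrow> (p3 set \<times> nsec) set" where
  "ncls Y Z p h = {(V, \<eta>). zopen V \<and> p \<in> V \<and>
     (\<exists>h'. hom_rep Y V h' \<and> \<eta> = hom_of Y V h' \<and> (\<forall>k\<in>stalk Y p. h' p k - h p k \<in> stalk Z p))}"

text \<open>This holds when \<open>Y\<close> is a local complete intersection; it makes the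
  canonical map \<open>can Y Z\<close> injective.\<close>

definition lifts :: "ideal \<Rightarrow> ideal \<Rightarrow> bool" where
  "lifts Y Z \<longleftrightarrow> (\<forall>U h p. hom_rep Y U h \<and> p \<in> U \<and> (\<forall>k\<in>stalk Y p. h p k \<in> stalk Z p) \<longrightarrow>
     (\<exists>W. zopen W \<and> p \<in> W \<and> W \<subseteq> U \<and> hom_of Y W h \<in> ideal_mult Z (normal Y) W))"

text \<open>The values of \<open>f\<close> modulo \<open>Z\<close> lift locally to a normal section
  of \<open>Y\<close>; this is the surjectivity that makes the inverse image in
  \<open>normal_map\<close> nonempty.\<close>

definition extends_to :: "ideal \<Rightarrow> ideal \<Rightarrow> p3 set \<Rightarrow> (p3 \<Rightarrow> ratfun \<Rightarrow> ratfun) \<Rightarrow> bool" where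
  "extends_to Y Z U f \<longleftrightarrow> (\<forall>p\<in>U. \<exists>V h. zopen V \<and> p \<in> V \<and> V \<subseteq> U \<and> hom_rep Y V h \<and>
     (\<forall>q\<in>V. \<forall>k\<in>stalk Y q. h q k - f q k \<in> stalk Z q))"

lemma extends_toE:
  assumes "extends_to Y Z U f" "p \<in> U"
  obtains V h where "zopen V" "p \<in> V" "V \<subseteq> U" "hom_rep Y V h"
    "\<forall>q\<in>V. \<forall>k\<in>stalk Y q. h q k - f q k \<in> stalk Z q"
  using bspec[OF assms(1)[unfolded extends_to_def] assms(2)] by (elim exE conjE) (rule that)

lemma nclsE:
  assumes "(V, \<eta>) \<in> ncls Y Z p h"
  obtains h' where "zopen V" "p \<in> V" "hom_rep Y V h'" "\<eta> = hom_of Y V h'"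
    "\<forall>k\<in>stalk Y p. h' p k - h p k \<in> stalk Z p"
  using assms unfolding ncls_def mem_Collect_eq case_prod_conv by (elim exE conjE) (rule that)

lemma nclsI:
  assumes "hom_rep Y V h'" "p \<in> V" "\<forall>k\<in>stalk Y p. h' p k - h p k \<in> stalk Z p"
  shows "(V, hom_of Y V h') \<in> ncls Y Z p h"
  unfolding ncls_def mem_Collect_eq case_prod_conv
  using hom_repD(1)[OF assms(1)] assms by (intro conjI exI[of _ h'] refl)

section \<open>The normal sheaf of a scheme restricted to a closed subscheme\<close>

locale subscheme = Y: ideal_sheaf Y + Z: ideal_sheaf Z for Y Z +
  assumes stalk_le: "stalk Y p \<subseteq> stalk Z p"
begin

lemma le: "Y \<le> Z"
  using ideal_sheaf_le_iff[OF Y.ideal_sheaf_axioms Z.ideal_sheaf_axioms] stalk_le by blast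

lemma ideal_multI:
  assumes h: "hom_rep Y W h" and a: "a \<in> Z W"
  shows "hom_of Y W (\<lambda>p k. germ a * h p k) \<in> ideal_mult Z (normal Y) W"
proof -
  let ?x = "hom_of Y W (\<lambda>p k. germ a * h p k)"
  note a' = Z.Sec[OF a]
  have W: "zopen W" by (rule hom_repD(1)[OF h])
  have x: "?x \<in> Sec (normal Y) W" by (rule Y.hom_of_Sec[OF Y.hom_rep_mult[OF h Sec_OP_germ[OF a']]])
  have "?x = Smul (normal Y) W a (hom_of Y W h)" by (rule Y.Smul_hom_of[OF h a', symmetric])
  then have "?x \<in> add_closure (normal Y) W {Smul (normal Y) W a x | a x. a \<in> Z W \<and> x \<in> Sec (normal Y) W}"
    using a Y.hom_of_Sec[OF h] by (intro add_closure.base) blast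
  moreover have "Res (normal Y) W ?x = ?x" by (rule Y.Res_hom_of) simp
  ultimately show ?thesis unfolding ideal_mult_def localize_def using x W by auto
qed

lemma add_closure_values:
  assumes "\<eta> \<in> add_closure (normal Y) U {Smul (normal Y) U a x | a x. a \<in> Z U \<and> x \<in> Sec (normal Y) U}"
  shows "\<exists>h. hom_rep Y U h \<and> \<eta> = hom_of Y U h \<and> (\<forall>p\<in>U. \<forall>k\<in>stalk Y p. h p k \<in> stalk Z p)"
  using assms
proof induction
  case (base x)
  then obtain a y where ay: "x = Smul (normal Y) U a y" "a \<in> Z U" "y \<in> Sec (normal Y) U" by blast
  obtain h where h: "hom_rep Y U h" "y = hom_of Y U h" by (rule Y.Sec_normalE[OF ay(3)])
  note a' = Z.Sec[OF ay(2)]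
  have "x = hom_of Y U (\<lambda>p k. germ a * h p k)" using Y.Smul_hom_of[OF h(1) a'] ay(1) h(2) by simp
  moreover have "germ a * h p k \<in> stalk Z p" if p: "p \<in> U" and k: "k \<in> stalk Y p" for p k
    by (rule idealD(5)[OF Z.stalk_ideal hom_repD(2)[OF h(1) p k] Z.germ_stalk[OF ay(2) p]])
  ultimately show ?case using Y.hom_rep_mult[OF h(1) Sec_OP_germ[OF a']] by (intro exI[of _ "\<lambda>p k. germ a * h p k"]) simp
next
  case (add x y)
  obtain h where h: "hom_rep Y U h" "x = hom_of Y U h" "\<forall>p\<in>U. \<forall>k\<in>stalk Y p. h p k \<in> stalk Z p" using add.IH(1) by (elim exE conjE) (rule that)
  obtain h' where h': "hom_rep Y U h'" "y = hom_of Y U h'" "\<forall>p\<in>U. \<forall>k\<in>stalk Y p. h' p k \<in> stalk Z p" using add.IH(2) by (elim exE conjE) (rule that)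
  show ?case
    using Y.hom_rep_add[OF h(1) h'(1)] Y.Add_hom_of[OF h(1) h'(1)] h(2,3) h'(2,3) Z.stalk_add
    by (intro exI[of _ "\<lambda>p k. h p k + h' p k"]) simp
qed

text \<open>Locally the section is a sum of multiples by elements of the ideal of \<open>Z\<close>.
  A change of representative alters values only by the ideal of \<open>Y\<close>, which is
  smaller.\<close>

lemma ideal_multD:
  assumes x: "hom_of Y W h \<in> ideal_mult Z (normal Y) W" and h: "hom_rep Y W h" and p: "p \<in> W" and k: "k \<in> stalk Y p"
  shows "h p k \<in> stalk Z p"
proof -
  obtain V where V: "zopen V" "p \<in> V" "V \<subseteq> W"
    "Res (normal Y) V (hom_of Y W h) \<in> add_closure (normal Y) V {Smul (normal Y) V a x | a x. a \<in> Z V \<and> x \<in> Sec (normal Y) V}"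
    using x p unfolding ideal_mult_def localize_def by blast
  obtain h' where h': "hom_rep Y V h'" "Res (normal Y) V (hom_of Y W h) = hom_of Y V h'"
    "\<forall>p\<in>V. \<forall>k\<in>stalk Y p. h' p k \<in> stalk Z p" using add_closure_values[OF V(4)] by (elim exE conjE) (rule that)
  have eq: "hom_of Y V h = hom_of Y V h'" using h'(2) Y.Res_hom_of[OF V(3)] by simp
  have "h p k - h' p k \<in> stalk Y p" by (rule Y.hom_of_eqD[OF eq hom_rep_mono[OF h V(1,3)] V(2) k])
  then have "h p k - h' p k \<in> stalk Z p" using stalk_le by blast
  moreover have "h' p k \<in> stalk Z p" using h'(3) V(2) k by blast
  ultimately show ?thesis using Z.stalk_add[of "h p k - h' p k" p "h' p k"] by simp
qed

lemma ncls_eqI: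
  assumes "\<And>k. k \<in> stalk Y p ==> h p k - h' p k \<in> stalk Z p"
  shows "ncls Y Z p h = ncls Y Z p h'"
proof -
  have "g p k - h p k \<in> stalk Z p \<longleftrightarrow> g p k - h' p k \<in> stalk Z p" if "k \<in> stalk Y p" for g k
    using Z.stalk_trans[OF _ assms[OF that]] Z.stalk_trans[OF _ Z.stalk_commute[OF assms[OF that]]] by blast
  then show ?thesis by (simp add: ncls_def cong: ball_cong)
qed

lemma ncls_eqD:
  assumes eq: "ncls Y Z p f = ncls Y Z p f'" and ne: "(V, \<eta>) \<in> ncls Y Z p f" and k: "k \<in> stalk Y p"
  shows "f p k - f' p k \<in> stalk Z p"
proof -
  obtain h where V: "p \<in> V" and h: "hom_rep Y V h" "\<eta> = hom_of Y V h"
    and d: "\<forall>k\<in>stalk Y p. h p k - f p k \<in> stalk Z p" by (rule nclsE[OF ne])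
  obtain h' where h': "\<eta> = hom_of Y V h'" and d': "\<forall>k\<in>stalk Y p. h' p k - f' p k \<in> stalk Z p"
    by (rule nclsE[OF ne[unfolded eq]])
  have "hom_of Y V h = hom_of Y V h'" using h(2) h' by simp
  then have "h p k - h' p k \<in> stalk Z p" using Y.hom_of_eqD[OF _ h(1) V k] stalk_le by blast
  then have "h p k - f' p k \<in> stalk Z p" by (rule Z.stalk_trans[OF _ bspec[OF d' k]])
  then show ?thesis by (rule Z.stalk_trans[OF Z.stalk_commute[OF bspec[OF d k]]])
qed

lemma ncls_self: "hom_rep Y U h ==> p \<in> U ==> (U, hom_of Y U h) \<in> ncls Y Z p h"
  using Z.stalk_zero by (intro nclsI) auto

text \<open>A quotient by the product with the ideal of \<open>Z\<close> always determines the
  values modulo \<open>Z\<close>. The converse inclusion is where \<open>lifts\<close>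
  enters.\<close>

lemma qgerm_normalD:
  assumes h: "hom_rep Y U h" and q: "(V, \<eta>) \<in> qgerm (normal Y) (ideal_mult Z (normal Y)) p U (hom_of Y U h)"
  shows "(V, \<eta>) \<in> ncls Y Z p h"
proof -
  obtain W where V: "zopen V" "p \<in> V" "\<eta> \<in> Sec (normal Y) V" and W: "zopen W" "p \<in> W" "W \<subseteq> U \<inter> V"
    and d: "Diff (normal Y) W (Res (normal Y) W \<eta>) (Res (normal Y) W (hom_of Y U h)) \<in> ideal_mult Z (normal Y) W"
    using q unfolding qgerm_def by blast
  obtain h' where h': "hom_rep Y V h'" "\<eta> = hom_of Y V h'" by (rule Y.Sec_normalE[OF V(3)])
  have WU: "W \<subseteq> U" "W \<subseteq> V" using W(3) by auto
  have r: "hom_rep Y W h'" "hom_rep Y W h" using hom_rep_mono h h'(1) W(1) WU by blast+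
  have "hom_of Y W (\<lambda>p k. h' p k - h p k) \<in> ideal_mult Z (normal Y) W"
    using d unfolding h'(2) Y.Res_hom_of[OF WU(1)] Y.Res_hom_of[OF WU(2)] Y.Diff_hom_of[OF r] .
  then have "h' p k - h p k \<in> stalk Z p" if "k \<in> stalk Y p" for k
    by (rule ideal_multD[OF _ Y.hom_rep_diff[OF r] W(2) that])
  then show ?thesis unfolding h'(2) using h'(1) V(2) by (intro nclsI) auto
qed

lemma qgerm_normal:
  assumes l: "lifts Y Z" and h: "hom_rep Y U h" and p: "p \<in> U"
  shows "qgerm (normal Y) (ideal_mult Z (normal Y)) p U (hom_of Y U h) = ncls Y Z p h"
proof -
  have "(V, \<eta>) \<in> qgerm (normal Y) (ideal_mult Z (normal Y)) p U (hom_of Y U h)" if n: "(V, \<eta>) \<in> ncls Y Z p h" for V \<eta>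
  proof -
    obtain h' where V: "zopen V" "p \<in> V" and h': "hom_rep Y V h'" "\<eta> = hom_of Y V h'"
      and d: "\<forall>k\<in>stalk Y p. h' p k - h p k \<in> stalk Z p" by (rule nclsE[OF n])
    have UV: "zopen (U \<inter> V)" "p \<in> U \<inter> V" using hom_repD(1)[OF h] V p by auto
    have r: "hom_rep Y (U \<inter> V) h'" "hom_rep Y (U \<inter> V) h"
      by (rule hom_rep_mono[OF h'(1) UV(1)], simp, rule hom_rep_mono[OF h UV(1)], simp)
    obtain W where W: "zopen W" "p \<in> W" "W \<subseteq> U \<inter> V"
      "hom_of Y W (\<lambda>p k. h' p k - h p k) \<in> ideal_mult Z (normal Y) W"
      using l[unfolded lifts_def, rule_format, OF conjI[OF Y.hom_rep_diff[OF r] conjI[OF UV(2)]]] d by blast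
    have WU: "W \<subseteq> U" "W \<subseteq> V" using W(3) by auto
    have rW: "hom_rep Y W h'" "hom_rep Y W h" using hom_rep_mono r W(1,3) by blast+
    have "Diff (normal Y) W (Res (normal Y) W \<eta>) (Res (normal Y) W (hom_of Y U h)) \<in> ideal_mult Z (normal Y) W"
      unfolding h'(2) Y.Res_hom_of[OF WU(1)] Y.Res_hom_of[OF WU(2)] Y.Diff_hom_of[OF rW] by (rule W(4))
    then show ?thesis unfolding qgerm_def using V W(1-3) Y.hom_of_Sec[OF h'(1)] h'(2) by blast
  qed
  then show ?thesis using qgerm_normalD[OF h] by auto
qed

lemma can_apply:
  assumes \<sigma>: "\<sigma> p = ncls Y Z p f" and ne: "(W0, \<eta>0) \<in> ncls Y Z p f"
    and V: "zopen V" "V \<subseteq> U" and a: "a \<in> Y V" and p: "p \<in> V"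
  shows "can Y Z U \<sigma> V a p = cls Z p (f p (germ a))"
proof -
  have k: "germ a \<in> stalk Y p" by (rule Y.germ_stalk[OF a p])
  have "quot_change OP Z (\<psi> (V \<inter> W) (Res OP (V \<inter> W) a)) p = cls Z p (f p (germ a))"
    if n: "(W, \<psi>) \<in> ncls Y Z p f" for W \<psi>
  proof -
    obtain h where W: "zopen W" "p \<in> W" and h: "hom_rep Y W h" "\<psi> = hom_of Y W h"
      and d: "\<forall>k\<in>stalk Y p. h p k - f p k \<in> stalk Z p" by (rule nclsE[OF n])
    have VW: "zopen (V \<inter> W)" "V \<inter> W \<subseteq> W" "V \<inter> W \<subseteq> V" "p \<in> V \<inter> W" "V \<inter> W \<noteq> {}" using V W p by auto
    have ra: "Res OP (V \<inter> W) a \<in> Y (V \<inter> W)" "germ (Res OP (V \<inter> W) a) = germ a"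
      using Y.res[OF V(1) a VW(1,3)] Res_OP(2)[OF Y.Sec[OF a] VW(1,3,5)] by auto
    have hk: "h p (germ a) \<in> \<O> p" by (rule hom_repD(2)[OF h(1) W(2) k])
    have *: "\<psi> (V \<inter> W) (Res OP (V \<inter> W) a) p = cls Y p (h p (germ a))"
      unfolding h(2) Y.hom_apply[OF VW(1,2) ra(1)] using VW(4) ra(2) by simp
    have "qgerm OP Z p N x = cls Z p (f p (germ a))" if x: "(N, x) \<in> cls Y p (h p (germ a))" for N x
    proof -
      have N: "x \<in> Sec OP N" "p \<in> N" "germ x - h p (germ a) \<in> stalk Y p" using x by (auto simp: cls_def)
      have "germ x - h p (germ a) \<in> stalk Z p" using N(3) stalk_le by blast
      then have "germ x - f p (germ a) \<in> stalk Z p" using Z.stalk_trans bspec[OF d k] by blast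
      then show ?thesis using Z.qgerm_OP[OF N(1,2)] Z.cls_eqI by simp
    qed
    moreover obtain N0 x0 where "(N0, x0) \<in> cls Y p (h p (germ a))" by (rule Y.cls_self[OF hk])
    ultimately show ?thesis unfolding quot_change_def * by (intro Union_const)
  qed
  then have "(\<Union>(W, \<psi>)\<in>ncls Y Z p f. quot_change OP Z (\<psi> (V \<inter> W) (Res OP (V \<inter> W) a)) p) = cls Z p (f p (germ a))"
    by (rule Union_const[OF ne])
  then show ?thesis unfolding can_def using V a p \<sigma> by simp
qed

lemma hom_restrict_apply:
  assumes V: "zopen V" "V \<subseteq> U" and a: "a \<in> Y V"
  shows "hom_restrict Y U (hom_of Z U f) V a = (\<lambda>p. if p \<in> V then cls Z p (f p (germ a)) else {})"
proof -
  have "a \<in> Z V" using a le by (auto simp: le_fun_def)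
  then show ?thesis using V a by (simp add: hom_restrict_def Z.hom_apply)
qed

text \<open>The map is defined through \<open>inv_into\<close>, so both halves matter:
  \<open>extends_to\<close> supplies a preimage under \<open>can\<close>, and \<open>lifts\<close>
  shows that any preimage has the stated class.\<close>

lemma normal_map_eq:
  assumes l: "lifts Y Z" and f: "hom_rep Z U f" and ext: "extends_to Y Z U f" and p: "p \<in> U"
  shows "normal_map Y Z U (hom_of Z U f) p = ncls Y Z p f"
proof -
  define S where "S = Sec (tensor_O (normal Y) Z) U"
  define \<sigma> where "\<sigma> q = (if q \<in> U then ncls Y Z q f else {})" for q
  have "\<sigma> \<in> S" unfolding S_def tensor_O_def quot_def omodule.simps mem_Collect_eq
  proof (intro conjI ballI allI impI)
    fix q assume "q \<in> U"
    then obtain V h where V: "zopen V" "q \<in> V" "V \<subseteq> U" and h: "hom_rep Y V h"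
      and d: "\<forall>q\<in>V. \<forall>k\<in>stalk Y q. h q k - f q k \<in> stalk Z q" by (rule extends_toE[OF ext])
    have "\<sigma> r = qgerm (normal Y) (ideal_mult Z (normal Y)) r V (hom_of Y V h)" if r: "r \<in> V" for r
      using qgerm_normal[OF l h r] ncls_eqI[of r h f] d r V(3) by (auto simp: \<sigma>_def)
    then show "\<exists>V x. zopen V \<and> q \<in> V \<and> V \<subseteq> U \<and> x \<in> Sec (normal Y) V \<and>
        (\<forall>q\<in>V. \<sigma> q = qgerm (normal Y) (ideal_mult Z (normal Y)) q V x)"
      using V Y.hom_of_Sec[OF h] by (intro exI[of _ V] exI[of _ "hom_of Y V h"]) simp
  qed (simp add: \<sigma>_def)
  moreover have "can Y Z U \<sigma> = hom_restrict Y U (hom_of Z U f)"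
  proof (intro HOL.ext)
    fix V a q
    show "can Y Z U \<sigma> V a q = hom_restrict Y U (hom_of Z U f) V a q"
    proof (cases "zopen V \<and> V \<subseteq> U \<and> a \<in> Y V")
      case True
      then have V: "zopen V" "V \<subseteq> U" and a: "a \<in> Y V" by auto
      show ?thesis
      proof (cases "q \<in> V")
        case q: True
        then have qU: "q \<in> U" using V by blast
        obtain W h where W: "q \<in> W" and h: "hom_rep Y W h"
          and d: "\<forall>q\<in>W. \<forall>k\<in>stalk Y q. h q k - f q k \<in> stalk Z q" by (rule extends_toE[OF ext qU])
        have "(W, hom_of Y W h) \<in> ncls Y Z q f" by (rule nclsI) (rule h, rule W, rule bspec[OF d W])
        then show ?thesis
          using can_apply[of \<sigma> q f _ _ V U a] V a q qU by (simp add: hom_restrict_apply \<sigma>_def)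
      next
        case False
        then show ?thesis using V a by (simp add: hom_restrict_apply can_def)
      qed
    next
      case False
      then show ?thesis by (simp only: can_def hom_restrict_def if_False)
    qed
  qed
  ultimately have im: "hom_restrict Y U (hom_of Z U f) \<in> can Y Z U ` S" by (metis image_eqI)
  \<comment> \<open>An arbitrary preimage is now evaluated on sections near \<open>p\<close>; its
    values agree with those of \<open>f\<close> modulo \<open>Z\<close>.\<close>
  define \<tau> where "\<tau> = normal_map Y Z U (hom_of Z U f)"
  have \<tau>: "\<tau> \<in> S" and can: "can Y Z U \<tau> = hom_restrict Y U (hom_of Z U f)"
    unfolding \<tau>_def normal_map_def S_def[symmetric] by (rule inv_into_into[OF im], rule f_inv_into_f[OF im])
  obtain V x where V: "zopen V" "p \<in> V" "V \<subseteq> U" and x: "x \<in> Sec (normal Y) V"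
    "\<forall>q\<in>V. \<tau> q = qgerm (normal Y) (ideal_mult Z (normal Y)) q V x"
    using \<tau> p unfolding S_def tensor_O_def quot_def omodule.simps mem_Collect_eq by blast
  obtain h where h: "hom_rep Y V h" "x = hom_of Y V h" by (rule Y.Sec_normalE[OF x(1)])
  have \<tau>p: "\<tau> p = ncls Y Z p h" using x(2) V(2) qgerm_normal[OF l h(1) V(2)] h(2) by simp
  have "h p k - f p k \<in> stalk Z p" if k: "k \<in> stalk Y p" for k
  proof -
    obtain N a where N: "zopen N" "p \<in> N" "N \<subseteq> V" "a \<in> Y N" "germ a = k"
      by (rule Y.section_near[OF k V(1,2)])
    have NU: "N \<subseteq> U" using N V by auto
    have "cls Z p (h p k) = cls Z p (f p k)"
      using can_apply[of \<tau>, OF \<tau>p ncls_self[OF h(1) V(2)] N(1) NU N(4,2)] hom_restrict_apply[OF N(1) NU N(4), of f] N(2,5) can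
      by simp
    then show ?thesis by (rule Z.cls_eqD) (rule hom_repD(2)[OF h(1) V(2) k])
  qed
  then show ?thesis unfolding \<tau>_def[symmetric] \<tau>p by (rule ncls_eqI)
qed

end

text \<open>Every map in the composite keeps the values on the ideal of \<open>Y\<close> and only
  weakens the congruence in which they are considered, finally to one modulo
  \<open>W\<close>.\<close>

lemma r_map_eq:
  assumes "subscheme Y Z" "subscheme Z W" and l: "lifts Y Z" "lifts Y W"
    and ext: "\<And>V f. hom_rep Z V f ==> extends_to Y Z V f" and f: "hom_rep Z UNIV f"
  shows "r_map Y Z W (hom_of Z UNIV f) p = ncls Y W p f"
proof -
  interpret YZ: subscheme Y Z by fact
  interpret ZW: subscheme Z W by fact
  interpret YW: subscheme Y W by unfold_locales (use YZ.stalk_le ZW.stalk_le in blast)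
  have main: "quot_change (normal Y) (ideal_mult W (normal Y)) (normal_map Y Z V \<phi>) p = ncls Y W p f"
    if n: "(V, \<phi>) \<in> ncls Z W p f" for V \<phi>
  proof -
    obtain f' where V: "p \<in> V" and f': "hom_rep Z V f'" "\<phi> = hom_of Z V f'"
      and d: "\<forall>k\<in>stalk Z p. f' p k - f p k \<in> stalk W p" by (rule nclsE[OF n])
    note e = ext[OF f'(1)]
    have *: "normal_map Y Z V \<phi> p = ncls Y Z p f'" unfolding f'(2) by (rule YZ.normal_map_eq[OF l(1) f'(1) e V])
    have "qgerm (normal Y) (ideal_mult W (normal Y)) p N x = ncls Y W p f" if x: "(N, x) \<in> ncls Y Z p f'" for N x
    proof -
      obtain h where N: "p \<in> N" and h: "hom_rep Y N h" "x = hom_of Y N h"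
        and d': "\<forall>k\<in>stalk Y p. h p k - f' p k \<in> stalk Z p" by (rule nclsE[OF x])
      have "h p k - f p k \<in> stalk W p" if k: "k \<in> stalk Y p" for k
        using ZW.Z.stalk_trans[of "h p k" "f' p k" p "f p k"] bspec[OF d' k] bspec[OF d] k YZ.stalk_le[of p] ZW.stalk_le[of p] by blast
      then have "ncls Y W p h = ncls Y W p f" by (rule YW.ncls_eqI)
      then show ?thesis unfolding h(2) using YW.qgerm_normal[OF l(2) h(1) N] by simp
    qed
    moreover obtain N h where N: "p \<in> N" and h: "hom_rep Y N h"
      and d'': "\<forall>q\<in>N. \<forall>k\<in>stalk Y q. h q k - f' q k \<in> stalk Z q" by (rule extends_toE[OF e V])
    have "(N, hom_of Y N h) \<in> ncls Y Z p f'" by (rule nclsI) (rule h, rule N, rule bspec[OF d'' N])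
    ultimately show ?thesis unfolding quot_change_def * by (intro Union_const)
  qed
  \<comment> \<open>For \<open>Z\<close> and \<open>W\<close> only the inclusion
    \<open>qgerm_normalD\<close> is at hand, which says nothing if the class is empty. The section
    represents its own class because the zero multiple lies in the product.\<close>
  have "(UNIV, hom_of Z UNIV f) \<in> qgerm (normal Z) (ideal_mult W (normal Z)) p UNIV (hom_of Z UNIV f)"
  proof -
    have g0: "germ (\<lambda>_. 0) = 0" using cst.cst_0 by (simp add: cst_def)
    have "Diff (normal Z) UNIV (hom_of Z UNIV f) (hom_of Z UNIV f) = hom_of Z UNIV (\<lambda>p k. germ (\<lambda>_. 0) * f p k)"
      using YZ.Z.Diff_hom_of[OF f f] g0 by simp
    also have "\<dots> \<in> ideal_mult W (normal Z) UNIV"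
      by (rule ZW.ideal_multI[OF f ZW.Z.zero[OF openin_zariski_UNIV]])
    finally have "Diff (normal Z) UNIV (Res (normal Z) UNIV (hom_of Z UNIV f)) (Res (normal Z) UNIV (hom_of Z UNIV f)) \<in> ideal_mult W (normal Z) UNIV"
      using YZ.Z.Res_hom_of[of UNIV UNIV f] by simp
    then show ?thesis unfolding qgerm_def mem_Collect_eq case_prod_conv
      using YZ.Z.hom_of_Sec[OF f] by (intro conjI exI[of _ UNIV]) auto
  qed
  moreover have "quot_change (normal Y) (ideal_mult W (normal Y)) (normal_map Y Z V \<phi>) p = ncls Y W p f"
    if "(V, \<phi>) \<in> qgerm (normal Z) (ideal_mult W (normal Z)) p UNIV (hom_of Z UNIV f)" for V \<phi>
    by (rule main[OF ZW.qgerm_normalD[OF f that]])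
  ultimately show ?thesis
    unfolding r_map_def normal_map_restricted_def restrict_to_def quot_proj_def by (simp add: Union_const)
qed

context ideal_sheaf
begin

lemma hom_rep_scale:
  assumes h: "hom_rep I U h" and p: "p \<in> U" and F: "F \<in> stalk I p" and c: "h p F - c \<in> stalk I p"
    and a: "a \<in> \<O> p"
  shows "h p (a * F) - a * c \<in> stalk I p"
  using stalk_add[OF hom_repD(4)[OF h p F a] stalk_mult[OF a c]] by (simp add: algebra_simps)

lemma hom_rep_comb:
  assumes h: "hom_rep I U h" and p: "p \<in> U" and F: "F \<in> stalk I p" "h p F - c \<in> stalk I p"
    and G: "G \<in> stalk I p" "h p G - d \<in> stalk I p" and ab: "a \<in> \<O> p" "b \<in> \<O> p"
  shows "h p (a * F + b * G) - (a * c + b * d) \<in> stalk I p"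
proof -
  have "h p (a * F + b * G) - (h p (a * F) + h p (b * G)) \<in> stalk I p"
    by (rule hom_repD(3)[OF h p stalk_mult[OF ab(1) F(1)] stalk_mult[OF ab(2) G(1)]])
  from stalk_add[OF this stalk_add[OF hom_rep_scale[OF h p F ab(1)] hom_rep_scale[OF h p G ab(2)]]]
  show ?thesis by (simp add: algebra_simps)
qed

end

section \<open>Normal sections of the surface\<close>

context surface
begin

text \<open>Division by the equation is the local generator of the normal bundle of the surface: it
  sends \<open>eqn j\<close> to 1.\<close>

lemma hom_rep_quotient:
  assumes W: "zopen W" "W \<subseteq> chart j"
  shows "hom_rep X W (\<lambda>q k. k / eqn j)"
  unfolding hom_rep_def
proof (intro conjI ballI W(1))
  have F0: "eqn j \<noteq> 0" by (rule eqn_nonzero)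
  have quot: "k / eqn j \<in> \<O> q" if q: "q \<in> W" and k: "k \<in> stalk X q" for q k
  proof -
    have qj: "q \<in> chart j" using q W by blast
    obtain r where "k = r * eqn j" "r \<in> \<O> q"
      using k unfolding stalk_eqn[OF qj] stalk.gen1[OF eqn_stalk[OF qj]] by blast
    then show ?thesis using F0 by simp
  qed
  fix p k assume p: "p \<in> W" and k: "k \<in> stalk X p"
  show "k / eqn j \<in> \<O> p" by (rule quot[OF p k])
  show "(k + l) / eqn j - (k / eqn j + l / eqn j) \<in> stalk X p" for l
    using stalk_zero by (simp add: add_divide_distrib)
  show "r * k / eqn j - r * (k / eqn j) \<in> stalk X p" for r using stalk_zero by simp
  obtain V where V: "zopen V" "p \<in> V" "\<And>q. q \<in> V ==> k \<in> stalk X q" by (rule stalk_open[OF k]) blast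
  have "k \<in> stalk X q \<and> k / eqn j \<in> \<O> q \<and> k / eqn j - k / eqn j \<in> stalk X q" if q: "q \<in> V \<inter> W" for q
    using V(3)[of q] quot[of q k] q stalk_zero by simp
  then show "\<exists>V c. zopen V \<and> p \<in> V \<and> V \<subseteq> W \<and>
      (\<forall>q\<in>V. k \<in> stalk X q \<and> c \<in> \<O> q \<and> k / eqn j - c \<in> stalk X q)"
    using V(1,2) W(1) p by (intro exI[of _ "V \<inter> W"] exI[of _ "k / eqn j"]) (auto intro: openin_Int)
qed

text \<open>On the ideal of \<open>X\<close> a homomorphism is determined by its value
  \<open>c\<close> on the single equation, so it is \<open>c\<close> times the generator
  \<open>k / eqn j\<close>.\<close>

lemma hom_form:
  assumes XZ: "subscheme X Z" and f: "hom_rep Z U f" and p: "p \<in> U"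
  obtains W c j where "zopen W" "p \<in> W" "W \<subseteq> U" "W \<subseteq> chart j"
    "\<And>q. q \<in> W ==> c \<in> \<O> q" "\<And>q. q \<in> W ==> f q (eqn j) - c \<in> stalk Z q"
    "\<And>q k. q \<in> W ==> k \<in> stalk X q ==> c * (k / eqn j) - f q k \<in> stalk Z q"
proof -
  interpret XZ: subscheme X Z by fact
  obtain j where pj: "p \<in> chart j" by (rule chart_cover)
  have FZ: "eqn j \<in> stalk Z q" if "q \<in> chart j" for q using eqn_in[OF that] XZ.stalk_le by blast
  obtain V c where V: "zopen V" "p \<in> V" "V \<subseteq> U"
    "\<And>q. q \<in> V ==> eqn j \<in> stalk Z q \<and> c \<in> \<O> q \<and> f q (eqn j) - c \<in> stalk Z q"
    by (rule hom_rep_const[OF f p FZ[OF pj]]) blast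
  have val: "c * (k / eqn j) - f q k \<in> stalk Z q" if q: "q \<in> V \<inter> chart j" and k: "k \<in> stalk X q" for q k
  proof -
    have qj: "q \<in> chart j" and qV: "q \<in> V" and qU: "q \<in> U" using q V(3) by auto
    obtain r where r: "k = r * eqn j" "r \<in> \<O> q"
      using k unfolding stalk_eqn[OF qj] stalk.gen1[OF eqn_stalk[OF qj]] by blast
    have "f q k - r * c \<in> stalk Z q"
      unfolding r(1) using XZ.Z.hom_rep_scale[OF f qU FZ[OF qj] _ r(2)] V(4)[OF qV] by blast
    moreover have "c * (k / eqn j) = r * c" using r(1) eqn_nonzero[of j] by simp
    ultimately show ?thesis using XZ.Z.stalk_commute by metis
  qed
  show ?thesis
  proof (rule that[of "V \<inter> chart j" j c])
    show "zopen (V \<inter> chart j)" using V(1) openin_chart by (rule openin_Int)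
  qed (use V pj val in auto)
qed

text \<open>If the value \<open>c\<close> on the equation lies in the ideal of \<open>Z\<close>,
  then \<open>c\<close> times the generator is visibly in the product of that ideal with the normal
  sheaf.\<close>

lemma lifts_surface:
  assumes XZ: "subscheme X Z" shows "lifts X Z"
  unfolding lifts_def
proof (intro allI impI, elim conjE)
  interpret XZ: subscheme X Z by fact
  have XX: "subscheme X X" by unfold_locales simp
  fix U h p assume h: "hom_rep X U h" and p: "p \<in> U" and v: "\<forall>k\<in>stalk X p. h p k \<in> stalk Z p"
  obtain W c j where W: "zopen W" "p \<in> W" "W \<subseteq> U" "W \<subseteq> chart j" "\<And>q. q \<in> W ==> c \<in> \<O> q"
    "\<And>q. q \<in> W ==> h q (eqn j) - c \<in> stalk X q"
    "\<And>q k. q \<in> W ==> k \<in> stalk X q ==> c * (k / eqn j) - h q k \<in> stalk X q"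
    by (rule hom_form[OF XX h p]) blast
  have pj: "p \<in> chart j" using W by blast
  have "h p (eqn j) - c \<in> stalk Z p" using W(6)[OF W(2)] XZ.stalk_le by blast
  then have "c \<in> stalk Z p" using XZ.Z.stalk_diff[OF bspec[OF v eqn_in[OF pj]]] by fastforce
  then obtain N where N: "zopen N" "p \<in> N" "\<And>q. q \<in> N ==> c \<in> stalk Z q" by (rule XZ.Z.stalk_open) blast
  define V where "V = W \<inter> N"
  have V: "zopen V" "p \<in> V" "V \<subseteq> U" "V \<subseteq> chart j" "V \<noteq> {}" using W N by (auto simp: V_def)
  have s: "section_of V c \<in> Z V" using N(3) by (intro XZ.Z.section_mem[OF V(1)]) (simp add: V_def)
  have g: "germ (section_of V c) = c" using W(5) by (intro section_of(2)[OF V(1) _ V(5)]) (simp add: V_def)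
  have "hom_of X V (\<lambda>q k. c * (k / eqn j)) \<in> ideal_mult Z (normal X) V"
    using XZ.ideal_multI[OF hom_rep_quotient[OF V(1,4)] s] unfolding g .
  moreover have "hom_of X V (\<lambda>q k. c * (k / eqn j)) = hom_of X V h"
    by (rule hom_of_cong) (use W(7) in \<open>simp add: V_def\<close>)
  ultimately show "\<exists>W. zopen W \<and> p \<in> W \<and> W \<subseteq> U \<and> hom_of X W h \<in> ideal_mult Z (normal X) W"
    using V(1-3) by (intro exI[of _ V]) simp
qed

text \<open>There are no relations to respect on one equation, so its value modulo \<open>Z\<close>
  may be lifted freely.\<close>

lemma extends_to_surface:
  assumes XZ: "subscheme X Z" and f: "hom_rep Z U f" shows "extends_to X Z U f"
  unfolding extends_to_def
proof
  fix p assume p: "p \<in> U"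
  obtain W c j where W: "zopen W" "p \<in> W" "W \<subseteq> U" "W \<subseteq> chart j" "\<And>q. q \<in> W ==> c \<in> \<O> q"
    "\<And>q. q \<in> W ==> f q (eqn j) - c \<in> stalk Z q"
    "\<And>q k. q \<in> W ==> k \<in> stalk X q ==> c * (k / eqn j) - f q k \<in> stalk Z q"
    by (rule hom_form[OF XZ f p]) blast
  have "hom_rep X W (\<lambda>q k. c * (k / eqn j))" by (rule hom_rep_mult[OF hom_rep_quotient[OF W(1,4)] W(5)])
  then show "\<exists>V h. zopen V \<and> p \<in> V \<and> V \<subseteq> U \<and> hom_rep X V h \<and>
     (\<forall>q\<in>V. \<forall>k\<in>stalk X q. h q k - f q k \<in> stalk Z q)"
    using W(1-3,7) by (intro exI[of _ W] exI[of _ "\<lambda>q k. c * (k / eqn j)"]) simp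
qed

end

section \<open>Normal sections of the sum and the gluing\<close>

context divisor_sum
begin

lemma subscheme_X_C: "subscheme X C" and subscheme_X_E: "subscheme X E" and subscheme_D_C: "subscheme D C"
  and subscheme_C_CE: "subscheme C (scheme_inter C E)" and subscheme_E_CE: "subscheme E (scheme_inter C E)"
  and subscheme_X_CE: "subscheme X (scheme_inter C E)"
  using X_C X_E stalk_D_inter C_CE E_CE order_trans[OF X_C C_CE]
  by (intro subscheme.intro subscheme_axioms.intro ideal_sheaf_axioms C.ideal_sheaf_axioms E.ideal_sheaf_axioms
      D.ideal_sheaf_axioms CE.ideal_sheaf_axioms; blast)+

text \<open>A homomorphism on the ideal of \<open>D\<close> is determined by its values on the two
  equations. If these lie in the ideal of \<open>C\<close>, they are \<open>g\<close> times some
  \<open>u\<close> and \<open>v\<close> modulo \<open>eqn j\<close>, and the homomorphism is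
  \<open>g\<close> times the one with values \<open>u\<close> and \<open>v\<close>.\<close>

lemma lifts_D_C: "lifts D C"
  unfolding lifts_def
proof (intro allI impI, elim conjE)
  interpret DC: subscheme D C by (rule subscheme_D_C)
  fix U h p assume h: "hom_rep D U h" and p: "p \<in> U" and v: "\<forall>k\<in>stalk D p. h p k \<in> stalk C p"
  obtain W0 j g e where W0: "zopen W0" "p \<in> W0" "W0 \<subseteq> chart j"
    and ge: "\<And>q. q \<in> W0 ==> g \<in> \<O> q \<and> e \<in> \<O> q"
    and Cq: "\<And>q. q \<in> W0 ==> stalk C q = gen (\<O> q) {eqn j, g}"
    and Dq: "\<And>q. q \<in> W0 ==> stalk D q = gen (\<O> q) {eqn j, g * e}"
    and dich: "(\<forall>q\<in>W0. \<forall>a\<in>\<O> q. \<forall>b\<in>\<O> q. a * eqn j + b * (g * e) = 0 \<longrightarrow> a \<in> stalk D q \<and> b \<in> stalk D q)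
      \<or> (\<forall>q\<in>W0. stalk C q = stalk D q)"
    by (rule local_equations[of p]) blast
  let ?F = "eqn j" let ?G = "g * e"
  have Fq: "?F \<in> \<O> q" "g \<in> \<O> q" "?G \<in> \<O> q" if "q \<in> W0" for q
    using eqn_stalk[of q j] ge[OF that] W0(3) that by auto
  have FD: "?F \<in> stalk D q" "?G \<in> stalk D q" if "q \<in> W0" for q
    using stalk.gen_incl[of "{?F, ?G}" q] Fq[OF that] unfolding Dq[OF that] by auto
  have gC: "g \<in> stalk C q" if "q \<in> W0" for q
    using stalk.gen_incl[of "{?F, g}" q] Fq[OF that] unfolding Cq[OF that] by auto
  have D_mem: "\<exists>a b. a \<in> \<O> q \<and> b \<in> \<O> q \<and> k = a * ?F + b * ?G" if "q \<in> W0" "k \<in> stalk D q" for q k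
    using that(2) unfolding Dq[OF that(1)] stalk.gen2[OF Fq(1,3)[OF that(1)]] by blast
  have D_memI: "a * ?F + b * ?G \<in> stalk D q" if "q \<in> W0" "a \<in> \<O> q" "b \<in> \<O> q" for q a b
    unfolding Dq[OF that(1)] by (rule stalk.gen2I[OF Fq(1,3)[OF that(1)] that(2,3)])
  obtain V1 c1 where V1: "zopen V1" "p \<in> V1" "V1 \<subseteq> U"
    "\<And>q. q \<in> V1 ==> ?F \<in> stalk D q \<and> c1 \<in> \<O> q \<and> h q ?F - c1 \<in> stalk D q"
    by (rule hom_rep_const[OF h p FD(1)[OF W0(2)]]) blast
  obtain V2 c2 where V2: "zopen V2" "p \<in> V2" "V2 \<subseteq> U"
    "\<And>q. q \<in> V2 ==> ?G \<in> stalk D q \<and> c2 \<in> \<O> q \<and> h q ?G - c2 \<in> stalk D q"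
    by (rule hom_rep_const[OF h p FD(2)[OF W0(2)]]) blast
  have "h p ?F - c1 \<in> stalk C p" "h p ?G - c2 \<in> stalk C p" using V1(2,4) V2(2,4) DC.stalk_le by blast+
  then have c: "c1 \<in> stalk C p" "c2 \<in> stalk C p"
    using C.stalk_diff[OF bspec[OF v FD(1)[OF W0(2)]]] C.stalk_diff[OF bspec[OF v FD(2)[OF W0(2)]]] by fastforce+
  define W1 where "W1 = W0 \<inter> (V1 \<inter> V2)"
  have W1: "zopen W1" "p \<in> W1" unfolding W1_def using W0 V1 V2 by auto
  have W1_sub: "q \<in> W0" "q \<in> V1" "q \<in> V2" "q \<in> U" if "q \<in> W1" for q using that V1(3) by (auto simp: W1_def)
  have comb: "h q (a * ?F + b * ?G) - (a * c1 + b * c2) \<in> stalk D q"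
    if q: "q \<in> W1" and ab: "a \<in> \<O> q" "b \<in> \<O> q" for q a b
    using V1(4)[OF W1_sub(2)[OF q]] V2(4)[OF W1_sub(3)[OF q]] by (intro D.hom_rep_comb[OF h W1_sub(4)[OF q]] ab) auto
  show "\<exists>W. zopen W \<and> p \<in> W \<and> W \<subseteq> U \<and> hom_of D W h \<in> ideal_mult C (normal D) W"
  proof (cases "\<forall>q\<in>W0. stalk C q = stalk D q")
    \<comment> \<open>Where the ideals of \<open>C\<close> and \<open>D\<close> agree, values in the
      ideal of \<open>C\<close> are zero modulo \<open>D\<close>, so \<open>h\<close> represents the
      zero section.\<close>
    case True
    obtain N1 where N1: "zopen N1" "p \<in> N1" "\<And>q. q \<in> N1 ==> c1 \<in> stalk C q" by (rule C.stalk_open[OF c(1)]) blast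
    obtain N2 where N2: "zopen N2" "p \<in> N2" "\<And>q. q \<in> N2 ==> c2 \<in> stalk C q" by (rule C.stalk_open[OF c(2)]) blast
    define W where "W = W1 \<inter> (N1 \<inter> N2)"
    have W: "zopen W" "p \<in> W" "W \<subseteq> U" unfolding W_def using W1 N1 N2 W1_sub by auto
    have hD: "h q k \<in> stalk D q" if q: "q \<in> W" and k: "k \<in> stalk D q" for q k
    proof -
      have qW: "q \<in> W1" "q \<in> N1" "q \<in> N2" using q by (auto simp: W_def)
      obtain a b where ab: "a \<in> \<O> q" "b \<in> \<O> q" "k = a * ?F + b * ?G" using D_mem[OF W1_sub(1)[OF qW(1)] k] by blast
      have "a * c1 + b * c2 \<in> stalk C q" by (intro C.stalk_add C.stalk_mult ab N1(3) N2(3) qW)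
      then have "a * c1 + b * c2 \<in> stalk D q" using True W1_sub(1)[OF qW(1)] by blast
      then show ?thesis using D.stalk_add[OF comb[OF qW(1) ab(1,2)]] unfolding ab(3) by fastforce
    qed
    have g0: "germ (\<lambda>_. 0) = 0" using cst.cst_0 by (simp add: cst_def)
    have "hom_of D W h = hom_of D W (\<lambda>q k. germ (\<lambda>_. 0) * h q k)" by (rule D.hom_of_cong) (simp add: g0 hD)
    also have "\<dots> \<in> ideal_mult C (normal D) W" by (rule DC.ideal_multI[OF hom_rep_mono[OF h W(1,3)] C.zero[OF W(1)]])
    finally show ?thesis using W by blast
  next
    case False
    then have triv: "a \<in> stalk D q \<and> b \<in> stalk D q"
      if "q \<in> W0" "a \<in> \<O> q" "b \<in> \<O> q" "a * ?F + b * ?G = 0" for q a b using dich that by blast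
    obtain a1 u where a1: "c1 = a1 * ?F + u * g" "a1 \<in> \<O> p" "u \<in> \<O> p"
      using c(1) unfolding Cq[OF W0(2)] stalk.gen2[OF Fq(1,2)[OF W0(2)]] by blast
    obtain a2 v where a2: "c2 = a2 * ?F + v * g" "a2 \<in> \<O> p" "v \<in> \<O> p"
      using c(2) unfolding Cq[OF W0(2)] stalk.gen2[OF Fq(1,2)[OF W0(2)]] by blast
    obtain N1 where N1: "zopen N1" "p \<in> N1" "\<And>q. q \<in> N1 ==> a1 \<in> \<O> q" by (rule stalk_ring_open[OF a1(2)]) blast
    obtain N2 where N2: "zopen N2" "p \<in> N2" "\<And>q. q \<in> N2 ==> u \<in> \<O> q" by (rule stalk_ring_open[OF a1(3)]) blast
    obtain N3 where N3: "zopen N3" "p \<in> N3" "\<And>q. q \<in> N3 ==> a2 \<in> \<O> q" by (rule stalk_ring_open[OF a2(2)]) blast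
    obtain N4 where N4: "zopen N4" "p \<in> N4" "\<And>q. q \<in> N4 ==> v \<in> \<O> q" by (rule stalk_ring_open[OF a2(3)]) blast
    define W where "W = W1 \<inter> ((N1 \<inter> N2) \<inter> (N3 \<inter> N4))"
    have W: "zopen W" "p \<in> W" "W \<noteq> {}" unfolding W_def using W1 N1 N2 N3 N4 by auto
    have W_sub: "q \<in> W1" "q \<in> W0" "a1 \<in> \<O> q" "u \<in> \<O> q" "a2 \<in> \<O> q" "v \<in> \<O> q" "q \<in> U"
      if "q \<in> W" for q using that N1(3) N2(3) N3(3) N4(3) W1_sub by (auto simp: W_def)
    \<comment> \<open>The values \<open>u\<close> and \<open>v\<close> on the two equations are to
      be extended linearly. Two expressions of \<open>k\<close> differ by a relation between the
      equations, whose coefficients lie in the ideal of \<open>D\<close> by \<open>triv\<close>; so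
      the result is well defined modulo \<open>D\<close>.\<close>
    define P where "P q k y \<longleftrightarrow> (\<exists>a b. a \<in> \<O> q \<and> b \<in> \<O> q \<and> k = a * ?F + b * ?G \<and> y = a * u + b * v)" for q k y
    define \<eta> where "\<eta> q k = (SOME y. P q k y)" for q k
    have \<eta>: "\<eta> q (a * ?F + b * ?G) \<in> \<O> q" "\<eta> q (a * ?F + b * ?G) - (a * u + b * v) \<in> stalk D q"
      if q: "q \<in> W" and ab: "a \<in> \<O> q" "b \<in> \<O> q" for q a b
    proof -
      have "P q (a * ?F + b * ?G) (a * u + b * v)" unfolding P_def
        by (rule exI[of _ a], rule exI[of _ b]) (intro conjI ab refl)
      then have "P q (a * ?F + b * ?G) (\<eta> q (a * ?F + b * ?G))" unfolding \<eta>_def by (rule someI)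
      then obtain a' b' where ab': "a' \<in> \<O> q" "b' \<in> \<O> q" "a * ?F + b * ?G = a' * ?F + b' * ?G"
        "\<eta> q (a * ?F + b * ?G) = a' * u + b' * v" unfolding P_def by (elim exE conjE)
      show "\<eta> q (a * ?F + b * ?G) \<in> \<O> q" unfolding ab'(4) using ab'(1,2) W_sub[OF q] by blast
      have "a' - a \<in> stalk D q \<and> b' - b \<in> stalk D q"
        using ab ab' by (intro triv W_sub(2)[OF q]) (auto simp: algebra_simps)
      then have "u * (a' - a) + v * (b' - b) \<in> stalk D q"
        by (intro D.stalk_add D.stalk_mult W_sub[OF q]) auto
      then show "\<eta> q (a * ?F + b * ?G) - (a * u + b * v) \<in> stalk D q" unfolding ab'(4) by (simp add: algebra_simps)
    qed
    have rep: "hom_rep D W \<eta>" unfolding hom_rep_def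
    proof (intro conjI ballI W(1))
      fix q k assume q: "q \<in> W" and k: "k \<in> stalk D q"
      obtain a b where ab: "a \<in> \<O> q" "b \<in> \<O> q" "k = a * ?F + b * ?G" using D_mem[OF W_sub(2)[OF q] k] by blast
      note k\<eta> = \<eta>[OF q ab(1,2), folded ab(3)]
      show "\<eta> q k \<in> \<O> q" by (rule k\<eta>(1))
      show "\<eta> q (k + l) - (\<eta> q k + \<eta> q l) \<in> stalk D q" if l: "l \<in> stalk D q" for l
      proof -
        obtain a' b' where ab': "a' \<in> \<O> q" "b' \<in> \<O> q" "l = a' * ?F + b' * ?G" using D_mem[OF W_sub(2)[OF q] l] by blast
        have kl: "k + l = (a + a') * ?F + (b + b') * ?G" by (simp add: ab(3) ab'(3) algebra_simps)
        have 1: "\<eta> q (k + l) - ((a + a') * u + (b + b') * v) \<in> stalk D q"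
          unfolding kl using ab ab' by (intro \<eta>(2)[OF q]) auto
        have 2: "(\<eta> q k - (a * u + b * v)) + (\<eta> q l - (a' * u + b' * v)) \<in> stalk D q"
          using D.stalk_add[OF k\<eta>(2) \<eta>(2)[OF q ab'(1,2)]] unfolding ab'(3) .
        show ?thesis using D.stalk_diff[OF 1 2] by (simp add: algebra_simps)
      qed
      show "\<eta> q (r * k) - r * \<eta> q k \<in> stalk D q" if r: "r \<in> \<O> q" for r
      proof -
        have rk: "r * k = (r * a) * ?F + (r * b) * ?G" by (simp add: ab(3) algebra_simps)
        have 1: "\<eta> q (r * k) - ((r * a) * u + (r * b) * v) \<in> stalk D q"
          unfolding rk using ab r by (intro \<eta>(2)[OF q]) auto
        show ?thesis using D.stalk_diff[OF 1 D.stalk_mult[OF r k\<eta>(2)]] by (simp add: algebra_simps)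
      qed
      obtain N where N: "zopen N" "q \<in> N" "\<And>r. r \<in> N ==> a \<in> \<O> r" by (rule stalk_ring_open[OF ab(1)]) blast
      obtain N' where N': "zopen N'" "q \<in> N'" "\<And>r. r \<in> N' ==> b \<in> \<O> r" by (rule stalk_ring_open[OF ab(2)]) blast
      have near: "k \<in> stalk D r \<and> a * u + b * v \<in> \<O> r \<and> \<eta> r k - (a * u + b * v) \<in> stalk D r"
        if r: "r \<in> W \<inter> (N \<inter> N')" for r
      proof -
        have r': "r \<in> W" "a \<in> \<O> r" "b \<in> \<O> r" using r N(3) N'(3) by auto
        show ?thesis
          using D_memI[OF W_sub(2)[OF r'(1)] r'(2,3)] \<eta>(2)[OF r'] r' W_sub[OF r'(1)] unfolding ab(3) by blast
      qed
      show "\<exists>V c. zopen V \<and> q \<in> V \<and> V \<subseteq> W \<and>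
          (\<forall>q\<in>V. k \<in> stalk D q \<and> c \<in> \<O> q \<and> \<eta> q k - c \<in> stalk D q)"
        by (rule exI[of _ "W \<inter> (N \<inter> N')"], rule exI[of _ "a * u + b * v"], intro conjI ballI)
          (use W(1) q N(1,2) N'(1,2) near in auto)
    qed
    have s: "section_of W g \<in> C W" by (rule C.section_mem[OF W(1) gC[OF W_sub(2)]])
    have gs: "germ (section_of W g) = g" by (rule section_of(2)[OF W(1) Fq(2)[OF W_sub(2)] W(3)])
    have "hom_of D W h = hom_of D W (\<lambda>q k. g * \<eta> q k)"
    proof (rule D.hom_of_cong)
      fix q k assume q: "q \<in> W" and k: "k \<in> stalk D q"
      obtain a b where ab: "a \<in> \<O> q" "b \<in> \<O> q" "k = a * ?F + b * ?G" using D_mem[OF W_sub(2)[OF q] k] by blast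
      have 1: "h q k - (a * c1 + b * c2) \<in> stalk D q" unfolding ab(3) by (rule comb[OF W_sub(1)[OF q] ab(1,2)])
      have 2: "(a * a1 + b * a2) * ?F \<in> stalk D q"
        by (rule D.stalk_mult[OF _ FD(1)[OF W_sub(2)[OF q]]]) (use ab W_sub[OF q] in blast)
      have 3: "g * (\<eta> q k - (a * u + b * v)) \<in> stalk D q"
        unfolding ab(3) by (rule D.stalk_mult[OF Fq(2)[OF W_sub(2)[OF q]] \<eta>(2)[OF q ab(1,2)]])
      \<comment> \<open>The parts of \<open>c1\<close> and \<open>c2\<close> that are multiples of
        \<open>?F\<close> vanish modulo \<open>D\<close>, which leaves \<open>g\<close> times the
        values of \<open>\<eta>\<close>.\<close>
      have eq: "h q k - g * \<eta> q k = (h q k - (a * c1 + b * c2)) + ((a * a1 + b * a2) * ?F - g * (\<eta> q k - (a * u + b * v)))"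
        unfolding a1(1) a2(1) by (simp add: algebra_simps)
      show "h q k - g * \<eta> q k \<in> stalk D q" by (subst eq) (rule D.stalk_add[OF 1 D.stalk_diff[OF 2 3]])
    qed
    moreover have "hom_of D W (\<lambda>q k. g * \<eta> q k) \<in> ideal_mult C (normal D) W"
      using DC.ideal_multI[OF rep s] unfolding gs .
    ultimately show ?thesis using W(1,2) W_sub(7) by (intro exI[of _ W]) auto
  qed
qed

text \<open>Two homomorphisms that agree on the ideal of \<open>X\<close> modulo \<open>C \<inter> E\<close> agree on the ideal of \<open>D\<close>,
  so their values modulo \<open>C\<close> and modulo \<open>E\<close> glue to a value modulo \<open>D\<close>.\<close>

lemma Upsilon_image:
  assumes f: "hom_rep C UNIV f" and f': "hom_rep E UNIV f'"
    and r: "r_map X C (scheme_inter C E) (hom_of C UNIV f) = r_map X E (scheme_inter C E) (hom_of E UNIV f')"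
  shows "Upsilon6 C D (hom_of C UNIV f) \<in> Upsilon5 C D ` H0 (normal D)"
proof -
  let ?CE = "scheme_inter C E"
  interpret XC: subscheme X C by (rule subscheme_X_C)
  interpret XCE: subscheme X ?CE by (rule subscheme_X_CE)
  interpret DC: subscheme D C by (rule subscheme_D_C)
  have onX: "f p k - f' p k \<in> stalk ?CE p" if k: "k \<in> stalk X p" for p k
  proof -
    have "r_map X C ?CE (hom_of C UNIV f) p = ncls X ?CE p f"
      by (rule r_map_eq[OF subscheme_X_C subscheme_C_CE lifts_surface[OF subscheme_X_C] lifts_surface[OF subscheme_X_CE]
            extends_to_surface[OF subscheme_X_C] f])
    moreover have "r_map X E ?CE (hom_of E UNIV f') p = ncls X ?CE p f'"
      by (rule r_map_eq[OF subscheme_X_E subscheme_E_CE lifts_surface[OF subscheme_X_E] lifts_surface[OF subscheme_X_CE]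
            extends_to_surface[OF subscheme_X_E] f'])
    ultimately have eq: "ncls X ?CE p f = ncls X ?CE p f'" using r by simp
    obtain V h where V: "p \<in> V" and h: "hom_rep X V h" and d: "\<forall>q\<in>V. \<forall>k\<in>stalk X q. h q k - f q k \<in> stalk C q"
      by (rule extends_toE[OF extends_to_surface[OF subscheme_X_C f], of p]) auto
    have d': "\<forall>k\<in>stalk X p. h p k - f p k \<in> stalk ?CE p" using bspec[OF d V] C_CE[of p] by blast
    have "(V, hom_of X V h) \<in> ncls X ?CE p f" by (rule nclsI) (rule h, rule V, rule d')
    then show ?thesis by (rule XCE.ncls_eqD[OF eq _ k])
  qed
  \<comment> \<open>Write \<open>k = c * e + x\<close>. Modulo the sum of the ideals
    \<open>f\<close> sends \<open>c * e\<close> to \<open>e * f p c\<close>, a multiple of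
    \<open>e\<close>, and \<open>f'\<close> sends it to \<open>c * f' p e\<close>, a multiple of
    \<open>c\<close>. Both vanish, and \<open>x\<close> is covered by \<open>onX\<close>.\<close>
  have onD: "f p k - f' p k \<in> stalk ?CE p" if k: "k \<in> stalk D p" for p k
  proof -
    obtain U e where U: "zopen U" "p \<in> U" "\<And>q. q \<in> U ==> divisor_equation X E q e" by (rule equationE[of p]) blast
    obtain c x where k: "k = c * e + x" "c \<in> stalk C p" "x \<in> stalk X p" using k unfolding stalk_D[OF U(3)[OF U(2)]] by blast
    have e: "e \<in> stalk E p" using U(3)[OF U(2)] unfolding divisor_equation_def by (rule conjunct1)
    have c': "c \<in> \<O> p" and e': "e \<in> \<O> p" using k(2) e stalk_at_subset by blast+
    have x: "x \<in> stalk C p" "x \<in> stalk E p" using k(3) X_C X_E by auto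
    have ce: "e * c \<in> stalk C p" "c * e \<in> stalk E p"
      by (rule C.stalk_mult[OF e' k(2)], rule E.stalk_mult[OF c' e])
    have "f p (e * c + x) - (f p (e * c) + f p x) \<in> stalk ?CE p"
      using hom_repD(3)[OF f UNIV_I ce(1) x(1)] C_CE[of p] by blast
    moreover have "f p (e * c) - e * f p c \<in> stalk ?CE p" using hom_repD(4)[OF f UNIV_I k(2) e'] C_CE[of p] by blast
    moreover have "e * f p c \<in> stalk ?CE p"
      using idealD(5)[OF E.stalk_ideal hom_repD(2)[OF f UNIV_I k(2)] e] E_CE[of p] by (auto simp: mult.commute)
    ultimately have 1: "(f p (e * c + x) - (f p (e * c) + f p x)) + ((f p (e * c) - e * f p c) + e * f p c) \<in> stalk ?CE p"
      by (intro CE.stalk_add)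
    have "f' p (c * e + x) - (f' p (c * e) + f' p x) \<in> stalk ?CE p"
      using hom_repD(3)[OF f' UNIV_I ce(2) x(2)] E_CE[of p] by blast
    moreover have "f' p (c * e) - c * f' p e \<in> stalk ?CE p" using hom_repD(4)[OF f' UNIV_I e c'] E_CE[of p] by blast
    moreover have "c * f' p e \<in> stalk ?CE p"
      using idealD(5)[OF C.stalk_ideal hom_repD(2)[OF f' UNIV_I e] k(2)] C_CE[of p] by blast
    ultimately have 2: "(f' p (c * e + x) - (f' p (c * e) + f' p x)) + ((f' p (c * e) - c * f' p e) + c * f' p e) \<in> stalk ?CE p"
      by (intro CE.stalk_add)
    show ?thesis using CE.stalk_add[OF CE.stalk_diff[OF 1 2] onX[OF k(3)]] unfolding k(1) by (simp add: algebra_simps)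
  qed
  \<comment> \<open>A value congruent to \<open>f p k\<close> modulo \<open>C\<close> and to
    \<open>f' p k\<close> modulo \<open>E\<close> exists because the two differ by an element of the
    sum of the ideals; it is unique modulo the intersection, which is the ideal of
    \<open>D\<close>.\<close>
  define P where "P p k y \<longleftrightarrow> y \<in> \<O> p \<and> y - f p k \<in> stalk C p \<and> y - f' p k \<in> stalk E p" for p k y
  define \<theta> where "\<theta> p k = (SOME y. P p k y)" for p k
  have DCE: "k \<in> stalk C p" "k \<in> stalk E p" if "k \<in> stalk D p" for k p using that unfolding stalk_D_inter by auto
  have \<theta>: "\<theta> p k \<in> \<O> p" "\<theta> p k - f p k \<in> stalk C p" "\<theta> p k - f' p k \<in> stalk E p" if k: "k \<in> stalk D p" for p k
  proof -
    obtain a b where ab: "f p k - f' p k = a + b" "a \<in> stalk C p" "b \<in> stalk E p"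
      using onD[OF k] unfolding stalk_CE by blast
    have "f p k - a \<in> \<O> p" using hom_repD(2)[OF f UNIV_I DCE(1)[OF k]] C.stalk_in[OF ab(2)] by blast
    moreover have "f p k - a - f p k \<in> stalk C p" using C.stalk_diff[OF C.stalk_zero ab(2)] by simp
    moreover have "f p k - a - f' p k \<in> stalk E p" using ab(1,3) by (simp add: algebra_simps)
    ultimately have "P p k (f p k - a)" unfolding P_def by blast
    then have "P p k (\<theta> p k)" unfolding \<theta>_def by (rule someI)
    then show "\<theta> p k \<in> \<O> p" "\<theta> p k - f p k \<in> stalk C p" "\<theta> p k - f' p k \<in> stalk E p"
      unfolding P_def by auto
  qed
  have rep: "hom_rep D UNIV \<theta>" unfolding hom_rep_def
  proof (intro conjI ballI openin_zariski_UNIV)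
    fix p k assume k: "k \<in> stalk D p"
    note kC = DCE[OF k] and k\<theta> = \<theta>[OF k]
    show "\<theta> p k \<in> \<O> p" by (rule k\<theta>(1))
    show "\<theta> p (k + l) - (\<theta> p k + \<theta> p l) \<in> stalk D p" if l: "l \<in> stalk D p" for l
    proof -
      note l\<theta> = \<theta>[OF l] and kl\<theta> = \<theta>[OF D.stalk_add[OF k l]]
      have "\<theta> p (k + l) - (\<theta> p k + \<theta> p l) \<in> stalk C p"
        using C.stalk_diff[OF C.stalk_add[OF kl\<theta>(2) hom_repD(3)[OF f UNIV_I kC(1) DCE(1)[OF l]]] C.stalk_add[OF k\<theta>(2) l\<theta>(2)]]
        by (simp add: algebra_simps)
      moreover have "\<theta> p (k + l) - (\<theta> p k + \<theta> p l) \<in> stalk E p"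
        using E.stalk_diff[OF E.stalk_add[OF kl\<theta>(3) hom_repD(3)[OF f' UNIV_I kC(2) DCE(2)[OF l]]] E.stalk_add[OF k\<theta>(3) l\<theta>(3)]]
        by (simp add: algebra_simps)
      ultimately show ?thesis unfolding stalk_D_inter by blast
    qed
    show "\<theta> p (s * k) - s * \<theta> p k \<in> stalk D p" if s: "s \<in> \<O> p" for s
    proof -
      note sk\<theta> = \<theta>[OF D.stalk_mult[OF s k]]
      have "\<theta> p (s * k) - s * \<theta> p k \<in> stalk C p"
        using C.stalk_diff[OF C.stalk_add[OF sk\<theta>(2) hom_repD(4)[OF f UNIV_I kC(1) s]] C.stalk_mult[OF s k\<theta>(2)]]
        by (simp add: algebra_simps)
      moreover have "\<theta> p (s * k) - s * \<theta> p k \<in> stalk E p"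
        using E.stalk_diff[OF E.stalk_add[OF sk\<theta>(3) hom_repD(4)[OF f' UNIV_I kC(2) s]] E.stalk_mult[OF s k\<theta>(3)]]
        by (simp add: algebra_simps)
      ultimately show ?thesis unfolding stalk_D_inter by blast
    qed
    obtain V c where V: "zopen V" "p \<in> V" "V \<subseteq> UNIV"
      "\<And>q. q \<in> V ==> k \<in> stalk C q \<and> c \<in> \<O> q \<and> f q k - c \<in> stalk C q"
      by (rule hom_rep_const[OF f UNIV_I kC(1)]) blast
    obtain V' c' where V': "zopen V'" "p \<in> V'" "V' \<subseteq> UNIV"
      "\<And>q. q \<in> V' ==> k \<in> stalk E q \<and> c' \<in> \<O> q \<and> f' q k - c' \<in> stalk E q"
      by (rule hom_rep_const[OF f' UNIV_I kC(2)]) blast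
    \<comment> \<open>The value chosen at \<open>p\<close> serves nearby points too: its congruences
      with the local constants \<open>c\<close> and \<open>c'\<close> persist on a
      neighbourhood.\<close>
    define d where "d = \<theta> p k"
    have "d - c \<in> stalk C p" unfolding d_def by (rule C.stalk_trans[OF k\<theta>(2)]) (use V(4)[OF V(2)] in blast)
    then obtain N where N: "zopen N" "p \<in> N" "\<And>q. q \<in> N ==> d - c \<in> stalk C q" by (rule C.stalk_open) blast
    have "d - c' \<in> stalk E p" unfolding d_def by (rule E.stalk_trans[OF k\<theta>(3)]) (use V'(4)[OF V'(2)] in blast)
    then obtain N' where N': "zopen N'" "p \<in> N'" "\<And>q. q \<in> N' ==> d - c' \<in> stalk E q" by (rule E.stalk_open) blast
    have near: "k \<in> stalk D q \<and> d \<in> \<O> q \<and> \<theta> q k - d \<in> stalk D q" if q: "q \<in> (V \<inter> V') \<inter> (N \<inter> N')" for q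
    proof -
      have vq: "k \<in> stalk C q" "c \<in> \<O> q" "f q k - c \<in> stalk C q" "k \<in> stalk E q" "f' q k - c' \<in> stalk E q"
        and dq: "d - c \<in> stalk C q" "d - c' \<in> stalk E q"
        using q V(4)[of q] V'(4)[of q] N(3)[of q] N'(3)[of q] by auto
      have kD: "k \<in> stalk D q" unfolding stalk_D_inter using vq by blast
      have "d - c + c \<in> \<O> q" by (rule stalk.add_closed[OF C.stalk_in[OF dq(1)] vq(2)])
      then have "d \<in> \<O> q" by simp
      moreover have "\<theta> q k - d \<in> stalk C q"
        by (rule C.stalk_trans[OF C.stalk_trans[OF \<theta>(2)[OF kD] vq(3)] C.stalk_commute[OF dq(1)]])
      moreover have "\<theta> q k - d \<in> stalk E q"
        by (rule E.stalk_trans[OF E.stalk_trans[OF \<theta>(3)[OF kD] vq(5)] E.stalk_commute[OF dq(2)]])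
      ultimately show ?thesis using kD unfolding stalk_D_inter by blast
    qed
    show "\<exists>V c. zopen V \<and> p \<in> V \<and> V \<subseteq> UNIV \<and>
        (\<forall>q\<in>V. k \<in> stalk D q \<and> c \<in> \<O> q \<and> \<theta> q k - c \<in> stalk D q)"
      by (rule exI[of _ "(V \<inter> V') \<inter> (N \<inter> N')"], rule exI[of _ d], intro conjI ballI)
        (use V(1,2) V'(1,2) N(1,2) N'(1,2) near in auto)
  qed
  have "extends_to D C UNIV f"
    unfolding extends_to_def
  proof
    fix p
    show "\<exists>V h. zopen V \<and> p \<in> V \<and> V \<subseteq> UNIV \<and> hom_rep D V h \<and> (\<forall>q\<in>V. \<forall>k\<in>stalk D q. h q k - f q k \<in> stalk C q)"
      using rep \<theta>(2) by (intro exI[of _ UNIV] exI[of _ \<theta>]) simp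
  qed
  note ext = this
  have "Upsilon6 C D (hom_of C UNIV f) = Upsilon5 C D (hom_of D UNIV \<theta>)"
  proof (rule HOL.ext)
    fix p
    have "Upsilon6 C D (hom_of C UNIV f) p = ncls D C p f"
      unfolding Upsilon6_def by (rule DC.normal_map_eq[OF lifts_D_C f ext UNIV_I])
    also have "\<dots> = ncls D C p \<theta>" by (rule DC.ncls_eqI) (rule C.stalk_commute[OF \<theta>(2)])
    also have "\<dots> = Upsilon5 C D (hom_of D UNIV \<theta>) p"
      unfolding Upsilon5_def restrict_to_def quot_proj_def using DC.qgerm_normal[OF lifts_D_C rep, of p] by simp
    finally show "Upsilon6 C D (hom_of C UNIV f) p = Upsilon5 C D (hom_of D UNIV \<theta>) p" .
  qed
  moreover have "hom_of D UNIV \<theta> \<in> H0 (normal D)" unfolding H0_def by (rule D.hom_of_Sec[OF rep])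
  ultimately show ?thesis by blast
qed

lemma points_inter_sub: "points C \<inter> points E \<subseteq> points (scheme_inter C E)"
proof
  fix p assume "p \<in> points C \<inter> points E"
  then have "stalk C p \<subseteq> max_ideal p" "stalk E p \<subseteq> max_ideal p"
    using points_iff[OF C.ideal_sheaf_axioms] points_iff[OF E.ideal_sheaf_axioms] by auto
  then have "stalk (scheme_inter C E) p \<subseteq> max_ideal p" unfolding stalk_CE max_ideal_def by fastforce
  then show "p \<in> points (scheme_inter C E)" using points_iff[OF CE.ideal_sheaf_axioms] by blast
qed

end

section \<open>Multiples of a reduced divisor and the conclusion\<close>

lemma localize_base:
  assumes f: "f \<in> Sec OP U" "f \<in> N U" shows "f \<in> localize OP N U"
proof -
  have r: "Res OP U f = f" using f(1) by (auto simp: OP_ops Sec_OP)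
  show ?thesis unfolding localize_def mem_Collect_eq
  proof (intro conjI ballI f(1))
    fix p assume "p \<in> U"
    then show "\<exists>V. zopen V \<and> p \<in> V \<and> V \<subseteq> U \<and> Res OP V f \<in> N V"
      using Sec_OP_open[OF f(1)] f(2) r by (intro exI[of _ U] conjI) simp_all
  qed
qed

text \<open>The ideal of the reduction contains that of \<open>C\<close>, so passing to it creates
  no points.\<close>

lemma points_inter_reduction:
  assumes "ideal_sheaf R" "ideal_sheaf C"
  shows "points (scheme_inter R (reduction C)) \<subseteq> points R \<inter> points C"
proof -
  interpret R: ideal_sheaf R by fact
  interpret C: ideal_sheaf C by fact
  have red: "f \<in> reduction C U" if f: "f \<in> C U" for f U
  proof -
    have "\<exists>n>0. (\<lambda>p. f p ^ n) \<in> C U" using f by (intro exI[of _ 1]) simp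
    then show ?thesis unfolding reduction_def by (intro localize_base C.Sec[OF f]) simp
  qed
  have inter: "Add OP U f g \<in> scheme_inter R (reduction C) U" if f: "f \<in> R U" and g: "g \<in> C U" for f g U
    unfolding scheme_inter_def
    by (rule localize_base[OF Add_OP(1)[OF R.Sec[OF f] C.Sec[OF g]]]) (use f red[OF g] in blast)
  show ?thesis
  proof
    fix p assume p: "p \<in> points (scheme_inter R (reduction C))"
    have z: "h p = 0" if "h \<in> scheme_inter R (reduction C) U" "p \<in> U" for h U using p that unfolding points_def by blast
    have "f p = 0" if f: "f \<in> R U" "p \<in> U" for f U
      using z[OF inter[OF f(1) C.zero[OF Sec_OP_open[OF R.Sec[OF f(1)]]]] f(2)] by (simp add: OP_ops)
    moreover have "f p = 0" if f: "f \<in> C U" "p \<in> U" for f U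
      using z[OF inter[OF R.zero[OF Sec_OP_open[OF C.Sec[OF f(1)]]] f(1)] f(2)] by (simp add: OP_ops)
    ultimately show "p \<in> points R \<inter> points C" unfolding points_def by blast
  qed
qed

text \<open>The empty curve is the case that arises when the divisor is the multiple 0 of a reduced
  one.\<close>

lemma curve_Sec_OP: "curve (Sec OP)"
  unfolding curve_def
proof (intro conjI allI impI)
  show "closed_subscheme (Sec OP)" by (rule closed_subscheme_Sec_OP)
  fix J assume J: "closed_subscheme J \<and> Sec OP \<le> J \<and> J \<noteq> Sec OP"
  interpret ideal_sheaf J by (rule closed_subscheme_ideal_sheaf) (use J in blast)
  have "J \<le> Sec OP" using sub by (auto simp: le_fun_def)
  then show "has_krull_dim (subtopology zariski (quot_support (Sec OP) J)) 1" using J by (meson antisym)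
qed

lemma div_mult_Sec_OP:
  assumes X: "ideal_sheaf X" shows "div_mult X 1 (Sec OP) = Sec OP"
proof -
  have eq: "div_mult X 1 (Sec OP) = div_add X (Sec OP) (Sec OP)" by simp
  note S = ideal_sheaf_Sec_OP
  show ?thesis unfolding eq
  proof (rule ideal_sheaf_eqI[OF ideal_sheaf_div_add[OF X S S] S])
    fix p
    have "\<O> p \<subseteq> stalk (div_add X (Sec OP) (Sec OP)) p"
    proof
      fix k assume k: "k \<in> \<O> p"
      let ?T = "{a * b | a b. a \<in> \<O> p \<and> b \<in> \<O> p}"
      have "1 * 1 \<in> ?T" by blast
      then have "k * (1 * 1) + 0 \<in> gen (\<O> p) ?T" by (intro gen.step[OF k] gen.zero)
      moreover have "0 \<in> stalk X p" by (rule ideal_sheaf.stalk_zero[OF X])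
      ultimately have "k * (1 * 1) + 0 + 0 \<in> stalk (div_add X (Sec OP) (Sec OP)) p"
        unfolding stalk_div_add[OF X S S] stalk_at_Sec_OP by blast
      then show "k \<in> stalk (div_add X (Sec OP) (Sec OP)) p" by simp
    qed
    then show "stalk (div_add X (Sec OP) (Sec OP)) p = stalk (Sec OP) p"
      using stalk_at_subset unfolding stalk_at_Sec_OP by blast
  qed
qed

text \<open>A positive multiple has at least one factor in the ideal of \<open>R\<close>, so its
  ideal stays inside that of \<open>R\<close>.\<close>

lemma points_div_mult:
  assumes X: "ideal_sheaf X" and R: "ideal_sheaf R" and XR: "X \<le> R" and m: "m > 0"
  shows "points R \<subseteq> points (div_mult X m R)"
proof
  fix p assume p: "p \<in> points R"
  obtain n where n: "m = Suc n" using m gr0_conv_Suc by blast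
  note M = ideal_sheaf_div_mult[OF X R, of n]
  interpret R: ideal_sheaf R by fact
  have XR': "stalk X p \<subseteq> stalk R p" using ideal_sheaf_le_iff[OF X R] XR by blast
  have "{a * b | a b. a \<in> stalk R p \<and> b \<in> stalk (div_mult X n R) p} \<subseteq> stalk R p"
    using idealD(5)[OF R.stalk_ideal] stalk_at_subset by blast
  then have "gen (\<O> p) {a * b | a b. a \<in> stalk R p \<and> b \<in> stalk (div_mult X n R) p} \<subseteq> stalk R p"
    by (rule gen_least[OF R.stalk_ideal])
  then have "stalk (div_mult X m R) p \<subseteq> stalk R p"
    unfolding n div_mult.simps stalk_div_add[OF X R M] using XR' R.stalk_add by blast
  then show "p \<in> points (div_mult X m R)"
    using p points_iff[OF R] points_iff[OF ideal_sheaf_div_mult[OF X R]] by blast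
qed

theorem theorem6p3:
  fixes d :: nat and C X Dc :: ideal
  assumes "d_embedded d C X"
    and "effective_divisor X Dc"
    and "\<exists>m R. effective_divisor X R \<and> is_reduced R \<and> Dc = div_mult X m R"
    and "finite (points (scheme_inter C Dc))"
    and "r_map X C (scheme_inter C Dc) ` H0 (normal C)
         \<subseteq> r_map X Dc (scheme_inter C Dc) ` H0 (normal Dc)"
  shows "simple_extension d (div_add X C Dc) C X"
proof -
  have C: "smooth_surface d X" "curve C" "X \<le> C" using assms(1) by (auto simp: d_embedded_def)
  obtain eqn where "surface X eqn" by (rule smooth_surface_locale[OF C(1)])
  then interpret surface X eqn .
  interpret divisor_sum X eqn C Dc by unfold_locales (rule C assms)+
  have XD: "X \<le> D" using ideal_sheaf_le_iff[OF ideal_sheaf_axioms D.ideal_sheaf_axioms] X_D by blast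
  have finite_meet: "finite (points R \<inter> points C)" if "points R \<subseteq> points Dc" for R
    by (rule finite_subset[OF _ assms(4)]) (use points_inter_sub that in blast)
  have "\<exists>n>0. \<exists>C'. curve C' \<and> is_reduced C' \<and> X \<le> C' \<and>
        D = div_add X C (div_mult X n C') \<and> finite (points (scheme_inter C' (reduction C)))"
  proof -
    obtain m R where R: "effective_divisor X R" "is_reduced R" and Dc: "Dc = div_mult X m R" using assms(3) by blast
    have R': "closed_subscheme R" "X \<le> R" using R(1) by (auto simp: effective_divisor_def)
    note RI = closed_subscheme_ideal_sheaf[OF R'(1)]
    show ?thesis
    proof (cases "m = 0")
      \<comment> \<open>The multiple 0 of any divisor is empty, while a simple extension asks for a
        positive multiple; the empty curve taken once serves.\<close>
      case True
      have S: "X \<le> Sec OP" using sub by (auto simp: le_fun_def)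
      have "Dc = div_mult X 1 (Sec OP)" using Dc True div_mult_Sec_OP[OF ideal_sheaf_axioms] by simp
      moreover have "is_reduced (Sec OP)" by (auto simp: is_reduced_def)
      moreover have "points (Sec OP) \<subseteq> points Dc" using Dc True by simp
      then have "finite (points (scheme_inter (Sec OP) (reduction C)))"
        by (rule finite_subset[OF points_inter_reduction[OF ideal_sheaf_Sec_OP C.ideal_sheaf_axioms] finite_meet])
      ultimately show ?thesis using curve_Sec_OP S by (intro exI[of _ 1] conjI exI[of _ "Sec OP"]) auto
    next
      case False
      have "points R \<subseteq> points Dc" unfolding Dc using False by (intro points_div_mult[OF ideal_sheaf_axioms RI R'(2)]) simp
      then have "finite (points (scheme_inter R (reduction C)))"
        by (rule finite_subset[OF points_inter_reduction[OF RI C.ideal_sheaf_axioms] finite_meet])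
      then show ?thesis using False Dc R R' effective_divisor_curve[OF R(1)] by (intro exI[of _ m] conjI exI[of _ R]) auto
    qed
  qed
  moreover have "Upsilon6 C D ` H0 (normal C) \<subseteq> Upsilon5 C D ` H0 (normal D)"
  proof
    fix y assume "y \<in> Upsilon6 C D ` H0 (normal C)"
    then obtain \<phi> where \<phi>: "\<phi> \<in> H0 (normal C)" "y = Upsilon6 C D \<phi>" by blast
    obtain \<psi> where \<psi>: "\<psi> \<in> H0 (normal Dc)"
      "r_map X C (scheme_inter C Dc) \<phi> = r_map X Dc (scheme_inter C Dc) \<psi>" using assms(5) \<phi>(1) by blast
    obtain f where f: "hom_rep C UNIV f" "\<phi> = hom_of C UNIV f" using \<phi>(1) unfolding H0_def by (rule C.Sec_normalE)
    obtain f' where f': "hom_rep Dc UNIV f'" "\<psi> = hom_of Dc UNIV f'" using \<psi>(1) unfolding H0_def by (rule E.Sec_normalE)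
    show "y \<in> Upsilon5 C D ` H0 (normal D)"
      unfolding \<phi>(2) f(2) by (rule Upsilon_image[OF f(1) f'(1) \<psi>(2)[unfolded f(2) f'(2)]])
  qed
  ultimately show ?thesis
    unfolding simple_extension_def using assms(1) C(1) curve_D XD by (auto simp: d_embedded_def)
qed

end
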